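(* Let $N\ge2$, $a>0$, and let $\hat\nu=\sum_{j=1}^N\delta_{\hat\nu_j}$ with $\hat\nu_1<\dots<\hat\nu_N$ real and $a|\hat\nu_j|<1/2$ for all $j$. Let $\boldsymbol X^a(t)=(X_1^a(t),\dots,X_N^a(t))$ be the O'Connell process with parameter vector $a\hat{\boldsymbol\nu}=(a\hat\nu_1,\dots,a\hat\nu_N)$ started according to the entrance law coming from $-\infty\boldsymbol\rho$. Then for every $h\in\mathbb R$ and $0<T\le t<\infty$, $$\mathbb E^{a\circ\hat\nu,a}\big[\Theta^a(X_1^a(t)-h)\big]=\mathrm E_{\hat{\boldsymbol\nu}}\Big[\prod_{j=1}^N\mathbf 1\big(B_j(1/t)\ge h/t\big)\,\mathcal D_{\hat\nu}^a\big(1/T,\boldsymbol B(1/T)\big)\Big].$$ Consequently $\mathbb E^{a\circ\hat\nu,a}[\Theta^a(X_1^a(t)-h)]$ is F-determinantal (it is expressed by a Fredholm determinant).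
   Context: $\Theta^a(x)=\exp(-e^{-x/a})$. Whittaker function: for $\boldsymbol\nu\in\mathbb C^N$, $\boldsymbol x\in\mathbb R^N$, $\psi^{(N)}_{\boldsymbol\nu}(\boldsymbol x)=\int\exp(\mathcal F_{\boldsymbol\nu}(\boldsymbol T))\,d\boldsymbol T$, the integral being over real lower triangular arrays $(T_{j,k})_{1\le k\le j\le N}$ with $T_{N,k}=x_k$ fixed, and $$\mathcal F_{\boldsymbol\nu}(\boldsymbol T)=\sum_{j=1}^N\nu_j\Big(\sum_{k=1}^jT_{j,k}-\sum_{k=1}^{j-1}T_{j-1,k}\Big)-\sum_{j=1}^{N-1}\sum_{k=1}^j\Big\{e^{-(T_{j,k}-T_{j+1,k})}+e^{-(T_{j+1,k+1}-T_{j,k})}\Big\}.$$ O'Connell process with parameter $\boldsymbol\nu$: the diffusion on $\mathbb R^N$ with generator $\frac12\Delta+\nabla\log\psi^{(N)}_{\boldsymbol\nu}(\boldsymbol x/a)\cdot\nabla$. The entrance law coming from $-\infty\boldsymbol\rho$, $\boldsymbol\rho=(-\frac{N-1}2,-\frac{N-1}2+1,\dots,\frac{N-1}2)$, is the limit as $M\to\infty$ of the process started at $-M\boldsymbol\rho$; at time $t>0$ its density is $$\mathcal P_N^{\nu,a}(t,\boldsymbol x)=e^{-t|\boldsymbol\nu|^2/2a^2}\psi^{(N)}_{\boldsymbol\nu}(\boldsymbol x/a)\int_{\mathbb R^N}e^{-t|\boldsymbol k|^2/2}\psi^{(N)}_{-ia\boldsymbol k}(\boldsymbol x/a)s_N(a\boldsymbol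 k)\,d\boldsymbol k,\quad s_N(\boldsymbol\mu)=\frac1{(2\pi)^NN!}\prod_{1\le j<\ell\le N}|\Gamma(i(\mu_\ell-\mu_j))|^{-2},$$ and $\mathbb E^{a\circ\hat\nu,a}[f(\boldsymbol X^a(t))]=\int_{\mathbb R^N}f(\boldsymbol x)\mathcal P_N^{a\hat\nu,a}(t,\boldsymbol x)\,d\boldsymbol x$. Under $\mathrm E_{\hat{\boldsymbol\nu}}$, $\boldsymbol B=(B_1,\dots,B_N)$ are independent one-dimensional standard Brownian motions with $B_j(0)=\hat\nu_j$. For $u\in\operatorname{supp}\hat\nu$, $$\Phi_{\hat\nu}^{u,a}(x)=\Gamma(1-a(u-x))\prod_{r\in\operatorname{supp}\hat\nu,\ r\ne u}\frac{\Gamma(a(r-u))}{\Gamma(a(r-x))},\qquad\mathcal M_{\hat\nu}^{u,a}(s,x)=\int_{\mathbb R}\frac1{\sqrt{2\pi s}}e^{-(ix+w)^2/2s}\,\Phi_{\hat\nu}^{u,a}(iw)\,dw\quad(s>0),$$ and $\mathcal D_{\hat\nu}^a(s,\boldsymbol B(s))=\det_{1\le j,k\le N}\big[\mathcal M_{\hat\nu}^{\hat\nu_k,a}(s,B_j(s))\big]$. A quantity is F-determinantal if it can be expressed by a Fredholm determinant, i.e. (for a single time $s$, kernel $\mathbf K(s,x;s,y)$ and function $\chi_s$) in the form $\sum_{n\ge0}\int_{x_1<\dots<x_n}\prod_{j=1}^n\{dx_j\,\chi_s(x_j)\}\det_{1\le j,k\le n}[\mathbf K(s,x_j;s,x_k)]$.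 *)

theory Defs
  imports "HOL-Probability.Probability" "Jordan_Normal_Form.Determinant"
begin

text \<open>
  Points of \<open>\<real>\<^sup>N\<close> are functions on \<open>nat\<close> read at the indices \<open>1, \<dots>, N\<close>, and Lebesgue measure on
  \<open>\<real>\<^sup>N\<close> is the product measure below.
\<close>

abbreviation lborel_pow :: "'i set \<Rightarrow> ('i \<Rightarrow> real) measure" where
  "lborel_pow I \<equiv> PiM I (\<lambda>_. lborel)"

text \<open>The matrices of \<^theory>\<open>Jordan_Normal_Form.Matrix\<close> are indexed from \<open>0\<close>.\<close>

definition det1 :: "nat \<Rightarrow> (nat \<Rightarrow> nat \<Rightarrow> complex) \<Rightarrow> complex" where
  "det1 n f = Determinant.det (Matrix.mat n n (\<lambda>(j, k). f (Suc j) (Suc k)))"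

definition Theta :: "real \<Rightarrow> real \<Rightarrow> real" where
  "Theta a x = exp (- exp (- x / a))"


section \<open>Whittaker function\<close>

definition whittaker_F :: "nat \<Rightarrow> (nat \<Rightarrow> complex) \<Rightarrow> (nat \<times> nat \<Rightarrow> real) \<Rightarrow> complex" where
  "whittaker_F N \<nu> T =
     (\<Sum>j=1..N. \<nu> j * complex_of_real ((\<Sum>k=1..j. T (j, k)) - (\<Sum>k=1..j - 1. T (j - 1, k))))
     - complex_of_real (\<Sum>j=1..N - 1. \<Sum>k=1..j.
         exp (- (T (j, k) - T (Suc j, k))) + exp (- (T (Suc j, Suc k) - T (j, k))))"

text \<open>The integration variables are the rows \<open>1, \<dots>, N - 1\<close>; row \<open>N\<close> is frozen to \<open>x\<close>.\<close>

definition whittaker :: "nat \<Rightarrow> (nat \<Rightarrow> complex) \<Rightarrow> (nat \<Rightarrow> real) \<Rightarrow> complex" where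
  "whittaker N \<nu> x =
     (\<integral>T. exp (whittaker_F N \<nu> (\<lambda>(j, k). if j = N then x k else T (j, k)))
        \<partial>lborel_pow {(j, k). 1 \<le> k \<and> k \<le> j \<and> j < N})"


section \<open>The O'Connell process\<close>

text \<open>
  At \<open>\<mu> j = \<mu> l\<close> the reciprocal Gamma factor vanishes; here this comes out of \<open>Gamma 0 = 0\<close> and
  \<open>inverse 0 = 0\<close>.
\<close>

definition sklyanin :: "nat \<Rightarrow> (nat \<Rightarrow> real) \<Rightarrow> real" where
  "sklyanin N \<mu> = 1 / ((2 * pi) ^ N * fact N) *
     (\<Prod>(j, l)\<in>{(j, l). 1 \<le> j \<and> j < l \<and> l \<le> N}.
        inverse ((cmod (Gamma (\<i> * complex_of_real (\<mu> l - \<mu> j))))\<^sup>2))"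

definition oconnell_density ::
  "nat \<Rightarrow> (nat \<Rightarrow> real) \<Rightarrow> real \<Rightarrow> real \<Rightarrow> (nat \<Rightarrow> real) \<Rightarrow> complex" where
  "oconnell_density N \<nu> a t x =
     complex_of_real (exp (- t * (\<Sum>j=1..N. (\<nu> j)\<^sup>2) / (2 * a\<^sup>2)))
     * whittaker N (\<lambda>j. complex_of_real (\<nu> j)) (\<lambda>j. x j / a)
     * (\<integral>k. complex_of_real (exp (- t * (\<Sum>j=1..N. (k j)\<^sup>2) / 2))
             * whittaker N (\<lambda>j. - \<i> * complex_of_real (a * k j)) (\<lambda>j. x j / a)
             * complex_of_real (sklyanin N (\<lambda>j. a * k j)) \<partial>lborel_pow {1..N})"

definition partial :: "nat \<Rightarrow> ((nat \<Rightarrow> real) \<Rightarrow> real) \<Rightarrow> (nat \<Rightarrow> real) \<Rightarrow> real" where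
  "partial i f x = deriv (\<lambda>u. f (x(i := u))) (x i)"

definition has_partials :: "nat \<Rightarrow> ((nat \<Rightarrow> real) \<Rightarrow> real) \<Rightarrow> bool" where
  "has_partials N f \<longleftrightarrow>
     (\<forall>i\<in>{1..N}. \<forall>x\<in>extensional {1..N}. (\<lambda>u. f (x(i := u))) differentiable at (x i))"

text \<open>
  Twice continuously differentiable, compactly supported functions on \<open>\<real>\<^sup>N\<close>. Only the values of \<open>f\<close>
  on \<open>extensional {1..N}\<close> matter; the subspace topology there is that of \<open>\<real>\<^sup>N\<close>.
\<close>

definition C2_compact_support :: "nat \<Rightarrow> ((nat \<Rightarrow> real) \<Rightarrow> real) \<Rightarrow> bool" where
  "C2_compact_support N f \<longleftrightarrow>
     continuous_on (extensional {1..N}) f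
     \<and> has_partials N f
     \<and> (\<forall>i\<in>{1..N}. continuous_on (extensional {1..N}) (partial i f) \<and> has_partials N (partial i f))
     \<and> (\<forall>i\<in>{1..N}. \<forall>j\<in>{1..N}. continuous_on (extensional {1..N}) (partial j (partial i f)))
     \<and> (\<exists>R. \<forall>x\<in>extensional {1..N}. (\<exists>i\<in>{1..N}. \<bar>x i\<bar> > R) \<longrightarrow> f x = 0)"

text \<open>
  The generator \<open>\<Delta>/2 + \<nabla>log \<psi>\<^sub>\<nu>(x/a) \<cdot> \<nabla>\<close>. For real parameters the Whittaker function is real and
  positive.
\<close>

definition oconnell_generator ::
  "nat \<Rightarrow> (nat \<Rightarrow> real) \<Rightarrow> real \<Rightarrow> ((nat \<Rightarrow> real) \<Rightarrow> real) \<Rightarrow> (nat \<Rightarrow> real) \<Rightarrow> real" where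
  "oconnell_generator N \<nu> a f x =
     1/2 * (\<Sum>i=1..N. partial i (partial i f) x)
     + (\<Sum>i=1..N. partial i
           (\<lambda>y. ln (Re (whittaker N (\<lambda>j. complex_of_real (\<nu> j)) (\<lambda>j. y j / a)))) x
         * partial i f x)"

definition history :: "nat \<Rightarrow> 'w measure \<Rightarrow> (real \<Rightarrow> 'w \<Rightarrow> nat \<Rightarrow> real) \<Rightarrow> real \<Rightarrow> 'w set set" where
  "history N P X s = sigma_sets (space P)
     {X r -` A \<inter> space P | r A. 0 < r \<and> r \<le> s \<and> A \<in> sets (lborel_pow {1..N})}"

text \<open>
  The O'Connell process on the time set \<open>t > 0\<close>, started according to the entrance law coming from
  \<open>-\<infinity>\<rho>\<close>: a continuous process solving the martingale problem for the generator on every time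
  interval bounded away from \<open>0\<close>, whose one-time marginals are given by the density
  \<open>oconnell_density\<close>. Without the last clause the law of the process at small times would be free:
  the entrance law is the family of these marginals.
\<close>

definition oconnell_process ::
  "'w measure \<Rightarrow> nat \<Rightarrow> (nat \<Rightarrow> real) \<Rightarrow> real \<Rightarrow> (real \<Rightarrow> 'w \<Rightarrow> nat \<Rightarrow> real) \<Rightarrow> bool" where
  "oconnell_process P N \<nu> a X \<longleftrightarrow>
     prob_space P
     \<and> (\<forall>t>0. X t \<in> P \<rightarrow>\<^sub>M lborel_pow {1..N})
     \<and> (\<forall>\<omega>\<in>space P. \<forall>i\<in>{1..N}. continuous_on {0<..} (\<lambda>t. X t \<omega> i))
     \<and> (\<forall>f s t A. C2_compact_support N f \<and> 0 < s \<and> s \<le> t \<and> A \<in> history N P X s \<longrightarrow>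
          (\<integral>\<omega>\<in>A. (f (X t \<omega>) - f (X s \<omega>)
             - (\<integral>r\<in>{s..t}. oconnell_generator N \<nu> a f (X r \<omega>) \<partial>lborel)) \<partial>P) = 0)
     \<and> (\<forall>t>0. distributed P (lborel_pow {1..N}) (X t)
                (\<lambda>x. ennreal (Re (oconnell_density N \<nu> a t x))))"


section \<open>Brownian motions\<close>

definition brownian_motion :: "'w measure \<Rightarrow> real \<Rightarrow> (real \<Rightarrow> 'w \<Rightarrow> real) \<Rightarrow> bool" where
  "brownian_motion Q x W \<longleftrightarrow>
     prob_space Q
     \<and> (\<forall>t\<ge>0. W t \<in> borel_measurable Q)
     \<and> (AE \<omega> in Q. W 0 \<omega> = x)
     \<and> (AE \<omega> in Q. continuous_on {0..} (\<lambda>t. W t \<omega>))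
     \<and> (\<forall>s t. 0 \<le> s \<and> s < t \<longrightarrow>
          distributed Q lborel (\<lambda>\<omega>. W t \<omega> - W s \<omega>)
            (\<lambda>y. ennreal (normal_density 0 (sqrt (t - s)) y)))
     \<and> (\<forall>(n::nat) \<tau>. 0 \<le> \<tau> 0 \<and> (\<forall>i<n. \<tau> i \<le> \<tau> (Suc i)) \<longrightarrow>
          prob_space.indep_vars Q (\<lambda>_. borel) (\<lambda>i \<omega>. W (\<tau> (Suc i)) \<omega> - W (\<tau> i) \<omega>) {..<n})"

definition indep_brownian_motions ::
  "'w measure \<Rightarrow> nat \<Rightarrow> (nat \<Rightarrow> real) \<Rightarrow> (nat \<Rightarrow> real \<Rightarrow> 'w \<Rightarrow> real) \<Rightarrow> bool" where
  "indep_brownian_motions Q N x B \<longleftrightarrow>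
     (\<forall>j\<in>{1..N}. brownian_motion Q (x j) (B j))
     \<and> prob_space.indep_vars Q (\<lambda>_. PiM {0..} (\<lambda>_. borel))
         (\<lambda>j \<omega>. restrict (\<lambda>t. B j t \<omega>) {0..}) {1..N}"


section \<open>Determinantal martingales\<close>

text \<open>
  The configuration \<open>\<Sum>\<^sub>j \<delta>(\<nu> j)\<close> is given by the injective function \<open>\<nu>\<close> on \<open>{1..N}\<close>; its support is
  \<open>\<nu> ` {1..N}\<close>. The factors \<open>1 / Gamma (a (r - x))\<close> vanish at the poles of \<open>Gamma\<close>, in agreement
  with the library conventions.
\<close>

definition Phi :: "nat \<Rightarrow> (nat \<Rightarrow> real) \<Rightarrow> real \<Rightarrow> real \<Rightarrow> complex \<Rightarrow> complex" where
  "Phi N \<nu> u a x =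
     Gamma (1 - complex_of_real a * (complex_of_real u - x))
     * (\<Prod>r\<in>\<nu> ` {1..N} - {u}.
          Gamma (complex_of_real (a * (r - u))) / Gamma (complex_of_real a * (complex_of_real r - x)))"

definition M_mart :: "nat \<Rightarrow> (nat \<Rightarrow> real) \<Rightarrow> real \<Rightarrow> real \<Rightarrow> real \<Rightarrow> real \<Rightarrow> complex" where
  "M_mart N \<nu> u a s x =
     (\<integral>w. complex_of_real (1 / sqrt (2 * pi * s))
          * exp (- (\<i> * complex_of_real x + complex_of_real w)\<^sup>2 / complex_of_real (2 * s))
          * Phi N \<nu> u a (\<i> * complex_of_real w) \<partial>lborel)"

definition D_mart :: "nat \<Rightarrow> (nat \<Rightarrow> real) \<Rightarrow> real \<Rightarrow> real \<Rightarrow> (nat \<Rightarrow> real) \<Rightarrow> complex" where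
  "D_mart N \<nu> a s b = det1 N (\<lambda>j k. M_mart N \<nu> (\<nu> k) a s (b j))"


section \<open>Fredholm determinants\<close>

text \<open>
  \<open>K s x s' y\<close> stands for \<open>\<^bold>K(s, x; s', y)\<close>. The series form includes absolute convergence of the
  individual integrals; the summand for \<open>n = 0\<close> is \<open>1\<close>.
\<close>

definition fredholm_expansion ::
  "real \<Rightarrow> (real \<Rightarrow> real \<Rightarrow> real \<Rightarrow> real \<Rightarrow> complex) \<Rightarrow> (real \<Rightarrow> real) \<Rightarrow> complex \<Rightarrow> bool" where
  "fredholm_expansion s K \<phi> q \<longleftrightarrow>
     (let S = (\<lambda>n. {x. strict_mono_on {1..n} x});
          g = (\<lambda>n x. complex_of_real (\<Prod>j=1..n. \<phi> (x j)) * det1 n (\<lambda>j k. K s (x j) s (x k)))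
      in (\<forall>n::nat. set_integrable (lborel_pow {1..n}) (S n) (g n))
         \<and> (\<lambda>n. \<integral>x\<in>S n. g n x \<partial>lborel_pow {1..n}) sums q)"

definition F_determinantal :: "complex \<Rightarrow> bool" where
  "F_determinantal q \<longleftrightarrow> (\<exists>s K \<phi>. fredholm_expansion s K \<phi> q)"

text \<open>
  As a statement about a single number \<open>F_determinantal\<close> has little content, so the theorem also
  names the kernel. It is the correlation kernel attached to the determinantal martingale,
  \<open>\<^bold>K(s, x; s', y) = \<Sum>\<^sub>u p(s, x | u) \<M>\<^sup>u(s', y) - 1(s > s') p(s - s', x | y)\<close> with \<open>u\<close> ranging over the
  support of the configuration and \<open>p\<close> the Brownian transition density; it does not depend on the
  test function. The second term vanishes for equal times.
\<close>

definition oconnell_kernel ::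
  "nat \<Rightarrow> (nat \<Rightarrow> real) \<Rightarrow> real \<Rightarrow> real \<Rightarrow> real \<Rightarrow> real \<Rightarrow> real \<Rightarrow> complex" where
  "oconnell_kernel N \<nu> a s x s' y =
     (\<Sum>u\<in>\<nu> ` {1..N}. complex_of_real (normal_density u (sqrt s) x) * M_mart N \<nu> u a s' y)
     - (if s > s' then complex_of_real (normal_density y (sqrt (s - s')) x) else 0)"

end

theory Submission
  imports Defs "HOL-Complex_Analysis.Complex_Analysis"
begin

text \<open>
  By Fubini the expectation of \<open>\<Theta>\<close> becomes a spectral integral over products of two Whittaker
  functions, weighted with \<open>exp (- exp (- x\<^sub>1))\<close>. Stade's identity evaluates such a product integral as
  \<open>\<Prod> \<Gamma>(- (\<mu>\<^sub>p + \<nu>\<^sub>q))\<close>; it is the statement that the geometric RSK correspondence maps an array of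
  independent log-gamma weights, in logarithmic coordinates without Jacobian, to a pair of
  triangular arrays with a common bottom row. Stade's identity needs negative real parts, so all
  spectral variables are first moved to the line \<open>Re z = 1 / (2 a)\<close>.

  There, the product of Gamma functions and the Sklyanin density are a product of two determinants:
  Cauchy's determinant for \<open>1 / (z - \<nu>)\<close> times the determinant of the \<open>\<Phi>\<close>, which is Cauchy's
  determinant for the sine after the reflection formula. Andreief's identity turns the spectral
  integral into a single determinant, whose entries are the integrals of \<open>p \<M>\<close> over a half line, \<open>p\<close> being
  the Brownian transition density: the half-line integral of \<open>exp (- (z - \<nu>) x)\<close> gives the factor
  \<open>1 / (z - \<nu>)\<close>.

  On the Brownian side independence of the components and the martingale property of \<open>\<M>\<close> lead to the
  same determinant. As \<open>\<integral> p \<M> = \<delta>\<^sub>j\<^sub>k\<close> over the whole line (a residue), its entries are those of the identity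
  minus an integral over the complementary half line, which is the Fredholm determinant of the
  kernel of rank \<open>N\<close>.
\<close>

section \<open>Measure preserving maps\<close>

text \<open>The abscissa 1 / (2 a) is where all constraints meet. Since a |\<nu>_j| < 1/2, the
  spectrum lies strictly between the lines Re z = -1 / (2 a) and Re z = 1 / (2 a). On the right line
  every a (z - \<nu>_j) has real part in (0, 1), away from the integers where reflection
  degenerates, and the poles of all \<Phi> stay to the left of the strip. Hence
  \<open>M_mart\<close> can be written on either edge: the right edge makes integrals over [c,
  \<infinity>) converge, the left edge those over (-\<infinity>, 0], and comparing the two leaves
  the residue at \<nu>_j. The spectral variables are moved by one common amount because the Sklyanin
  density depends on their differences only; the Whittaker function then merely acquires an
  exponential in the sum of the x_j. Exchanging the spatial and the spectral integral rests on
  |\<psi>_\<mu>| \<le> \<psi>_(Re \<mu>): after the shift the majorant has constant parameters -1/2,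
  and Stade's identity itself shows that it is integrable.\<close>

definition preserves :: "'a measure \<Rightarrow> 'b measure \<Rightarrow> ('a \<Rightarrow> 'b) \<Rightarrow> bool" where
  "preserves M N f \<longleftrightarrow> f \<in> M \<rightarrow>\<^sub>M N \<and> distr M N f = N"

lemma preserves_comp:
  assumes "preserves M N f" "preserves N L g"
  shows "preserves M L (\<lambda>x. g (f x))"
proof -
  have [measurable]: "f \<in> M \<rightarrow>\<^sub>M N" "g \<in> N \<rightarrow>\<^sub>M L" using assms by (auto simp: preserves_def)
  have "distr M L (\<lambda>x. g (f x)) = distr (distr M N f) L g"
    by (subst distr_distr) (auto simp: comp_def)
  then show ?thesis using assms by (auto simp: preserves_def)
qed

lemma preserves_id: "preserves M M (\<lambda>x. x)"
  by (simp add: preserves_def distr_id2)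

lemma preserves_cong:
  "(\<And>x. x \<in> space M \<Longrightarrow> f x = g x) \<Longrightarrow> preserves M N f \<longleftrightarrow> preserves M N g"
  unfolding preserves_def using distr_cong[of M M N N f g] measurable_cong[of M f g N] by auto

lemma preserves_integral:
  fixes g :: "'b \<Rightarrow> 'c::{banach, second_countable_topology}"
  assumes "preserves M N f" and [measurable]: "g \<in> borel_measurable N"
  shows "(\<integral>x. g (f x) \<partial>M) = (\<integral>y. g y \<partial>N)"
proof -
  have [measurable]: "f \<in> M \<rightarrow>\<^sub>M N" and d: "distr M N f = N" using assms by (auto simp: preserves_def)
  have "(\<integral>x. g (f x) \<partial>M) = (\<integral>y. g y \<partial>distr M N f)" by (subst integral_distr) auto
  then show ?thesis by (simp only: d)
qed

lemma preserves_integrable: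
  fixes g :: "'b \<Rightarrow> 'c::{banach, second_countable_topology}"
  assumes "preserves M N f" and [measurable]: "g \<in> borel_measurable N"
  shows "integrable M (\<lambda>x. g (f x)) \<longleftrightarrow> integrable N g"
proof -
  have [measurable]: "f \<in> M \<rightarrow>\<^sub>M N" and d: "distr M N f = N" using assms by (auto simp: preserves_def)
  have "integrable M (\<lambda>x. g (f x)) \<longleftrightarrow> integrable (distr M N f) g" by (subst integrable_distr_eq) auto
  then show ?thesis by (simp only: d)
qed

lemma preserves_AE:
  assumes "preserves M N f" and "AE y in N. Q y"
  shows "AE x in M. Q (f x)"
proof -
  have [measurable]: "f \<in> M \<rightarrow>\<^sub>M N" and d: "distr M N f = N" using assms by (auto simp: preserves_def)
  show ?thesis
    using assms(2) d by (metis AE_distrD \<open>f \<in> M \<rightarrow>\<^sub>M N\<close>)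
qed

lemma preserves_nn_integralI:
  assumes [measurable]: "f \<in> M \<rightarrow>\<^sub>M N"
    and "\<And>F. F \<in> borel_measurable N \<Longrightarrow> (\<integral>\<^sup>+x. F (f x) \<partial>M) = (\<integral>\<^sup>+y. F y \<partial>N)"
  shows "preserves M N f"
  unfolding preserves_def
proof (intro conjI assms(1) measure_eqI)
  fix A assume "A \<in> sets (distr M N f)"
  then have [measurable]: "A \<in> sets N" by simp
  have "emeasure (distr M N f) A = (\<integral>\<^sup>+y. indicator A y \<partial>distr M N f)" by simp
  also have "\<dots> = (\<integral>\<^sup>+x. indicator A (f x) \<partial>M)" by (subst nn_integral_distr) auto
  also have "\<dots> = emeasure N A" by (subst assms(2)) auto
  finally show "emeasure (distr M N f) A = emeasure N A" .
qed simp

lemma preserves_pair: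
  assumes "preserves M M' f" "preserves N N' g" "sigma_finite_measure M'" "sigma_finite_measure N'"
  shows "preserves (M \<Otimes>\<^sub>M N) (M' \<Otimes>\<^sub>M N') (\<lambda>(x, y). (f x, g y))"
proof -
  have [measurable]: "f \<in> M \<rightarrow>\<^sub>M M'" "g \<in> N \<rightarrow>\<^sub>M N'" using assms by (auto simp: preserves_def)
  have d: "distr M M' f = M'" "distr N N' g = N'" using assms by (auto simp: preserves_def)
  show ?thesis
    using pair_measure_distr[of f M M' g N N'] assms(4) d by (auto simp: preserves_def)
qed

interpretation lborel_pow: product_sigma_finite "\<lambda>_::'i. lborel :: real measure"
  by standard

lemma sigma_finite_lborel_pow: "finite I \<Longrightarrow> sigma_finite_measure (lborel_pow I)"
  by (rule lborel_pow.sigma_finite)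

text \<open>Serves both to rename the cells of the square by \<open>cell_key\<close> and to permute
  the coordinates of a tuple in \<open>integral_ordered\<close>.\<close>

lemma preserves_reindex:
  fixes f :: "'i \<Rightarrow> 'j"
  assumes I: "finite I" "bij_betw f I J"
  shows "preserves (lborel_pow J) (lborel_pow I) (\<lambda>x. \<lambda>i\<in>I. x (f i))"
proof -
  have fin: "finite J" using I bij_betw_finite by blast
  have fJ: "f i \<in> J" if "i \<in> I" for i using I that by (auto simp: bij_betw_def)
  let ?g = "\<lambda>x::'j \<Rightarrow> real. \<lambda>i\<in>I. x (f i)"
  have [measurable]: "?g \<in> lborel_pow J \<rightarrow>\<^sub>M lborel_pow I"
    using fJ by (intro measurable_restrict) auto
  have "distr (lborel_pow J) (lborel_pow I) ?g = lborel_pow I"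
  proof (rule lborel_pow.PiM_eqI)
    fix A :: "'i \<Rightarrow> real set" assume A: "\<And>i. i \<in> I \<Longrightarrow> A i \<in> sets lborel"
    define A' where "A' = (\<lambda>j. A (inv_into I f j))"
    have inv: "inv_into I f (f i) = i" if "i \<in> I" for i
      using I that by (simp add: bij_betw_def)
    have "(\<forall>i\<in>I. x (f i) \<in> A i) \<longleftrightarrow> (\<forall>j\<in>J. x j \<in> A' j)" for x
      using I(2) inv unfolding A'_def bij_betw_def by auto
    then have eq: "?g -` (Pi\<^sub>E I A) \<inter> space (lborel_pow J) = Pi\<^sub>E J A'"
      by (auto simp: space_PiM PiE_iff)
    have "emeasure (distr (lborel_pow J) (lborel_pow I) ?g) (Pi\<^sub>E I A)
        = emeasure (lborel_pow J) (Pi\<^sub>E J A')"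
      using A I(1) by (subst emeasure_distr) (auto simp: eq intro!: sets_PiM_I_finite)
    also have "\<dots> = (\<Prod>j\<in>J. emeasure lborel (A' j))"
      using A I fin fJ by (intro lborel_pow.emeasure_PiM) (auto simp: A'_def bij_betw_def inv_into_into)
    also have "\<dots> = (\<Prod>i\<in>I. emeasure lborel (A i))"
      by (subst prod.reindex_bij_betw[OF I(2), symmetric]) (auto simp: A'_def inv intro!: prod.cong)
    finally show "emeasure (distr (lborel_pow J) (lborel_pow I) ?g) (Pi\<^sub>E I A)
        = (\<Prod>i\<in>I. emeasure lborel (A i))" .
  qed (use I in auto)
  then show ?thesis unfolding preserves_def by auto
qed

text \<open>Gluing uses \<open>tri N\<close> twice as an index set; the sum type keeps the two
  copies apart.\<close>

lemma preserves_sum: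
  assumes I: "finite I" "finite J"
  shows "preserves (lborel_pow I \<Otimes>\<^sub>M lborel_pow J) (lborel_pow (I <+> J))
           (\<lambda>(x, y). \<lambda>k\<in>I <+> J. case k of Inl i \<Rightarrow> x i | Inr j \<Rightarrow> y j)"
proof -
  let ?g = "\<lambda>(x::'a \<Rightarrow> real, y::'b \<Rightarrow> real). \<lambda>k\<in>I <+> J. case k of Inl i \<Rightarrow> x i | Inr j \<Rightarrow> y j"
  interpret J: sigma_finite_measure "lborel_pow J" using I by (intro sigma_finite_lborel_pow)
  have [measurable]: "?g \<in> lborel_pow I \<Otimes>\<^sub>M lborel_pow J \<rightarrow>\<^sub>M lborel_pow (I <+> J)"
    unfolding split_beta by (intro measurable_restrict) (auto split: sum.splits)
  have "distr (lborel_pow I \<Otimes>\<^sub>M lborel_pow J) (lborel_pow (I <+> J)) ?g = lborel_pow (I <+> J)"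
  proof (rule lborel_pow.PiM_eqI)
    fix A :: "'a + 'b \<Rightarrow> real set" assume A: "\<And>i. i \<in> I <+> J \<Longrightarrow> A i \<in> sets lborel"
    have eq: "?g -` (Pi\<^sub>E (I <+> J) A) \<inter> space (lborel_pow I \<Otimes>\<^sub>M lborel_pow J)
        = Pi\<^sub>E I (\<lambda>i. A (Inl i)) \<times> Pi\<^sub>E J (\<lambda>j. A (Inr j))"
      by (force simp: space_PiM space_pair_measure PiE_iff Plus_def ball_Un)
    have "emeasure (distr (lborel_pow I \<Otimes>\<^sub>M lborel_pow J) (lborel_pow (I <+> J)) ?g) (Pi\<^sub>E (I <+> J) A)
        = emeasure (lborel_pow I \<Otimes>\<^sub>M lborel_pow J) (Pi\<^sub>E I (\<lambda>i. A (Inl i)) \<times> Pi\<^sub>E J (\<lambda>j. A (Inr j)))"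
      using A I by (subst emeasure_distr) (auto simp: eq intro!: sets_PiM_I_finite)
    also have "\<dots> = emeasure (lborel_pow I) (Pi\<^sub>E I (\<lambda>i. A (Inl i))) * emeasure (lborel_pow J) (Pi\<^sub>E J (\<lambda>j. A (Inr j)))"
      using A I by (intro J.emeasure_pair_measure_Times sets_PiM_I_finite) auto
    also have "\<dots> = (\<Prod>i\<in>I. emeasure lborel (A (Inl i))) * (\<Prod>i\<in>J. emeasure lborel (A (Inr i)))"
      using A I by (subst (1 2) lborel_pow.emeasure_PiM) auto
    also have "\<dots> = (\<Prod>i\<in>I <+> J. emeasure lborel (A i))"
      using I by (simp add: prod.Plus)
    finally show "emeasure (distr (lborel_pow I \<Otimes>\<^sub>M lborel_pow J) (lborel_pow (I <+> J)) ?g) (Pi\<^sub>E (I <+> J) A)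
        = (\<Prod>i\<in>I <+> J. emeasure lborel (A i))" .
  qed (use I in auto)
  then show ?thesis unfolding preserves_def by auto
qed

text \<open>By Fubini the coordinate \<open>i\<close> is integrated first; for fixed other
  coordinates \<open>g x\<close> is a constant by \<open>gi\<close>, so the map is a translation of
  the line, possibly after a reflection. Geometric RSK needs both signs: a toggle reverses its
  coordinate, the new corner is only shifted.\<close>

lemma preserves_shear:
  fixes e :: real
  assumes I: "finite I" "i \<in> I" and e: "\<bar>e\<bar> = 1"
    and g[measurable]: "g \<in> borel_measurable (lborel_pow I)"
    and gi: "\<And>x u. g (x(i := u)) = g x"
  shows "preserves (lborel_pow I) (lborel_pow I) (\<lambda>x. x(i := e * x i + g x))"
proof (rule preserves_nn_integralI)
  have "(\<lambda>x. \<lambda>j\<in>I. if j = i then e * x i + g x else x j) \<in> lborel_pow I \<rightarrow>\<^sub>M lborel_pow I"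
    using I by (intro measurable_restrict) auto
  also have "?this \<longleftrightarrow> (\<lambda>x. x(i := e * x i + g x)) \<in> lborel_pow I \<rightarrow>\<^sub>M lborel_pow I"
    using I by (intro measurable_cong) (auto simp: space_PiM fun_eq_iff PiE_def extensional_def)
  finally show m[measurable]: "(\<lambda>x. x(i := e * x i + g x)) \<in> lborel_pow I \<rightarrow>\<^sub>M lborel_pow I" .
  fix F :: "_ \<Rightarrow> ennreal" assume [measurable]: "F \<in> borel_measurable (lborel_pow I)"
  define J where "J = I - {i}"
  have J: "I = insert i J" "i \<notin> J" "finite J" using I by (auto simp: J_def)
  have Fm[measurable]: "F \<in> borel_measurable (lborel_pow (insert i J))"
    by (simp add: J(1)[symmetric])
  have mm[measurable]: "(\<lambda>x. F (x(i := e * x i + g x))) \<in> borel_measurable (lborel_pow (insert i J))"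
    by (subst J(1)[symmetric]) measurable
  have "(\<integral>\<^sup>+x. F (x(i := e * x i + g x)) \<partial>lborel_pow I)
      = (\<integral>\<^sup>+x. (\<integral>\<^sup>+y. F (x(i := e * y + g x)) \<partial>lborel) \<partial>lborel_pow J)"
    by (subst J(1), subst lborel_pow.product_nn_integral_insert[OF J(3,2) mm]) (simp add: gi)
  also have "\<dots> = (\<integral>\<^sup>+x. (\<integral>\<^sup>+y. F (x(i := y)) \<partial>lborel) \<partial>lborel_pow J)"
  proof (rule nn_integral_cong)
    fix x assume "x \<in> space (lborel_pow J)"
    then have [measurable]: "(\<lambda>y. F (x(i := y))) \<in> borel_measurable lborel"
      using measurable_comp[OF measurable_component_update Fm, of x] J by (auto simp: comp_def)
    show "(\<integral>\<^sup>+y. F (x(i := e * y + g x)) \<partial>lborel) = (\<integral>\<^sup>+y. F (x(i := y)) \<partial>lborel)"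
      using e by (subst (2) nn_integral_real_affine[of _ e "g x"]) (auto simp: add.commute)
  qed
  also have "\<dots> = (\<integral>\<^sup>+x. F x \<partial>lborel_pow I)"
    unfolding J(1) by (subst lborel_pow.product_nn_integral_insert[OF J(3,2) Fm]) simp
  finally show "(\<integral>\<^sup>+x. F (x(i := e * x i + g x)) \<partial>lborel_pow I) = (\<integral>\<^sup>+x. F x \<partial>lborel_pow I)" .
qed

text \<open>As no \<open>g c\<close> reads a coordinate in \<open>D\<close>, the simultaneous update
  equals the single shears applied one after another.\<close>

lemma preserves_shears:
  fixes e :: "'i \<Rightarrow> real"
  assumes I: "finite I" "D \<subseteq> I" and e: "\<And>c. c \<in> D \<Longrightarrow> \<bar>e c\<bar> = 1"
    and g[measurable]: "\<And>c. c \<in> D \<Longrightarrow> g c \<in> borel_measurable (lborel_pow I)"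
    and gi: "\<And>c x y. c \<in> D \<Longrightarrow> (\<And>d. d \<notin> D \<Longrightarrow> x d = y d) \<Longrightarrow> g c x = g c y"
  shows "preserves (lborel_pow I) (lborel_pow I) (\<lambda>x c. if c \<in> D then e c * x c + g c x else x c)"
proof -
  have "finite D" using I finite_subset by blast
  have "preserves (lborel_pow I) (lborel_pow I) (\<lambda>x c. if c \<in> E then e c * x c + g c x else x c)"
    if "E \<subseteq> D" for E
    using finite_subset[OF that \<open>finite D\<close>] that
  proof (induction E rule: finite_induct)
    case empty
    then show ?case by (simp add: preserves_id)
  next
    case (insert b E)
    let ?f = "\<lambda>x c. if c \<in> E then e c * x c + g c x else x c"
    have 1: "preserves (lborel_pow I) (lborel_pow I) (\<lambda>x. x(b := e b * x b + g b x))"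
      using insert.prems I e by (intro preserves_shear g gi) auto
    have 2: "preserves (lborel_pow I) (lborel_pow I) ?f"
      using insert.IH insert.prems by blast
    have "preserves (lborel_pow I) (lborel_pow I) (\<lambda>x. (?f x)(b := e b * (?f x) b + g b (?f x)))"
      by (rule preserves_comp[OF 2 1])
    moreover have "g b (?f x) = g b x" for x
      using insert.prems by (intro gi) auto
    moreover have "(?f x)(b := e b * (?f x) b + g b x) = (\<lambda>c. if c \<in> insert b E then e c * x c + g c x else x c)" for x
      using insert.hyps by (auto simp: fun_eq_iff)
    ultimately show ?case by simp
  qed
  then show ?thesis by simp
qed

text \<open>Both claims come from one identity of measures: Lebesgue measure is
  \<open>a ^ card I\<close> times its image under the affine map.\<close>

lemma integral_lborel_pow_affine:
  fixes F :: "('i \<Rightarrow> real) \<Rightarrow> 'c::{banach, second_countable_topology}" and a c :: real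
  assumes I: "finite I" and a: "a > 0" and [measurable]: "F \<in> borel_measurable (lborel_pow I)"
  shows "integrable (lborel_pow I) (\<lambda>x. F (\<lambda>i\<in>I. c + a * x i)) \<longleftrightarrow> integrable (lborel_pow I) F" (is ?A)
    and "(\<integral>x. F x \<partial>lborel_pow I) = a ^ card I *\<^sub>R (\<integral>x. F (\<lambda>i\<in>I. c + a * x i) \<partial>lborel_pow I)" (is ?B)
proof -
  let ?g = "\<lambda>x::'i \<Rightarrow> real. \<lambda>i\<in>I. c + a * x i"
  have [measurable]: "?g \<in> lborel_pow I \<rightarrow>\<^sub>M lborel_pow I"
    by (intro measurable_restrict) auto
  have eq: "lborel_pow I = density (distr (lborel_pow I) (lborel_pow I) ?g) (\<lambda>_. ennreal (a ^ card I))"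
  proof (rule lborel_pow.PiM_eqI[symmetric])
    fix A :: "'i \<Rightarrow> real set" assume A: "\<And>i. i \<in> I \<Longrightarrow> A i \<in> sets lborel"
    have box: "Pi\<^sub>E I A \<in> sets (lborel_pow I)" using A I by (intro sets_PiM_I_finite) auto
    have v: "(\<lambda>u. c + a * u) -` A i \<in> sets lborel" if "i \<in> I" for i
      using A[OF that] measurable_sets_borel[of "\<lambda>u. c + a * u" borel "A i"] by simp
    have eq: "?g -` (Pi\<^sub>E I A) \<inter> space (lborel_pow I) = Pi\<^sub>E I (\<lambda>i. (\<lambda>u. c + a * u) -` A i)"
      by (auto simp: space_PiM PiE_def Pi_def extensional_def)
    have one: "ennreal a * emeasure lborel ((\<lambda>u. c + a * u) -` A i) = emeasure lborel (A i)" if "i \<in> I" for i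
    proof -
      have "emeasure lborel (A i) = emeasure (density (distr lborel borel (\<lambda>u. c + a * u)) (\<lambda>_. ennreal \<bar>a\<bar>)) (A i)"
        using lborel_real_affine[of a c] a by simp
      also have "\<dots> = ennreal a * emeasure lborel ((\<lambda>u. c + a * u) -` A i)"
        using A[OF that] a by (simp add: emeasure_density nn_integral_cmult nn_integral_distr emeasure_distr)
      finally show ?thesis ..
    qed
    have "emeasure (density (distr (lborel_pow I) (lborel_pow I) ?g) (\<lambda>_. ennreal (a ^ card I))) (Pi\<^sub>E I A)
        = ennreal (a ^ card I) * emeasure (lborel_pow I) (?g -` (Pi\<^sub>E I A) \<inter> space (lborel_pow I))"
      using box by (simp add: emeasure_density nn_integral_cmult emeasure_distr)
    also have "\<dots> = ennreal (a ^ card I) * (\<Prod>i\<in>I. emeasure lborel ((\<lambda>u. c + a * u) -` A i))"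
      unfolding eq using I v by (subst lborel_pow.emeasure_PiM) auto
    also have "\<dots> = (\<Prod>i\<in>I. ennreal a * emeasure lborel ((\<lambda>u. c + a * u) -` A i))"
      using a by (simp add: prod.distrib ennreal_power)
    also have "\<dots> = (\<Prod>i\<in>I. emeasure lborel (A i))"
      by (intro prod.cong refl one)
    finally show "emeasure (density (distr (lborel_pow I) (lborel_pow I) ?g) (\<lambda>_. ennreal (a ^ card I))) (Pi\<^sub>E I A)
        = (\<Prod>i\<in>I. emeasure lborel (A i))" .
  qed (use I in auto)
  let ?D = "density (distr (lborel_pow I) (lborel_pow I) ?g) (\<lambda>_. ennreal (a ^ card I))"
  have "integrable ?D F \<longleftrightarrow> integrable (lborel_pow I) (\<lambda>x. a ^ card I *\<^sub>R F (?g x))"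
    using a by (subst integrable_density) (auto simp: integrable_distr_eq)
  also have "\<dots> \<longleftrightarrow> integrable (lborel_pow I) (\<lambda>x. F (?g x))"
  proof
    assume "integrable (lborel_pow I) (\<lambda>x. a ^ card I *\<^sub>R F (?g x))"
    then have "integrable (lborel_pow I) (\<lambda>x. inverse (a ^ card I) *\<^sub>R (a ^ card I *\<^sub>R F (?g x)))"
      by (rule integrable_scaleR_right)
    then show "integrable (lborel_pow I) (\<lambda>x. F (?g x))" using a by simp
  qed (rule integrable_scaleR_right)
  finally show ?A by (simp only: eq[symmetric])
  have "(\<integral>x. F x \<partial>?D) = a ^ card I *\<^sub>R (\<integral>x. F (?g x) \<partial>lborel_pow I)"
    using a by (subst integral_density) (auto simp: integral_distr)
  then show ?B by (simp only: eq[symmetric])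
qed

section \<open>Geometric RSK correspondence\<close>

definition covers :: "nat \<times> nat \<Rightarrow> nat \<times> nat \<Rightarrow> bool" where
  "covers c d \<longleftrightarrow> c = (Suc (fst d), snd d) \<or> c = (fst d, Suc (snd d))"

text \<open>In the multiplicative coordinates t = exp y this is the sum of t_d / t_c over the edges
  of the shape plus 1 / t at the corner (0, 0). Geometric RSK turns it into the sum of the inverse
  weights, and on a square it splits into two Whittaker potentials and exp (-x_1).\<close>

definition energy :: "(nat \<times> nat) set \<Rightarrow> (nat \<times> nat \<Rightarrow> real) \<Rightarrow> real" where
  "energy L y = (\<Sum>(c, d)\<in>{(c, d). c \<in> L \<and> d \<in> L \<and> covers c d}. exp (y d - y c))
     + (if (0, 0) \<in> L then exp (- y (0, 0)) else 0)"

text \<open>Logarithm of the product of the entries on the diagonal that ends at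
  \<open>(i, j)\<close>. At a boundary cell geometric RSK makes it the total weight of the rectangle
  below \<open>(i, j)\<close>.\<close>

definition diag_sum :: "(nat \<times> nat \<Rightarrow> real) \<Rightarrow> nat \<Rightarrow> nat \<Rightarrow> real" where
  "diag_sum y i j = (\<Sum>r\<le>min i j. y (i - r, j - r))"

lemma diag_sum_0 [simp]: "diag_sum y 0 j = y (0, j)" "diag_sum y i 0 = y (i, 0)"
  by (simp_all add: diag_sum_def)

lemma diag_sum_Suc: "diag_sum y (Suc i) (Suc j) = y (Suc i, Suc j) + diag_sum y i j"
  unfolding diag_sum_def min_Suc_Suc sum.atMost_Suc_shift by simp

text \<open>For a cell \<open>c\<close> with all its neighbours in the shape, the terms of
  \<open>energy\<close> that contain \<open>y c\<close> are
  \<open>inflow y c * exp (- y c) + exp (y c) * outflow y c\<close>. The summand 1 at (0, 0) stands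
  for the term \<open>exp (- y (0, 0))\<close>.\<close>

definition inflow :: "(nat \<times> nat \<Rightarrow> real) \<Rightarrow> nat \<times> nat \<Rightarrow> real" where
  "inflow y = (\<lambda>(p, q). (if p = 0 \<and> q = 0 then 1 else 0)
     + (if p = 0 then 0 else exp (y (p - 1, q))) + (if q = 0 then 0 else exp (y (p, q - 1))))"

definition outflow :: "(nat \<times> nat \<Rightarrow> real) \<Rightarrow> nat \<times> nat \<Rightarrow> real" where
  "outflow y = (\<lambda>(p, q). exp (- y (Suc p, q)) + exp (- y (p, Suc q)))"

lemma inflow_pos: "inflow y c > 0"
  by (auto simp: inflow_def split: prod.splits intro: add_pos_pos)

lemma outflow_pos: "outflow y c > 0"
  by (auto simp: outflow_def split: prod.splits intro: add_pos_pos)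

text \<open>Both sides see the same two cells: 1 / A + 1 / B = (A + B) / (A B). This makes
  consecutive toggles on a diagonal telescope.\<close>

lemma ln_outflow:
  "ln (outflow y (p, q)) = ln (inflow y (Suc p, Suc q)) - y (Suc p, q) - y (p, Suc q)"
proof -
  have "outflow y (p, q) = inflow y (Suc p, Suc q) * exp (- y (Suc p, q) - y (p, Suc q))"
    by (simp add: outflow_def inflow_def distrib_right flip: exp_add)
  then show ?thesis using inflow_pos[of y "(Suc p, Suc q)"] by (simp add: ln_mult)
qed

text \<open>By \<open>ln_outflow\<close> the outflow of a cell cancels the inflow of the next cell
  up the diagonal, so only the inflow beyond the top survives. At the boundary the inflow is a
  single exponential, or 1 at the corner; its logarithm is the one entry by which a neighbouring
  diagonal is longer.\<close>

lemma diag_sum_toggle: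
  assumes "\<And>r. r \<le> min p q \<Longrightarrow> y' (p - r, q - r)
      = ln (inflow y (p - r, q - r)) - ln (outflow y (p - r, q - r)) - y (p - r, q - r)"
  shows "diag_sum y' p q
      = diag_sum y (Suc p) q + diag_sum y p (Suc q) - diag_sum y p q - ln (inflow y (Suc p, Suc q))"
  using assms
proof (induction p arbitrary: q)
  case 0
  then show ?case
    using 0[of 0] by (cases q) (auto simp: ln_outflow diag_sum_Suc inflow_def)
next
  case (Suc p)
  show ?case
  proof (cases q)
    case 0
    then show ?thesis
      using Suc.prems[of 0] by (auto simp: ln_outflow diag_sum_Suc inflow_def)
  next
    case [simp]: (Suc q')
    have "diag_sum y' p q'
        = diag_sum y (Suc p) q' + diag_sum y p (Suc q') - diag_sum y p q' - ln (inflow y (Suc p, Suc q'))"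
    proof (rule Suc.IH)
      fix r assume "r \<le> min p q'"
      then show "y' (p - r, q' - r)
          = ln (inflow y (p - r, q' - r)) - ln (outflow y (p - r, q' - r)) - y (p - r, q' - r)"
        using Suc.prems[of "Suc r"] by simp
    qed
    then show ?thesis
      using Suc.prems[of 0] by (simp add: ln_outflow diag_sum_Suc)
  qed
qed

text \<open>
  Inserting a new corner \<open>(i, j)\<close> with weight \<open>w\<close> toggles the cells of its diagonal. The toggle is the
  involution \<open>t \<mapsto> A / (B t)\<close> exchanging the two summands of \<open>A / t + B t\<close>.
\<close>

definition insert_corner :: "nat \<Rightarrow> nat \<Rightarrow> (nat \<times> nat \<Rightarrow> real) \<Rightarrow> nat \<times> nat \<Rightarrow> real" where
  "insert_corner i j y = (\<lambda>c. if c = (i, j) then y c + ln (inflow y c)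
     else if fst c + j = snd c + i \<and> fst c < i then ln (inflow y c) - ln (outflow y c) - y c
     else y c)"

text \<open>This is the recursion that rectangle sums of the weights satisfy by inclusion and
  exclusion. The new corner contributes \<open>ln (inflow y (i, j))\<close>, exactly the term left
  over by the telescoping in \<open>diag_sum_toggle\<close>.\<close>

lemma diag_sum_insert_corner:
  "diag_sum (insert_corner i j y) i j = y (i, j)
     + (if i = 0 then 0 else diag_sum y (i - 1) j) + (if j = 0 then 0 else diag_sum y i (j - 1))
     - (if i = 0 \<or> j = 0 then 0 else diag_sum y (i - 1) (j - 1))"
proof (cases "i = 0 \<or> j = 0")
  case True
  then show ?thesis by (cases i; cases j) (auto simp: insert_corner_def inflow_def)
next
  case False
  then obtain p q where [simp]: "i = Suc p" "j = Suc q" by (metis not0_implies_Suc)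
  have "diag_sum (insert_corner i j y) p q
      = diag_sum y (Suc p) q + diag_sum y p (Suc q) - diag_sum y p q - ln (inflow y (Suc p, Suc q))"
    by (rule diag_sum_toggle) (auto simp: insert_corner_def)
  then show ?thesis by (simp add: diag_sum_Suc insert_corner_def)
qed

lemma diag_sum_insert_corner_other:
  assumes "p + j \<noteq> q + i"
  shows "diag_sum (insert_corner i j y) p q = diag_sum y p q"
  unfolding diag_sum_def insert_corner_def using assms by (intro sum.cong) auto

text \<open>All altered cells lie on one diagonal, while \<open>inflow\<close> and
  \<open>outflow\<close> read only the two adjacent ones; hence the map is a family of shears. The
  rectangle contained in \<open>I\<close> guarantees that the neighbours that are read are
  coordinates.\<close>

lemma preserves_insert_corner:
  assumes I: "finite I" "{..i} \<times> {..j} \<subseteq> I"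
  shows "preserves (lborel_pow I) (lborel_pow I) (insert_corner i j)"
proof -
  define D where "D = {c. c = (i, j) \<or> fst c + j = snd c + i \<and> fst c < i}"
  define e where "e = (\<lambda>c. if c = (i, j) then 1 else - 1 :: real)"
  define g where "g = (\<lambda>c y. ln (inflow y c) - (if c = (i, j) then 0 else ln (outflow y c)))"
  have "D \<subseteq> I" using I unfolding D_def by (intro subset_trans[OF _ I(2)]) auto
  have "preserves (lborel_pow I) (lborel_pow I) (\<lambda>x c. if c \<in> D then e c * x c + g c x else x c)"
  proof (rule preserves_shears)
    fix c assume c: "c \<in> D"
    obtain p q where [simp]: "c = (p, q)" by (cases c)
    have mem: "p \<noteq> 0 \<Longrightarrow> (p - 1, q) \<in> I" "q \<noteq> 0 \<Longrightarrow> (p, q - 1) \<in> I"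
      "c \<noteq> (i, j) \<Longrightarrow> (Suc p, q) \<in> I" "c \<noteq> (i, j) \<Longrightarrow> (p, Suc q) \<in> I"
      using c I(2) by (auto simp: D_def)
    then show "g c \<in> borel_measurable (lborel_pow I)"
      unfolding g_def inflow_def outflow_def
      by (cases "p = 0"; cases "q = 0"; cases "c = (i, j)") (simp_all, measurable)
    fix x y :: "nat \<times> nat \<Rightarrow> real" assume "\<And>d. d \<notin> D \<Longrightarrow> x d = y d"
    moreover have "p \<noteq> 0 \<Longrightarrow> (p - 1, q) \<notin> D" "q \<noteq> 0 \<Longrightarrow> (p, q - 1) \<notin> D" "(Suc p, q) \<notin> D" "(p, Suc q) \<notin> D"
      using c by (auto simp: D_def)
    ultimately show "g c x = g c y" by (auto simp: g_def inflow_def outflow_def)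
  qed (use I \<open>D \<subseteq> I\<close> in \<open>auto simp: e_def\<close>)
  moreover have "(\<lambda>x c. if c \<in> D then e c * x c + g c x else x c) = insert_corner i j"
    by (auto simp: fun_eq_iff insert_corner_def D_def e_def g_def)
  ultimately show ?thesis by simp
qed

lemma toggle_exp: "A > 0 \<Longrightarrow> B > 0 \<Longrightarrow> y' = ln A - ln B - y
  \<Longrightarrow> A * exp (- y') + exp y' * B = A * exp (- y) + exp y * (B::real)"
  by (simp add: exp_diff exp_minus divide_simps)

definition down_closed :: "(nat \<times> nat) set \<Rightarrow> bool" where
  "down_closed L \<longleftrightarrow> (\<forall>p q p' q'. (p, q) \<in> L \<and> p' \<le> p \<and> q' \<le> q \<longrightarrow> (p', q') \<in> L)"

text \<open>\<open>D\<close> will be a diagonal. No edge joins two of its cells, so an edge avoids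
  \<open>D\<close> (\<open>?E0\<close>), has its upper end there (\<open>?E1\<close>) or its lower
  end (\<open>?E2\<close>).\<close>

lemma energy_split:
  assumes L: "finite L" and D: "\<And>c d. c \<in> D \<Longrightarrow> d \<in> D \<Longrightarrow> \<not> covers c d"
  shows "energy L y = (\<Sum>(c, d)\<in>{(c, d). c \<in> L - D \<and> d \<in> L - D \<and> covers c d}. exp (y d - y c))
     + (if (0, 0) \<in> L - D then exp (- y (0, 0)) else 0)
     + (\<Sum>e\<in>L \<inter> D. ((\<Sum>d\<in>{d\<in>L. covers e d}. exp (y d)) + (if e = (0, 0) then 1 else 0)) * exp (- y e)
          + exp (y e) * (\<Sum>c\<in>{c\<in>L. covers c e}. exp (- y c)))"
proof -
  let ?f = "\<lambda>(c, d). exp (y d - y c)"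
  let ?E0 = "{(c, d). c \<in> L - D \<and> d \<in> L - D \<and> covers c d}"
  let ?E1 = "Sigma (L \<inter> D) (\<lambda>e. {d\<in>L. covers e d})"
  let ?E2 = "Sigma (L \<inter> D) (\<lambda>e. {c\<in>L. covers c e})"
  have fin: "finite ?E0" "finite ?E1" "finite ?E2"
    using L by (auto intro: finite_subset[of _ "L \<times> L"])
  have "{(c, d). c \<in> L \<and> d \<in> L \<and> covers c d} = ?E0 \<union> (?E1 \<union> prod.swap ` ?E2)"
    using D by (auto simp: image_iff)
  then have "(\<Sum>x\<in>{(c, d). c \<in> L \<and> d \<in> L \<and> covers c d}. ?f x)
      = sum ?f ?E0 + (sum ?f ?E1 + sum ?f (prod.swap ` ?E2))"
  proof -
    have fin': "finite (prod.swap ` ?E2)" using fin by simp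
    have "?E0 \<inter> (?E1 \<union> prod.swap ` ?E2) = {}" by auto
    moreover have "?E1 \<inter> prod.swap ` ?E2 = {}" using D by auto
    ultimately show ?thesis
      using fin fin' \<open>_ = ?E0 \<union> (?E1 \<union> prod.swap ` ?E2)\<close> by (simp only: sum.union_disjoint finite_UnI)
  qed
  also have "sum ?f (prod.swap ` ?E2) = (\<Sum>e\<in>L \<inter> D. \<Sum>c\<in>{c\<in>L. covers c e}. exp (y e - y c))"
    using L by (subst sum.reindex) (auto simp: sum.Sigma intro!: sum.cong)
  also have "sum ?f ?E1 = (\<Sum>e\<in>L \<inter> D. \<Sum>d\<in>{d\<in>L. covers e d}. exp (y d - y e))"
    using L by (subst sum.Sigma) auto
  finally have "energy L y = sum ?f ?E0 + (\<Sum>e\<in>L \<inter> D. \<Sum>d\<in>{d\<in>L. covers e d}. exp (y d - y e))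
     + (\<Sum>e\<in>L \<inter> D. \<Sum>c\<in>{c\<in>L. covers c e}. exp (y e - y c)) + (if (0, 0) \<in> L then exp (- y (0, 0)) else 0)"
    by (simp add: energy_def)
  moreover have "(if (0, 0) \<in> L then exp (- y (0, 0)) else 0) = (if (0, 0) \<in> L - D then exp (- y (0, 0)) else 0)
      + (\<Sum>e\<in>L \<inter> D. (if e = (0, 0) then 1 else 0) * exp (- y e))"
    using L by (auto simp: if_distrib[of "\<lambda>x. x * _"] sum.delta cong: if_cong)
  moreover have "((\<Sum>d\<in>{d\<in>L. covers e d}. exp (y d)) + (if e = (0, 0) then 1 else 0)) * exp (- y e)
        + exp (y e) * (\<Sum>c\<in>{c\<in>L. covers c e}. exp (- y c))
      = (\<Sum>d\<in>{d\<in>L. covers e d}. exp (y d - y e)) + (\<Sum>c\<in>{c\<in>L. covers c e}. exp (y e - y c))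
        + (if e = (0, 0) then 1 else 0) * exp (- y e)" for e
    by (simp add: distrib_right sum_distrib_left sum_distrib_right exp_diff exp_minus divide_inverse)
  ultimately show ?thesis by (simp only: sum.distrib)
qed

text \<open>A toggle exchanges the two terms in the bracket of its cell and keeps their sum, and the
  brackets on one diagonal do not interact. The new corner has lower neighbours only, and its shift
  by \<open>ln (inflow y (i, j))\<close> reduces its bracket to
  \<open>exp (- y (i, j))\<close>.\<close>

lemma energy_insert_corner:
  assumes L: "finite L" "down_closed (insert (i, j) L)" "down_closed L" "(i, j) \<notin> L"
  shows "energy (insert (i, j) L) (insert_corner i j y) = energy L y + exp (- y (i, j))"
proof -
  define D where "D = {c. fst c + j = snd c + i}"
  define y' where "y' = insert_corner i j y"
  let ?L = "insert (i, j) L"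
  have D: "\<not> covers c d" if "c \<in> D" "d \<in> D" for c d
    using that by (auto simp: D_def covers_def)
  have same: "y' c = y c" if "c \<notin> D" for c
    using that by (auto simp: y'_def insert_corner_def D_def)
  have ijD: "(i, j) \<in> D" by (simp add: D_def)
  \<comment> \<open>A cell of \<open>L\<close> on this diagonal at or above \<open>(i, j)\<close>
    would force \<open>(i, j)\<close> into the down-closed set \<open>L\<close>.\<close>
  have less: "fst e < i \<and> snd e < j" if "e \<in> L \<inter> D" for e
  proof (rule ccontr)
    assume "\<not> ?thesis"
    then have "i \<le> fst e" "j \<le> snd e" using that by (auto simp: D_def)
    then show False using L(3,4) that unfolding down_closed_def by (cases e) auto
  qed
  have down: "{d\<in>M. covers e d} = (case e of (p, q) \<Rightarrow> (if p = 0 then {} else {(p - 1, q)}) \<union> (if q = 0 then {} else {(p, q - 1)}))"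
    if "e \<in> M" "down_closed M" for e M
  proof -
    obtain p q where [simp]: "e = (p, q)" by (cases e)
    have "(p - 1, q) \<in> M" "(p, q - 1) \<in> M"
      using that unfolding down_closed_def by (metis \<open>e = (p, q)\<close> diff_le_self order_refl)+
    then show ?thesis by (cases p; cases q) (auto simp: covers_def)
  qed
  have infl: "(\<Sum>d\<in>{d\<in>M. covers e d}. exp (z d)) + (if e = (0, 0) then 1 else 0) = inflow z e"
    if "e \<in> M" "down_closed M" for e M z
    unfolding down[OF that] by (cases e) (auto simp: inflow_def)
  \<comment> \<open>Strictly below the corner on its diagonal both upper neighbours are present:
    they lie below \<open>(i, j)\<close> and differ from it.\<close>
  have up: "{c\<in>M. covers c (p, q)} = {(Suc p, q), (p, Suc q)}" if "(p, q) \<in> L \<inter> D" "L \<subseteq> M" for p q M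
  proof -
    have "(Suc p, q) \<in> ?L" "(p, Suc q) \<in> ?L"
      using less[OF that(1)] L(2) unfolding down_closed_def by (metis Suc_leI fst_conv insertI1 less_imp_le snd_conv)+
    then have "(Suc p, q) \<in> L" "(p, Suc q) \<in> L" using less[OF that(1)] by auto
    then show ?thesis using that(2) by (auto simp: covers_def)
  qed
  have outfl: "(\<Sum>c\<in>{c\<in>M. covers c e}. exp (- z c)) = outflow z e" if "e \<in> L \<inter> D" "L \<subseteq> M" for e M z
    using up[of "fst e" "snd e" M] that by (cases e) (auto simp: outflow_def)
  have top: "{c\<in>?L. covers c (i, j)} = {}"
  proof -
    have "(Suc i, j) \<notin> L" "(i, Suc j) \<notin> L"
      using L(3,4) unfolding down_closed_def by (meson le_SucI order_refl)+
    then show ?thesis by (auto simp: covers_def)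
  qed
  have nb: "inflow y' e = inflow y e" "outflow y' e = outflow y e" if "e \<in> D" for e
  proof -
    obtain p q where [simp]: "e = (p, q)" by (cases e)
    have "p \<noteq> 0 \<Longrightarrow> y' (p - 1, q) = y (p - 1, q)" "q \<noteq> 0 \<Longrightarrow> y' (p, q - 1) = y (p, q - 1)"
      "y' (Suc p, q) = y (Suc p, q)" "y' (p, Suc q) = y (p, Suc q)"
      using that by (auto intro!: same simp: D_def)
    then show "inflow y' e = inflow y e" "outflow y' e = outflow y e"
      by (auto simp: inflow_def outflow_def)
  qed
  have int: "?L \<inter> D = insert (i, j) (L \<inter> D)" "(i, j) \<notin> L \<inter> D" "finite (L \<inter> D)" "?L - D = L - D"
    using ijD L(4) finite_Int[OF disjI1[OF L(1)]] by blast+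
  have tog: "inflow y' e * exp (- y' e) + exp (y' e) * outflow y' e
      = inflow y e * exp (- y e) + exp (y e) * outflow y e" if "e \<in> L \<inter> D" for e
  proof -
    have "y' e = ln (inflow y e) - ln (outflow y e) - y e"
      using less[OF that] that by (auto simp: y'_def insert_corner_def D_def)
    then show ?thesis
      using nb[of e] that toggle_exp[OF inflow_pos outflow_pos] by simp
  qed
  have sumL: "(\<Sum>e\<in>L \<inter> D. ((\<Sum>d\<in>{d\<in>M. covers e d}. exp (z d)) + (if e = (0, 0) then 1 else 0)) * exp (- z e)
          + exp (z e) * (\<Sum>c\<in>{c\<in>M. covers c e}. exp (- z c)))
      = (\<Sum>e\<in>L \<inter> D. inflow z e * exp (- z e) + exp (z e) * outflow z e)"
    if "L \<subseteq> M" "down_closed M" for M z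
  proof (intro sum.cong refl)
    fix e assume e: "e \<in> L \<inter> D"
    then have "e \<in> M" using that by auto
    from infl[OF this that(2)] outfl[OF e that(1)]
    show "((\<Sum>d\<in>{d\<in>M. covers e d}. exp (z d)) + (if e = (0, 0) then 1 else 0)) * exp (- z e)
          + exp (z e) * (\<Sum>c\<in>{c\<in>M. covers c e}. exp (- z c))
      = inflow z e * exp (- z e) + exp (z e) * outflow z e"
      by (simp only:)
  qed
  have rest: "(\<Sum>(c, d)\<in>{(c, d). c \<in> L - D \<and> d \<in> L - D \<and> covers c d}. exp (y' d - y' c))
      = (\<Sum>(c, d)\<in>{(c, d). c \<in> L - D \<and> d \<in> L - D \<and> covers c d}. exp (y d - y c))"
    "(if (0, 0) \<in> L - D then exp (- y' (0, 0)) else 0) = (if (0, 0) \<in> L - D then exp (- y (0, 0)) else 0)"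
    using same by (auto intro!: sum.cong)
  have corner: "((\<Sum>d\<in>{d\<in>?L. covers (i, j) d}. exp (y' d)) + (if (i, j) = (0, 0) then 1 else 0)) * exp (- y' (i, j))
      = exp (- y (i, j))"
    using inflow_pos[of y "(i, j)"]
    unfolding infl[OF insertI1 L(2)] nb(1)[OF ijD]
    by (simp add: y'_def insert_corner_def exp_diff exp_minus field_simps exp_add)
  define R where "R = (\<Sum>(c, d)\<in>{(c, d). c \<in> L - D \<and> d \<in> L - D \<and> covers c d}. exp (y d - y c))
    + (if (0, 0) \<in> L - D then exp (- y (0, 0)) else 0)"
  have "energy L y = R + (\<Sum>e\<in>L \<inter> D. inflow y e * exp (- y e) + exp (y e) * outflow y e)"
    using energy_split[of L D y, OF L(1) D] unfolding sumL[OF subset_refl L(3)] R_def by simp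
  moreover have "energy ?L y' = R + (exp (- y (i, j)) + (\<Sum>e\<in>L \<inter> D. inflow y' e * exp (- y' e) + exp (y' e) * outflow y' e))"
    using energy_split[of ?L D y', OF finite_insert[THEN iffD2, OF L(1)] D]
    unfolding int(4) rest R_def[symmetric] int(1) sum.insert[OF int(3,2)] corner top sumL[OF subset_insertI L(2)] by simp
  moreover have "(\<Sum>e\<in>L \<inter> D. inflow y' e * exp (- y' e) + exp (y' e) * outflow y' e)
      = (\<Sum>e\<in>L \<inter> D. inflow y e * exp (- y e) + exp (y e) * outflow y e)"
    by (intro sum.cong refl tog)
  ultimately show ?thesis by (simp add: y'_def)
qed

text \<open>The shape \<open>L\<close> is filled cell by cell, each step being one
  \<open>insert_corner\<close>, so the induction is on its size. The measure lives on the fixed set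
  \<open>G\<close> throughout; cells outside \<open>L\<close> still hold their raw weights, which
  the next insertion consumes. Diagonal sums are controlled at boundary cells, those with
  \<open>(Suc i, Suc j)\<close> outside \<open>L\<close>.\<close>

theorem geometric_rsk:
  assumes G: "finite G" "down_closed G" and "L \<subseteq> G" "down_closed L"
  shows "\<exists>f. preserves (lborel_pow G) (lborel_pow G) f \<and>
    (\<forall>w. (\<forall>c. c \<notin> L \<longrightarrow> f w c = w c) \<and>
      energy L (f w) = (\<Sum>c\<in>L. exp (- w c)) \<and>
      (\<forall>i j. (i, j) \<in> L \<and> (Suc i, Suc j) \<notin> L \<longrightarrow> diag_sum (f w) i j = (\<Sum>c\<in>{..i} \<times> {..j}. w c)))"
proof -
  show ?thesis using assms(3,4)
  proof (induction "card L" arbitrary: L)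
    case 0
    then have "L = {}" using G(1) finite_subset by (metis card_0_eq)
    then show ?case by (intro exI[of _ "\<lambda>x. x"]) (auto simp: preserves_id energy_def)
  next
    case (Suc n)
    have "L \<noteq> {}" using Suc.hyps(2) by auto
    have finL: "finite L" using Suc.prems G(1) finite_subset by blast
    \<comment> \<open>A cell with maximal coordinate sum is an outer corner: removing it leaves a
      down-closed shape.\<close>
    have "Max ((\<lambda>c. fst c + snd c) ` L) \<in> (\<lambda>c. fst c + snd c) ` L"
      using \<open>L \<noteq> {}\<close> finL by (intro Max_in) auto
    then obtain c0 where c0': "c0 \<in> L" "Max ((\<lambda>c. fst c + snd c) ` L) = fst c0 + snd c0" by auto
    have c0: "c0 \<in> L" "\<And>c. c \<in> L \<Longrightarrow> fst c + snd c \<le> fst c0 + snd c0"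
      using c0' finL by (auto simp flip: c0'(2) intro!: Max_ge)
    obtain i j where c0_eq [simp]: "c0 = (i, j)" by (cases c0)
    define K where "K = L - {(i, j)}"
    have L: "L = insert (i, j) K" "(i, j) \<notin> K" "finite K" using c0 finL by (auto simp: K_def)
    have dK: "down_closed K"
      unfolding down_closed_def
    proof (intro allI impI)
      fix p q p' q' assume *: "(p, q) \<in> K \<and> p' \<le> p \<and> q' \<le> q"
      then have "(p', q') \<in> L" using Suc.prems(2)[unfolded down_closed_def, rule_format, of p q p' q'] L(1) by auto
      moreover have "p + q \<le> i + j" "(p, q) \<noteq> (i, j)" using * c0(2)[of "(p, q)"] L by auto
      ultimately show "(p', q') \<in> K" using * by (auto simp: K_def)
    qed
    obtain f where f: "preserves (lborel_pow G) (lborel_pow G) f"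
      "\<And>w c. c \<notin> K \<Longrightarrow> f w c = w c"
      "\<And>w. energy K (f w) = (\<Sum>c\<in>K. exp (- w c))"
      "\<And>w i j. (i, j) \<in> K \<Longrightarrow> (Suc i, Suc j) \<notin> K \<Longrightarrow> diag_sum (f w) i j = (\<Sum>c\<in>{..i} \<times> {..j}. w c)"
      using Suc.hyps(1)[of K] Suc.hyps(2) Suc.prems L dK by auto
    have box: "{..i} \<times> {..j} \<subseteq> L"
      using Suc.prems(2) c0(1) unfolding down_closed_def by auto
    have notL: "(Suc p, Suc q) \<notin> L" if "p + q + 2 > i + j" for p q
      using c0(2)[of "(Suc p, Suc q)"] that by auto
    let ?f = "\<lambda>w. insert_corner i j (f w)"
    have "preserves (lborel_pow G) (lborel_pow G) ?f"
      using box Suc.prems by (intro preserves_comp[OF f(1) preserves_insert_corner] G(1)) auto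
    moreover have "?f w c = w c" if "c \<notin> L" for w c
    proof -
      have "c \<notin> {..i} \<times> {..j}" using that box by blast
      then have "?f w c = f w c" by (cases c) (auto simp: insert_corner_def)
      then show ?thesis using that L by (auto simp: f(2))
    qed
    moreover have "energy L (?f w) = (\<Sum>c\<in>L. exp (- w c))" for w
      using energy_insert_corner[OF L(3) _ dK L(2), of "f w"] Suc.prems(2) L by (simp add: f)
    moreover have "diag_sum (?f w) p q = (\<Sum>c\<in>{..p} \<times> {..q}. w c)"
      if pq: "(p, q) \<in> L" "(Suc p, Suc q) \<notin> L" for w p q
    proof (cases "(p, q) = (i, j)")
      case True
      have mem: "(p, q) \<in> K" if "p \<le> i" "q \<le> j" "(p, q) \<noteq> (i, j)" for p q
        using box that by (auto simp: K_def)
      have nK: "(Suc p, Suc q) \<notin> K" if "p + q + 2 > i + j" for p q using notL[OF that] L by auto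
      \<comment> \<open>The three neighbouring cells are boundary cells of \<open>K\<close>, so the
        induction hypothesis evaluates every term of the recursion.\<close>
      have 1: "diag_sum (f w) (i - 1) j = (\<Sum>c\<in>{..i - 1} \<times> {..j}. w c)" if "i \<noteq> 0"
        using that by (intro f(4) nK mem) auto
      have 2: "diag_sum (f w) i (j - 1) = (\<Sum>c\<in>{..i} \<times> {..j - 1}. w c)" if "j \<noteq> 0"
        using that by (intro f(4) nK mem) auto
      have 3: "diag_sum (f w) (i - 1) (j - 1) = (\<Sum>c\<in>{..i - 1} \<times> {..j - 1}. w c)" if "i \<noteq> 0" "j \<noteq> 0"
        using that L(2) by (intro f(4) mem) auto
      have 4: "f w (i, j) = w (i, j)" using L by (simp add: f(2))
      have cart: "(\<Sum>c\<in>{..p} \<times> {..q}. w c) = (\<Sum>x\<le>p. \<Sum>y\<le>q. w (x, y))" for p q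
        by (simp add: sum.cartesian_product)
      show ?thesis
        using True diag_sum_insert_corner[of i j "f w", unfolded 4] 1 2 3
        unfolding cart by (cases i; cases j) (simp_all add: sum.distrib del: diag_sum_0)
    next
      case False
      \<comment> \<open>Another boundary cell on the diagonal of the new corner would lie strictly
        below it, and then \<open>(Suc p, Suc q)\<close> would belong to the rectangle contained in
        \<open>L\<close>. Hence its diagonal sum is left alone.\<close>
      have "p + j \<noteq> q + i"
      proof
        assume *: "p + j = q + i"
        have "(p, q) \<in> K" using False pq L by auto
        then have "p < i" using * c0(2)[of "(p, q)"] pq False by auto
        then have "Suc p \<le> i" "Suc q \<le> j" using * by auto
        then show False using box pq by auto
      qed
      then show ?thesis
        using False pq L by (auto simp: diag_sum_insert_corner_other f(4))
    qed
    ultimately show ?case by (intro exI[of _ ?f]) blast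
  qed
qed

section \<open>Stade's identity for Whittaker functions\<close>

text \<open>Euler's integral after the substitution t = exp (-x); it is the contribution of a single
  cell of the square.\<close>

lemma Gamma_integral_log:
  fixes \<mu> :: complex
  assumes "Re \<mu> < 0"
  shows "integrable lborel (\<lambda>x. exp (\<mu> * of_real x - of_real (exp (- x))))"
    and "(\<integral>x. exp (\<mu> * of_real x - of_real (exp (- x))) \<partial>lborel) = Gamma (- \<mu>)"
proof -
  let ?f = "\<lambda>t. complex_of_real t powr (- \<mu> - 1) / of_real (exp t)"
  let ?h = "\<lambda>x. exp (\<mu> * of_real x - of_real (exp (- x)))"
  have img: "(\<lambda>x::real. exp (- x)) ` UNIV = {0<..}"
    by (auto simp: image_iff) (metis exp_ln minus_minus)
  have h: "\<bar>- exp (- x)\<bar> *\<^sub>R ?f (exp (- x)) = ?h x" for x :: real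
  proof -
    have "complex_of_real (exp (- x)) powr (- \<mu> - 1) = exp (\<mu> * of_real x + of_real x)"
      by (simp add: powr_def Ln_of_real algebra_simps del: of_real_minus) (simp add: algebra_simps)
    then have "\<bar>- exp (- x)\<bar> *\<^sub>R ?f (exp (- x))
        = exp (- of_real x) * (exp (\<mu> * of_real x + of_real x) / exp (of_real (exp (- x))))"
      by (simp add: scaleR_conv_of_real exp_of_real[symmetric])
    also have "\<dots> = exp (- of_real x + (\<mu> * of_real x + of_real x) - of_real (exp (- x)))"
      by (simp only: exp_add exp_diff times_divide_eq_right)
    finally show ?thesis by simp
  qed
  have der: "((\<lambda>x. exp (- x)) has_real_derivative - exp (- x)) (at x within UNIV)" for x :: real
    by (auto intro!: derivative_eq_intros)
  have "?f absolutely_integrable_on {0<..} \<and> integral {0<..} ?f = Gamma (- \<mu>)"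
    using assms absolutely_integrable_Gamma_integral'[of "- \<mu>"] Gamma_integral_complex'[of "- \<mu>"]
    by (auto simp: integral_unique)
  then have "?h absolutely_integrable_on UNIV \<and> integral UNIV ?h = Gamma (- \<mu>)"
    using has_absolute_integral_change_of_variables_real[of UNIV "\<lambda>x. exp (- x)" "\<lambda>x. - exp (- x)" ?f "Gamma (- \<mu>)", OF _ der]
    unfolding img h by (auto simp: inj_on_def)
  then have abs: "integrable lebesgue ?h" and int: "integral UNIV ?h = Gamma (- \<mu>)"
    by (simp_all add: set_integrable_def)
  have [measurable]: "?h \<in> borel_measurable borel"
    by (intro borel_measurable_continuous_onI continuous_intros)
  show *: "integrable lborel ?h"
    using abs by (subst (asm) integrable_completion) auto
  show "(\<integral>x. ?h x \<partial>lborel) = Gamma (- \<mu>)"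
    using set_borel_integral_eq_integral(2)[of UNIV ?h] * int
    by (simp add: set_integrable_def set_lebesgue_integral_def)
qed

text \<open>Triangle inequality in Euler's integral, whose integrand has a modulus that depends on
  Re z only.\<close>

lemma norm_Gamma_le: "Re z > 0 \<Longrightarrow> norm (Gamma z) \<le> Gamma (Re z)"
proof -
  assume z: "Re z > 0"
  have "complex_of_real (Gamma (Re z)) = (\<integral>x. exp (- of_real (Re z) * of_real x - of_real (exp (- x))) \<partial>lborel)"
    using z by (subst Gamma_integral_log(2)) (simp_all add: Gamma_complex_of_real)
  also have "\<dots> = of_real (\<integral>x. exp (- Re z * x - exp (- x)) \<partial>lborel)"
    by (subst integral_complex_of_real[symmetric]) (simp flip: exp_of_real)
  finally have 1: "Gamma (Re z) = (\<integral>x. exp (- Re z * x - exp (- x)) \<partial>lborel)"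
    using of_real_eq_iff by blast
  have "norm (Gamma z) = norm (\<integral>x. exp (- z * of_real x - of_real (exp (- x))) \<partial>lborel)"
    using z by (subst Gamma_integral_log(2)) simp_all
  also have "\<dots> \<le> (\<integral>x. norm (exp (- z * of_real x - of_real (exp (- x)))) \<partial>lborel)"
    by (rule integral_norm_bound)
  also have "\<dots> = Gamma (Re z)"
    by (simp add: 1 norm_exp_eq_Re)
  finally show ?thesis .
qed

definition grid :: "nat \<Rightarrow> (nat \<times> nat) set" where "grid N = {..<N} \<times> {..<N}"

definition tri :: "nat \<Rightarrow> (nat \<times> nat) set" where "tri N = {(j, k). 1 \<le> k \<and> k \<le> j \<and> j < N}"

lemma finite_grid [simp]: "finite (grid N)" and finite_tri [simp]: "finite (tri N)"
proof -
  show "finite (grid N)" by (simp add: grid_def)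
  have "tri N \<subseteq> {..N} \<times> {..N}" by (auto simp: tri_def)
  then show "finite (tri N)" by (rule finite_subset) simp
qed

definition increment :: "(nat \<Rightarrow> real) \<Rightarrow> nat \<Rightarrow> real" where
  "increment f j = f j - (if j = 0 then 0 else f (j - 1))"

text \<open>Pulled back by geometric RSK this becomes a product over the cells, because the
  increments of the diagonal sums along the last row and the last column are the column sums and the
  row sums of the weights.\<close>

definition grid_weight :: "nat \<Rightarrow> (nat \<Rightarrow> complex) \<Rightarrow> (nat \<Rightarrow> complex) \<Rightarrow> (nat \<times> nat \<Rightarrow> real) \<Rightarrow> complex" where
  "grid_weight N \<mu> \<nu> y = exp (- of_real (energy (grid N) y)
     + (\<Sum>j<N. \<mu> (Suc j) * of_real (increment (\<lambda>j. diag_sum y (N - 1) j) j))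
     + (\<Sum>i<N. \<nu> (Suc i) * of_real (increment (\<lambda>i. diag_sum y i (N - 1)) i)))"

lemma grid_weight_measurable [measurable]: "grid_weight N \<mu> \<nu> \<in> borel_measurable (lborel_pow (grid N))"
proof -
  have c: "(\<lambda>y. y c) \<in> borel_measurable (lborel_pow (grid N))" if "c \<in> grid N" for c
    using that by measurable
  have d: "(\<lambda>y. diag_sum y i j) \<in> borel_measurable (lborel_pow (grid N))" if "i < N" "j < N" for i j
    unfolding diag_sum_def using that by (intro borel_measurable_sum c) (auto simp: grid_def)
  have "(\<lambda>y. if (0, 0) \<in> grid N then exp (- y (0, 0)) else 0) \<in> borel_measurable (lborel_pow (grid N))"
    by (cases "(0, 0) \<in> grid N") (auto intro!: borel_measurable_exp borel_measurable_uminus c)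
  then have "(\<lambda>y. energy (grid N) y) \<in> borel_measurable (lborel_pow (grid N))"
    unfolding energy_def split_beta
    by (intro borel_measurable_add borel_measurable_sum borel_measurable_exp borel_measurable_diff c) auto
  moreover have "(\<lambda>y. increment (\<lambda>j. diag_sum y (N - 1) j) j) \<in> borel_measurable (lborel_pow (grid N))" if "j < N" for j
    unfolding increment_def using that d[of "N - 1" j] d[of "N - 1" "j - 1"] by (cases "j = 0") auto
  moreover have "(\<lambda>y. increment (\<lambda>i. diag_sum y i (N - 1)) j) \<in> borel_measurable (lborel_pow (grid N))" if "j < N" for j
    unfolding increment_def using that d[of j "N - 1"] d[of "j - 1" "N - 1"] by (cases "j = 0") auto
  ultimately show ?thesis
    unfolding grid_weight_def by measurable
qed

text \<open>In the coordinates of \<open>geometric_rsk\<close> the exponent is a sum over the cells,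
  the coefficient of a weight being the \<open>\<mu>\<close> of its column plus the
  \<open>\<nu>\<close> of its row; the integral is therefore a product of Gamma integrals.\<close>

lemma grid_weight_integral:
  assumes "\<And>p q. p \<in> {1..N} \<Longrightarrow> q \<in> {1..N} \<Longrightarrow> Re (\<mu> q + \<nu> p) < 0"
  shows "integrable (lborel_pow (grid N)) (grid_weight N \<mu> \<nu>)"
    and "(\<integral>y. grid_weight N \<mu> \<nu> y \<partial>lborel_pow (grid N)) = (\<Prod>p=1..N. \<Prod>q=1..N. Gamma (- (\<mu> q + \<nu> p)))"
proof -
  have "down_closed (grid N)" by (auto simp: down_closed_def grid_def)
  then obtain f where f: "preserves (lborel_pow (grid N)) (lborel_pow (grid N)) f"
    "\<And>w. energy (grid N) (f w) = (\<Sum>c\<in>grid N. exp (- w c))"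
    "\<And>w i j. (i, j) \<in> grid N \<Longrightarrow> (Suc i, Suc j) \<notin> grid N \<Longrightarrow> diag_sum (f w) i j = (\<Sum>c\<in>{..i} \<times> {..j}. w c)"
    using geometric_rsk[of "grid N" "grid N"] by auto
  let ?g = "\<lambda>c x. exp ((\<mu> (Suc (snd c)) + \<nu> (Suc (fst c))) * of_real x - of_real (exp (- x)))"
  have eq: "grid_weight N \<mu> \<nu> (f w) = (\<Prod>c\<in>grid N. ?g c (w c))" for w
  proof -
    have cart: "(\<Sum>c\<in>{..p} \<times> {..q}. w c) = (\<Sum>x\<le>p. \<Sum>y\<le>q. w (x, y))" for p q
      by (simp add: sum.cartesian_product)
    have atM: "{..N - 1} = {..<N}" if "k < N" for k using that by auto
    \<comment> \<open>Along the last row the diagonal sums are sums over rectangles of full height,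
      and consecutive ones differ by one column.\<close>
    have col: "increment (\<lambda>j. diag_sum (f w) (N - 1) j) j = (\<Sum>p<N. w (p, j))" if "j < N" for j
    proof -
      have "diag_sum (f w) (N - 1) k = (\<Sum>x<N. \<Sum>y\<le>k. w (x, y))" if "k < N" for k
        using that f(3)[of "N - 1" k w] cart[of "N - 1" k] atM[OF that] by (simp add: grid_def)
      then show ?thesis
        using that by (cases j) (simp_all add: increment_def sum.distrib del: diag_sum_0)
    qed
    have row: "increment (\<lambda>i. diag_sum (f w) i (N - 1)) i = (\<Sum>q<N. w (i, q))" if "i < N" for i
    proof -
      have "diag_sum (f w) k (N - 1) = (\<Sum>x\<le>k. \<Sum>y<N. w (x, y))" if "k < N" for k
        using that f(3)[of k "N - 1" w] cart[of k "N - 1"] atM[OF that] by (simp add: grid_def)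
      then show ?thesis
        using that by (cases i) (simp_all add: increment_def sum.distrib del: diag_sum_0)
    qed
    have s1: "(\<Sum>j<N. \<mu> (Suc j) * of_real (increment (\<lambda>j. diag_sum (f w) (N - 1) j) j))
        = (\<Sum>j<N. \<mu> (Suc j) * of_real (\<Sum>p<N. w (p, j)))"
      by (intro sum.cong refl) (simp only: col lessThan_iff)
    have s2: "(\<Sum>i<N. \<nu> (Suc i) * of_real (increment (\<lambda>i. diag_sum (f w) i (N - 1)) i))
        = (\<Sum>i<N. \<nu> (Suc i) * of_real (\<Sum>q<N. w (i, q)))"
      by (intro sum.cong refl) (simp only: row lessThan_iff)
    have "grid_weight N \<mu> \<nu> (f w) = exp (- of_real (\<Sum>c\<in>grid N. exp (- w c))
      + (\<Sum>j<N. \<mu> (Suc j) * of_real (\<Sum>p<N. w (p, j))) + (\<Sum>i<N. \<nu> (Suc i) * of_real (\<Sum>q<N. w (i, q))))"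
      unfolding grid_weight_def f(2) s1 s2 ..
    also have "(\<Sum>j<N. \<mu> (Suc j) * of_real (\<Sum>p<N. w (p, j))) = (\<Sum>c\<in>grid N. \<mu> (Suc (snd c)) * of_real (w c))"
      unfolding grid_def of_real_sum sum_distrib_left by (subst sum.swap) (simp add: sum.cartesian_product split_beta)
    also have "(\<Sum>i<N. \<nu> (Suc i) * of_real (\<Sum>q<N. w (i, q))) = (\<Sum>c\<in>grid N. \<nu> (Suc (fst c)) * of_real (w c))"
      unfolding grid_def of_real_sum sum_distrib_left by (simp add: sum.cartesian_product split_beta)
    finally show ?thesis
      by (simp add: exp_sum[symmetric] sum.distrib[symmetric] sum_subtractf[symmetric] sum_negf[symmetric] algebra_simps)
  qed
  have re: "Re (\<mu> (Suc (snd c)) + \<nu> (Suc (fst c))) < 0" if "c \<in> grid N" for c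
    using that assms by (auto simp: grid_def simp del: plus_complex.simps)
  have "integrable (lborel_pow (grid N)) (\<lambda>w. \<Prod>c\<in>grid N. ?g c (w c))"
    by (intro lborel_pow.product_integrable_prod Gamma_integral_log(1) re) auto
  then have "integrable (lborel_pow (grid N)) (\<lambda>w. grid_weight N \<mu> \<nu> (f w))" by (simp only: eq)
  then show "integrable (lborel_pow (grid N)) (grid_weight N \<mu> \<nu>)"
    using preserves_integrable[OF f(1) grid_weight_measurable] by blast
  have "(\<integral>y. grid_weight N \<mu> \<nu> y \<partial>lborel_pow (grid N)) = (\<integral>w. (\<Prod>c\<in>grid N. ?g c (w c)) \<partial>lborel_pow (grid N))"
    by (subst preserves_integral[OF f(1) grid_weight_measurable, symmetric]) (simp only: eq)
  also have "\<dots> = (\<Prod>c\<in>grid N. Gamma (- (\<mu> (Suc (snd c)) + \<nu> (Suc (fst c)))))"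
    by (subst lborel_pow.product_integral_prod) (auto intro!: Gamma_integral_log re prod.cong simp del: plus_complex.simps minus_add_distrib)
  also have "\<dots> = (\<Prod>p<N. \<Prod>q<N. Gamma (- (\<mu> (Suc q) + \<nu> (Suc p))))"
    by (simp add: grid_def prod.cartesian_product split_beta)
  also have "\<dots> = (\<Prod>p=1..N. \<Prod>q=1..N. Gamma (- (\<mu> q + \<nu> p)))"
    by (simp add: prod.atLeast1_atMost_eq)
  finally show "(\<integral>y. grid_weight N \<mu> \<nu> y \<partial>lborel_pow (grid N)) = (\<Prod>p=1..N. \<Prod>q=1..N. Gamma (- (\<mu> q + \<nu> p)))" .
qed


section \<open>Two triangular arrays glued along a common row into a square\<close>

definition cell_key :: "nat \<Rightarrow> nat \<times> nat \<Rightarrow> nat + (nat \<times> nat + nat \<times> nat)" where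
  "cell_key N = (\<lambda>(p, q). if p = q then Inl (Suc p)
     else if q < p then Inr (Inl (N - (p - q), Suc q)) else Inr (Inr (N - (q - p), Suc p)))"

lemma bij_cell_key: "bij_betw (cell_key N) (grid N) ({1..N} <+> (tri N <+> tri N))"
proof (rule bij_betw_byWitness)
  let ?g = "\<lambda>k. case k of Inl i \<Rightarrow> (i - 1, i - 1)
    | Inr (Inl (j, k)) \<Rightarrow> (k - 1 + (N - j), k - 1) | Inr (Inr (j, k)) \<Rightarrow> (k - 1, k - 1 + (N - j))"
  show "\<forall>a\<in>grid N. ?g (cell_key N a) = a"
    by (auto simp: cell_key_def grid_def)
  show "\<forall>a\<in>{1..N} <+> (tri N <+> tri N). cell_key N (?g a) = a"
    by (auto simp: cell_key_def tri_def)
  show "cell_key N ` grid N \<subseteq> {1..N} <+> (tri N <+> tri N)"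
    by (auto simp: cell_key_def grid_def tri_def)
  show "?g ` ({1..N} <+> (tri N <+> tri N)) \<subseteq> grid N"
    by (auto simp: grid_def tri_def)
qed

definition frame :: "nat \<Rightarrow> (nat \<Rightarrow> real) \<Rightarrow> (nat \<times> nat \<Rightarrow> real) \<Rightarrow> nat \<times> nat \<Rightarrow> real" where
  "frame N x T = (\<lambda>(j, k). if j = N then x k else T (j, k))"

text \<open>The main diagonal of the square is the common row \<open>x\<close>; the diagonal at
  distance m from it is row N - m of \<open>U\<close> below and of \<open>V\<close> above. The
  corner (0, 0) carries \<open>x 1\<close>, whence the weight exp (-exp (-x_1)) in Stade's
  identity.\<close>

definition glue :: "nat \<Rightarrow> (nat \<Rightarrow> real) \<Rightarrow> (nat \<times> nat \<Rightarrow> real) \<Rightarrow> (nat \<times> nat \<Rightarrow> real) \<Rightarrow> nat \<times> nat \<Rightarrow> real" where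
  "glue N x U V = (\<lambda>(p, q)\<in>grid N. if q \<le> p then frame N x U (N - (p - q), Suc q) else V (N - (q - p), Suc p))"

text \<open>Gluing relabels coordinates: two merges into sum types, followed by the bijection
  \<open>cell_key\<close>.\<close>

lemma preserves_glue:
  "preserves (lborel_pow {1..N} \<Otimes>\<^sub>M (lborel_pow (tri N) \<Otimes>\<^sub>M lborel_pow (tri N))) (lborel_pow (grid N))
     (\<lambda>(x, U, V). glue N x U V)"
proof -
  let ?s = "\<lambda>(x, y). \<lambda>k\<in>tri N <+> tri N. case k of Inl i \<Rightarrow> x i | Inr j \<Rightarrow> y j"
  let ?r = "\<lambda>(x, y). \<lambda>k\<in>{1..N} <+> (tri N <+> tri N). case k of Inl i \<Rightarrow> x i | Inr j \<Rightarrow> y j"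
  have 1: "preserves (lborel_pow {1..N} \<Otimes>\<^sub>M (lborel_pow (tri N) \<Otimes>\<^sub>M lborel_pow (tri N)))
      (lborel_pow {1..N} \<Otimes>\<^sub>M lborel_pow (tri N <+> tri N)) (\<lambda>(x, y). (x, ?s y))"
    by (intro preserves_pair preserves_id preserves_sum sigma_finite_lborel_pow) auto
  have 2: "preserves (lborel_pow {1..N} \<Otimes>\<^sub>M lborel_pow (tri N <+> tri N)) (lborel_pow ({1..N} <+> (tri N <+> tri N))) ?r"
    by (intro preserves_sum) auto
  have 3: "preserves (lborel_pow ({1..N} <+> (tri N <+> tri N))) (lborel_pow (grid N)) (\<lambda>x. \<lambda>i\<in>grid N. x (cell_key N i))"
    by (intro preserves_reindex bij_cell_key) auto
  have key: "cell_key N c \<in> {1..N} <+> (tri N <+> tri N)" if "c \<in> grid N" for c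
    using bij_cell_key that by (auto simp: bij_betw_def)
  have "preserves (lborel_pow {1..N} \<Otimes>\<^sub>M (lborel_pow (tri N) \<Otimes>\<^sub>M lborel_pow (tri N))) (lborel_pow (grid N))
      (\<lambda>z. \<lambda>i\<in>grid N. ?r ((\<lambda>(x, y). (x, ?s y)) z) (cell_key N i))"
    by (rule preserves_comp[OF preserves_comp[OF 1 2] 3])
  also have "(\<lambda>z. \<lambda>i\<in>grid N. ?r ((\<lambda>(x, y). (x, ?s y)) z) (cell_key N i)) = (\<lambda>(x, U, V). glue N x U V)"
  proof (intro ext)
    fix z :: "(nat \<Rightarrow> real) \<times> (nat \<times> nat \<Rightarrow> real) \<times> (nat \<times> nat \<Rightarrow> real)" and c :: "nat \<times> nat"
    obtain x U V where [simp]: "z = (x, U, V)" by (cases z)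
    obtain p q where [simp]: "c = (p, q)" by (cases c)
    show "(\<lambda>i\<in>grid N. ?r ((\<lambda>(x, y). (x, ?s y)) z) (cell_key N i)) c = (\<lambda>(x, U, V). glue N x U V) z c"
    proof (cases "c \<in> grid N")
      case True
      then show ?thesis
        using key[OF True] by (auto simp: glue_def cell_key_def frame_def grid_def)
    qed (simp add: glue_def)
  qed
  finally show ?thesis .
qed

definition tri_energy :: "nat \<Rightarrow> (nat \<times> nat \<Rightarrow> real) \<Rightarrow> real" where
  "tri_energy N T = (\<Sum>j=1..N - 1. \<Sum>k=1..j.
     exp (- (T (j, k) - T (Suc j, k))) + exp (- (T (Suc j, Suc k) - T (j, k))))"

lemma sum_below_diagonal:
  fixes \<phi> :: "nat \<Rightarrow> nat \<Rightarrow> 'a::comm_monoid_add"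
  shows "(\<Sum>(p, q)\<in>{(p, q). q < p \<and> p < N}. \<phi> p q) = (\<Sum>j=1..N - 1. \<Sum>k=1..j. \<phi> (k - 1 + (N - j)) (k - 1))"
proof -
  have "(\<Sum>j=1..N - 1. \<Sum>k=1..j. \<phi> (k - 1 + (N - j)) (k - 1))
      = (\<Sum>(j, k)\<in>Sigma {1..N - 1} (\<lambda>j. {1..j}). \<phi> (k - 1 + (N - j)) (k - 1))"
    by (subst sum.Sigma) auto
  also have "\<dots> = (\<Sum>(p, q)\<in>{(p, q). q < p \<and> p < N}. \<phi> p q)"
    by (rule sum.reindex_bij_witness[where i = "\<lambda>(p, q). (N - (p - q), Suc q)"
          and j = "\<lambda>(j, k). (k - 1 + (N - j), k - 1)"]) auto
  finally show ?thesis ..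
qed

text \<open>Every edge of the square joins two adjacent diagonals and is assigned to its endpoint
  farther from the main diagonal; this sorts the edges into the two triangles.\<close>

lemma energy_glue:
  assumes N: "N \<ge> 1"
  shows "energy (grid N) (glue N x U V) = exp (- x 1) + tri_energy N (frame N x U) + tri_energy N (frame N x V)"
proof -
  define y where "y = glue N x U V"
  let ?low = "{(p, q). q < p \<and> p < N}"
  let ?f = "\<lambda>(c, d). exp (y d - y c)"
  have lo: "y (p, q) = frame N x U (N - (p - q), Suc q)" if "q \<le> p" "p < N" for p q
    using that by (simp add: y_def glue_def grid_def)
  have up: "y (q, p) = frame N x V (N - (p - q), Suc q)" if "q \<le> p" "p < N" for p q
    using that by (cases "p = q") (auto simp: y_def glue_def grid_def frame_def)
  \<comment> \<open>For a cell \<open>(p, q)\<close> below the diagonal the neighbours nearer to it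
    are \<open>(p - 1, q)\<close> and \<open>(p, Suc q)\<close>, giving \<open>?A\<close> and
    \<open>?B\<close>. \<open>?C\<close> and \<open>?D\<close> are the mirror images.\<close>
  let ?A = "(\<lambda>(p, q). ((p, q), (p - 1, q))) ` ?low" and ?B = "(\<lambda>(p, q). ((p, Suc q), (p, q))) ` ?low"
  let ?C = "(\<lambda>(p, q). ((q, p), (q, p - 1))) ` ?low" and ?D = "(\<lambda>(p, q). ((Suc q, p), (q, p))) ` ?low"
  have fin: "finite ?low" by (rule finite_subset[of _ "{..N} \<times> {..N}"]) auto
  have "{(c, d). c \<in> grid N \<and> d \<in> grid N \<and> covers c d} = ?A \<union> (?B \<union> (?C \<union> ?D))" (is "?E = _")
  proof (intro subset_antisym subsetI)
    fix e assume "e \<in> ?E"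
    then obtain c d where cd: "e = (c, d)" "c \<in> grid N" "d \<in> grid N" "covers c d" by blast
    obtain p q where d: "d = (p, q)" by (cases d)
    have "p < N" "q < N" "e = ((Suc p, q), (p, q)) \<and> Suc p < N \<or> e = ((p, Suc q), (p, q)) \<and> Suc q < N"
      using cd by (auto simp: covers_def grid_def d)
    then consider "e = ((Suc p, q), (p, q))" "q < Suc p" "Suc p < N" | "e = ((p, Suc q), (p, q))" "q < p" "p < N"
      | "e = ((p, Suc q), (p, q))" "p < Suc q" "Suc q < N" | "e = ((Suc p, q), (p, q))" "p < q" "q < N"
      by linarith
    then show "e \<in> ?A \<union> (?B \<union> (?C \<union> ?D))"
    proof cases
      case 1
      then have "e \<in> ?A" by (auto intro!: image_eqI[of _ _ "(Suc p, q)"])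
      then show ?thesis by blast
    next
      case 2
      then have "e \<in> ?B" by (auto intro!: image_eqI[of _ _ "(p, q)"])
      then show ?thesis by blast
    next
      case 3
      then have "e \<in> ?C" by (auto intro!: image_eqI[of _ _ "(Suc q, p)"])
      then show ?thesis by blast
    next
      case 4
      then have "e \<in> ?D" by (auto intro!: image_eqI[of _ _ "(q, p)"])
      then show ?thesis by blast
    qed
  qed (auto simp: covers_def grid_def)
  moreover have "?A \<inter> (?B \<union> (?C \<union> ?D)) = {}" "?B \<inter> (?C \<union> ?D) = {}" "?C \<inter> ?D = {}" by auto
  moreover have "finite ?A" "finite ?B" "finite ?C" "finite ?D" using fin by auto
  ultimately have "sum ?f {(c, d). c \<in> grid N \<and> d \<in> grid N \<and> covers c d} = sum ?f ?A + (sum ?f ?B + (sum ?f ?C + sum ?f ?D))"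
    by (simp only: sum.union_disjoint finite_UnI)
  also have "sum ?f ?A = (\<Sum>(p, q)\<in>?low. exp (y (p - 1, q) - y (p, q)))"
    by (subst sum.reindex) (auto simp: inj_on_def intro!: sum.cong)
  also have "sum ?f ?B = (\<Sum>(p, q)\<in>?low. exp (y (p, q) - y (p, Suc q)))"
    by (subst sum.reindex) (auto simp: inj_on_def intro!: sum.cong)
  also have "sum ?f ?C = (\<Sum>(p, q)\<in>?low. exp (y (q, p - 1) - y (q, p)))"
    by (subst sum.reindex) (auto simp: inj_on_def intro!: sum.cong)
  also have "sum ?f ?D = (\<Sum>(p, q)\<in>?low. exp (y (q, p) - y (Suc q, p)))"
    by (subst sum.reindex) (auto simp: inj_on_def intro!: sum.cong)
  also have "(\<Sum>(p, q)\<in>?low. exp (y (p - 1, q) - y (p, q))) + ((\<Sum>(p, q)\<in>?low. exp (y (p, q) - y (p, Suc q)))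
      + ((\<Sum>(p, q)\<in>?low. exp (y (q, p - 1) - y (q, p))) + (\<Sum>(p, q)\<in>?low. exp (y (q, p) - y (Suc q, p)))))
    = (\<Sum>(p, q)\<in>?low. exp (y (p - 1, q) - y (p, q)) + exp (y (p, q) - y (p, Suc q)))
    + (\<Sum>(p, q)\<in>?low. exp (y (q, p - 1) - y (q, p)) + exp (y (q, p) - y (Suc q, p)))"
    by (simp add: sum.distrib split_beta)
  also have "(\<Sum>(p, q)\<in>?low. exp (y (p - 1, q) - y (p, q)) + exp (y (p, q) - y (p, Suc q))) = tri_energy N (frame N x U)"
    unfolding sum_below_diagonal tri_energy_def
  proof (intro sum.cong refl)
    fix j k assume jk: "j \<in> {1..N - 1}" "k \<in> {1..j}"
    let ?p = "k - 1 + (N - j)"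
    have "y (?p - 1, k - 1) = frame N x U (Suc j, k)" "y (?p, k - 1) = frame N x U (j, k)" "y (?p, Suc (k - 1)) = frame N x U (Suc j, Suc k)"
      using jk by (subst lo; force intro!: arg_cong[where f = "frame N x U"])+
    then show "exp (y (?p - 1, k - 1) - y (?p, k - 1)) + exp (y (?p, k - 1) - y (?p, Suc (k - 1)))
        = exp (- (frame N x U (j, k) - frame N x U (Suc j, k))) + exp (- (frame N x U (Suc j, Suc k) - frame N x U (j, k)))"
      by simp
  qed
  also have "(\<Sum>(p, q)\<in>?low. exp (y (q, p - 1) - y (q, p)) + exp (y (q, p) - y (Suc q, p))) = tri_energy N (frame N x V)"
    unfolding sum_below_diagonal tri_energy_def
  proof (intro sum.cong refl)
    fix j k assume jk: "j \<in> {1..N - 1}" "k \<in> {1..j}"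
    let ?p = "k - 1 + (N - j)"
    have "y (k - 1, ?p - 1) = frame N x V (Suc j, k)" "y (k - 1, ?p) = frame N x V (j, k)" "y (Suc (k - 1), ?p) = frame N x V (Suc j, Suc k)"
      using jk by (subst up; force intro!: arg_cong[where f = "frame N x V"])+
    then show "exp (y (k - 1, ?p - 1) - y (k - 1, ?p)) + exp (y (k - 1, ?p) - y (Suc (k - 1), ?p))
        = exp (- (frame N x V (j, k) - frame N x V (Suc j, k))) + exp (- (frame N x V (Suc j, Suc k) - frame N x V (j, k)))"
      by simp
  qed
  moreover have "y (0, 0) = x 1" using N by (simp add: y_def glue_def grid_def frame_def)
  ultimately show ?thesis
    using N unfolding energy_def y_def[symmetric] by (simp add: grid_def)
qed

lemma whittaker_F_frame:
  "whittaker_F N \<mu> T = (\<Sum>j<N. \<mu> (Suc j) * of_real (increment (\<lambda>j. \<Sum>k=1..Suc j. T (Suc j, k)) j)) - of_real (tri_energy N T)"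
proof -
  have "(\<Sum>j=1..N. \<mu> j * complex_of_real ((\<Sum>k=1..j. T (j, k)) - (\<Sum>k=1..j - 1. T (j - 1, k))))
      = (\<Sum>j<N. \<mu> (Suc j) * of_real (increment (\<lambda>j. \<Sum>k=1..Suc j. T (Suc j, k)) j))"
  proof (rule sum.reindex_bij_witness[where i = Suc and j = "\<lambda>j. j - 1"])
    fix j assume "j \<in> {1..N}"
    then obtain b where "j = Suc b" by (cases j) auto
    then show "\<mu> (Suc (j - 1)) * of_real (increment (\<lambda>j. \<Sum>k=1..Suc j. T (Suc j, k)) (j - 1))
        = \<mu> j * complex_of_real ((\<Sum>k=1..j. T (j, k)) - (\<Sum>k=1..j - 1. T (j - 1, k)))"
      by (cases b) (simp_all add: increment_def)
  qed auto
  then show ?thesis unfolding whittaker_F_def tri_energy_def by simp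
qed

text \<open>The diagonal through \<open>(N - 1, j)\<close> is row j + 1 of \<open>U\<close>, so the
  increments of the diagonal sums are the differences of row sums in \<open>whittaker_F\<close>;
  likewise for \<open>V\<close> and the last column.\<close>

lemma grid_weight_glue:
  assumes N: "N \<ge> 1"
  shows "grid_weight N \<mu> \<nu> (glue N x U V)
    = exp (- of_real (exp (- x 1))) * (exp (whittaker_F N \<mu> (frame N x U)) * exp (whittaker_F N \<nu> (frame N x V)))"
proof -
  have col: "diag_sum (glue N x U V) (N - 1) j = (\<Sum>k=1..Suc j. frame N x U (Suc j, k))" if "j < N" for j
  proof -
    have "diag_sum (glue N x U V) (N - 1) j = (\<Sum>r\<le>j. frame N x U (Suc j, Suc (j - r)))"
      unfolding diag_sum_def using that by (intro sum.cong) (auto simp: glue_def grid_def Suc_diff_le)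
    also have "\<dots> = (\<Sum>k=1..Suc j. frame N x U (Suc j, k))"
      by (rule sum.reindex_bij_witness[where i = "\<lambda>k. Suc j - k" and j = "\<lambda>r. Suc (j - r)"]) auto
    finally show ?thesis .
  qed
  have row: "diag_sum (glue N x U V) i (N - 1) = (\<Sum>k=1..Suc i. frame N x V (Suc i, k))" if "i < N" for i
  proof -
    have "diag_sum (glue N x U V) i (N - 1) = (\<Sum>r\<le>i. frame N x V (Suc i, Suc (i - r)))"
      unfolding diag_sum_def using that by (intro sum.cong) (auto simp: glue_def grid_def frame_def Suc_diff_le)
    also have "\<dots> = (\<Sum>k=1..Suc i. frame N x V (Suc i, k))"
      by (rule sum.reindex_bij_witness[where i = "\<lambda>k. Suc i - k" and j = "\<lambda>r. Suc (i - r)"]) auto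
    finally show ?thesis .
  qed
  have col': "increment (\<lambda>j. diag_sum (glue N x U V) (N - 1) j) j = increment (\<lambda>j. \<Sum>k=1..Suc j. frame N x U (Suc j, k)) j"
    if "j < N" for j
    unfolding increment_def using col[of j] col[of "j - 1"] that by (cases "j = 0") (simp_all del: diag_sum_0)
  have row': "increment (\<lambda>i. diag_sum (glue N x U V) i (N - 1)) i = increment (\<lambda>i. \<Sum>k=1..Suc i. frame N x V (Suc i, k)) i"
    if "i < N" for i
    unfolding increment_def using row[of i] row[of "i - 1"] that by (cases "i = 0") (simp_all del: diag_sum_0)
  have s1: "(\<Sum>j<N. \<mu> (Suc j) * of_real (increment (\<lambda>j. diag_sum (glue N x U V) (N - 1) j) j))
      = (\<Sum>j<N. \<mu> (Suc j) * of_real (increment (\<lambda>j. \<Sum>k=1..Suc j. frame N x U (Suc j, k)) j))"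
    by (intro sum.cong refl) (simp only: col' lessThan_iff)
  have s2: "(\<Sum>i<N. \<nu> (Suc i) * of_real (increment (\<lambda>i. diag_sum (glue N x U V) i (N - 1)) i))
      = (\<Sum>i<N. \<nu> (Suc i) * of_real (increment (\<lambda>i. \<Sum>k=1..Suc i. frame N x V (Suc i, k)) i))"
    by (intro sum.cong refl) (simp only: row' lessThan_iff)
  show ?thesis
    unfolding grid_weight_def s1 s2 energy_glue[OF N] whittaker_F_frame exp_add[symmetric]
    by (rule arg_cong[where f = exp]) simp
qed

lemma whittaker_frame: "whittaker N \<mu> x = (\<integral>T. exp (whittaker_F N \<mu> (frame N x T)) \<partial>lborel_pow (tri N))"
  unfolding whittaker_def frame_def tri_def by simp

section \<open>Measurability of Whittaker functions and Stade's identity\<close>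

lemma frame_measurable:
  shows "(\<lambda>(x, T). tri_energy N (frame N x T)) \<in> borel_measurable (lborel_pow {1..N} \<Otimes>\<^sub>M lborel_pow (tri N))"
    and "j < N \<Longrightarrow> (\<lambda>(x, T). increment (\<lambda>j. \<Sum>k=1..Suc j. frame N x T (Suc j, k)) j)
      \<in> borel_measurable (lborel_pow {1..N} \<Otimes>\<^sub>M lborel_pow (tri N))"
proof -
  have c: "(\<lambda>z. frame N (fst z) (snd z) (j, k)) \<in> borel_measurable (lborel_pow {1..N} \<Otimes>\<^sub>M lborel_pow (tri N))"
    if "1 \<le> k" "k \<le> j" "j \<le> N" for j k
  proof (cases "j = N")
    case True
    then have "k \<in> {1..N}" using that by auto
    then show ?thesis unfolding frame_def using True by simp
  next
    case False
    then have "(j, k) \<in> tri N" using that by (auto simp: tri_def)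
    then show ?thesis unfolding frame_def using False by simp
  qed
  have e: "(\<lambda>z. exp (- (frame N (fst z) (snd z) c - frame N (fst z) (snd z) d))) \<in> borel_measurable (lborel_pow {1..N} \<Otimes>\<^sub>M lborel_pow (tri N))"
    if "(\<lambda>z. frame N (fst z) (snd z) c) \<in> borel_measurable (lborel_pow {1..N} \<Otimes>\<^sub>M lborel_pow (tri N))"
       "(\<lambda>z. frame N (fst z) (snd z) d) \<in> borel_measurable (lborel_pow {1..N} \<Otimes>\<^sub>M lborel_pow (tri N))" for c d
    using that by measurable
  show "(\<lambda>(x, T). tri_energy N (frame N x T)) \<in> borel_measurable (lborel_pow {1..N} \<Otimes>\<^sub>M lborel_pow (tri N))"
    unfolding tri_energy_def split_beta by (intro borel_measurable_sum borel_measurable_add e c) auto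
  show "(\<lambda>(x, T). increment (\<lambda>j. \<Sum>k=1..Suc j. frame N x T (Suc j, k)) j) \<in> borel_measurable (lborel_pow {1..N} \<Otimes>\<^sub>M lborel_pow (tri N))"
    if "j < N"
  proof -
    have "(\<lambda>z. \<Sum>k=1..Suc i. frame N (fst z) (snd z) (Suc i, k)) \<in> borel_measurable (lborel_pow {1..N} \<Otimes>\<^sub>M lborel_pow (tri N))"
      if "i < N" for i using that by (intro borel_measurable_sum c) auto
    from this[OF that] this[of "j - 1"] show ?thesis
      unfolding increment_def split_beta using that by (cases "j = 0") auto
  qed
qed

lemma complex_of_real_measurable:
  "f \<in> borel_measurable M \<Longrightarrow> (\<lambda>x. complex_of_real (f x)) \<in> borel_measurable M"
  by measurable

lemma complex_exp_measurable:
  "f \<in> borel_measurable M \<Longrightarrow> (\<lambda>x. exp (f x) :: complex) \<in> borel_measurable M"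
  by measurable

lemma whittaker_F_measurable:
  "(\<lambda>(x, T). exp (whittaker_F N \<mu> (frame N x T))) \<in> borel_measurable (lborel_pow {1..N} \<Otimes>\<^sub>M lborel_pow (tri N))"
proof -
  have "(\<lambda>z. exp ((\<Sum>j<N. \<mu> (Suc j) * complex_of_real (case z of (x, T) \<Rightarrow> increment (\<lambda>j. \<Sum>k=1..Suc j. frame N x T (Suc j, k)) j))
      - complex_of_real (case z of (x, T) \<Rightarrow> tri_energy N (frame N x T))))
    \<in> borel_measurable (lborel_pow {1..N} \<Otimes>\<^sub>M lborel_pow (tri N))"
    by (intro complex_exp_measurable borel_measurable_diff borel_measurable_sum borel_measurable_times
        complex_of_real_measurable frame_measurable) auto
  then show ?thesis unfolding whittaker_F_frame by (simp add: split_beta)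
qed

text \<open>Joint measurability in parameter and argument prepares the exchange of the spectral and
  the spatial integral.\<close>

lemma whittaker_measurable_pair:
  assumes \<mu>: "\<And>j. j \<in> {1..N} \<Longrightarrow> (\<lambda>k. \<mu> k j) \<in> borel_measurable M"
  shows "(\<lambda>(k, x). whittaker N (\<mu> k) x) \<in> borel_measurable (M \<Otimes>\<^sub>M lborel_pow {1..N})"
proof -
  interpret sigma_finite_measure "lborel_pow (tri N)" by (rule sigma_finite_lborel_pow) simp
  let ?R = "\<lambda>j (x, T). increment (\<lambda>j. \<Sum>k=1..Suc j. frame N x T (Suc j, k)) j"
  let ?E = "\<lambda>(x, T). tri_energy N (frame N x T)"
  have p: "(\<lambda>z. (snd (fst z), snd z)) \<in> (M \<Otimes>\<^sub>M lborel_pow {1..N}) \<Otimes>\<^sub>M lborel_pow (tri N) \<rightarrow>\<^sub>M lborel_pow {1..N} \<Otimes>\<^sub>M lborel_pow (tri N)"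
    by measurable
  have m: "(\<lambda>z. \<mu> (fst (fst z)) (Suc j)) \<in> borel_measurable ((M \<Otimes>\<^sub>M lborel_pow {1..N}) \<Otimes>\<^sub>M lborel_pow (tri N))" if "j < N" for j
  proof -
    have [measurable]: "(\<lambda>k. \<mu> k (Suc j)) \<in> borel_measurable M" using \<mu>[of "Suc j"] that by simp
    show ?thesis by measurable
  qed
  have "(\<lambda>z. \<mu> (fst (fst z)) (Suc j) * complex_of_real (?R j (snd (fst z), snd z))) \<in> borel_measurable ((M \<Otimes>\<^sub>M lborel_pow {1..N}) \<Otimes>\<^sub>M lborel_pow (tri N))"
    if "j < N" for j
    using m[OF that] measurable_compose[OF p frame_measurable(2)[OF that]]
    by (intro borel_measurable_times complex_of_real_measurable) simp_all
  moreover have "(\<lambda>z. complex_of_real (?E (snd (fst z), snd z))) \<in> borel_measurable ((M \<Otimes>\<^sub>M lborel_pow {1..N}) \<Otimes>\<^sub>M lborel_pow (tri N))"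
    using measurable_compose[OF p frame_measurable(1)]
    by (intro complex_of_real_measurable) simp_all
  ultimately have "(\<lambda>z. exp ((\<Sum>j<N. \<mu> (fst (fst z)) (Suc j) * complex_of_real (?R j (snd (fst z), snd z))) - complex_of_real (?E (snd (fst z), snd z))))
      \<in> borel_measurable ((M \<Otimes>\<^sub>M lborel_pow {1..N}) \<Otimes>\<^sub>M lborel_pow (tri N))"
    by (intro complex_exp_measurable borel_measurable_diff borel_measurable_sum) auto
  then show ?thesis
    unfolding whittaker_frame whittaker_F_frame split_beta
    by (intro borel_measurable_lebesgue_integral) (simp add: split_beta)
qed

lemma whittaker_measurable [measurable]: "whittaker N \<mu> \<in> borel_measurable (lborel_pow {1..N})"
proof -
  have "(\<lambda>x. (0::real, x)) \<in> lborel_pow {1..N} \<rightarrow>\<^sub>M borel \<Otimes>\<^sub>M lborel_pow {1..N}" by measurable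
  from measurable_compose[OF this whittaker_measurable_pair[of N "\<lambda>_. \<mu>" borel]] show ?thesis by simp
qed

text \<open>This is \<open>grid_weight_integral\<close> read through \<open>glue\<close>. For fixed
  \<open>x\<close> the integrals over the two arrays separate into the two Whittaker functions;
  Fubini grants the separation for almost every \<open>x\<close>.\<close>

theorem whittaker_stade:
  assumes N: "N \<ge> 1" and neg: "\<And>p q. p \<in> {1..N} \<Longrightarrow> q \<in> {1..N} \<Longrightarrow> Re (\<mu> q + \<nu> p) < 0"
  shows "integrable (lborel_pow {1..N}) (\<lambda>x. of_real (exp (- exp (- x 1))) * (whittaker N \<mu> x * whittaker N \<nu> x))"
    and "(\<integral>x. of_real (exp (- exp (- x 1))) * (whittaker N \<mu> x * whittaker N \<nu> x) \<partial>lborel_pow {1..N})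
      = (\<Prod>p=1..N. \<Prod>q=1..N. Gamma (- (\<mu> q + \<nu> p)))"
proof -
  let ?M = "lborel_pow {1..N}" and ?T = "lborel_pow (tri N)"
  interpret T: sigma_finite_measure ?T by (rule sigma_finite_lborel_pow) simp
  interpret TT: pair_sigma_finite ?T ?T ..
  interpret M: sigma_finite_measure ?M by (rule sigma_finite_lborel_pow) simp
  interpret TT2: sigma_finite_measure "?T \<Otimes>\<^sub>M ?T" by (rule TT.sigma_finite_measure_axioms)
  interpret MTT: pair_sigma_finite ?M "?T \<Otimes>\<^sub>M ?T" ..
  let ?F = "\<lambda>(x, U, V). exp (- of_real (exp (- x 1))) * (exp (whittaker_F N \<mu> (frame N x U)) * exp (whittaker_F N \<nu> (frame N x V)))"
  have F: "?F = (\<lambda>z. grid_weight N \<mu> \<nu> ((\<lambda>(x, U, V). glue N x U V) z))"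
    using grid_weight_glue[OF N] by (auto simp: fun_eq_iff)
  have int: "integrable (?M \<Otimes>\<^sub>M (?T \<Otimes>\<^sub>M ?T)) ?F"
    unfolding F by (subst preserves_integrable[OF preserves_glue]) (auto intro!: grid_weight_integral neg)
  have val: "(\<integral>z. ?F z \<partial>(?M \<Otimes>\<^sub>M (?T \<Otimes>\<^sub>M ?T))) = (\<Prod>p=1..N. \<Prod>q=1..N. Gamma (- (\<mu> q + \<nu> p)))"
    unfolding F preserves_integral[OF preserves_glue grid_weight_measurable]
    by (rule grid_weight_integral(2)[OF neg])
  have AE: "AE x in ?M. (\<integral>z. ?F (x, z) \<partial>(?T \<Otimes>\<^sub>M ?T)) = of_real (exp (- exp (- x 1))) * (whittaker N \<mu> x * whittaker N \<nu> x)"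
    using MTT.AE_integrable_fst'[OF int]
  proof eventually_elim
    case (elim x)
    have "(\<integral>z. ?F (x, z) \<partial>(?T \<Otimes>\<^sub>M ?T)) = (\<integral>U. (\<integral>V. ?F (x, (U, V)) \<partial>?T) \<partial>?T)"
      using TT.integral_fst'[OF elim] by simp
    also have "\<dots> = exp (- of_real (exp (- x 1))) * (whittaker N \<mu> x * whittaker N \<nu> x)"
      by (simp add: whittaker_frame)
    finally show ?case by (simp flip: exp_of_real)
  qed
  have m: "(\<lambda>x. of_real (exp (- exp (- x 1))) * (whittaker N \<mu> x * whittaker N \<nu> x)) \<in> borel_measurable ?M"
  proof -
    have "1 \<in> {1..N}" using N by simp
    then show ?thesis by measurable
  qed
  have m2: "(\<lambda>x. \<integral>z. ?F (x, z) \<partial>(?T \<Otimes>\<^sub>M ?T)) \<in> borel_measurable ?M"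
    using MTT.integrable_fst'[OF int] by auto
  show "integrable ?M (\<lambda>x. of_real (exp (- exp (- x 1))) * (whittaker N \<mu> x * whittaker N \<nu> x))"
    using MTT.integrable_fst'[OF int] integrable_cong_AE[OF m2 m AE] by blast
  show "(\<integral>x. of_real (exp (- exp (- x 1))) * (whittaker N \<mu> x * whittaker N \<nu> x) \<partial>?M)
      = (\<Prod>p=1..N. \<Prod>q=1..N. Gamma (- (\<mu> q + \<nu> p)))"
    using MTT.integral_fst'[OF int] integral_cong_AE[OF m2 m AE] val by simp
qed

section \<open>Andreief's identity and Fredholm determinants of finite rank\<close>

text \<open>Leibniz formula over an arbitrary index set, so that principal minors are indexed by
  subsets without renumbering.\<close>

definition detS :: "'i set \<Rightarrow> ('i \<Rightarrow> 'i \<Rightarrow> complex) \<Rightarrow> complex" where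
  "detS I g = (\<Sum>p | p permutes I. of_int (sign p) * (\<Prod>i\<in>I. g i (p i)))"

lemma detS_cong: "(\<And>i j. i \<in> I \<Longrightarrow> j \<in> I \<Longrightarrow> f i j = g i j) \<Longrightarrow> detS I f = detS I g"
  unfolding detS_def by (intro sum.cong prod.cong arg_cong2[where f = "(*)"] refl) (auto simp: permutes_in_image)

text \<open>Conjugation by \<open>f\<close> carries permutations of \<open>A\<close> to permutations
  of \<open>B\<close> and keeps the sign.\<close>

lemma detS_reindex:
  assumes f: "bij_betw f A B" and A: "finite A"
  shows "detS B g = detS A (\<lambda>i j. g (f i) (f j))"
proof -
  have inj: "inj_on f A" using f by (simp add: bij_betw_def)
  have bij: "bij_betw (map_permutation A f) {p. p permutes A} {p. p permutes B}"
  proof -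
    have "map_permutation A f = (\<lambda>p x. if x \<in> B then f (p (inv_into A f x)) else x)"
      using f by (auto simp: map_permutation_def restrict_id_def fun_eq_iff bij_betw_def)
    then show ?thesis using bij_betw_permutations[OF f] by simp
  qed
  have "detS B g = (\<Sum>p | p permutes A. of_int (sign (map_permutation A f p)) * (\<Prod>i\<in>B. g i (map_permutation A f p i)))"
    unfolding detS_def by (rule sum.reindex_bij_betw[OF bij, symmetric])
  also have "\<dots> = detS A (\<lambda>i j. g (f i) (f j))"
    unfolding detS_def
  proof (intro sum.cong refl)
    fix p assume "p \<in> {p. p permutes A}"
    then have p: "p permutes A" by simp
    have "(\<Prod>i\<in>B. g i (map_permutation A f p i)) = (\<Prod>i\<in>A. g (f i) (map_permutation A f p (f i)))"
      by (rule prod.reindex_bij_betw[OF f, symmetric])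
    also have "\<dots> = (\<Prod>i\<in>A. g (f i) (f (p i)))"
      using inj by (intro prod.cong refl) (simp add: map_permutation_def restrict_id_def)
    finally show "of_int (sign (map_permutation A f p)) * (\<Prod>i\<in>B. g i (map_permutation A f p i))
        = of_int (sign p) * (\<Prod>i\<in>A. g (f i) (f (p i)))"
      using sign_map_permutation[OF inj p A] by simp
  qed
  finally show ?thesis .
qed

lemma det1_eq_detS: "det1 n f = detS {1..n} f"
proof -
  have "det1 n f = detS {0..<n} (\<lambda>i j. f (Suc i) (Suc j))"
  proof -
    have "p i < n" if "p permutes {0..<n}" "i < n" for p i
      using permutes_in_image[OF that(1), of i] that(2) by simp
    then show ?thesis
      unfolding det1_def detS_def
      by (subst Determinant.det_def'[of _ n]) (auto intro!: sum.cong prod.cong)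
  qed
  also have "\<dots> = detS {1..n} f"
    by (rule detS_reindex[symmetric]) (auto simp: bij_betw_def image_Suc_atLeastLessThan)
  finally show ?thesis .
qed

lemma det1_identical_rows:
  assumes "i \<in> {1..n}" "j \<in> {1..n}" "i \<noteq> j" "\<And>k. k \<in> {1..n} \<Longrightarrow> f i k = f j k"
  shows "det1 n f = 0"
  unfolding det1_def
proof (rule det_identical_rows[of _ n "i - 1" "j - 1"])
  show "row (mat n n (\<lambda>(j, k). f (Suc j) (Suc k))) (i - 1) = row (mat n n (\<lambda>(j, k). f (Suc j) (Suc k))) (j - 1)"
    using assms by (intro eq_vecI) auto
qed (use assms in auto)

text \<open>Expand every product over the set \<open>I\<close> of rows in which the entry of
  \<open>g\<close> is chosen. The remaining rows force the permutation to fix them, so a permutation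
  of \<open>I\<close> is left.\<close>

lemma detS_one_plus:
  assumes S: "finite S"
  shows "detS S (\<lambda>i j. (if i = j then 1 else 0) + g i j) = (\<Sum>I\<in>Pow S. detS I g)"
proof -
  have "detS S (\<lambda>i j. (if i = j then 1 else 0) + g i j)
      = (\<Sum>p | p permutes S. \<Sum>I\<in>Pow S. of_int (sign p) * ((\<Prod>i\<in>I. g i (p i)) * (\<Prod>i\<in>S - I. if i = p i then 1 else 0)))"
  proof -
    have "(\<Prod>i\<in>S. (if i = p i then 1 else 0) + g i (p i))
        = (\<Sum>I\<in>Pow S. (\<Prod>i\<in>I. g i (p i)) * (\<Prod>i\<in>S - I. if i = p i then 1 else 0))" for p
      using prod_add[OF S, of "\<lambda>i. g i (p i)" "\<lambda>i. if i = p i then 1 else 0"] by (simp only: add.commute)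
    then show ?thesis by (simp only: detS_def sum_distrib_left)
  qed
  also have "\<dots> = (\<Sum>I\<in>Pow S. \<Sum>p | p permutes S. of_int (sign p) * ((\<Prod>i\<in>I. g i (p i)) * (\<Prod>i\<in>S - I. if i = p i then 1 else 0)))"
    by (rule sum.swap)
  also have "\<dots> = (\<Sum>I\<in>Pow S. detS I g)"
  proof (intro sum.cong refl)
    fix I assume "I \<in> Pow S"
    then have I: "I \<subseteq> S" by simp
    have eq: "{p. p permutes I} = {p. p permutes S \<and> (\<forall>i\<in>S - I. i = p i)}"
      using I permutes_subset[of _ I S] permutes_superset[of _ S I] by (auto simp: permutes_not_in)
    have "(\<Sum>p | p permutes S. of_int (sign p) * ((\<Prod>i\<in>I. g i (p i)) * (\<Prod>i\<in>S - I. if i = p i then 1 else 0)))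
        = (\<Sum>p | p permutes I. of_int (sign p) * ((\<Prod>i\<in>I. g i (p i)) * (\<Prod>i\<in>S - I. if i = p i then 1 else 0)))"
      using S unfolding eq
      by (intro sum.mono_neutral_right) (auto simp: finite_permutations)
    also have "\<dots> = detS I g"
      unfolding detS_def eq by (intro sum.cong refl) auto
    finally show "(\<Sum>p | p permutes S. of_int (sign p) * ((\<Prod>i\<in>I. g i (p i)) * (\<Prod>i\<in>S - I. if i = p i then 1 else 0))) = detS I g" .
  qed
  finally show ?thesis .
qed

lemma card_inj_PiE: "finite A \<Longrightarrow> finite I \<Longrightarrow> card A = card I \<Longrightarrow> card {u \<in> A \<rightarrow>\<^sub>E I. inj_on u A} = fact (card A)"
  by (simp add: card_inj_on_subset_funcset fact_prod_rev)

text \<open>Tuples with a repeated entry contribute \<open>0\<close>, and each principal minor is met \<open>n!\<close> times.\<close>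

lemma sum_det_tuples:
  fixes S :: "nat set"
  assumes S: "finite S"
  shows "(\<Sum>u\<in>{1..n} \<rightarrow>\<^sub>E S. det1 n (\<lambda>j k. g (u j) (u k))) = fact n * (\<Sum>I | I \<subseteq> S \<and> card I = n. detS I g)"
proof -
  let ?A = "{1..n}"
  let ?U = "{u \<in> ?A \<rightarrow>\<^sub>E S. inj_on u ?A}"
  let ?h = "\<lambda>u. det1 n (\<lambda>j k. g (u j) (u k))"
  have finU: "finite ?U" using S by (auto intro!: finite_PiE)
  have "(\<Sum>u\<in>?A \<rightarrow>\<^sub>E S. ?h u) = (\<Sum>u\<in>?U. ?h u)"
  proof (rule sum.mono_neutral_right)
    show "\<forall>u\<in>(?A \<rightarrow>\<^sub>E S) - ?U. ?h u = 0"
    proof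
      fix u assume "u \<in> (?A \<rightarrow>\<^sub>E S) - ?U"
      then obtain i j where "i \<in> ?A" "j \<in> ?A" "i \<noteq> j" "u i = u j" by (auto simp: inj_on_def)
      then show "?h u = 0" by (intro det1_identical_rows[of i n j]) auto
    qed
  qed (use S in \<open>auto intro!: finite_PiE\<close>)
  also have "\<dots> = (\<Sum>I\<in>(\<lambda>u. u ` ?A) ` ?U. \<Sum>u | u \<in> ?U \<and> u ` ?A = I. ?h u)"
    by (rule sum.image_gen[OF finU])
  also have "\<dots> = (\<Sum>I\<in>(\<lambda>u. u ` ?A) ` ?U. fact n * detS I g)"
  proof (intro sum.cong refl)
    fix I assume "I \<in> (\<lambda>u. u ` ?A) ` ?U"
    then have I: "I \<subseteq> S" "card I = n" by (auto simp: card_image)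
    then have finI: "finite I" using S finite_subset by blast
    have eq: "{u. u \<in> ?U \<and> u ` ?A = I} = {u \<in> ?A \<rightarrow>\<^sub>E I. inj_on u ?A}"
    proof (intro subset_antisym subsetI)
      fix u assume "u \<in> {u. u \<in> ?U \<and> u ` ?A = I}"
      then show "u \<in> {u \<in> ?A \<rightarrow>\<^sub>E I. inj_on u ?A}" by (auto simp: PiE_iff)
    next
      fix u assume u: "u \<in> {u \<in> ?A \<rightarrow>\<^sub>E I. inj_on u ?A}"
      then have "u ` ?A \<subseteq> I" "card (u ` ?A) = card I" using I by (auto simp: card_image)
      then have "u ` ?A = I" using finI card_subset_eq by blast
      then show "u \<in> {u. u \<in> ?U \<and> u ` ?A = I}" using u I by (auto simp: PiE_iff)
    qed
    have "(\<Sum>u | u \<in> ?U \<and> u ` ?A = I. ?h u) = (\<Sum>u | u \<in> ?U \<and> u ` ?A = I. detS I g)"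
      by (intro sum.cong refl, subst det1_eq_detS, rule detS_reindex[symmetric]) (auto simp: bij_betw_def)
    also have "\<dots> = fact n * detS I g"
      unfolding eq using card_inj_PiE[of ?A I] I finI by simp
    finally show "(\<Sum>u | u \<in> ?U \<and> u ` ?A = I. ?h u) = fact n * detS I g" .
  qed
  also have "(\<lambda>u. u ` ?A) ` ?U = {I. I \<subseteq> S \<and> card I = n}"
  proof (intro subset_antisym subsetI)
    fix I assume "I \<in> {I. I \<subseteq> S \<and> card I = n}"
    then have I: "I \<subseteq> S" "card I = n" "finite I" using S finite_subset by auto
    then obtain u where u: "bij_betw u ?A I"
      using finite_same_card_bij[of ?A I] by auto
    have "restrict u ?A \<in> ?A \<rightarrow>\<^sub>E S" using I bij_betwE[OF u] by (auto simp: PiE_iff)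
    moreover have "inj_on (restrict u ?A) ?A" "restrict u ?A ` ?A = I"
      using u by (simp_all add: bij_betw_def)
    ultimately have "restrict u ?A \<in> ?U" "restrict u ?A ` ?A = I" by blast+
    then show "I \<in> (\<lambda>u. u ` ?A) ` ?U" by blast
  qed (auto simp: card_image)
  also have "(\<Sum>I | I \<subseteq> S \<and> card I = n. fact n * detS I g) = fact n * (\<Sum>I | I \<subseteq> S \<and> card I = n. detS I g)"
    by (rule sum_distrib_left[symmetric])
  finally show ?thesis .
qed

lemma integral_sum2:
  fixes H :: "'p \<Rightarrow> 'q \<Rightarrow> 'a \<Rightarrow> 'b::{banach, second_countable_topology}"
  assumes "\<And>p q. p \<in> A \<Longrightarrow> q \<in> B \<Longrightarrow> integrable M (H p q)"
  shows "(\<integral>x. (\<Sum>p\<in>A. \<Sum>q\<in>B. H p q x) \<partial>M) = (\<Sum>p\<in>A. \<Sum>q\<in>B. \<integral>x. H p q x \<partial>M)"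
  using assms by (simp add: Bochner_Integration.integral_sum Bochner_Integration.integrable_sum)

text \<open>Expand both determinants and integrate coordinate by coordinate. Replacing
  \<open>q\<close> by \<open>q \<circ> p\<close> removes \<open>p\<close> from the summand, so each
  of the N! permutations \<open>p\<close> yields the same determinant.\<close>

lemma andreief:
  fixes f g :: "nat \<Rightarrow> real \<Rightarrow> complex"
  assumes int: "\<And>j k. j \<in> {1..N} \<Longrightarrow> k \<in> {1..N} \<Longrightarrow> integrable lborel (\<lambda>x. f j x * g k x)"
  shows "(\<integral>x. det1 N (\<lambda>l j. f j (x l)) * det1 N (\<lambda>l k. g k (x l)) \<partial>lborel_pow {1..N})
    = fact N * det1 N (\<lambda>j k. \<integral>x. f j x * g k x \<partial>lborel)"
proof -
  let ?P = "{p. p permutes {1..N}}"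
  let ?G = "\<lambda>j k. \<integral>x. f j x * g k x \<partial>lborel"
  have finP: "finite ?P" by (simp add: finite_permutations)
  have mem: "p l \<in> {1..N}" if "p \<in> ?P" "l \<in> {1..N}" for p l using that permutes_in_image[of p "{1..N}" l] by simp
  have integ: "integrable (lborel_pow {1..N}) (\<lambda>x. \<Prod>l=1..N. f (p l) (x l) * g (q l) (x l))"
    if "p \<in> ?P" "q \<in> ?P" for p q
    using mem that by (intro lborel_pow.product_integrable_prod int) auto
  have "(\<integral>x. det1 N (\<lambda>l j. f j (x l)) * det1 N (\<lambda>l k. g k (x l)) \<partial>lborel_pow {1..N})
     = (\<integral>x. (\<Sum>p\<in>?P. \<Sum>q\<in>?P. of_int (sign p) * of_int (sign q) * (\<Prod>l=1..N. f (p l) (x l) * g (q l) (x l))) \<partial>lborel_pow {1..N})"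
    by (simp add: det1_eq_detS detS_def sum_product prod.distrib mult_ac)
  also have "\<dots> = (\<Sum>p\<in>?P. \<Sum>q\<in>?P. of_int (sign p) * of_int (sign q) * (\<Prod>l=1..N. ?G (p l) (q l)))"
  proof -
    have "(\<integral>x. (\<Prod>l=1..N. f (p l) (x l) * g (q l) (x l)) \<partial>lborel_pow {1..N}) = (\<Prod>l=1..N. ?G (p l) (q l))"
      if "p \<in> ?P" "q \<in> ?P" for p q
      using mem that by (intro lborel_pow.product_integral_prod int) auto
    then show ?thesis
      using integ by (subst integral_sum2) (auto intro!: sum.cong)
  qed
  also have "\<dots> = (\<Sum>p\<in>?P. det1 N ?G)"
  proof (intro sum.cong refl)
    fix p assume "p \<in> ?P"
    then have p: "p permutes {1..N}" by simp
    have "(\<Sum>q\<in>?P. of_int (sign p) * of_int (sign q) * (\<Prod>l=1..N. ?G (p l) (q l)))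
        = (\<Sum>q\<in>?P. of_int (sign p) * of_int (sign (q \<circ> p)) * (\<Prod>l=1..N. ?G (p l) ((q \<circ> p) l)))"
      by (rule sum_permutations_compose_right[OF p])
    also have "\<dots> = (\<Sum>q\<in>?P. of_int (sign q) * (\<Prod>l=1..N. ?G l (q l)))"
    proof (intro sum.cong refl)
      fix q assume "q \<in> ?P"
      then have q: "q permutes {1..N}" by simp
      have "of_int (sign (q \<circ> p)) = (of_int (sign q) * of_int (sign p) :: complex)"
        using sign_compose[of q p] p q by (metis finite_atLeastAtMost of_int_mult permutation_permutes)
      moreover have "(\<Prod>l=1..N. ?G (p l) ((q \<circ> p) l)) = (\<Prod>l=1..N. ?G l (q l))"
        using prod.permute[OF p, of "\<lambda>l. ?G l (q l)"] by (simp add: comp_def)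
      moreover have "of_int (sign p) * of_int (sign p) = (1::complex)"
        by (metis of_int_1 of_int_mult sign_idempotent)
      ultimately show "of_int (sign p) * of_int (sign (q \<circ> p)) * (\<Prod>l=1..N. ?G (p l) ((q \<circ> p) l))
          = of_int (sign q) * (\<Prod>l=1..N. ?G l (q l))"
        by (simp add: mult_ac)
    qed
    also have "\<dots> = det1 N ?G" by (simp add: det1_eq_detS detS_def)
    finally show "(\<Sum>q\<in>?P. of_int (sign p) * of_int (sign q) * (\<Prod>l=1..N. ?G (p l) (q l))) = det1 N ?G" .
  qed
  also have "\<dots> = fact N * det1 N ?G"
    using card_permutations[of "{1..N}" N] by simp
  finally show ?thesis .
qed

text \<open>Expanding each kernel entry into its rank-one terms attaches an index \<open>u j\<close>
  to every row. The factor \<open>\<beta> (u j) (x (p j))\<close> is then collected at the variable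
  that it reads, which puts the inverse of \<open>p\<close> into the index. Now the integral
  factorises, and the sum over \<open>p\<close> is a determinant of \<open>G\<close> along the tuple
  \<open>u\<close>.\<close>

lemma finite_rank_det_integral:
  fixes \<alpha> \<beta> :: "nat \<Rightarrow> real \<Rightarrow> complex" and \<phi> :: "real \<Rightarrow> complex"
  assumes S: "finite S"
    and int: "\<And>u v. u \<in> S \<Longrightarrow> v \<in> S \<Longrightarrow> integrable lborel (\<lambda>x. \<phi> x * \<alpha> v x * \<beta> u x)"
  defines "K \<equiv> \<lambda>x y. \<Sum>u\<in>S. \<alpha> u x * \<beta> u y"
  defines "G \<equiv> \<lambda>u v. \<integral>x. \<phi> x * \<alpha> v x * \<beta> u x \<partial>lborel"
  shows "integrable (lborel_pow {1..n}) (\<lambda>x. (\<Prod>j=1..n. \<phi> (x j)) * det1 n (\<lambda>j k. K (x j) (x k)))"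
    and "(\<integral>x. (\<Prod>j=1..n. \<phi> (x j)) * det1 n (\<lambda>j k. K (x j) (x k)) \<partial>lborel_pow {1..n})
      = fact n * (\<Sum>I | I \<subseteq> S \<and> card I = n. detS I G)"
proof -
  let ?A = "{1..n}" and ?P = "{p. p permutes {1..n}}"
  let ?h = "\<lambda>u p x. \<Prod>j=1..n. \<phi> (x j) * \<alpha> (u j) (x j) * \<beta> (u (Hilbert_Choice.inv p j)) (x j)"
  have eq: "(\<Prod>j=1..n. \<phi> (x j)) * det1 n (\<lambda>j k. K (x j) (x k))
      = (\<Sum>p\<in>?P. \<Sum>u\<in>?A \<rightarrow>\<^sub>E S. of_int (sign p) * ?h u p x)" for x
  proof -
    have "(\<Prod>j=1..n. \<phi> (x j)) * (\<Prod>j=1..n. K (x j) (x (p j))) = (\<Sum>u\<in>?A \<rightarrow>\<^sub>E S. ?h u p x)" if "p \<in> ?P" for p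
    proof -
      have p: "p permutes ?A" using that by simp
      have "(\<Prod>j=1..n. K (x j) (x (p j))) = (\<Sum>u\<in>?A \<rightarrow>\<^sub>E S. \<Prod>j=1..n. \<alpha> (u j) (x j) * \<beta> (u j) (x (p j)))"
        unfolding K_def using S by (intro prod_sum_PiE) auto
      moreover have "(\<Prod>j=1..n. \<beta> (u j) (x (p j))) = (\<Prod>j=1..n. \<beta> (u (Hilbert_Choice.inv p j)) (x j))" for u
        using prod.permute[OF p, of "\<lambda>j. \<beta> (u (Hilbert_Choice.inv p j)) (x j)"] permutes_inverses(2)[OF p] by (simp add: comp_def)
      ultimately show ?thesis by (simp add: prod.distrib sum_distrib_left mult_ac)
    qed
    then show ?thesis
      unfolding det1_eq_detS detS_def sum_distrib_left
      by (intro sum.cong refl) (simp add: sum_distrib_left[symmetric] mult.left_commute)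
  qed
  have mem: "u j \<in> S" "u (Hilbert_Choice.inv p j) \<in> S" if "u \<in> ?A \<rightarrow>\<^sub>E S" "p \<in> ?P" "j \<in> ?A" for u p j
    using that permutes_in_image[OF permutes_inv, of p ?A j] by (auto simp: PiE_iff)
  have h: "integrable (lborel_pow ?A) (?h u p)" if "u \<in> ?A \<rightarrow>\<^sub>E S" "p \<in> ?P" for u p
    using mem[OF that] by (intro lborel_pow.product_integrable_prod int) auto
  show "integrable (lborel_pow ?A) (\<lambda>x. (\<Prod>j=1..n. \<phi> (x j)) * det1 n (\<lambda>j k. K (x j) (x k)))"
    unfolding eq using h by (intro Bochner_Integration.integrable_sum integrable_mult_right) auto
  have hI: "(\<integral>x. ?h u p x \<partial>lborel_pow ?A) = (\<Prod>j=1..n. G (u j) (u (p j)))" if "u \<in> ?A \<rightarrow>\<^sub>E S" "p \<in> ?P" for u p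
  proof -
    have p: "p permutes ?A" using that by simp
    have "(\<integral>x. ?h u p x \<partial>lborel_pow ?A) = (\<Prod>j=1..n. G (u (Hilbert_Choice.inv p j)) (u j))"
      unfolding G_def using mem[OF that] by (intro lborel_pow.product_integral_prod int) auto
    also have "\<dots> = (\<Prod>j=1..n. G (u j) (u (p j)))"
      using prod.permute[OF p, of "\<lambda>j. G (u (Hilbert_Choice.inv p j)) (u j)"] permutes_inverses(2)[OF p] by (simp add: comp_def)
    finally show ?thesis .
  qed
  have "(\<integral>x. (\<Prod>j=1..n. \<phi> (x j)) * det1 n (\<lambda>j k. K (x j) (x k)) \<partial>lborel_pow ?A)
      = (\<Sum>p\<in>?P. \<Sum>u\<in>?A \<rightarrow>\<^sub>E S. of_int (sign p) * (\<integral>x. ?h u p x \<partial>lborel_pow ?A))"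
    unfolding eq using h
    by (subst integral_sum2) (auto intro!: sum.cong)
  also have "\<dots> = (\<Sum>p\<in>?P. \<Sum>u\<in>?A \<rightarrow>\<^sub>E S. of_int (sign p) * (\<Prod>j=1..n. G (u j) (u (p j))))"
    by (intro sum.cong refl arg_cong2[where f = "(*)"] hI)
  also have "\<dots> = (\<Sum>u\<in>?A \<rightarrow>\<^sub>E S. det1 n (\<lambda>j k. G (u j) (u k)))"
    unfolding det1_eq_detS detS_def by (rule sum.swap)
  also have "\<dots> = fact n * (\<Sum>I | I \<subseteq> S \<and> card I = n. detS I G)"
    by (rule sum_det_tuples[OF S])
  finally show "(\<integral>x. (\<Prod>j=1..n. \<phi> (x j)) * det1 n (\<lambda>j k. K (x j) (x k)) \<partial>lborel_pow ?A)
      = fact n * (\<Sum>I | I \<subseteq> S \<and> card I = n. detS I G)" .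
qed

section \<open>Integrals over ordered tuples and the Fredholm series\<close>

lemma AE_distinct_coordinates:
  assumes I: "finite I"
  shows "AE x in lborel_pow I. inj_on x I"
proof -
  have "AE x in lborel_pow I. x i \<noteq> x j" if ij: "i \<in> I" "j \<in> I" "i \<noteq> j" for i j
  proof -
    have "AE x in lborel_pow I. x i \<noteq> (0::real)"
    proof -
      have s: "{x \<in> space (lborel_pow I). x i = (0::real)} = Pi\<^sub>E I (\<lambda>k. if k = i then {0} else UNIV)"
        using ij by (auto simp: space_PiM PiE_iff split: if_splits intro: extensional_arb)
      have "emeasure (lborel_pow I) (Pi\<^sub>E I (\<lambda>k. if k = i then {0} else UNIV))
          = (\<Prod>k\<in>I. emeasure lborel (if k = i then {0 :: real} else UNIV))"
        using I by (intro lborel_pow.emeasure_PiM) auto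
      \<comment> \<open>A single factor 0 suffices, since 0 times \<infinity> is 0 in
        \<open>ennreal\<close>.\<close>
      also have "\<dots> = 0" using ij I by (intro prod_zero) (auto intro!: bexI[of _ i])
      finally show ?thesis
        by (intro AE_I[where N = "{x \<in> space (lborel_pow I). x i = 0}"])
           (auto simp: s intro!: sets_PiM_I_finite I)
    qed
    \<comment> \<open>This shear carries the hyperplane x_i = x_j to x_i = 0.\<close>
    moreover have "preserves (lborel_pow I) (lborel_pow I) (\<lambda>x. x(i := 1 * x i + - x j))"
      using ij I by (intro preserves_shear) auto
    ultimately have "AE x in lborel_pow I. (x(i := 1 * x i + - x j)) i \<noteq> (0::real)"
      by (rule preserves_AE[where Q = "\<lambda>x. x i \<noteq> 0", rotated])
    then show ?thesis by simp
  qed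
  then have "AE x in lborel_pow I. \<forall>i\<in>I. \<forall>j\<in>I. i \<noteq> j \<longrightarrow> x i \<noteq> (x j :: real)"
    using I by (intro AE_finite_allI) auto
  then show ?thesis by eventually_elim (auto simp: inj_on_def)
qed

text \<open>The sorted list of the values yields the permutation; every sorting permutation
  reproduces this list, which by injectivity of \<open>x\<close> determines it.\<close>

lemma ex1_sorting_permutation:
  fixes x :: "nat \<Rightarrow> real"
  assumes x: "inj_on x {1..n}"
  shows "\<exists>!p. p permutes {1..n} \<and> strict_mono_on {1..n} (\<lambda>i. x (p i))"
proof (rule ex_ex1I)
  let ?A = "{1..n}"
  define xs where "xs = sorted_list_of_set (x ` ?A)"
  have len: "length xs = n" using card_image[OF x] by (simp add: xs_def)
  have set: "set xs = x ` ?A" by (simp add: xs_def)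
  have sorted: "sorted_wrt (<) xs" by (simp add: xs_def)
  define p where "p = (\<lambda>i. if i \<in> ?A then inv_into ?A x (xs ! (i - 1)) else i)"
  have xp: "x (p i) = xs ! (i - 1)" "p i \<in> ?A" if "i \<in> ?A" for i
  proof -
    have "xs ! (i - 1) \<in> x ` ?A" using that len unfolding set[symmetric] by (intro nth_mem) auto
    then show "x (p i) = xs ! (i - 1)" "p i \<in> ?A"
      using that f_inv_into_f[of "xs ! (i - 1)" x ?A] inv_into_into[of "xs ! (i - 1)" x ?A] by (auto simp: p_def)
  qed
  have mono: "strict_mono_on ?A (\<lambda>i. x (p i))"
  proof (rule strict_mono_onI)
    fix i j assume "i \<in> ?A" "j \<in> ?A" "i < j"
    then show "x (p i) < x (p j)"
      using sorted_wrt_nth_less[OF sorted, of "i - 1" "j - 1"] len by (auto simp: xp)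
  qed
  have inj: "inj_on p ?A"
    using strict_mono_on_imp_inj_on[OF mono] by (intro inj_on_imageI2[of x p]) (simp add: comp_def)
  have "p ` ?A = ?A"
    using xp(2) inj by (intro endo_inj_surj) blast+
  with inj have bij: "bij_betw p ?A ?A" by (rule bij_betw_imageI)
  have "p i = i" if "i \<notin> ?A" for i using that by (simp only: p_def if_False)
  with bij have "p permutes ?A" by (rule bij_imp_permutes)
  with mono show "\<exists>p. p permutes ?A \<and> strict_mono_on ?A (\<lambda>i. x (p i))" by (intro exI[of _ p] conjI)
next
  let ?A = "{1..n}"
  fix p q assume p: "p permutes ?A \<and> strict_mono_on ?A (\<lambda>i. x (p i))"
    and q: "q permutes ?A \<and> strict_mono_on ?A (\<lambda>i. x (q i))"
  have *: "map (\<lambda>i. x (r i)) [1..<Suc n] = sorted_list_of_set (x ` ?A)"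
    if "r permutes ?A \<and> strict_mono_on ?A (\<lambda>i. x (r i))" for r
  proof -
    have "sorted_wrt (<) (map (\<lambda>i. x (r i)) [1..<Suc n])"
      using that unfolding sorted_wrt_map
      by (intro sorted_wrt_mono_rel[OF _ sorted_wrt_upt]) (auto simp: strict_mono_on_def)
    moreover have "set (map (\<lambda>i. x (r i)) [1..<Suc n]) = x ` ?A"
    proof -
      have "set (map (\<lambda>i. x (r i)) [1..<Suc n]) = x ` (r ` ?A)"
        by (simp only: set_map set_upt atLeastLessThanSuc_atLeastAtMost image_image)
      also have "r ` ?A = ?A" using that by (intro permutes_image) blast
      finally show ?thesis .
    qed
    ultimately show ?thesis
      by (intro strict_sorted_equal) simp_all
  qed
  have "map (\<lambda>i. x (p i)) [1..<Suc n] = map (\<lambda>i. x (q i)) [1..<Suc n]" using *[OF p] *[OF q] by simp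
  then have "\<forall>i\<in>?A. x (p i) = x (q i)" by auto
  then have "p i = q i" if "i \<in> ?A" for i
    using that p q by (intro inj_onD[OF x]) (simp_all only: permutes_in_image)
  moreover have "p i = q i" if "i \<notin> ?A" for i
    using p q permutes_not_in[OF _ that] by metis
  ultimately show "p = q" by (intro ext) blast
qed

lemma strict_mono_on_measurable:
  "Measurable.pred (lborel_pow {1..n}) (\<lambda>x. strict_mono_on {1..n::nat} x)"
proof -
  have "(\<lambda>x. strict_mono_on {1..n::nat} x) = (\<lambda>x::nat \<Rightarrow> real. \<forall>i\<in>{1..n}. \<forall>j\<in>{1..n}. i < j \<longrightarrow> x i < x j)"
    by (intro ext) (auto simp: strict_mono_on_def)
  then show ?thesis by simp measurable
qed

text \<open>Outside a null set exactly one permutation sorts a given tuple, so the n! permuted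
  copies of the ordered region tile the space, and a symmetric \<open>g\<close> has the same
  integral over each.\<close>

lemma integral_ordered:
  fixes g :: "(nat \<Rightarrow> real) \<Rightarrow> complex"
  assumes int: "integrable (lborel_pow {1..n}) g"
    and sym: "\<And>p x. p permutes {1..n} \<Longrightarrow> g (\<lambda>i\<in>{1..n}. x (p i)) = g x"
  shows "set_integrable (lborel_pow {1..n}) {x. strict_mono_on {1..n} x} g"
    and "fact n * (\<integral>x\<in>{x. strict_mono_on {1..n} x}. g x \<partial>lborel_pow {1..n}) = (\<integral>x. g x \<partial>lborel_pow {1..n})"
proof -
  let ?A = "{1..n}" and ?M = "lborel_pow {1..n}" and ?P = "{p. p permutes {1..n}}"
  let ?f = "\<lambda>x. indicator {x. strict_mono_on ?A x} x *\<^sub>R g x"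
  have [measurable]: "g \<in> borel_measurable ?M" using int by auto
  note strict_mono_on_measurable[measurable]
  have ind[measurable]: "(indicator {x. strict_mono_on ?A x} :: _ \<Rightarrow> real) \<in> borel_measurable ?M"
    by (subst borel_measurable_indicator_iff) (use strict_mono_on_measurable[of n] in \<open>simp add: pred_def Int_def conj_commute Collect_conj_eq[symmetric]\<close>)
  have f: "integrable ?M ?f"
  proof (rule Bochner_Integration.integrable_bound[OF int])
    show "?f \<in> borel_measurable ?M" by measurable
  qed (auto simp: indicator_def)
  then show "set_integrable ?M {x. strict_mono_on ?A x} g" by (simp add: set_integrable_def)
  have pres: "preserves ?M ?M (\<lambda>x. \<lambda>i\<in>?A. x (p i))" if "p \<in> ?P" for p
    using that by (intro preserves_reindex) (auto simp: permutes_imp_bij)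
  have "fact n * (\<integral>x\<in>{x. strict_mono_on ?A x}. g x \<partial>?M) = (\<Sum>p\<in>?P. \<integral>x. ?f x \<partial>?M)"
    using card_permutations[of ?A n] by (simp add: set_lebesgue_integral_def)
  also have "\<dots> = (\<Sum>p\<in>?P. \<integral>x. ?f (\<lambda>i\<in>?A. x (p i)) \<partial>?M)"
    by (intro sum.cong refl) (simp only: preserves_integral[where g = ?f, OF pres borel_measurable_integrable[OF f]])
  also have "\<dots> = (\<integral>x. (\<Sum>p\<in>?P. ?f (\<lambda>i\<in>?A. x (p i))) \<partial>?M)"
    using preserves_integrable[where g = ?f, OF pres borel_measurable_integrable[OF f]] f
    by (intro Bochner_Integration.integral_sum[symmetric]) blast
  also have "\<dots> = (\<integral>x. g x \<partial>?M)"
  proof (rule integral_cong_AE)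
    show "AE x in ?M. (\<Sum>p\<in>?P. ?f (\<lambda>i\<in>?A. x (p i))) = g x"
      using AE_distinct_coordinates[OF finite_atLeastAtMost[of 1 n]]
    proof eventually_elim
      case (elim x)
      obtain q where q: "q \<in> ?P" "strict_mono_on ?A (\<lambda>i. x (q i))"
        "\<And>p. p \<in> ?P \<Longrightarrow> strict_mono_on ?A (\<lambda>i. x (p i)) \<Longrightarrow> p = q"
        using ex1_sorting_permutation[OF elim] by auto
      have res: "strict_mono_on ?A (\<lambda>i\<in>?A. x (p i)) \<longleftrightarrow> strict_mono_on ?A (\<lambda>i. x (p i))" for p
        by (auto simp: strict_mono_on_def)
      have "(\<Sum>p\<in>?P. ?f (\<lambda>i\<in>?A. x (p i))) = (\<Sum>p\<in>?P. if p = q then g x else 0)"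
      proof (intro sum.cong refl)
        fix p assume p: "p \<in> ?P"
        show "?f (\<lambda>i\<in>?A. x (p i)) = (if p = q then g x else 0)"
        proof -
          have "strict_mono_on ?A (\<lambda>i\<in>?A. x (p i)) \<longleftrightarrow> p = q"
            using res q(2) q(3)[OF p] by blast
          then show ?thesis using p sym[of p x] by (simp add: indicator_def)
        qed
      qed
      also have "\<dots> = g x"
        using q(1) by (subst sum.delta) (simp_all add: finite_permutations)
      finally show ?case .
    qed
    have "(\<lambda>x. ?f (\<lambda>i\<in>?A. x (p i))) \<in> borel_measurable ?M" if "p \<in> ?P" for p
      using pres[OF that] f by (auto simp: preserves_def intro: measurable_compose)
    then show "(\<lambda>x. \<Sum>p\<in>?P. ?f (\<lambda>i\<in>?A. x (p i))) \<in> borel_measurable ?M" by (intro borel_measurable_sum)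
  qed (rule borel_measurable_integrable[OF int])
  finally show "fact n * (\<integral>x\<in>{x. strict_mono_on ?A x}. g x \<partial>?M) = (\<integral>x. g x \<partial>?M)" .
qed

text \<open>The n-th term of the series is the sum of the principal minors of size n, the factor n!
  being absorbed by the ordering. Terms beyond N vanish, and all principal minors together give det
  (1 + G).\<close>

theorem fredholm_expansion_finite_rank:
  fixes \<alpha> \<beta> :: "nat \<Rightarrow> real \<Rightarrow> complex" and \<phi> :: "real \<Rightarrow> real"
  assumes K: "\<And>x y. K s x s y = (\<Sum>u=1..N. \<alpha> u x * \<beta> u y)"
    and int: "\<And>u v. u \<in> {1..N} \<Longrightarrow> v \<in> {1..N} \<Longrightarrow> integrable lborel (\<lambda>x. \<phi> x * \<alpha> v x * \<beta> u x)"
  shows "fredholm_expansion s K \<phi> (det1 N (\<lambda>u v. (if u = v then 1 else 0) + (\<integral>x. \<phi> x * \<alpha> v x * \<beta> u x \<partial>lborel)))"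
proof -
  let ?S = "{1..N}"
  let ?G = "\<lambda>u v. \<integral>x. \<phi> x * \<alpha> v x * \<beta> u x \<partial>lborel"
  let ?g = "\<lambda>n x. complex_of_real (\<Prod>j=1..n. \<phi> (x j)) * det1 n (\<lambda>j k. K s (x j) s (x k))"
  have g: "integrable (lborel_pow {1..n}) (?g n)"
    "(\<integral>x. ?g n x \<partial>lborel_pow {1..n}) = fact n * (\<Sum>I | I \<subseteq> ?S \<and> card I = n. detS I ?G)" for n
    using finite_rank_det_integral[of ?S "\<lambda>x. of_real (\<phi> x)" \<alpha> \<beta> n] int unfolding K by auto
  have sym: "?g n (\<lambda>i\<in>{1..n}. x (p i)) = ?g n x" if p: "p permutes {1..n}" for n p x
  proof -
    have "(\<Prod>j=1..n. \<phi> ((\<lambda>i\<in>{1..n}. x (p i)) j)) = (\<Prod>j=1..n. \<phi> (x j))"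
      using prod.permute[OF p, of "\<lambda>j. \<phi> (x j)"] by (simp add: comp_def)
    moreover have "det1 n (\<lambda>j k. K s ((\<lambda>i\<in>{1..n}. x (p i)) j) s ((\<lambda>i\<in>{1..n}. x (p i)) k)) = det1 n (\<lambda>j k. K s (x j) s (x k))"
      unfolding det1_eq_detS
      by (subst detS_reindex[OF permutes_imp_bij[OF p]]) (auto intro!: detS_cong)
    ultimately show ?thesis by simp
  qed
  have ord: "(\<integral>x\<in>{x. strict_mono_on {1..n} x}. ?g n x \<partial>lborel_pow {1..n}) = (\<Sum>I | I \<subseteq> ?S \<and> card I = n. detS I ?G)" for n
    using integral_ordered(2)[OF g(1) sym, of n] g(2)[of n] by simp
  have "(\<lambda>n. \<integral>x\<in>{x. strict_mono_on {1..n} x}. ?g n x \<partial>lborel_pow {1..n})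
      sums (\<Sum>n\<le>N. \<integral>x\<in>{x. strict_mono_on {1..n} x}. ?g n x \<partial>lborel_pow {1..n})"
  proof (rule sums_finite)
    fix n assume "n \<notin> {..N}"
    then have none: "{I. I \<subseteq> ?S \<and> card I = n} = {}" using card_mono[of ?S] by fastforce
    show "(\<integral>x\<in>{x. strict_mono_on {1..n} x}. ?g n x \<partial>lborel_pow {1..n}) = 0"
      by (simp only: ord none sum.empty)
  qed auto
  also have "(\<Sum>n\<le>N. \<integral>x\<in>{x. strict_mono_on {1..n} x}. ?g n x \<partial>lborel_pow {1..n}) = (\<Sum>n\<le>N. \<Sum>I | I \<in> Pow ?S \<and> card I = n. detS I ?G)"
    unfolding ord by simp
  also have "\<dots> = (\<Sum>I\<in>Pow ?S. detS I ?G)"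
    using card_mono[of ?S] by (intro sum.group) auto
  also have "\<dots> = det1 N (\<lambda>u v. (if u = v then 1 else 0) + ?G u v)"
    unfolding det1_eq_detS by (rule detS_one_plus[symmetric]) simp
  finally show ?thesis
    unfolding fredholm_expansion_def Let_def using integral_ordered(1)[OF g(1) sym] by auto
qed

section \<open>Cauchy determinants\<close>

definition pairs :: "nat \<Rightarrow> (nat \<times> nat) set" where
  "pairs n = {(j, l). 1 \<le> j \<and> j < l \<and> l \<le> n}"

lemma pairs_0 [simp]: "pairs 0 = {}"
  by (auto simp: pairs_def)

lemma pairs_Suc: "pairs (Suc n) = pairs n \<union> (\<lambda>i. (i, Suc n)) ` {1..n}"
  by (auto simp: pairs_def)

lemma finite_pairs [simp]: "finite (pairs n)"
  by (rule finite_subset[of _ "{..n} \<times> {..n}"]) (auto simp: pairs_def)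

lemma prod_pairs_Suc: "(\<Prod>p\<in>pairs (Suc n). h p) = (\<Prod>p\<in>pairs n. h p) * (\<Prod>i=1..n. h (i, Suc n))"
proof -
  have "pairs n \<inter> (\<lambda>i. (i, Suc n)) ` {1..n} = {}" by (auto simp: pairs_def)
  then show ?thesis
    unfolding pairs_Suc by (subst prod.union_disjoint) (auto simp: prod.reindex inj_on_def)
qed

text \<open>Written as a sum so that the exponent N^2 in \<open>det_product\<close> splits into N
  and twice the number of pairs.\<close>

lemma card_pairs: "2 * card (pairs n) + n = n * n"
proof (induction n)
  case (Suc n)
  have "pairs n \<inter> (\<lambda>i. (i, Suc n)) ` {1..n} = {}" by (auto simp: pairs_def)
  then have "card (pairs (Suc n)) = card (pairs n) + n"
    unfolding pairs_Suc by (simp add: card_Un_disjoint card_image inj_on_def)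
  then show ?case using Suc by simp
qed simp

lemma prod_off_diagonal:
  fixes h :: "nat \<Rightarrow> nat \<Rightarrow> 'a::comm_monoid_mult"
  shows "(\<Prod>k=1..n. \<Prod>m\<in>{1..n} - {k}. h k m) = (\<Prod>(i, j)\<in>pairs n. h i j * h j i)"
proof -
  have eq: "Sigma {1..n} (\<lambda>k. {1..n} - {k}) = pairs n \<union> prod.swap ` pairs n"
    by (auto simp: pairs_def image_iff)
  have dis: "pairs n \<inter> prod.swap ` pairs n = {}" by (auto simp: pairs_def)
  have "(\<Prod>k=1..n. \<Prod>m\<in>{1..n} - {k}. h k m) = (\<Prod>(k, m)\<in>pairs n \<union> prod.swap ` pairs n. h k m)"
    unfolding eq[symmetric] by (rule prod.Sigma) auto
  also have "\<dots> = (\<Prod>(k, m)\<in>pairs n. h k m) * (\<Prod>(k, m)\<in>prod.swap ` pairs n. h k m)"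
    by (rule prod.union_disjoint[OF _ _ dis]) simp_all
  also have "(\<Prod>(k, m)\<in>prod.swap ` pairs n. h k m) = (\<Prod>(k, m)\<in>pairs n. h m k)"
    by (subst prod.reindex) (auto simp: split_beta)
  finally show ?thesis by (simp add: prod.distrib split_beta)
qed

lemma det1_cong:
  assumes "\<And>i j. i \<in> {1..n} \<Longrightarrow> j \<in> {1..n} \<Longrightarrow> f i j = g i j"
  shows "det1 n f = det1 n g"
  unfolding det1_def using assms by (intro arg_cong[where f = Determinant.det] eq_matI) auto

lemma det1_scale:
  "det1 n (\<lambda>i j. r i * c j * f i j) = (\<Prod>i=1..n. r i) * (\<Prod>j=1..n. c j) * det1 n f"
proof -
  have r: "(\<Prod>i=1..n. r i) = (\<Prod>i = 0..<n. r (Suc i))" "(\<Prod>i=1..n. c i) = (\<Prod>i = 0..<n. c (Suc i))"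
    by (simp_all add: prod.atLeast1_atMost_eq atLeast0LessThan)
  have d: "det1 n g = (\<Sum>p | p permutes {0..<n}. of_int (sign p) * (\<Prod>i = 0..<n. g (Suc i) (Suc (p i))))" for g
  proof -
    have "p i < n" if "p permutes {0..<n}" "i < n" for p i
      using permutes_in_image[OF that(1), of i] that(2) by simp
    then show ?thesis
      unfolding det1_def by (subst Determinant.det_def'[of _ n]) (auto intro!: sum.cong prod.cong)
  qed
  have "(\<Prod>i = 0..<n. c (Suc (p i))) = (\<Prod>i = 0..<n. c (Suc i))" if "p permutes {0..<n}" for p
    using prod.permute[OF that, of "\<lambda>i. c (Suc i)"] by (simp add: comp_def)
  then show ?thesis
    unfolding d r sum_distrib_left by (intro sum.cong refl) (simp add: prod.distrib mult_ac)
qed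

text \<open>Block elimination: the matrix is a unipotent upper triangular matrix times one whose
  last column is zero above its last entry.\<close>

lemma det1_schur:
  assumes d: "f (Suc n) (Suc n) \<noteq> 0"
  shows "det1 (Suc n) f = f (Suc n) (Suc n)
    * det1 n (\<lambda>i j. f i j - f i (Suc n) * f (Suc n) j / f (Suc n) (Suc n))"
proof -
  let ?m = "f (Suc n) (Suc n)"
  let ?M = "mat (Suc n) (Suc n) (\<lambda>(j, k). f (Suc j) (Suc k))"
  let ?S = "mat n n (\<lambda>(i, j). f (Suc i) (Suc j) - f (Suc i) (Suc n) * f (Suc n) (Suc j) / ?m)"
  let ?l = "mat n 1 (\<lambda>(i, j). f (Suc i) (Suc n) / ?m)"
  let ?c = "mat 1 n (\<lambda>(i, j). f (Suc n) (Suc j))"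
  let ?d = "mat 1 1 (\<lambda>(i, j). ?m)"
  let ?L = "four_block_mat (1\<^sub>m n) ?l (0\<^sub>m 1 n) (1\<^sub>m 1)"
  let ?B = "four_block_mat ?S (0\<^sub>m n 1) ?c ?d"
  have L: "?L \<in> carrier_mat (Suc n) (Suc n)" and B: "?B \<in> carrier_mat (Suc n) (Suc n)"
    by (auto simp: carrier_matI)
  have "?L * ?B = four_block_mat (1\<^sub>m n * ?S + ?l * ?c) (1\<^sub>m n * 0\<^sub>m n 1 + ?l * ?d) (0\<^sub>m 1 n * ?S + 1\<^sub>m 1 * ?c) (0\<^sub>m 1 n * 0\<^sub>m n 1 + 1\<^sub>m 1 * ?d)"
    by (rule mult_four_block_mat) auto
  also have "\<dots> = ?M"
    using d by (intro eq_matI) (auto simp: scalar_prod_def less_Suc_eq field_simps)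
  finally have M: "?M = ?L * ?B" ..
  have "det ?L = prod_list (diag_mat ?L)"
    by (rule det_upper_triangular[OF _ L]) (auto simp: upper_triangular_def less_Suc_eq)
  also have "\<dots> = 1"
    unfolding prod_list_diag_prod by (intro prod.neutral) (auto simp: less_Suc_eq)
  finally have "det ?L = 1" .
  moreover have "det ?B = det ?S * det ?d"
    by (rule det_four_block_mat_upper_right_zero_col) auto
  moreover have "det ?d = ?m" by (simp add: det_single)
  ultimately show ?thesis
    unfolding det1_def M det_mult[OF L B] by simp
qed

text \<open>The identity function and the sine both satisfy the three-term identity.\<close>

lemma cauchy_det:
  fixes f :: "complex \<Rightarrow> complex"
  assumes three: "\<And>p q r s. f (p - s) * f (r - q) - f (r - s) * f (p - q) = f (p - r) * f (s - q)"
    and odd: "\<And>w. f (- w) = - f w"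
    and nz: "\<And>i j. i \<in> {1..n} \<Longrightarrow> j \<in> {1..n} \<Longrightarrow> f (x i - y j) \<noteq> 0"
  shows "det1 n (\<lambda>i j. 1 / f (x i - y j))
    = (\<Prod>(i, j)\<in>pairs n. f (x j - x i) * f (y i - y j)) / (\<Prod>i=1..n. \<Prod>j=1..n. f (x i - y j))"
  using nz
proof (induction n)
  case 0
  then show ?case by (simp add: det1_def)
next
  case (Suc n)
  let ?m = "Suc n"
  have nz: "f (x i - y j) \<noteq> 0" if "i \<in> {1..?m}" "j \<in> {1..?m}" for i j using Suc.prems that .
  define r where "r = (\<lambda>i. f (x ?m - x i) / f (x i - y ?m))"
  define c where "c = (\<lambda>j. f (y j - y ?m) / f (x ?m - y j))"
  \<comment> \<open>Elimination reproduces the Cauchy matrix up to row and column factors; this is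
    the three-term identity with p = x_i, q = y_j, r = x_(n+1) and s = y_(n+1).\<close>
  have entry: "1 / f (x i - y j) - 1 / f (x i - y ?m) * (1 / f (x ?m - y j)) / (1 / f (x ?m - y ?m))
      = r i * c j * (1 / f (x i - y j))" if "i \<in> {1..n}" "j \<in> {1..n}" for i j
  proof -
    have "f (x i - y ?m) * f (x ?m - y j) - f (x ?m - y ?m) * f (x i - y j) = f (x i - x ?m) * f (y ?m - y j)"
      by (rule three)
    also have "\<dots> = f (x ?m - x i) * f (y j - y ?m)"
      using odd[of "x ?m - x i"] odd[of "y j - y ?m"] by simp
    finally show ?thesis
      using nz[of i j] nz[of i ?m] nz[of ?m j] nz[of ?m ?m] that
      by (simp add: r_def c_def divide_simps)
  qed
  have "det1 ?m (\<lambda>i j. 1 / f (x i - y j)) = 1 / f (x ?m - y ?m) * det1 n (\<lambda>i j. 1 / f (x i - y j)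
      - 1 / f (x i - y ?m) * (1 / f (x ?m - y j)) / (1 / f (x ?m - y ?m)))"
    using nz[of ?m ?m] by (intro det1_schur) simp
  also have "\<dots> = 1 / f (x ?m - y ?m) * det1 n (\<lambda>i j. r i * c j * (1 / f (x i - y j)))"
    by (intro arg_cong2[where f = "(*)"] refl det1_cong entry)
  also have "\<dots> = 1 / f (x ?m - y ?m) * ((\<Prod>i=1..n. r i) * (\<Prod>j=1..n. c j)
      * ((\<Prod>(i, j)\<in>pairs n. f (x j - x i) * f (y i - y j)) / (\<Prod>i=1..n. \<Prod>j=1..n. f (x i - y j))))"
    using Suc by (subst det1_scale) auto
  also have "\<dots> = (\<Prod>(i, j)\<in>pairs ?m. f (x j - x i) * f (y i - y j)) / (\<Prod>i=1..?m. \<Prod>j=1..?m. f (x i - y j))"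
    unfolding prod_pairs_Suc by (simp add: r_def c_def prod_dividef prod.distrib mult_ac)
  finally show ?case .
qed

section \<open>Reflection formulas and the product of the two determinants\<close>

lemma Gamma_mult_minus:
  fixes w :: complex
  assumes "w \<notin> \<int>"
  shows "Gamma w * Gamma (- w) = - (of_real pi) / (w * sin (of_real pi * w))"
proof -
  have w0: "w \<noteq> 0" using assms by auto
  have "Gamma (1 - w) = - w * Gamma (- w)"
    using Gamma_plus1[of "- w"] assms nonpos_Ints_Int[of "- w"] by (auto simp: add.commute)
  then have "- w * (Gamma w * Gamma (- w)) = of_real pi / sin (of_real pi * w)"
    using Gamma_reflection_complex[of w] by (simp add: mult_ac)
  then have "Gamma w * Gamma (- w) = (of_real pi / sin (of_real pi * w)) / (- w)"
    using w0 by (metis neg_equal_0_iff_equal nonzero_mult_div_cancel_left)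
  then show ?thesis by (simp add: mult.commute)
qed

lemma Gamma_one_minus:
  fixes w :: complex
  assumes "w \<notin> \<int>"
  shows "Gamma (1 - w) = 1 / Gamma w * (of_real pi / sin (of_real pi * w))"
proof -
  have "Gamma w \<noteq> 0" using assms nonpos_Ints_Int by (auto simp: Gamma_eq_zero_iff)
  then show ?thesis
    using Gamma_reflection_complex[of w] by (metis nonzero_mult_div_cancel_left times_divide_eq_left mult_1)
qed

lemma sin_pi_nz:
  fixes w :: complex
  assumes "w \<notin> \<int>"
  shows "sin (of_real pi * w) \<noteq> 0"
  using assms sin_eq_0[of "of_real pi * w"] by (auto simp: mult.commute)

text \<open>Completing the product to all indices and reflecting the leading Gamma factor leaves the
  sine as the only factor that depends on both \<open>k\<close> and \<open>z\<close>. As a matrix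
  this is 1 / sin up to row and column factors.\<close>

lemma Phi_eq:
  assumes \<nu>: "inj_on \<nu> {1..N}" and k: "k \<in> {1..N}"
    and nI: "\<And>m. m \<in> {1..N} \<Longrightarrow> of_real a * (of_real (\<nu> m) - z) \<notin> \<int>"
  shows "Phi N \<nu> (\<nu> k) a z = (\<Prod>m=1..N. 1 / Gamma (of_real a * (of_real (\<nu> m) - z)))
    * (\<Prod>m\<in>{1..N} - {k}. Gamma (of_real (a * (\<nu> m - \<nu> k))))
    * (of_real pi / sin (of_real pi * (of_real a * (of_real (\<nu> k) - z))))"
proof -
  let ?w = "\<lambda>m. of_real a * (of_real (\<nu> m) - z)"
  have img: "\<nu> ` {1..N} - {\<nu> k} = \<nu> ` ({1..N} - {k})"
    using inj_on_image_set_diff[OF \<nu>, of "{1..N}" "{k}"] k by simp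
  have "Gamma (1 - ?w k) = 1 / Gamma (?w k) * (of_real pi / sin (of_real pi * ?w k))"
    by (rule Gamma_one_minus[OF nI[OF k]])
  moreover have "(\<Prod>m=1..N. 1 / Gamma (?w m)) = 1 / Gamma (?w k) * (\<Prod>m\<in>{1..N} - {k}. 1 / Gamma (?w m))"
    using k by (rule prod.remove[OF finite_atLeastAtMost])
  moreover have "(\<Prod>r\<in>\<nu> ` {1..N} - {\<nu> k}. Gamma (of_real (a * (r - \<nu> k))) / Gamma (of_real a * (of_real r - z)))
      = (\<Prod>m\<in>{1..N} - {k}. Gamma (of_real (a * (\<nu> m - \<nu> k)))) * (\<Prod>m\<in>{1..N} - {k}. 1 / Gamma (?w m))"
    unfolding img using \<nu> by (subst prod.reindex) (auto simp: prod.distrib[symmetric] intro: inj_on_subset)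
  ultimately show ?thesis unfolding Phi_def by (simp add: mult_ac)
qed

text \<open>Both matrices are Cauchy matrices up to row and column factors. Reflection cancels the
  differences of the \<nu>_j and their sines against the constants in \<open>Phi\<close>, and turns
  the differences of the z_l and their sines into the Gamma factors of the Sklyanin density.\<close>

lemma det_product:
  fixes z :: "nat \<Rightarrow> complex"
  assumes a: "a > 0" and \<nu>: "inj_on \<nu> {1..N}" and small: "\<And>j. j \<in> {1..N} \<Longrightarrow> a * \<bar>\<nu> j\<bar> < 1 / 2"
    and z: "\<And>l. l \<in> {1..N} \<Longrightarrow> Re (z l) = 1 / (2 * a)"
    and zinj: "inj_on z {1..N}"
  shows "det1 N (\<lambda>l j. 1 / (z l - of_real (\<nu> j))) * det1 N (\<lambda>l k. Phi N \<nu> (\<nu> k) a (z l))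
    = of_real a ^ N * (\<Prod>l=1..N. \<Prod>j=1..N. Gamma (of_real a * (z l - of_real (\<nu> j))))
      * (\<Prod>(i, j)\<in>pairs N. 1 / (Gamma (of_real a * (z j - z i)) * Gamma (- (of_real a * (z j - z i)))))"
proof -
  let ?s = "\<lambda>w. sin (of_real pi * w) :: complex"
  let ?\<zeta> = "\<lambda>l. of_real a * z l" and ?\<eta> = "\<lambda>j. complex_of_real (a * \<nu> j)"
  let ?\<pi> = "of_real pi :: complex" and ?a = "of_real a :: complex"
  let ?w = "\<lambda>l j. ?\<zeta> l - ?\<eta> j"
  let ?P = "pairs N"
  have a0: "?a \<noteq> 0" using a by simp
  \<comment> \<open>On this line the real part is 1/2 - a \<nu>_j, strictly between 0 and 1.\<close>
  have nI: "?w l j \<notin> \<int>" if "l \<in> {1..N}" "j \<in> {1..N}" for l j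
  proof
    assume "?w l j \<in> \<int>"
    then obtain n where n: "?w l j = of_int n" by (elim Ints_cases)
    have "Re (?w l j) = 1 / 2 - a * \<nu> j" using z[OF that(1)] a by simp
    moreover have "a * \<bar>\<nu> j\<bar> = \<bar>a * \<nu> j\<bar>" using a by (simp add: abs_mult)
    ultimately have "0 < Re (?w l j)" "Re (?w l j) < 1" using small[OF that(2)] by (auto simp: abs_less_iff)
    then show False unfolding n by simp
  qed
  have nI': "?a * (of_real (\<nu> m) - z l) \<notin> \<int>" if "l \<in> {1..N}" "m \<in> {1..N}" for l m
    using nI[OF that] Ints_minus[of "?a * (of_real (\<nu> m) - z l)"] by (auto simp: algebra_simps)
  have three: "?s (p - s) * ?s (r - q) - ?s (r - s) * ?s (p - q) = ?s (p - r) * ?s (s - q)" for p q r s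
  proof -
    have sd: "?s (x - y) = ?s x * cos (of_real pi * y) - cos (of_real pi * x) * ?s y" for x y
      by (simp add: right_diff_distrib sin_diff)
    show ?thesis unfolding sd by (simp add: algebra_simps)
  qed
  have nI\<eta>: "?\<eta> j - ?\<eta> i \<notin> \<int>" if "(i, j) \<in> ?P" for i j
  proof
    assume "?\<eta> j - ?\<eta> i \<in> \<int>"
    then obtain n where n: "?\<eta> j - ?\<eta> i = of_int n" by (elim Ints_cases)
    have ij: "i \<in> {1..N}" "j \<in> {1..N}" "i \<noteq> j" using that by (auto simp: pairs_def)
    have "a * \<nu> j - a * \<nu> i = real_of_int n"
      using arg_cong[OF n, of Re] by simp
    moreover have "a * \<bar>\<nu> j\<bar> = \<bar>a * \<nu> j\<bar>" "a * \<bar>\<nu> i\<bar> = \<bar>a * \<nu> i\<bar>" using a by (simp_all add: abs_mult)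
    ultimately have "\<bar>real_of_int n\<bar> < 1" using small[OF ij(1)] small[OF ij(2)] by linarith
    then have "n = 0" by linarith
    then have "\<nu> j = \<nu> i" using \<open>a * \<nu> j - a * \<nu> i = real_of_int n\<close> a by simp
    then show False using ij inj_onD[OF \<nu>] by blast
  qed
  \<comment> \<open>The differences are purely imaginary, so the only possible integer is 0, which
    injectivity excludes.\<close>
  have nI\<zeta>: "?\<zeta> j - ?\<zeta> i \<notin> \<int>" if "(i, j) \<in> ?P" for i j
  proof
    assume "?\<zeta> j - ?\<zeta> i \<in> \<int>"
    then obtain n where n: "?\<zeta> j - ?\<zeta> i = of_int n" by (elim Ints_cases)
    have ij: "i \<in> {1..N}" "j \<in> {1..N}" "i \<noteq> j" using that by (auto simp: pairs_def)
    have "Re (?\<zeta> j - ?\<zeta> i) = 0" using z[OF ij(1)] z[OF ij(2)] by simp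
    then have "?\<zeta> j - ?\<zeta> i = 0" unfolding n by simp
    then have "z j = z i" using a0 by simp
    then show False using ij inj_onD[OF zinj] by blast
  qed
  define c where "c = (\<lambda>k. \<Prod>m\<in>{1..N} - {k}. Gamma (complex_of_real (a * (\<nu> m - \<nu> k))))"
  define R where "R = (\<lambda>l. \<Prod>m=1..N. 1 / Gamma (- ?w l m))"
  have Phi: "Phi N \<nu> (\<nu> k) a (z l) = R l * (- ?\<pi> * c k) * (1 / ?s (?w l k))" if "l \<in> {1..N}" "k \<in> {1..N}" for l k
  proof -
    have w: "?a * (of_real (\<nu> m) - z l) = - ?w l m" for m by (simp add: algebra_simps)
    have P: "Phi N \<nu> (\<nu> k) a (z l) = R l * c k * (?\<pi> / ?s (- ?w l k))"
      using Phi_eq[OF \<nu> that(2) nI'[OF that(1)]] unfolding w R_def c_def .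
    show ?thesis unfolding P mult_minus_right[of ?\<pi>] sin_minus by simp
  qed
  have "det1 N (\<lambda>l k. Phi N \<nu> (\<nu> k) a (z l)) = det1 N (\<lambda>l k. R l * (- ?\<pi> * c k) * (1 / ?s (?w l k)))"
    by (intro det1_cong Phi)
  also have "\<dots> = (\<Prod>l=1..N. R l) * (\<Prod>k=1..N. - ?\<pi> * c k)
      * ((\<Prod>(i, j)\<in>?P. ?s (?\<zeta> j - ?\<zeta> i) * ?s (?\<eta> i - ?\<eta> j)) / (\<Prod>l=1..N. \<Prod>k=1..N. ?s (?w l k)))"
    using three sin_pi_nz nI by (subst det1_scale, subst cauchy_det) auto
  \<comment> \<open>The constants \<open>c k\<close> together run over ordered pairs; grouped by
    unordered pairs they become products Gamma w Gamma (-w), which reflection evaluates.\<close>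
  also have "(\<Prod>k=1..N. - ?\<pi> * c k) = (- ?\<pi>) ^ N * (\<Prod>(i, j)\<in>?P. Gamma (?\<eta> j - ?\<eta> i) * Gamma (- (?\<eta> j - ?\<eta> i)))"
    unfolding c_def prod.distrib prod_off_diagonal by (simp add: algebra_simps)
  finally have 1: "det1 N (\<lambda>l k. Phi N \<nu> (\<nu> k) a (z l)) = (\<Prod>l=1..N. R l)
      * ((- ?\<pi>) ^ N * (\<Prod>(i, j)\<in>?P. Gamma (?\<eta> j - ?\<eta> i) * Gamma (- (?\<eta> j - ?\<eta> i))))
      * ((\<Prod>(i, j)\<in>?P. ?s (?\<zeta> j - ?\<zeta> i) * ?s (?\<eta> i - ?\<eta> j)) / (\<Prod>l=1..N. \<Prod>k=1..N. ?s (?w l k)))" .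
  have znz: "z l - of_real (\<nu> j) \<noteq> 0" if "l \<in> {1..N}" "j \<in> {1..N}" for l j
    using nI[OF that] by (auto simp: algebra_simps)
  have 2: "det1 N (\<lambda>l j. 1 / (z l - of_real (\<nu> j)))
      = (\<Prod>(i, j)\<in>?P. (z j - z i) * (of_real (\<nu> i) - of_real (\<nu> j))) / (\<Prod>l=1..N. \<Prod>j=1..N. z l - of_real (\<nu> j))"
    using cauchy_det[of "\<lambda>w. w" N z "\<lambda>j. of_real (\<nu> j)"] znz by (simp add: algebra_simps)
  have "(\<Prod>l=1..N. \<Prod>j=1..N. z l - of_real (\<nu> j)) \<noteq> 0" "(\<Prod>l=1..N. \<Prod>k=1..N. ?s (?w l k)) \<noteq> 0"
    using znz sin_pi_nz nI by auto
  then have "det1 N (\<lambda>l j. 1 / (z l - of_real (\<nu> j))) * det1 N (\<lambda>l k. Phi N \<nu> (\<nu> k) a (z l))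
      = (- ?\<pi>) ^ N * (\<Prod>l=1..N. \<Prod>j=1..N. 1 / ((z l - of_real (\<nu> j)) * Gamma (- ?w l j) * ?s (?w l j)))
        * (\<Prod>(i, j)\<in>?P. ((of_real (\<nu> i) - of_real (\<nu> j)) * ?s (?\<eta> i - ?\<eta> j) * (Gamma (?\<eta> j - ?\<eta> i) * Gamma (- (?\<eta> j - ?\<eta> i))))
            * ((z j - z i) * ?s (?\<zeta> j - ?\<zeta> i)))"
    unfolding 1 2 R_def by (simp add: prod.distrib prod_dividef split_beta mult_ac)
  also have "(\<Prod>l=1..N. \<Prod>j=1..N. 1 / ((z l - of_real (\<nu> j)) * Gamma (- ?w l j) * ?s (?w l j)))
      = (\<Prod>l=1..N. \<Prod>j=1..N. (- ?a / ?\<pi>) * Gamma (?w l j))"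
  proof (intro prod.cong refl)
    fix l j assume lj: "l \<in> {1..N}" "j \<in> {1..N}"
    have w: "?w l j = ?a * (z l - of_real (\<nu> j))" by (simp add: algebra_simps)
    have w0: "?w l j \<noteq> 0" "?s (?w l j) \<noteq> 0" "Gamma (- ?w l j) \<noteq> 0"
      using nI[OF lj] sin_pi_nz[OF nI[OF lj]] nonpos_Ints_Int Ints_minus[of "- ?w l j"] by (auto simp: Gamma_eq_zero_iff)
    have "Gamma (?w l j) * Gamma (- ?w l j) = - ?\<pi> / (?w l j * ?s (?w l j))"
      by (rule Gamma_mult_minus[OF nI[OF lj]])
    then have "Gamma (?w l j) = - ?\<pi> / (?w l j * ?s (?w l j) * Gamma (- ?w l j))"
      using w0 by (simp add: field_simps)
    then show "1 / ((z l - of_real (\<nu> j)) * Gamma (- ?w l j) * ?s (?w l j)) = (- ?a / ?\<pi>) * Gamma (?w l j)"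
      using w0 a0 unfolding w by simp
  qed
  also have "\<dots> = (- ?a / ?\<pi>) ^ (N * N) * (\<Prod>l=1..N. \<Prod>j=1..N. Gamma (?w l j))"
    by (simp only: prod.distrib prod_constant card_atLeastAtMost diff_Suc_1 power_mult)
  also have "(\<Prod>(i, j)\<in>?P. ((of_real (\<nu> i) - of_real (\<nu> j)) * ?s (?\<eta> i - ?\<eta> j) * (Gamma (?\<eta> j - ?\<eta> i) * Gamma (- (?\<eta> j - ?\<eta> i))))
            * ((z j - z i) * ?s (?\<zeta> j - ?\<zeta> i)))
      = (\<Prod>(i, j)\<in>?P. (?\<pi> / ?a)\<^sup>2 * (1 / (Gamma (?a * (z j - z i)) * Gamma (- (?a * (z j - z i))))))"
  proof (intro prod.cong refl, clarify)
    fix i j assume ij: "(i, j) \<in> ?P"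
    let ?e = "?\<eta> j - ?\<eta> i" and ?W = "?a * (z j - z i)"
    have W: "?W = ?\<zeta> j - ?\<zeta> i" by (simp add: algebra_simps)
    have e: "?e = ?a * (of_real (\<nu> j) - of_real (\<nu> i))" by (simp add: algebra_simps)
    have e0: "?e \<noteq> 0" "?s ?e \<noteq> 0" using nI\<eta>[OF ij] sin_pi_nz[OF nI\<eta>[OF ij]] by auto
    have W0: "?W \<noteq> 0" "?s ?W \<noteq> 0" using nI\<zeta>[OF ij] sin_pi_nz[OF nI\<zeta>[OF ij]] unfolding W by auto
    have h1: "?s (?\<eta> i - ?\<eta> j) = - ?s ?e" by (metis minus_diff_eq mult_minus_right sin_minus)
    have h2: "of_real (\<nu> i) - of_real (\<nu> j) = - ?e / ?a" using a0 unfolding e by simp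
    have h3: "Gamma ?e * Gamma (- ?e) = - ?\<pi> / (?e * ?s ?e)" by (rule Gamma_mult_minus[OF nI\<eta>[OF ij]])
    have "(- E / A) * (- S) * (- P / (E * S)) = - P / A" if "E \<noteq> 0" "S \<noteq> 0" for E S P A :: complex
      using that by simp
    from this[OF e0] have A: "(of_real (\<nu> i) - of_real (\<nu> j)) * ?s (?\<eta> i - ?\<eta> j) * (Gamma ?e * Gamma (- ?e)) = - ?\<pi> / ?a"
      unfolding h1 h2 h3 .
    have "Gamma ?W * Gamma (- ?W) = - ?\<pi> / (?W * ?s ?W)"
      using nI\<zeta>[OF ij] unfolding W by (rule Gamma_mult_minus)
    then have "1 / (Gamma ?W * Gamma (- ?W)) = - (?W * ?s ?W) / ?\<pi>" by simp
    then have B: "(z j - z i) * ?s (?\<zeta> j - ?\<zeta> i) = - ?\<pi> / ?a * (1 / (Gamma ?W * Gamma (- ?W)))"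
      unfolding W[symmetric] using a0 by simp
    show "(of_real (\<nu> i) - of_real (\<nu> j)) * ?s (?\<eta> i - ?\<eta> j) * (Gamma ?e * Gamma (- ?e)) * ((z j - z i) * ?s (?\<zeta> j - ?\<zeta> i))
        = (?\<pi> / ?a)\<^sup>2 * (1 / (Gamma ?W * Gamma (- ?W)))"
      unfolding A B by (simp add: power2_eq_square)
  qed
  also have "\<dots> = (?\<pi> / ?a) ^ (2 * card ?P) * (\<Prod>(i, j)\<in>?P. 1 / (Gamma (?a * (z j - z i)) * Gamma (- (?a * (z j - z i)))))"
    unfolding case_prod_unfold prod.distrib prod_constant power_mult by (rule refl)
  finally have "det1 N (\<lambda>l j. 1 / (z l - of_real (\<nu> j))) * det1 N (\<lambda>l k. Phi N \<nu> (\<nu> k) a (z l))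
    = ((- ?\<pi>) ^ N * (- ?a / ?\<pi>) ^ (N * N) * (?\<pi> / ?a) ^ (2 * card ?P))
      * (\<Prod>l=1..N. \<Prod>j=1..N. Gamma (?w l j))
      * (\<Prod>(i, j)\<in>?P. 1 / (Gamma (?a * (z j - z i)) * Gamma (- (?a * (z j - z i)))))"
    by (simp add: mult_ac)
  \<comment> \<open>\<open>card_pairs\<close> distributes the exponent N^2 so that the signs and the
    powers of \<pi> cancel.\<close>
  also have "(- ?\<pi>) ^ N * (- ?a / ?\<pi>) ^ (N * N) * (?\<pi> / ?a) ^ (2 * card ?P) = ?a ^ N"
  proof -
    have "(- ?\<pi>) ^ N * (- ?a / ?\<pi>) ^ (N * N) * (?\<pi> / ?a) ^ (2 * card ?P)
        = ((- ?\<pi>) * (- ?a / ?\<pi>)) ^ N * ((- ?a / ?\<pi>)\<^sup>2 * (?\<pi> / ?a)\<^sup>2) ^ card ?P"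
      unfolding card_pairs[of N, symmetric] power_add power_mult power_mult_distrib by (simp add: mult_ac)
    also have "(- ?\<pi>) * (- ?a / ?\<pi>) = ?a" by simp
    also have "(- ?a / ?\<pi>)\<^sup>2 * (?\<pi> / ?a)\<^sup>2 = 1" using a0 by (simp add: power_divide)
    finally show ?thesis by simp
  qed
  finally show ?thesis by (simp add: algebra_simps)
qed

section \<open>Integrals over vertical lines\<close>

text \<open>Completing the square with the real part of \<open>\<beta>\<close> is a real affine
  substitution; the imaginary part remains as the frequency in the characteristic function of the
  standard normal law.\<close>

lemma gaussian_integral:
  fixes \<beta> :: complex and \<alpha> :: real
  assumes \<alpha>: "\<alpha> > 0"
  shows "integrable lborel (\<lambda>r. exp (\<beta> * of_real r - of_real (\<alpha> * r\<^sup>2 / 2)))"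
    and "(\<integral>r. exp (\<beta> * of_real r - of_real (\<alpha> * r\<^sup>2 / 2)) \<partial>lborel) = of_real (sqrt (2 * pi / \<alpha>)) * exp (\<beta>\<^sup>2 / of_real (2 * \<alpha>))"
proof -
  define c where "c = sqrt \<alpha>"
  have c: "c > 0" "c\<^sup>2 = \<alpha>" using \<alpha> by (simp_all add: c_def)
  define b where "b = Re \<beta> / c"
  define w where "w = Im \<beta> / c"
  have \<beta>: "\<beta> = of_real c * (of_real b + \<i> * of_real w)" using c by (simp add: b_def w_def complex_eq_iff)
  define K where "K = complex_of_real (sqrt (2 * pi)) * exp (of_real (b\<^sup>2 / 2) + \<i> * of_real (b * w))"
  let ?f = "\<lambda>r. exp (\<beta> * of_real r - of_real (\<alpha> * r\<^sup>2 / 2))"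
  let ?g = "\<lambda>x. of_real (std_normal_density x) * iexp (w * x)"
  have eq: "?f (b / c + x / c) = K * ?g x" for x
  proof -
    have "\<beta> * of_real (b / c + x / c) - of_real (\<alpha> * (b / c + x / c)\<^sup>2 / 2)
        = (of_real (b\<^sup>2 / 2) + \<i> * of_real (b * w)) + (- of_real (x\<^sup>2 / 2) + \<i> * of_real (w * x))"
    proof -
      have "\<alpha> * (b / c + x / c)\<^sup>2 = (b + x)\<^sup>2"
        using c \<alpha> by (simp add: add_divide_distrib[symmetric] power_divide)
      moreover have "\<beta> * of_real (b / c + x / c) = (of_real b + \<i> * of_real w) * of_real (b + x)"
        using c by (simp add: \<beta> add_divide_distrib[symmetric])
      ultimately show ?thesis by (simp add: power2_eq_square algebra_simps) (simp add: field_simps)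
    qed
    then have "?f (b / c + x / c) = exp (of_real (b\<^sup>2 / 2) + \<i> * of_real (b * w)) * (of_real (exp (- (x\<^sup>2 / 2))) * iexp (w * x))"
      by (simp only: exp_add exp_of_real of_real_minus[symmetric])
    then show ?thesis
      by (simp add: K_def normal_density_def mult_ac)
  qed
  have g: "integrable lborel ?g"
    by (rule Bochner_Integration.integrable_bound[of _ "\<lambda>x. std_normal_density x"])
       (auto simp: norm_mult integrable_normal_density)
  have gI: "(\<integral>x. ?g x \<partial>lborel) = of_real (exp (- w\<^sup>2 / 2))"
  proof -
    have "char std_normal_distribution w = (\<integral>x. ?g x \<partial>lborel)"
      unfolding char_def by (subst integral_density) (auto simp: scaleR_conv_of_real)
    then show ?thesis by (simp add: char_std_normal_distribution)
  qed
  have "integrable lborel (\<lambda>x. ?f (b / c + (1 / c) * x)) \<longleftrightarrow> integrable lborel ?f"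
    using c by (intro lborel_integrable_real_affine_iff) auto
  then show "integrable lborel ?f"
    using g eq by simp
  have "(\<integral>r. ?f r \<partial>lborel) = \<bar>1 / c\<bar> *\<^sub>R (\<integral>x. ?f (b / c + (1 / c) * x) \<partial>lborel)"
    using c by (intro lborel_integral_real_affine) auto
  also have "(\<lambda>x. ?f (b / c + (1 / c) * x)) = (\<lambda>x. K * ?g x)" using eq by (simp add: fun_eq_iff)
  also have "(\<integral>x. K * ?g x \<partial>lborel) = K * of_real (exp (- w\<^sup>2 / 2))"
    by (simp only: integral_mult_right_zero gI)
  also have "\<bar>1 / c\<bar> *\<^sub>R (K * of_real (exp (- w\<^sup>2 / 2))) = of_real (sqrt (2 * pi / \<alpha>)) * exp (\<beta>\<^sup>2 / of_real (2 * \<alpha>))"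
  proof -
    have "\<beta>\<^sup>2 / of_real (2 * \<alpha>) = (of_real (b\<^sup>2 / 2) + \<i> * of_real (b * w)) + of_real (- w\<^sup>2 / 2)"
      using c(1) unfolding \<beta> c(2)[symmetric] by (simp add: power2_eq_square field_simps)
    moreover have "sqrt (2 * pi / \<alpha>) = sqrt (2 * pi) / c" by (simp add: c_def real_sqrt_divide)
    ultimately show ?thesis using c(1)
      by (simp only: K_def exp_add exp_of_real) (simp add: scaleR_conv_of_real)
  qed
  finally show "(\<integral>r. ?f r \<partial>lborel) = of_real (sqrt (2 * pi / \<alpha>)) * exp (\<beta>\<^sup>2 / of_real (2 * \<alpha>))" .
qed

lemma gaussian_integrable: "\<beta> > 0 \<Longrightarrow> integrable lborel (\<lambda>y::real. exp (- \<beta> * y\<^sup>2))"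
proof -
  assume "\<beta> > 0"
  then have "integrable lborel (\<lambda>r. exp (0 * of_real r - of_real (2 * \<beta> * r\<^sup>2 / 2)) :: complex)"
    by (intro gaussian_integral) auto
  then have "integrable lborel (\<lambda>r. norm (exp (0 * of_real r - of_real (2 * \<beta> * r\<^sup>2 / 2)) :: complex))"
    by (rule integrable_norm)
  then show ?thesis by (simp add: norm_exp_eq_Re)
qed

text \<open>Rectangles of growing height: the horizontal sides vanish by the Gaussian bound. The
  bound is asked for only on the two vertical lines and where |Im z| \<ge> 1, which leaves room for
  a pole near the real axis inside the strip.\<close>

lemma strip_contour_limit:
  fixes f :: "complex \<Rightarrow> complex"
  assumes \<sigma>: "\<sigma>1 < \<sigma>2" and \<beta>: "\<beta> > 0" and C: "C \<ge> 0"
    and bound: "\<And>z. \<sigma>1 \<le> Re z \<Longrightarrow> Re z \<le> \<sigma>2 \<Longrightarrow> (Re z = \<sigma>1 \<or> Re z = \<sigma>2 \<or> \<bar>Im z\<bar> \<ge> 1) \<Longrightarrow> norm (f z) \<le> C * exp (- \<beta> * (Im z)\<^sup>2)"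
    and cont: "\<And>R. R \<ge> 1 \<Longrightarrow> continuous_on (path_image (rectpath (Complex \<sigma>1 (- R)) (Complex \<sigma>2 R))) f"
    and v: "\<And>R. R \<ge> 1 \<Longrightarrow> (f has_contour_integral v) (rectpath (Complex \<sigma>1 (- R)) (Complex \<sigma>2 R))"
  shows "integrable lborel (\<lambda>y. f (Complex \<sigma>1 y))" "integrable lborel (\<lambda>y. f (Complex \<sigma>2 y))"
    and "\<i> * ((\<integral>y. f (Complex \<sigma>2 y) \<partial>lborel) - (\<integral>y. f (Complex \<sigma>1 y) \<partial>lborel)) = v"
proof -
  have line: "continuous_on UNIV (\<lambda>y. f (Complex \<sigma> y))" if "\<sigma> = \<sigma>1 \<or> \<sigma> = \<sigma>2" for \<sigma>
  proof -
    have "continuous_on {- R<..<R} (\<lambda>y. f (Complex \<sigma> y))" if R: "R \<ge> 1" for R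
    proof (rule continuous_on_compose2[OF cont[OF R]])
      show "continuous_on {- R<..<R} (\<lambda>y. Complex \<sigma> y)"
        unfolding Complex_eq by (intro continuous_intros)
      show "Complex \<sigma> ` {- R<..<R} \<subseteq> path_image (rectpath (Complex \<sigma>1 (- R)) (Complex \<sigma>2 R))"
        using \<sigma> R \<open>\<sigma> = \<sigma>1 \<or> \<sigma> = \<sigma>2\<close> by (subst path_image_rectpath) auto
    qed
    note on = this
    have "isCont (\<lambda>y. f (Complex \<sigma> y)) y" for y
    proof -
      have "continuous_on {- (\<bar>y\<bar> + 1)<..<\<bar>y\<bar> + 1} (\<lambda>y. f (Complex \<sigma> y))" by (rule on) simp
      then show ?thesis by (rule continuous_on_interior) (auto simp: interior_open)
    qed
    then show ?thesis by (simp add: continuous_at_imp_continuous_on)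
  qed
  have meas: "(\<lambda>y. f (Complex \<sigma> y)) \<in> borel_measurable borel" if "\<sigma> = \<sigma>1 \<or> \<sigma> = \<sigma>2" for \<sigma>
    using line[OF that] by (rule borel_measurable_continuous_onI)
  have int: "integrable lborel (\<lambda>y. f (Complex \<sigma> y))" if "\<sigma> = \<sigma>1 \<or> \<sigma> = \<sigma>2" for \<sigma>
  proof (rule Bochner_Integration.integrable_bound)
    show "integrable lborel (\<lambda>y. C * exp (- \<beta> * y\<^sup>2))" using gaussian_integrable[OF \<beta>] by simp
    show "(\<lambda>y. f (Complex \<sigma> y)) \<in> borel_measurable lborel" using meas[OF that] by simp
    show "AE y in lborel. norm (f (Complex \<sigma> y)) \<le> norm (C * exp (- \<beta> * y\<^sup>2))"
      using bound[of "Complex \<sigma> _"] that \<sigma> C by (intro AE_I2) (auto simp: abs_mult)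
  qed
  show int1: "integrable lborel (\<lambda>y. f (Complex \<sigma>1 y))" and int2: "integrable lborel (\<lambda>y. f (Complex \<sigma>2 y))"
    by (intro int; simp)+
  define I where "I = (\<lambda>\<sigma> (n::nat). integral {- real n..real n} (\<lambda>y. f (Complex \<sigma> y)))"
  have lim: "I \<sigma> \<longlonglongrightarrow> (\<integral>y. f (Complex \<sigma> y) \<partial>lborel)" if "\<sigma> = \<sigma>1 \<or> \<sigma> = \<sigma>2" for \<sigma>
  proof -
    have "(\<lambda>n. \<integral>y. indicator {- real n..real n} y *\<^sub>R f (Complex \<sigma> y) \<partial>lborel) \<longlonglongrightarrow> (\<integral>y. f (Complex \<sigma> y) \<partial>lborel)"
    proof (rule integral_dominated_convergence)
      show "integrable lborel (\<lambda>y. norm (f (Complex \<sigma> y)))" using int[OF that] by (rule integrable_norm)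
      show "AE y in lborel. (\<lambda>n. indicator {- real n..real n} y *\<^sub>R f (Complex \<sigma> y)) \<longlonglongrightarrow> f (Complex \<sigma> y)"
      proof (rule AE_I2, rule tendsto_eventually)
        fix y :: real
        obtain m :: nat where "\<bar>y\<bar> \<le> real m" using real_arch_simple by blast
        then show "eventually (\<lambda>n. indicator {- real n..real n} y *\<^sub>R f (Complex \<sigma> y) = f (Complex \<sigma> y)) sequentially"
          by (intro eventually_sequentiallyI[of m]) (auto simp: indicator_def)
      qed
    qed (use meas[OF that] in \<open>auto simp: indicator_def\<close>)
    moreover have "I \<sigma> n = (\<integral>y. indicator {- real n..real n} y *\<^sub>R f (Complex \<sigma> y) \<partial>lborel)" for n
    proof -
      have "set_integrable lborel {- real n..real n} (\<lambda>y. f (Complex \<sigma> y))"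
        unfolding set_integrable_def using int[OF that] by (intro integrable_mult_indicator) auto
      then show ?thesis
        unfolding I_def by (subst set_borel_integral_eq_integral(2)[symmetric]) (auto simp: set_lebesgue_integral_def)
    qed
    ultimately show ?thesis by presburger
  qed
  define B where "B = (\<lambda>n::nat. C * exp (- \<beta> * (real n)\<^sup>2) * (\<sigma>2 - \<sigma>1))"
  have Blim: "B \<longlonglongrightarrow> 0"
  proof -
    have "filterlim (\<lambda>n::nat. \<beta> * (real n)\<^sup>2) at_top sequentially"
      using \<beta> by (intro filterlim_tendsto_pos_mult_at_top[OF tendsto_const] filterlim_pow_at_top filterlim_real_sequentially) auto
    then have "(\<lambda>n::nat. exp (- (\<beta> * (real n)\<^sup>2))) \<longlonglongrightarrow> 0"
      by (intro filterlim_compose[OF exp_at_bot] filterlim_compose[OF filterlim_uminus_at_bot_at_top])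
    then have "(\<lambda>n::nat. C * exp (- (\<beta> * (real n)\<^sup>2)) * (\<sigma>2 - \<sigma>1)) \<longlonglongrightarrow> C * 0 * (\<sigma>2 - \<sigma>1)"
      by (intro tendsto_intros)
    then show ?thesis by (simp add: B_def)
  qed
  have key: "norm (v - \<i> * (I \<sigma>2 n - I \<sigma>1 n)) \<le> 2 * B n" if n: "n \<ge> 1" for n
  proof -
    let ?R = "real n"
    have R: "?R \<ge> 1" using n by simp
    let ?a1 = "Complex \<sigma>1 (- ?R)" and ?a2 = "Complex \<sigma>2 (- ?R)" and ?a3 = "Complex \<sigma>2 ?R" and ?a4 = "Complex \<sigma>1 ?R"
    have rect: "rectpath ?a1 ?a3 = linepath ?a1 ?a2 +++ linepath ?a2 ?a3 +++ linepath ?a3 ?a4 +++ linepath ?a4 ?a1"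
      by (simp add: rectpath_def Let_def)
    have sub: "f contour_integrable_on linepath p q" if "closed_segment p q \<subseteq> path_image (rectpath ?a1 ?a3)" for p q
      using continuous_on_subset[OF cont[OF R] that] by (rule contour_integrable_continuous_linepath)
    have pim: "path_image (rectpath ?a1 ?a3) = closed_segment ?a1 ?a2 \<union> closed_segment ?a2 ?a3 \<union> closed_segment ?a3 ?a4 \<union> closed_segment ?a4 ?a1"
      unfolding rect by (simp add: path_image_join Un_assoc)
    have ci: "f contour_integrable_on linepath ?a1 ?a2" "f contour_integrable_on linepath ?a2 ?a3"
      "f contour_integrable_on linepath ?a3 ?a4" "f contour_integrable_on linepath ?a4 ?a1"
      by (intro sub; unfold pim; blast)+
    have "v = contour_integral (rectpath ?a1 ?a3) f"
      using contour_integral_unique[OF v[OF R]] by simp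
    also have "\<dots> = contour_integral (linepath ?a1 ?a2) f + contour_integral (linepath ?a2 ?a3) f
        + contour_integral (linepath ?a3 ?a4) f + contour_integral (linepath ?a4 ?a1) f"
      unfolding rect using ci by (simp add: contour_integrable_joinI add_ac)
    also have "contour_integral (linepath ?a2 ?a3) f = \<i> * I \<sigma>2 n"
      unfolding I_def using R by (subst contour_integral_linepath_same_Re[of _ \<sigma>2 _ "- ?R" ?R]) auto
    also have "contour_integral (linepath ?a4 ?a1) f = - \<i> * I \<sigma>1 n"
    proof -
      have "contour_integral (linepath ?a4 ?a1) f = - contour_integral (linepath ?a1 ?a4) f"
        by (metis contour_integral_reversepath reversepath_linepath valid_path_linepath)
      also have "contour_integral (linepath ?a1 ?a4) f = \<i> * I \<sigma>1 n"
        unfolding I_def using R by (subst contour_integral_linepath_same_Re[of _ \<sigma>1 _ "- ?R" ?R]) auto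
      finally show ?thesis by simp
    qed
    finally have "v - \<i> * (I \<sigma>2 n - I \<sigma>1 n) = contour_integral (linepath ?a1 ?a2) f + contour_integral (linepath ?a3 ?a4) f"
      by (simp add: algebra_simps)
    moreover have h: "norm (f z) \<le> C * exp (- \<beta> * ?R\<^sup>2)" if "\<bar>Im z\<bar> = ?R" "\<sigma>1 \<le> Re z" "Re z \<le> \<sigma>2" for z
    proof -
      have "(Im z)\<^sup>2 = ?R\<^sup>2" using that(1) by (metis power2_abs)
      then show ?thesis using bound[of z] that R by simp
    qed
    have "norm (contour_integral (linepath ?a1 ?a2) f) \<le> C * exp (- \<beta> * ?R\<^sup>2) * norm (?a2 - ?a1)"
    proof (rule contour_integral_bound_linepath[OF ci(1)])
      fix z assume "z \<in> closed_segment ?a1 ?a2"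
      then obtain u where u: "0 \<le> u" "u \<le> 1" "z = (1 - u) *\<^sub>R ?a1 + u *\<^sub>R ?a2" by (auto simp: closed_segment_def)
      have "Im z = - ?R" "Re z = \<sigma>1 + u * (\<sigma>2 - \<sigma>1)" by (simp_all add: u(3) algebra_simps)
      moreover have "0 \<le> u * (\<sigma>2 - \<sigma>1)" "u * (\<sigma>2 - \<sigma>1) \<le> \<sigma>2 - \<sigma>1"
        using u \<sigma> by (auto intro: mult_left_le_one_le)
      ultimately show "norm (f z) \<le> C * exp (- \<beta> * ?R\<^sup>2)" using R by (intro h) auto
    qed (use C in auto)
    moreover have "norm (contour_integral (linepath ?a3 ?a4) f) \<le> C * exp (- \<beta> * ?R\<^sup>2) * norm (?a4 - ?a3)"
    proof (rule contour_integral_bound_linepath[OF ci(3)])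
      fix z assume "z \<in> closed_segment ?a3 ?a4"
      then obtain u where u: "0 \<le> u" "u \<le> 1" "z = (1 - u) *\<^sub>R ?a3 + u *\<^sub>R ?a4" by (auto simp: closed_segment_def)
      have "Im z = ?R" "Re z = \<sigma>2 - u * (\<sigma>2 - \<sigma>1)" by (simp_all add: u(3) algebra_simps)
      moreover have "0 \<le> u * (\<sigma>2 - \<sigma>1)" "u * (\<sigma>2 - \<sigma>1) \<le> \<sigma>2 - \<sigma>1"
        using u \<sigma> by (auto intro: mult_left_le_one_le)
      ultimately show "norm (f z) \<le> C * exp (- \<beta> * ?R\<^sup>2)" using R by (intro h) auto
    qed (use C in auto)
    moreover have "norm (?a2 - ?a1) = \<sigma>2 - \<sigma>1" "norm (?a4 - ?a3) = \<sigma>2 - \<sigma>1"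
      using \<sigma> by (simp_all add: cmod_def)
    ultimately show ?thesis
      unfolding B_def using norm_triangle_ineq[of "contour_integral (linepath ?a1 ?a2) f" "contour_integral (linepath ?a3 ?a4) f"]
      by simp
  qed
  have "(\<lambda>n. v - \<i> * (I \<sigma>2 n - I \<sigma>1 n)) \<longlonglongrightarrow> 0"
  proof (rule Lim_null_comparison)
    show "eventually (\<lambda>n. norm (v - \<i> * (I \<sigma>2 n - I \<sigma>1 n)) \<le> 2 * B n) sequentially"
      using key by (intro eventually_sequentiallyI[of 1])
    show "(\<lambda>n. 2 * B n) \<longlonglongrightarrow> 0" using tendsto_mult[OF tendsto_const[of 2] Blim] by simp
  qed
  moreover have "(\<lambda>n. v - \<i> * (I \<sigma>2 n - I \<sigma>1 n)) \<longlonglongrightarrow> v - \<i> * ((\<integral>y. f (Complex \<sigma>2 y) \<partial>lborel) - (\<integral>y. f (Complex \<sigma>1 y) \<partial>lborel))"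
    by (intro tendsto_intros lim) auto
  ultimately show "\<i> * ((\<integral>y. f (Complex \<sigma>2 y) \<partial>lborel) - (\<integral>y. f (Complex \<sigma>1 y) \<partial>lborel)) = v"
    using LIMSEQ_unique by fastforce
qed

lemma strip_shift:
  fixes f :: "complex \<Rightarrow> complex"
  assumes \<sigma>: "b < \<sigma>1" "\<sigma>1 \<le> \<sigma>2" and \<beta>: "\<beta> > 0" and C: "C \<ge> 0"
    and hol: "f holomorphic_on {z. b < Re z}"
    and bound: "\<And>z. \<sigma>1 \<le> Re z \<Longrightarrow> Re z \<le> \<sigma>2 \<Longrightarrow> norm (f z) \<le> C * exp (- \<beta> * (Im z)\<^sup>2)"
  shows "(\<integral>y. f (Complex \<sigma>2 y) \<partial>lborel) = (\<integral>y. f (Complex \<sigma>1 y) \<partial>lborel)"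
proof (cases "\<sigma>1 = \<sigma>2")
  case False
  then have lt: "\<sigma>1 < \<sigma>2" using \<sigma> by simp
  have pim: "path_image (rectpath (Complex \<sigma>1 (- R)) (Complex \<sigma>2 R)) \<subseteq> {z. b < Re z}" if "R \<ge> 1" for R
    using lt \<sigma> that by (subst path_image_rectpath) auto
  have "\<i> * ((\<integral>y. f (Complex \<sigma>2 y) \<partial>lborel) - (\<integral>y. f (Complex \<sigma>1 y) \<partial>lborel)) = 0"
  proof (rule strip_contour_limit(3)[OF lt \<beta> C bound])
    fix R :: real assume R: "R \<ge> 1"
    show "continuous_on (path_image (rectpath (Complex \<sigma>1 (- R)) (Complex \<sigma>2 R))) f"
      using pim[OF R] hol holomorphic_on_imp_continuous_on continuous_on_subset by blast
    show "(f has_contour_integral 0) (rectpath (Complex \<sigma>1 (- R)) (Complex \<sigma>2 R))"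
      using pim[OF R] by (intro Cauchy_theorem_convex_simple[OF hol convex_halfspace_Re_gt]) auto
  qed auto
  then show ?thesis by simp
qed simp

text \<open>The rectangles enclose the simple pole at \<open>v\<close>, where Cauchy's integral
  formula supplies the limit.\<close>

lemma strip_residue:
  fixes f :: "complex \<Rightarrow> complex"
  assumes \<sigma>: "b < \<sigma>1" "\<sigma>1 < v" "v < \<sigma>2" and \<beta>: "\<beta> > 0" and C: "C \<ge> 0"
    and hol: "f holomorphic_on {z. b < Re z}"
    and bound: "\<And>z. \<sigma>1 \<le> Re z \<Longrightarrow> Re z \<le> \<sigma>2 \<Longrightarrow> norm (f z) \<le> C * exp (- \<beta> * (Im z)\<^sup>2)"
  shows "(\<integral>y. f (Complex \<sigma>2 y) / (Complex \<sigma>2 y - of_real v) \<partial>lborel)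
    - (\<integral>y. f (Complex \<sigma>1 y) / (Complex \<sigma>1 y - of_real v) \<partial>lborel) = 2 * of_real pi * f (of_real v)"
proof -
  \<comment> \<open>\<open>m\<close> bounds |z - v| from below wherever
    \<open>strip_contour_limit\<close> asks for an estimate: on the two lines and where |Im z| \<ge>
    1.\<close>
  define m where "m = min 1 (min (v - \<sigma>1) (\<sigma>2 - v))"
  have m: "m > 0" "m \<le> 1" "m \<le> v - \<sigma>1" "m \<le> \<sigma>2 - v" using \<sigma> by (auto simp: m_def)
  have lt: "\<sigma>1 < \<sigma>2" using \<sigma> by simp
  have C': "C / m \<ge> 0" using C m by simp
  have pim: "path_image (rectpath (Complex \<sigma>1 (- R)) (Complex \<sigma>2 R)) \<subseteq> {z. b < Re z} - {of_real v}" if "R \<ge> 1" for R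
    using \<sigma> that by (subst path_image_rectpath) auto
  have "\<i> * ((\<integral>y. f (Complex \<sigma>2 y) / (Complex \<sigma>2 y - of_real v) \<partial>lborel)
      - (\<integral>y. f (Complex \<sigma>1 y) / (Complex \<sigma>1 y - of_real v) \<partial>lborel)) = 2 * pi * \<i> * 1 * f (of_real v)"
  proof (rule strip_contour_limit(3)[OF lt \<beta> C'])
    fix z assume z: "\<sigma>1 \<le> Re z" "Re z \<le> \<sigma>2" "Re z = \<sigma>1 \<or> Re z = \<sigma>2 \<or> 1 \<le> \<bar>Im z\<bar>"
    have "m \<le> norm (z - of_real v)"
      using z(3) m abs_Re_le_cmod[of "z - of_real v"] abs_Im_le_cmod[of "z - of_real v"] by auto
    then show "norm (f z / (z - of_real v)) \<le> C / m * exp (- \<beta> * (Im z)\<^sup>2)"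
      using bound[OF z(1,2)] m C by (simp add: norm_divide) (intro frac_le; simp)
  next
    fix R :: real assume R: "R \<ge> 1"
    show "continuous_on (path_image (rectpath (Complex \<sigma>1 (- R)) (Complex \<sigma>2 R))) (\<lambda>z. f z / (z - of_real v))"
      using pim[OF R] by (intro continuous_intros continuous_on_subset[OF holomorphic_on_imp_continuous_on[OF hol]]) auto
    have "winding_number (rectpath (Complex \<sigma>1 (- R)) (Complex \<sigma>2 R)) (of_real v) = 1"
      using \<sigma> R by (intro winding_number_rectpath) (auto simp: in_box_complex_iff)
    moreover have "of_real v \<in> interior {z. b < Re z}"
      using \<sigma> by (simp add: interior_open open_halfspace_Re_gt)
    ultimately show "((\<lambda>z. f z / (z - of_real v)) has_contour_integral 2 * pi * \<i> * 1 * f (of_real v)) (rectpath (Complex \<sigma>1 (- R)) (Complex \<sigma>2 R))"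
      using Cauchy_integral_formula_convex_simple[OF convex_halfspace_Re_gt hol, of "of_real v" "rectpath (Complex \<sigma>1 (- R)) (Complex \<sigma>2 R)"] pim[OF R]
      by simp
  qed
  then have "\<i> * ((\<integral>y. f (Complex \<sigma>2 y) / (Complex \<sigma>2 y - of_real v) \<partial>lborel)
      - (\<integral>y. f (Complex \<sigma>1 y) / (Complex \<sigma>1 y - of_real v) \<partial>lborel)) = \<i> * (2 * of_real pi * f (of_real v))" by simp
  then show ?thesis by (subst (asm) mult_cancel_left) simp
qed

section \<open>Laplace transforms on a half line\<close>

lemma exp_decay_integral:
  fixes \<alpha> :: complex
  assumes \<alpha>: "Re \<alpha> > 0"
  shows "integrable lborel (\<lambda>x. indicator {c..} x *\<^sub>R exp (- \<alpha> * of_real x))"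
    and "(\<integral>x. indicator {c..} x *\<^sub>R exp (- \<alpha> * of_real x) \<partial>lborel) = exp (- \<alpha> * of_real c) / \<alpha>"
proof -
  have \<alpha>0: "\<alpha> \<noteq> 0" using \<alpha> by auto
  let ?f = "\<lambda>x. exp (- \<alpha> * of_real x)"
  have [measurable]: "?f \<in> borel_measurable borel"
    by (intro borel_measurable_continuous_onI continuous_intros)
  have "(\<lambda>x. exp (- Re \<alpha> * x)) absolutely_integrable_on {c..}"
    using integrable_on_exp_minus_to_infinity[of "Re \<alpha>" c] \<alpha>
    by (intro nonnegative_absolutely_integrable_1) auto
  then have "integrable lebesgue (\<lambda>x. indicator {c..} x *\<^sub>R exp (- Re \<alpha> * x))"
    by (simp add: set_integrable_def)
  then have real: "integrable lborel (\<lambda>x. indicator {c..} x *\<^sub>R exp (- Re \<alpha> * x))"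
    by (subst (asm) integrable_completion) auto
  show int: "integrable lborel (\<lambda>x. indicator {c..} x *\<^sub>R ?f x)"
  proof (rule Bochner_Integration.integrable_bound[OF real])
    show "(\<lambda>x. indicator {c..} x *\<^sub>R ?f x) \<in> borel_measurable lborel" by measurable
  qed (auto simp: indicator_def norm_exp_eq_Re)
  define F where "F = (\<lambda>x. - exp (- \<alpha> * of_real x) / \<alpha>)"
  have "(LBINT x=ereal c..\<infinity>. ?f x) = 0 - F c"
  proof (rule interval_integral_FTC_integrable)
    fix x :: real
    show "(F has_vector_derivative ?f x) (at x)"
      unfolding F_def using \<alpha>0
      by (auto intro!: derivative_eq_intros has_vector_derivative_real_field simp: field_simps)
    show "isCont ?f x" by (intro continuous_intros)
  next
    have "integrable lborel (\<lambda>x. indicator {c<..} x *\<^sub>R (indicator {c..} x *\<^sub>R ?f x))"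
      by (rule integrable_mult_indicator[OF _ int]) simp
    then show "set_integrable lborel (einterval (ereal c) \<infinity>) ?f"
      unfolding set_integrable_def by (rule Bochner_Integration.integrable_cong[THEN iffD1, rotated -1]) (auto simp: indicator_def einterval_def)
    show "((F \<circ> real_of_ereal) \<longlongrightarrow> F c) (at_right (ereal c))"
    proof -
      have "(F \<longlongrightarrow> F c) (at_right c)"
        unfolding F_def by (intro tendsto_intros) (use \<alpha>0 in auto)
      then show ?thesis by (simp add: ereal_tendsto_simps)
    qed
    show "((F \<circ> real_of_ereal) \<longlongrightarrow> 0) (at_left \<infinity>)"
    proof -
      have "((\<lambda>x. exp (- Re \<alpha> * x) / norm \<alpha>) \<longlongrightarrow> 0 / norm \<alpha>) at_top"
        using \<alpha> by (intro tendsto_divide tendsto_const filterlim_compose[OF exp_at_bot]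
            filterlim_tendsto_neg_mult_at_bot[OF tendsto_const] filterlim_ident) (use \<alpha>0 in auto)
      then have "(F \<longlongrightarrow> 0) at_top"
        by (intro Lim_null_comparison[of F "\<lambda>x. exp (- Re \<alpha> * x) / norm \<alpha>"])
           (auto simp: F_def norm_divide norm_exp_eq_Re)
      then show ?thesis by (simp add: ereal_tendsto_simps)
    qed
  qed simp
  then have "(LBINT x=ereal c..\<infinity>. ?f x) = ?f c / \<alpha>" by (simp add: F_def)
  moreover have "(LBINT x=ereal c..\<infinity>. ?f x) = (\<integral>x. indicator {c..} x *\<^sub>R ?f x \<partial>lborel)"
  proof -
    have "(LBINT x=ereal c..\<infinity>. ?f x) = (\<integral>x. indicator {c<..} x *\<^sub>R ?f x \<partial>lborel)"
      by (simp add: interval_lebesgue_integral_def einterval_def set_lebesgue_integral_def greaterThan_def)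
    also have "\<dots> = (\<integral>x. indicator {c..} x *\<^sub>R ?f x \<partial>lborel)"
    proof (rule integral_cong_AE)
      show "AE x in lborel. indicator {c<..} x *\<^sub>R ?f x = indicator {c..} x *\<^sub>R ?f x"
        using AE_lborel_singleton[of c] by eventually_elim (auto simp: indicator_def)
    qed measurable
    finally show ?thesis .
  qed
  ultimately show "(\<integral>x. indicator {c..} x *\<^sub>R ?f x \<partial>lborel) = ?f c / \<alpha>" by simp
qed

lemma (in pair_sigma_finite) integrable_times:
  fixes f :: "'a \<Rightarrow> 'c::{real_normed_field, banach, second_countable_topology}"
  assumes f: "integrable M1 f" and g: "integrable M2 g"
  shows "integrable (M1 \<Otimes>\<^sub>M M2) (\<lambda>(x, y). f x * g y)"
proof (rule Fubini_integrable)
  have [measurable]: "f \<in> borel_measurable M1" "g \<in> borel_measurable M2" using f g by auto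
  show "(\<lambda>(x, y). f x * g y) \<in> borel_measurable (M1 \<Otimes>\<^sub>M M2)" by measurable
  show "integrable M1 (\<lambda>x. \<integral>y. norm (case (x, y) of (x, y) \<Rightarrow> f x * g y) \<partial>M2)"
    using f by (simp add: norm_mult)
  show "AE x in M1. integrable M2 (\<lambda>y. case (x, y) of (x, y) \<Rightarrow> f x * g y)"
    using g by simp
qed

text \<open>Damping by \<open>\<gamma> > 0\<close> gives absolute convergence in both variables, so
  Fubini moves the half-line integral inside. The number \<open>q\<close> may have either sign: the
  left half line is reached by reflection.\<close>

lemma half_line_transform:
  fixes L :: "real \<Rightarrow> complex"
  assumes \<gamma>: "\<gamma> > 0" and L: "integrable lborel L"
  shows "integrable lborel (\<lambda>x. indicator {c..} x *\<^sub>R (\<integral>y. exp (- (of_real \<gamma> + \<i> * of_real (q * y)) * of_real x) * L y \<partial>lborel))"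
    and "(\<integral>x. indicator {c..} x *\<^sub>R (\<integral>y. exp (- (of_real \<gamma> + \<i> * of_real (q * y)) * of_real x) * L y \<partial>lborel) \<partial>lborel)
      = (\<integral>y. exp (- (of_real \<gamma> + \<i> * of_real (q * y)) * of_real c) / (of_real \<gamma> + \<i> * of_real (q * y)) * L y \<partial>lborel)"
    and "integrable lborel (\<lambda>y. exp (- (of_real \<gamma> + \<i> * of_real (q * y)) * of_real c) / (of_real \<gamma> + \<i> * of_real (q * y)) * L y)"
proof -
  let ?a = "\<lambda>y. of_real \<gamma> + \<i> * of_real (q * y) :: complex"
  let ?F = "\<lambda>(x, y). indicator {c..} x *\<^sub>R (exp (- ?a y * of_real x) * L y)"
  have [measurable]: "L \<in> borel_measurable borel" using L by (simp add: borel_measurable_integrable)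
  have Fm: "?F \<in> borel_measurable (lborel \<Otimes>\<^sub>M lborel)" by measurable
  have F: "integrable (lborel \<Otimes>\<^sub>M lborel) ?F"
  proof (rule Bochner_Integration.integrable_bound[OF _ Fm])
    have "integrable lborel (\<lambda>x. norm (indicator {c..} x *\<^sub>R exp (- complex_of_real \<gamma> * of_real x)))"
      using \<gamma> by (intro integrable_norm exp_decay_integral) auto
    then show "integrable (lborel \<Otimes>\<^sub>M lborel) (\<lambda>(x, y). norm (indicator {c..} x *\<^sub>R exp (- complex_of_real \<gamma> * of_real x)) * norm (L y))"
      by (rule lborel_pair.integrable_times[OF _ integrable_norm[OF L]])
    show "AE z in lborel \<Otimes>\<^sub>M lborel. norm (?F z) \<le> norm (case z of (x, y) \<Rightarrow> norm (indicator {c..} x *\<^sub>R exp (- complex_of_real \<gamma> * of_real x)) * norm (L y))"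
      by (rule AE_I2) (auto simp: indicator_def norm_mult norm_exp_eq_Re)
  qed
  have eq: "(\<integral>y. ?F (x, y) \<partial>lborel) = indicator {c..} x *\<^sub>R (\<integral>y. exp (- ?a y * of_real x) * L y \<partial>lborel)" for x
    by simp
  show "integrable lborel (\<lambda>x. indicator {c..} x *\<^sub>R (\<integral>y. exp (- ?a y * of_real x) * L y \<partial>lborel))"
    using lborel_pair.integrable_fst'[OF F] unfolding eq .
  have swap: "(\<integral>x. indicator {c..} x *\<^sub>R (\<integral>y. exp (- ?a y * of_real x) * L y \<partial>lborel) \<partial>lborel) = (\<integral>y. (\<integral>x. ?F (x, y) \<partial>lborel) \<partial>lborel)"
    using lborel_pair.Fubini_integral[of "\<lambda>x y. ?F (x, y)"] F unfolding eq[symmetric] by simp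
  have inner: "(\<integral>x. ?F (x, y) \<partial>lborel) = exp (- ?a y * of_real c) / ?a y * L y" for y
  proof -
    have "(\<integral>x. ?F (x, y) \<partial>lborel) = (\<integral>x. indicator {c..} x *\<^sub>R exp (- ?a y * of_real x) * L y \<partial>lborel)"
      by (simp add: scaleR_conv_of_real mult_ac)
    also have "\<dots> = (\<integral>x. indicator {c..} x *\<^sub>R exp (- ?a y * of_real x) \<partial>lborel) * L y"
      by (rule Bochner_Integration.integral_mult_left_zero)
    also have "\<dots> = exp (- ?a y * of_real c) / ?a y * L y"
      using exp_decay_integral(2)[of "?a y" c] \<gamma> by simp
    finally show ?thesis .
  qed
  have "(\<integral>y. (\<integral>x. ?F (x, y) \<partial>lborel) \<partial>lborel) = (\<integral>y. exp (- ?a y * of_real c) / ?a y * L y \<partial>lborel)"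
    unfolding inner ..
  with swap show "(\<integral>x. indicator {c..} x *\<^sub>R (\<integral>y. exp (- ?a y * of_real x) * L y \<partial>lborel) \<partial>lborel)
      = (\<integral>y. exp (- ?a y * of_real c) / ?a y * L y \<partial>lborel)"
    by (rule trans)
  show "integrable lborel (\<lambda>y. exp (- ?a y * of_real c) / ?a y * L y)"
    using lborel_pair.integrable_snd[of "\<lambda>x y. ?F (x, y)"] F unfolding inner by simp
qed

section \<open>Determinantal martingales\<close>

lemma normal_density_sqrt:
  "s > 0 \<Longrightarrow> normal_density v (sqrt s) x = 1 / sqrt (2 * pi * s) * exp (- (x - v)\<^sup>2 / (2 * s))"
  by (simp add: normal_density_def)

lemma pos_Re_not_nonpos_Ints: "Re z > 0 \<Longrightarrow> z \<notin> \<int>\<^sub>\<le>\<^sub>0"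
proof
  assume "Re z > 0" "z \<in> \<int>\<^sub>\<le>\<^sub>0"
  then obtain n where "z = of_int n" "n \<le> 0" by (elim nonpos_Ints_cases)
  then show False using \<open>Re z > 0\<close> by simp
qed

text \<open>Trades 1 / Gamma for a Gamma value that is bounded on the strip and a sine of
  exponential growth. At the poles of Gamma both sides are 0.\<close>

lemma inverse_Gamma_reflection:
  fixes w :: complex
  assumes "Re w < 1"
  shows "1 / Gamma w = Gamma (1 - w) * sin (of_real pi * w) / of_real pi"
proof -
  have nz: "Gamma (1 - w) \<noteq> 0"
    using pos_Re_not_nonpos_Ints[of "1 - w"] assms by (simp add: Gamma_eq_zero_iff)
  have r: "Gamma w * Gamma (1 - w) = of_real pi / sin (of_real pi * w)" by (rule Gamma_reflection_complex)
  show ?thesis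
  proof (cases "sin (of_real pi * w) = 0")
    case True
    then show ?thesis using r nz by simp
  next
    case False
    then have "Gamma w \<noteq> 0" using r by auto
    then show ?thesis using r False by (simp add: field_simps)
  qed
qed

lemma norm_sin_le_exp: "norm (sin (z::complex)) \<le> exp \<bar>Im z\<bar>"
  using cmod_sin_le_exp[of 1 z] by simp

section \<open>The functions \<open>Phi\<close> and \<open>M_mart\<close> on the strip between the
  two contours\<close>

locale spectrum =
  fixes N :: nat and a :: real and \<nu> :: "nat \<Rightarrow> real"
  assumes a: "a > 0" and inj: "inj_on \<nu> {1..N}" and small: "\<And>j. j \<in> {1..N} \<Longrightarrow> a * \<bar>\<nu> j\<bar> < 1 / 2"
begin

text \<open>Half the width of the strip: all \<nu>_j lie in (-\<delta>, \<delta>), and the poles of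
  \<open>Phi\<close> lie to the left of -\<delta>.\<close>

definition \<delta> :: real where "\<delta> = 1 / (2 * a)"

lemma \<delta>_pos: "\<delta> > 0" and a\<delta>: "a * \<delta> = 1 / 2"
  using a by (simp_all add: \<delta>_def)

lemma \<nu>_bound: "j \<in> {1..N} \<Longrightarrow> \<bar>\<nu> j\<bar> < \<delta>"
  using small[of j] a by (simp add: \<delta>_def field_simps)

text \<open>The real part of the argument stays in a compact subinterval of (0, 2), where the real
  Gamma function is bounded, and \<open>norm_Gamma_le\<close> does the rest.\<close>

lemma Gamma_strip_bound:
  assumes "\<bar>r\<bar> < \<delta>"
  obtains C where "C \<ge> 0" "\<And>z. \<bar>Re z\<bar> \<le> \<delta> \<Longrightarrow> norm (Gamma (1 - of_real a * (of_real r - z))) \<le> C"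
proof -
  let ?I = "{1 / 2 - a * r..3 / 2 - a * r}"
  have ar: "\<bar>a * r\<bar> < 1 / 2"
    using assms a mult_strict_left_mono[of "\<bar>r\<bar>" \<delta> a] by (simp add: abs_mult a\<delta>)
  then have "continuous_on ?I (Gamma :: real \<Rightarrow> real)"
    by (intro continuous_on_Gamma) (auto elim!: nonpos_Ints_cases)
  then have "bounded (Gamma ` ?I)"
    by (intro compact_imp_bounded compact_continuous_image) auto
  then obtain C where "\<forall>y\<in>Gamma ` ?I. norm (y :: real) \<le> C" unfolding bounded_iff by blast
  then have C: "norm (Gamma x :: real) \<le> C" if "x \<in> ?I" for x using that by blast
  have "norm (Gamma (1 - of_real a * (of_real r - z))) \<le> C" if z: "\<bar>Re z\<bar> \<le> \<delta>" for z
  proof -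
    have re: "Re (1 - of_real a * (of_real r - z)) = 1 - a * r + a * Re z" by (simp add: algebra_simps)
    have "\<bar>a * Re z\<bar> \<le> 1 / 2" using z a mult_left_mono[of "\<bar>Re z\<bar>" \<delta> a] by (simp add: abs_mult a\<delta>)
    then have mem: "1 - a * r + a * Re z \<in> ?I" by auto
    then have pos: "1 - a * r + a * Re z > 0" using ar by auto
    have "norm (Gamma (1 - of_real a * (of_real r - z))) \<le> Gamma (1 - a * r + a * Re z)"
      using norm_Gamma_le[of "1 - of_real a * (of_real r - z)"] pos unfolding re by simp
    also have "\<dots> \<le> C" using C[OF mem] by simp
    finally show ?thesis .
  qed
  moreover have "C \<ge> 0" using C[of "1 / 2 - a * r"] norm_ge_zero order_trans by fastforce
  ultimately show thesis using that by blast
qed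

text \<open>The leading Gamma factor is bounded on the strip. Each quotient contains a reciprocal
  Gamma, by reflection a bounded factor times a sine of growth exp (\<pi> a |Im z|). Such growth is
  harmless against the Gaussian in \<open>kernel\<close>.\<close>

lemma Phi_bound:
  assumes k: "k \<in> {1..N}"
  shows "\<exists>C\<ge>0. \<exists>\<kappa>\<ge>0. \<forall>z. \<bar>Re z\<bar> \<le> \<delta> \<longrightarrow> norm (Phi N \<nu> (\<nu> k) a z) \<le> C * exp (\<kappa> * \<bar>Im z\<bar>)"
proof -
  let ?R = "\<nu> ` {1..N} - {\<nu> k}"
  have "\<forall>r\<in>\<nu> ` {1..N}. \<exists>C\<ge>0. \<forall>z. \<bar>Re z\<bar> \<le> \<delta> \<longrightarrow> norm (Gamma (1 - of_real a * (of_real r - z))) \<le> C"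
    using Gamma_strip_bound \<nu>_bound by (metis imageE)
  then obtain G where G: "\<And>r. r \<in> \<nu> ` {1..N} \<Longrightarrow> G r \<ge> 0"
    "\<And>r z. r \<in> \<nu> ` {1..N} \<Longrightarrow> \<bar>Re z\<bar> \<le> \<delta> \<Longrightarrow> norm (Gamma (1 - of_real a * (of_real r - z))) \<le> G r"
    by metis
  define H where "H = (\<lambda>r. norm (Gamma (complex_of_real (a * (r - \<nu> k)))) * (G r / pi))"
  have H0: "H r \<ge> 0" if "r \<in> ?R" for r using G(1)[of r] that by (simp add: H_def)
  have "norm (Phi N \<nu> (\<nu> k) a z) \<le> (G (\<nu> k) * (\<Prod>r\<in>?R. H r)) * exp ((card ?R * (pi * a)) * \<bar>Im z\<bar>)"
    if z: "\<bar>Re z\<bar> \<le> \<delta>" for z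
  proof -
    have fac: "norm (Gamma (complex_of_real (a * (r - \<nu> k))) / Gamma (of_real a * (of_real r - z))) \<le> H r * exp (pi * a * \<bar>Im z\<bar>)"
      if r: "r \<in> ?R" for r
    proof -
      let ?w = "of_real a * (of_real r - z)"
      have "\<bar>r\<bar> < \<delta>" using r \<nu>_bound by auto
      then have "a * (r - Re z) < a * (2 * \<delta>)" using z a by (intro mult_strict_left_mono) auto
      \<comment> \<open>Both r and -Re z are at most \<delta> and the first strictly less, while 2 a
        \<delta> = 1.\<close>
      then have "Re ?w < 1" using a\<delta> by (simp add: algebra_simps)
      then have "norm (1 / Gamma ?w) = norm (Gamma (1 - ?w)) * norm (sin (of_real pi * ?w)) / pi"
        by (simp add: inverse_Gamma_reflection norm_mult norm_divide)
      also have "\<dots> \<le> G r * exp (pi * a * \<bar>Im z\<bar>) / pi"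
      proof -
        have "norm (sin (of_real pi * ?w)) \<le> exp \<bar>Im (of_real pi * ?w)\<bar>" by (rule norm_sin_le_exp)
        also have "\<bar>Im (of_real pi * ?w)\<bar> = pi * a * \<bar>Im z\<bar>" using a by (simp add: abs_mult)
        finally show ?thesis
          using G(1,2)[of r] r z by (intro divide_right_mono mult_mono) auto
      qed
      finally have "norm (1 / Gamma ?w) \<le> G r * exp (pi * a * \<bar>Im z\<bar>) / pi" .
      then have "norm (Gamma (complex_of_real (a * (r - \<nu> k)))) * norm (1 / Gamma ?w)
          \<le> norm (Gamma (complex_of_real (a * (r - \<nu> k)))) * (G r * exp (pi * a * \<bar>Im z\<bar>) / pi)"
        by (rule mult_left_mono) simp
      then show ?thesis by (simp add: H_def norm_divide mult_ac)
    qed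
    have "norm (Phi N \<nu> (\<nu> k) a z) = norm (Gamma (1 - of_real a * (of_real (\<nu> k) - z)))
        * (\<Prod>r\<in>?R. norm (Gamma (complex_of_real (a * (r - \<nu> k))) / Gamma (of_real a * (of_real r - z))))"
      by (simp add: Phi_def norm_mult prod_norm)
    also have "\<dots> \<le> G (\<nu> k) * (\<Prod>r\<in>?R. H r * exp (pi * a * \<bar>Im z\<bar>))"
      using k z G(1)[of "\<nu> k"] G(2)[of "\<nu> k" z] fac by (intro mult_mono prod_mono prod_nonneg conjI) auto
    also have "\<dots> = (G (\<nu> k) * (\<Prod>r\<in>?R. H r)) * exp ((card ?R * (pi * a)) * \<bar>Im z\<bar>)"
      by (simp add: prod.distrib exp_of_nat_mult[symmetric] mult_ac)
    finally show ?thesis .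
  qed
  moreover have "G (\<nu> k) * (\<Prod>r\<in>?R. H r) \<ge> 0" using G(1)[of "\<nu> k"] H0 k by (auto intro!: mult_nonneg_nonneg prod_nonneg)
  moreover have "real (card ?R) * (pi * a) \<ge> 0" using a by simp
  ultimately show ?thesis by blast
qed

text \<open>The reciprocal Gamma function is entire, so poles can come only from the leading factor,
  at the points u - n / a with n \<ge> 1.\<close>

lemma Phi_holomorphic: "Phi N \<nu> u a holomorphic_on {z. u - 1 / a < Re z}"
proof -
  have "Gamma w1 / Gamma w2 = Gamma w1 * rGamma w2" for w1 w2 :: complex
    by (simp add: rGamma_inverse_Gamma divide_inverse)
  then have eq: "Phi N \<nu> u a = (\<lambda>x. Gamma (1 - complex_of_real a * (complex_of_real u - x))
     * (\<Prod>r\<in>\<nu> ` {1..N} - {u}. Gamma (complex_of_real (a * (r - u))) * rGamma (complex_of_real a * (complex_of_real r - x))))"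
    by (simp add: Phi_def fun_eq_iff)
  show ?thesis
    unfolding eq
  proof (intro holomorphic_intros)
    fix z assume "z \<in> {z. u - 1 / a < Re z}"
    then have "a * (u - 1 / a) < a * Re z" using a by (intro mult_strict_left_mono) auto
    then have "Re (1 - complex_of_real a * (complex_of_real u - z)) > 0" using a by (simp add: algebra_simps)
    then show "1 - complex_of_real a * (complex_of_real u - z) \<notin> \<int>\<^sub>\<le>\<^sub>0" by (rule pos_Re_not_nonpos_Ints)
  qed
qed

lemma \<delta>_left: "k \<in> {1..N} \<Longrightarrow> \<nu> k - 1 / a < - \<delta>"
  using \<nu>_bound[of k] by (simp add: \<delta>_def)

text \<open>The integrand of \<open>M_mart\<close> in the variable z = i w, where -(i x + w)^2 = (x
  - z)^2. In this form the contour can leave the imaginary axis.\<close>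

definition kernel :: "nat \<Rightarrow> real \<Rightarrow> real \<Rightarrow> complex \<Rightarrow> complex" where
  "kernel k s x z = of_real (1 / sqrt (2 * pi * s)) * exp ((of_real x - z)\<^sup>2 / of_real (2 * s)) * Phi N \<nu> (\<nu> k) a z"

lemma kernel_holomorphic: "kernel k s x holomorphic_on {z. \<nu> k - 1 / a < Re z}"
proof -
  have "kernel k s x = (\<lambda>z. of_real (1 / sqrt (2 * pi * s)) * exp ((of_real x - z)\<^sup>2 * inverse (of_real (2 * s))) * Phi N \<nu> (\<nu> k) a z)"
    by (rule ext) (simp only: kernel_def divide_inverse)
  then show ?thesis by (simp only:) (intro holomorphic_intros Phi_holomorphic)
qed

lemma norm_exp_square: "norm (exp ((of_real x - z)\<^sup>2 / of_real (2 * s))) = exp (((x - Re z)\<^sup>2 - (Im z)\<^sup>2) / (2 * s))"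
proof -
  have "Re ((of_real x - z)\<^sup>2 / of_real (2 * s)) = ((x - Re z)\<^sup>2 - (Im z)\<^sup>2) / (2 * s)"
    by (simp only: Re_divide_of_real) (simp add: power2_eq_square)
  then show ?thesis by (simp add: norm_exp_eq_Re)
qed

lemma kernel_bound:
  assumes k: "k \<in> {1..N}" and s: "s > 0"
  shows "\<exists>C\<ge>0. \<forall>z. \<bar>Re z\<bar> \<le> \<delta> \<longrightarrow> norm (kernel k s x z) \<le> C * exp (- (1 / (4 * s)) * (Im z)\<^sup>2)"
proof -
  obtain C \<kappa> where C: "C \<ge> 0" "\<kappa> \<ge> 0"
    "\<And>z. \<bar>Re z\<bar> \<le> \<delta> \<Longrightarrow> norm (Phi N \<nu> (\<nu> k) a z) \<le> C * exp (\<kappa> * \<bar>Im z\<bar>)"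
    using Phi_bound[OF k] by blast
  let ?D = "1 / sqrt (2 * pi * s) * (C * exp ((\<bar>x\<bar> + \<delta>)\<^sup>2 / (2 * s) + s * \<kappa>\<^sup>2))"
  have "norm (kernel k s x z) \<le> ?D * exp (- (1 / (4 * s)) * (Im z)\<^sup>2)" if z: "\<bar>Re z\<bar> \<le> \<delta>" for z
  proof -
    have "(x - Re z)\<^sup>2 \<le> (\<bar>x\<bar> + \<delta>)\<^sup>2" using z by (intro abs_le_square_iff[THEN iffD1]) auto
    then have "((x - Re z)\<^sup>2 - (Im z)\<^sup>2) / (2 * s) \<le> ((\<bar>x\<bar> + \<delta>)\<^sup>2 - (Im z)\<^sup>2) / (2 * s)"
      using s by (intro divide_right_mono) auto
    \<comment> \<open>Half of the Gaussian absorbs the growth of \<open>Phi\<close>, which is why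
      the remaining rate is 1 / (4 s).\<close>
    moreover have "\<kappa> * \<bar>Im z\<bar> \<le> (Im z)\<^sup>2 / (4 * s) + s * \<kappa>\<^sup>2"
    proof -
      have "0 \<le> (\<bar>Im z\<bar> - 2 * s * \<kappa>)\<^sup>2 / (4 * s)" using s by simp
      also have "\<dots> = (Im z)\<^sup>2 / (4 * s) + s * \<kappa>\<^sup>2 - \<kappa> * \<bar>Im z\<bar>"
        using s by (simp add: power2_diff power_mult_distrib power2_abs field_simps) (simp add: power2_eq_square)
      finally show ?thesis by simp
    qed
    moreover have "(Im z)\<^sup>2 / (2 * s) = 2 * ((Im z)\<^sup>2 / (4 * s))" "- (1 / (4 * s)) * (Im z)\<^sup>2 = - ((Im z)\<^sup>2 / (4 * s))"
      by simp_all
    ultimately have le: "((x - Re z)\<^sup>2 - (Im z)\<^sup>2) / (2 * s) + \<kappa> * \<bar>Im z\<bar>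
        \<le> ((\<bar>x\<bar> + \<delta>)\<^sup>2 / (2 * s) + s * \<kappa>\<^sup>2) + - (1 / (4 * s)) * (Im z)\<^sup>2"
      unfolding diff_divide_distrib by linarith
    have c: "norm (complex_of_real (1 / sqrt (2 * pi * s))) = 1 / sqrt (2 * pi * s)"
      using s by (simp only: norm_of_real) simp
    have "norm (kernel k s x z) = 1 / sqrt (2 * pi * s) * (exp (((x - Re z)\<^sup>2 - (Im z)\<^sup>2) / (2 * s)) * norm (Phi N \<nu> (\<nu> k) a z))"
      unfolding kernel_def norm_mult norm_exp_square c by (simp only: mult.assoc)
    also have "\<dots> \<le> 1 / sqrt (2 * pi * s) * (exp (((x - Re z)\<^sup>2 - (Im z)\<^sup>2) / (2 * s)) * (C * exp (\<kappa> * \<bar>Im z\<bar>)))"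
      using s C(3)[OF z] by (intro mult_left_mono) auto
    also have "\<dots> = 1 / sqrt (2 * pi * s) * (C * exp (((x - Re z)\<^sup>2 - (Im z)\<^sup>2) / (2 * s) + \<kappa> * \<bar>Im z\<bar>))"
      by (simp add: exp_add mult_ac)
    also have "\<dots> \<le> 1 / sqrt (2 * pi * s) * (C * exp (((\<bar>x\<bar> + \<delta>)\<^sup>2 / (2 * s) + s * \<kappa>\<^sup>2) + - (1 / (4 * s)) * (Im z)\<^sup>2))"
      using s C(1) le by (intro mult_left_mono) auto
    also have "\<dots> = ?D * exp (- (1 / (4 * s)) * (Im z)\<^sup>2)" unfolding exp_add by (simp only: mult_ac)
    finally show ?thesis .
  qed
  moreover have "?D \<ge> 0" using C(1) s by simp
  ultimately show ?thesis by blast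
qed

lemma kernel_line_measurable:
  assumes k: "k \<in> {1..N}" and \<sigma>: "\<bar>\<sigma>\<bar> \<le> \<delta>"
  shows "(\<lambda>y. Phi N \<nu> (\<nu> k) a (Complex \<sigma> y)) \<in> borel_measurable borel"
    and "(\<lambda>y. kernel k s x (Complex \<sigma> y)) \<in> borel_measurable borel"
proof -
  have sub: "range (Complex \<sigma>) \<subseteq> {z. \<nu> k - 1 / a < Re z}" using \<delta>_left[OF k] \<sigma> by auto
  have c: "continuous_on UNIV (Complex \<sigma>)" unfolding Complex_eq by (intro continuous_intros)
  show "(\<lambda>y. Phi N \<nu> (\<nu> k) a (Complex \<sigma> y)) \<in> borel_measurable borel"
    using continuous_on_compose2[OF holomorphic_on_imp_continuous_on[OF Phi_holomorphic] c sub]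
    by (rule borel_measurable_continuous_onI)
  show "(\<lambda>y. kernel k s x (Complex \<sigma> y)) \<in> borel_measurable borel"
    using continuous_on_compose2[OF holomorphic_on_imp_continuous_on[OF kernel_holomorphic] c sub]
    by (rule borel_measurable_continuous_onI)
qed

lemma kernel_line_integrable:
  assumes k: "k \<in> {1..N}" and s: "s > 0" and \<sigma>: "\<bar>\<sigma>\<bar> \<le> \<delta>"
  shows "integrable lborel (\<lambda>y. kernel k s x (Complex \<sigma> y))"
proof -
  obtain C where C: "C \<ge> 0" "\<And>z. \<bar>Re z\<bar> \<le> \<delta> \<Longrightarrow> norm (kernel k s x z) \<le> C * exp (- (1 / (4 * s)) * (Im z)\<^sup>2)"
    using kernel_bound[OF k s] by blast
  show ?thesis
  proof (rule Bochner_Integration.integrable_bound)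
    show "integrable lborel (\<lambda>y. C * exp (- (1 / (4 * s)) * y\<^sup>2))"
      using gaussian_integrable[of "1 / (4 * s)"] s by simp
    show "(\<lambda>y. kernel k s x (Complex \<sigma> y)) \<in> borel_measurable lborel"
      using kernel_line_measurable(2)[OF k \<sigma>] by simp
    show "AE y in lborel. norm (kernel k s x (Complex \<sigma> y)) \<le> norm (C * exp (- (1 / (4 * s)) * y\<^sup>2))"
      using C(1) C(2)[of "Complex \<sigma> _"] \<sigma> by (intro AE_I2) (auto simp: abs_mult)
  qed
qed

text \<open>Any vertical line of the closed strip may serve as contour: the edges \<delta> and
  -\<delta> will be paired with half lines, the imaginary axis with the martingale property.\<close>

lemma M_mart_shift:
  assumes k: "k \<in> {1..N}" and s: "s > 0" and \<sigma>: "\<bar>\<sigma>\<bar> \<le> \<delta>"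
  shows "M_mart N \<nu> (\<nu> k) a s x = (\<integral>y. kernel k s x (Complex \<sigma> y) \<partial>lborel)"
proof -
  obtain C where C: "C \<ge> 0" "\<And>z. \<bar>Re z\<bar> \<le> \<delta> \<Longrightarrow> norm (kernel k s x z) \<le> C * exp (- (1 / (4 * s)) * (Im z)\<^sup>2)"
    using kernel_bound[OF k s] by blast
  have sq: "- (\<i> * complex_of_real x + complex_of_real w)\<^sup>2 = (of_real x - Complex 0 w)\<^sup>2" for w
    by (simp add: Complex_eq power2_eq_square algebra_simps)
  have "\<i> * complex_of_real w = Complex 0 w" for w by (simp add: Complex_eq)
  then have "M_mart N \<nu> (\<nu> k) a s x = (\<integral>y. kernel k s x (Complex 0 y) \<partial>lborel)"
    unfolding M_mart_def kernel_def sq by (simp only:)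
  also have "\<dots> = (\<integral>y. kernel k s x (Complex \<sigma> y) \<partial>lborel)"
  proof (cases "\<sigma> \<ge> 0")
    case True
    then show ?thesis
      using \<delta>_left[OF k] \<delta>_pos \<sigma> s C
      by (intro strip_shift[OF _ _ _ _ kernel_holomorphic, symmetric, where \<beta> = "1 / (4 * s)" and C = C]) auto
  next
    case False
    then show ?thesis
      using \<delta>_left[OF k] \<delta>_pos \<sigma> s C
      by (intro strip_shift[OF _ _ _ _ kernel_holomorphic, where \<beta> = "1 / (4 * s)" and C = C]) auto
  qed
  finally show ?thesis .
qed

text \<open>The squares of \<open>x\<close> in the two exponents cancel and leave an exponential
  linear in \<open>x\<close>, whose half-line integral produces the factor s / (z - v).\<close>

lemma density_kernel:
  assumes s: "s > 0"
  shows "of_real (normal_density v (sqrt s) x) * kernel k s x z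
    = exp (- ((z - of_real v) / of_real s) * of_real x) * (of_real (normal_density v (sqrt s) 0) * kernel k s 0 z)"
proof -
  have nd: "complex_of_real (normal_density v (sqrt s) x) = of_real (1 / sqrt (2 * pi * s)) * exp (- (of_real x - of_real v)\<^sup>2 / of_real (2 * s))" for x
    unfolding normal_density_sqrt[OF s] of_real_mult exp_of_real[symmetric] by simp
  have "- (of_real x - of_real v)\<^sup>2 / of_real (2 * s) + (of_real x - z)\<^sup>2 / of_real (2 * s)
      = - ((z - of_real v) / of_real s) * of_real x + (- (of_real 0 - of_real v)\<^sup>2 / of_real (2 * s) + (of_real 0 - z)\<^sup>2 / of_real (2 * s))"
    using s by (simp add: field_simps power2_eq_square)
  from arg_cong[OF this, of exp] show ?thesis
    unfolding nd kernel_def exp_add by (simp only: mult_ac)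
qed

text \<open>On the right edge Re (z - v) > 0, so the exponential of \<open>density_kernel\<close>
  decays towards +\<infinity>.\<close>

lemma density_M_mart_right:
  assumes k: "k \<in> {1..N}" and s: "s > 0" and v: "v < \<delta>"
  shows "integrable lborel (\<lambda>x. indicator {c..} x *\<^sub>R (of_real (normal_density v (sqrt s) x) * M_mart N \<nu> (\<nu> k) a s x))"
    and "(\<integral>x. indicator {c..} x *\<^sub>R (of_real (normal_density v (sqrt s) x) * M_mart N \<nu> (\<nu> k) a s x) \<partial>lborel)
      = (\<integral>y. exp (- ((Complex \<delta> y - of_real v) / of_real s) * of_real c) / ((Complex \<delta> y - of_real v) / of_real s)
            * (of_real (normal_density v (sqrt s) 0) * kernel k s 0 (Complex \<delta> y)) \<partial>lborel)"
    and "integrable lborel (\<lambda>y. exp (- ((Complex \<delta> y - of_real v) / of_real s) * of_real c) / ((Complex \<delta> y - of_real v) / of_real s)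
            * (of_real (normal_density v (sqrt s) 0) * kernel k s 0 (Complex \<delta> y)))"
proof -
  have \<sigma>: "\<bar>\<delta>\<bar> \<le> \<delta>" using \<delta>_pos by simp
  let ?L = "\<lambda>y. of_real (normal_density v (sqrt s) 0) * kernel k s 0 (Complex \<delta> y)"
  have arg: "(Complex \<delta> y - of_real v) / of_real s = of_real ((\<delta> - v) / s) + \<i> * of_real (1 / s * y)" for y
    using s by (simp add: Complex_eq field_simps)
  have pM: "of_real (normal_density v (sqrt s) x) * M_mart N \<nu> (\<nu> k) a s x
      = (\<integral>y. exp (- (of_real ((\<delta> - v) / s) + \<i> * of_real (1 / s * y)) * of_real x) * ?L y \<partial>lborel)" for x
    unfolding M_mart_shift[OF k s \<sigma>] arg[symmetric] density_kernel[OF s, symmetric] by simp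
  have L: "integrable lborel ?L" using kernel_line_integrable[OF k s \<sigma>] by simp
  have g: "(\<delta> - v) / s > 0" using v s by simp
  show "integrable lborel (\<lambda>x. indicator {c..} x *\<^sub>R (of_real (normal_density v (sqrt s) x) * M_mart N \<nu> (\<nu> k) a s x))"
    unfolding pM by (rule half_line_transform(1)[OF g L])
  show "(\<integral>x. indicator {c..} x *\<^sub>R (of_real (normal_density v (sqrt s) x) * M_mart N \<nu> (\<nu> k) a s x) \<partial>lborel)
      = (\<integral>y. exp (- ((Complex \<delta> y - of_real v) / of_real s) * of_real c) / ((Complex \<delta> y - of_real v) / of_real s) * ?L y \<partial>lborel)"
    unfolding pM arg by (rule half_line_transform(2)[OF g L])
  show "integrable lborel (\<lambda>y. exp (- ((Complex \<delta> y - of_real v) / of_real s) * of_real c) / ((Complex \<delta> y - of_real v) / of_real s) * ?L y)"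
    unfolding arg by (rule half_line_transform(3)[OF g L])
qed

text \<open>On the left edge Re (z - v) < 0, so the exponential decays towards -\<infinity>. After
  the reflection x -> -x the denominator is -(z - v) / s, which accounts for the minus sign.\<close>

lemma density_M_mart_left:
  assumes k: "k \<in> {1..N}" and s: "s > 0" and v: "- \<delta> < v"
  shows "integrable lborel (\<lambda>x. indicator {..0} x *\<^sub>R (of_real (normal_density v (sqrt s) x) * M_mart N \<nu> (\<nu> k) a s x))"
    and "(\<integral>x. indicator {..0} x *\<^sub>R (of_real (normal_density v (sqrt s) x) * M_mart N \<nu> (\<nu> k) a s x) \<partial>lborel)
      = - (\<integral>y. 1 / ((Complex (- \<delta>) y - of_real v) / of_real s)
            * (of_real (normal_density v (sqrt s) 0) * kernel k s 0 (Complex (- \<delta>) y)) \<partial>lborel)"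
proof -
  have \<sigma>: "\<bar>- \<delta>\<bar> \<le> \<delta>" using \<delta>_pos by simp
  let ?L = "\<lambda>y. of_real (normal_density v (sqrt s) 0) * kernel k s 0 (Complex (- \<delta>) y)"
  let ?g = "\<lambda>x. of_real (normal_density v (sqrt s) x) * M_mart N \<nu> (\<nu> k) a s x"
  have arg: "- ((Complex (- \<delta>) y - of_real v) / of_real s) = of_real ((\<delta> + v) / s) + \<i> * of_real (- (1 / s) * y)" for y
    using s by (simp add: Complex_eq field_simps)
  have pM: "?g (- x) = (\<integral>y. exp (- (of_real ((\<delta> + v) / s) + \<i> * of_real (- (1 / s) * y)) * of_real x) * ?L y \<partial>lborel)" for x
  proof -
    have "- (of_real ((\<delta> + v) / s) + \<i> * of_real (- (1 / s) * y)) * of_real x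
        = - ((Complex (- \<delta>) y - of_real v) / of_real s) * of_real (- x)" for y
      unfolding arg[symmetric] by simp
    then show ?thesis
      unfolding M_mart_shift[OF k s \<sigma>] by (simp only: density_kernel[OF s, symmetric]) simp
  qed
  have L: "integrable lborel ?L" using kernel_line_integrable[OF k s \<sigma>] by simp
  have g: "(\<delta> + v) / s > 0" using v s by simp
  have ind: "indicator {0..} x *\<^sub>R ?g (- x) = indicator {..0} (0 + (- 1) * x) *\<^sub>R ?g (0 + (- 1) * x)" for x
    by (simp add: indicator_def)
  have int: "integrable lborel (\<lambda>x. indicator {0..} x *\<^sub>R ?g (- x))"
    unfolding pM by (rule half_line_transform(1)[OF g L])
  then show "integrable lborel (\<lambda>x. indicator {..0} x *\<^sub>R ?g x)"
    unfolding ind by (subst (asm) lborel_integrable_real_affine_iff) auto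
  have "(\<integral>x. indicator {..0} x *\<^sub>R ?g x \<partial>lborel) = \<bar>- 1\<bar> *\<^sub>R (\<integral>x. indicator {..0} (0 + (- 1) * x) *\<^sub>R ?g (0 + (- 1) * x) \<partial>lborel)"
    by (rule lborel_integral_real_affine) simp
  also have "\<dots> = (\<integral>x. indicator {0..} x *\<^sub>R ?g (- x) \<partial>lborel)"
    unfolding ind by simp
  also have "\<dots> = (\<integral>y. exp (- (of_real ((\<delta> + v) / s) + \<i> * of_real (- (1 / s) * y)) * of_real 0)
      / (of_real ((\<delta> + v) / s) + \<i> * of_real (- (1 / s) * y)) * ?L y \<partial>lborel)"
    unfolding pM by (rule half_line_transform(2)[OF g L])
  also have "\<dots> = (\<integral>y. - (1 / ((Complex (- \<delta>) y - of_real v) / of_real s) * ?L y) \<partial>lborel)"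
    unfolding arg[symmetric] by simp
  finally show "(\<integral>x. indicator {..0} x *\<^sub>R ?g x \<partial>lborel) = - (\<integral>y. 1 / ((Complex (- \<delta>) y - of_real v) / of_real s) * ?L y \<partial>lborel)"
    by simp
qed

text \<open>\<open>Phi\<close> interpolates as a Lagrange polynomial does. For j \<noteq> k the
  factor with r = \<nu>_j is divided by Gamma 0 = 0 and hence vanishes; for j = k each quotient is a
  nonzero number over itself, as 0 < |a (r - \<nu>_k)| < 1.\<close>

lemma Phi_at_spectrum:
  assumes "j \<in> {1..N}" "k \<in> {1..N}"
  shows "Phi N \<nu> (\<nu> k) a (of_real (\<nu> j)) = (if j = k then 1 else 0)"
proof (cases "j = k")
  case True
  have "Gamma (complex_of_real (a * (r - \<nu> k))) \<noteq> 0" if "r \<in> \<nu> ` {1..N} - {\<nu> k}" for r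
  proof -
    have "\<bar>r\<bar> < \<delta>" "\<bar>\<nu> k\<bar> < \<delta>" "r \<noteq> \<nu> k" using that \<nu>_bound assms by auto
    then have "a * \<bar>r - \<nu> k\<bar> < a * (2 * \<delta>)" using a by (intro mult_strict_left_mono) auto
    then have "a * \<bar>r - \<nu> k\<bar> < 1" using a\<delta> by linarith
    then have lt: "\<bar>a * (r - \<nu> k)\<bar> < 1" and nz: "a * (r - \<nu> k) \<noteq> 0"
      using a \<open>r \<noteq> \<nu> k\<close> by (simp_all add: abs_mult)
    show ?thesis
    proof
      assume "Gamma (complex_of_real (a * (r - \<nu> k))) = 0"
      then have "complex_of_real (a * (r - \<nu> k)) \<in> \<int>\<^sub>\<le>\<^sub>0" by (simp only: Gamma_eq_zero_iff)
      then obtain n where "complex_of_real (a * (r - \<nu> k)) = of_int n" by (elim nonpos_Ints_cases)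
      from arg_cong[OF this, of Re] have n: "a * (r - \<nu> k) = of_int n" by simp
      with lt have "of_int \<bar>n\<bar> < (1 :: real)" by simp
      then have "n = 0" by linarith
      with n nz show False by simp
    qed
  qed
  then have "(\<Prod>r\<in>\<nu> ` {1..N} - {\<nu> k}. Gamma (complex_of_real (a * (r - \<nu> k))) / Gamma (of_real a * (of_real r - of_real (\<nu> k)))) = 1"
    by (intro prod.neutral) (auto simp flip: of_real_diff of_real_mult)
  then show ?thesis using True by (simp add: Phi_def)
next
  case False
  then have mem: "\<nu> j \<in> \<nu> ` {1..N} - {\<nu> k}" using inj_on_eq_iff[OF inj assms] assms(1) by blast
  have 0: "Gamma (complex_of_real (a * (\<nu> j - \<nu> k))) / Gamma (of_real a * (of_real (\<nu> j) - of_real (\<nu> j))) = 0" by simp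
  have "(\<Prod>r\<in>\<nu> ` {1..N} - {\<nu> k}. Gamma (complex_of_real (a * (r - \<nu> k))) / Gamma (of_real a * (of_real r - of_real (\<nu> j)))) = 0"
  proof (rule prod_zero)
    show "\<exists>r\<in>\<nu> ` {1..N} - {\<nu> k}. Gamma (complex_of_real (a * (r - \<nu> k))) / Gamma (of_real a * (of_real r - of_real (\<nu> j))) = 0"
      using 0 mem by (rule bexI[where x = "\<nu> j"])
  qed simp
  then show ?thesis using False by (simp add: Phi_def)
qed

text \<open>The two half-line integrals are integrals of one meromorphic function over the two edges
  of the strip, with opposite signs. Together they give the residue at \<nu>_j, which is
  \<open>Phi\<close> at \<nu>_j.\<close>

lemma density_M_mart:
  assumes j: "j \<in> {1..N}" and k: "k \<in> {1..N}" and s: "s > 0"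
  shows "integrable lborel (\<lambda>x. of_real (normal_density (\<nu> j) (sqrt s) x) * M_mart N \<nu> (\<nu> k) a s x)"
    and "(\<integral>x. of_real (normal_density (\<nu> j) (sqrt s) x) * M_mart N \<nu> (\<nu> k) a s x \<partial>lborel) = (if j = k then 1 else 0)"
proof -
  let ?g = "\<lambda>x. of_real (normal_density (\<nu> j) (sqrt s) x) * M_mart N \<nu> (\<nu> k) a s x"
  let ?n = "complex_of_real (normal_density (\<nu> j) (sqrt s) 0)"
  have v: "\<nu> j < \<delta>" "- \<delta> < \<nu> j" using \<nu>_bound[OF j] by auto
  note R = density_M_mart_right[OF k s v(1), of 0] and L = density_M_mart_left[OF k s v(2)]
  \<comment> \<open>The half lines overlap in the point 0, a null set.\<close>
  let ?h = "\<lambda>x. indicator {0..} x *\<^sub>R ?g x + indicator {..0} x *\<^sub>R ?g x"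
  have AE: "AE x in lborel. ?h x = ?g x"
    using AE_lborel_singleton[of 0] by eventually_elim (auto simp: indicator_def)
  have meas: "?g \<in> borel_measurable lborel"
  proof -
    have "?g = (\<lambda>x. indicator {0..} x *\<^sub>R ?g x + indicator {..<0} x *\<^sub>R (indicator {..0} x *\<^sub>R ?g x))"
      by (auto simp: fun_eq_iff indicator_def)
    also have "\<dots> \<in> borel_measurable lborel"
      using borel_measurable_integrable[OF R(1)] borel_measurable_integrable[OF L(1)] by measurable
    finally show ?thesis .
  qed
  have h: "integrable lborel ?h" using R(1) L(1) by (rule Bochner_Integration.integrable_add)
  show "integrable lborel ?g"
    using integrable_cong_AE[OF borel_measurable_integrable[OF h] meas AE] h by blast
  have "(\<integral>x. ?g x \<partial>lborel) = (\<integral>x. ?h x \<partial>lborel)"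
    using AE by (intro integral_cong_AE meas borel_measurable_integrable[OF h]) auto
  also have "\<dots> = (\<integral>y. (of_real s * (?n * kernel k s 0 (Complex \<delta> y))) / (Complex \<delta> y - of_real (\<nu> j)) \<partial>lborel)
      - (\<integral>y. (of_real s * (?n * kernel k s 0 (Complex (- \<delta>) y))) / (Complex (- \<delta>) y - of_real (\<nu> j)) \<partial>lborel)"
    unfolding Bochner_Integration.integral_add[OF R(1) L(1)] R(2) L(2) by (simp add: mult_ac)
  also have "\<dots> = 2 * of_real pi * (of_real s * (?n * kernel k s 0 (of_real (\<nu> j))))"
  proof -
    obtain C where C: "C \<ge> 0" "\<And>z. \<bar>Re z\<bar> \<le> \<delta> \<Longrightarrow> norm (kernel k s 0 z) \<le> C * exp (- (1 / (4 * s)) * (Im z)\<^sup>2)"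
      using kernel_bound[OF k s] by blast
    show ?thesis
    proof (rule strip_residue[where b = "\<nu> k - 1 / a" and \<beta> = "1 / (4 * s)" and C = "norm (of_real s * ?n) * C"])
      show "(\<lambda>z. of_real s * (?n * kernel k s 0 z)) holomorphic_on {z. \<nu> k - 1 / a < Re z}"
        by (intro holomorphic_intros kernel_holomorphic)
      fix z assume "- \<delta> \<le> Re z" "Re z \<le> \<delta>"
      then have "norm (kernel k s 0 z) \<le> C * exp (- (1 / (4 * s)) * (Im z)\<^sup>2)" by (intro C(2)) auto
      then have "norm (of_real s * ?n) * norm (kernel k s 0 z) \<le> norm (of_real s * ?n) * (C * exp (- (1 / (4 * s)) * (Im z)\<^sup>2))"
        by (rule mult_left_mono) simp
      then show "norm (of_real s * (?n * kernel k s 0 z)) \<le> norm (of_real s * ?n) * C * exp (- (1 / (4 * s)) * (Im z)\<^sup>2)"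
        by (simp add: norm_mult mult_ac)
    qed (use v \<delta>_left[OF k] s C(1) in auto)
  qed
  \<comment> \<open>At z = \<nu>_j the two Gaussians cancel, and their normalisations give 1 / (2
    \<pi> s) against the factor 2 \<pi> s.\<close>
  also have "\<dots> = Phi N \<nu> (\<nu> k) a (of_real (\<nu> j))"
  proof -
    have "?n * kernel k s 0 (of_real (\<nu> j))
        = of_real (1 / sqrt (2 * pi * s) * (1 / sqrt (2 * pi * s))) * (exp (- (of_real (\<nu> j))\<^sup>2 / of_real (2 * s) + (of_real (\<nu> j))\<^sup>2 / of_real (2 * s)) * Phi N \<nu> (\<nu> k) a (of_real (\<nu> j)))"
    proof -
      have 1: "complex_of_real (exp (- (0 - \<nu> j)\<^sup>2 / (2 * s))) = exp (- (of_real (\<nu> j))\<^sup>2 / of_real (2 * s))"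
        by (simp add: exp_of_real[symmetric])
      have 2: "(of_real 0 - complex_of_real (\<nu> j))\<^sup>2 = (of_real (\<nu> j))\<^sup>2" by simp
      show ?thesis
        unfolding kernel_def normal_density_sqrt[OF s] exp_add of_real_mult[of "1 / sqrt (2 * pi * s)"] 1 2
        by (simp only: mult_ac)
    qed
    also have "1 / sqrt (2 * pi * s) * (1 / sqrt (2 * pi * s)) = 1 / (2 * pi * s)" using s by simp
    also have "- (complex_of_real (\<nu> j))\<^sup>2 / of_real (2 * s) + (of_real (\<nu> j))\<^sup>2 / of_real (2 * s) = 0" by simp
    finally show ?thesis using s by simp
  qed
  finally show "(\<integral>x. ?g x \<partial>lborel) = (if j = k then 1 else 0)"
    using Phi_at_spectrum[OF j k] by simp
qed

lemma M_mart_measurable: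
  assumes k: "k \<in> {1..N}" and s: "s > 0"
  shows "M_mart N \<nu> (\<nu> k) a s \<in> borel_measurable borel"
proof -
  have [measurable]: "(\<lambda>y. Phi N \<nu> (\<nu> k) a (Complex 0 y)) \<in> borel_measurable borel"
    using kernel_line_measurable(1)[OF k, of 0] \<delta>_pos by simp
  have [measurable]: "(\<lambda>y. Complex 0 y) \<in> borel_measurable borel"
    by (intro borel_measurable_continuous_onI) (simp add: Complex_eq continuous_intros)
  have "(\<lambda>x. \<integral>y. kernel k s x (Complex 0 y) \<partial>lborel) \<in> borel_measurable borel"
    unfolding kernel_def by measurable
  moreover have "M_mart N \<nu> (\<nu> k) a s = (\<lambda>x. \<integral>y. kernel k s x (Complex 0 y) \<partial>lborel)"
    using M_mart_shift[OF k s, of 0] \<delta>_pos by (intro ext) simp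
  ultimately show ?thesis by simp
qed

text \<open>\<open>Phi\<close> has real parameters, so conjugating the integrand on the imaginary
  axis amounts to the reflection y -> -y.\<close>

lemma M_mart_real:
  assumes k: "k \<in> {1..N}" and s: "s > 0"
  shows "cnj (M_mart N \<nu> (\<nu> k) a s x) = M_mart N \<nu> (\<nu> k) a s x"
proof -
  have Phi: "cnj (Phi N \<nu> (\<nu> k) a z) = Phi N \<nu> (\<nu> k) a (cnj z)" for z
    by (simp add: Phi_def cnj_Gamma)
  have "cnj (kernel k s x (Complex 0 y)) = kernel k s x (Complex 0 (0 + (- 1) * y))" for y
    by (simp add: kernel_def exp_cnj Phi complex_cnj)
  then have "(\<integral>y. cnj (kernel k s x (Complex 0 y)) \<partial>lborel) = (\<integral>y. kernel k s x (Complex 0 (0 + (- 1) * y)) \<partial>lborel)"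
    by (simp only:)
  moreover have "(\<integral>y. cnj (kernel k s x (Complex 0 y)) \<partial>lborel) = cnj (\<integral>y. kernel k s x (Complex 0 y) \<partial>lborel)"
    by (rule integral_bounded_linear[OF bounded_linear_cnj kernel_line_integrable[OF k s]]) (use \<delta>_pos in simp)
  ultimately have "cnj (\<integral>y. kernel k s x (Complex 0 y) \<partial>lborel) = (\<integral>y. kernel k s x (Complex 0 (0 + (- 1) * y)) \<partial>lborel)"
    by simp
  also have "\<dots> = (\<integral>y. kernel k s x (Complex 0 y) \<partial>lborel)"
    using lborel_integral_real_affine[of "- 1" "\<lambda>y. kernel k s x (Complex 0 y)" 0] by simp
  finally show ?thesis using M_mart_shift[OF k s, of 0 x] \<delta>_pos by simp
qed

text \<open>For fixed z the function exp ((x - z)^2 / (2 s)) / sqrt s solves the backward heat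
  equation in (s, x), and \<open>M_mart\<close> is a superposition of such functions.\<close>

lemma M_mart_martingale:
  assumes k: "k \<in> {1..N}" and s: "0 < s" "s < S"
  shows "(\<integral>r. of_real (normal_density 0 (sqrt (S - s)) r) * M_mart N \<nu> (\<nu> k) a S (x + r) \<partial>lborel) = M_mart N \<nu> (\<nu> k) a s x"
proof -
  have S: "S > 0" using s by simp
  define q where "q = S - s"
  have q: "q > 0" "S = s + q" using s by (simp_all add: q_def)
  \<comment> \<open>The net quadratic rate 1 / q - 1 / S. It is positive because q = S - s < S: the
    Gaussian of the increment dominates the growth of the kernel.\<close>
  define \<alpha> where "\<alpha> = s / (q * S)"
  have \<alpha>: "\<alpha> > 0" using s q S by (simp add: \<alpha>_def)
  have al: "\<alpha> = 1 / q - 1 / S" using q s S by (simp add: \<alpha>_def field_simps)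
  let ?z = "\<lambda>w. Complex 0 w"
  let ?F = "\<lambda>(r, w). of_real (normal_density 0 (sqrt q) r) * kernel k S (x + r) (?z w)"
  let ?c = "1 / sqrt (2 * pi * q) * (1 / sqrt (2 * pi * S))"
  have F: "of_real (normal_density 0 (sqrt q) r) * kernel k S (x + r) z
      = of_real ?c * exp ((of_real x - z)\<^sup>2 / of_real (2 * S)) * Phi N \<nu> (\<nu> k) a z
        * exp ((of_real x - z) / of_real S * of_real r - of_real (\<alpha> * r\<^sup>2 / 2))" for r z
  proof -
    have "- (of_real r)\<^sup>2 / of_real (2 * q) + (of_real (x + r) - z)\<^sup>2 / of_real (2 * S)
        = (of_real x - z)\<^sup>2 / of_real (2 * S) + ((of_real x - z) / of_real S * of_real r - of_real (\<alpha> * r\<^sup>2 / 2))"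
      using S q(1) unfolding al by (simp add: field_simps power2_eq_square)
    from arg_cong[OF this, of exp] show ?thesis
      unfolding kernel_def normal_density_sqrt[OF q(1)] exp_add
      by (simp add: exp_of_real[symmetric] mult_ac)
  qed
  have \<sigma>: "\<bar>0\<bar> \<le> \<delta>" using \<delta>_pos by simp
  have [measurable]: "(\<lambda>y. Phi N \<nu> (\<nu> k) a (Complex 0 y)) \<in> borel_measurable borel"
    using kernel_line_measurable(1)[OF k \<sigma>] .
  have [measurable]: "(\<lambda>y. Complex 0 y) \<in> borel_measurable borel"
    by (intro borel_measurable_continuous_onI) (simp add: Complex_eq continuous_intros)
  have Fm: "?F \<in> borel_measurable (lborel \<Otimes>\<^sub>M lborel)"
    unfolding kernel_def split_beta by measurable
  have int: "integrable (lborel \<Otimes>\<^sub>M lborel) ?F"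
  proof (rule Bochner_Integration.integrable_bound[OF _ Fm])
    have "integrable lborel (\<lambda>r. norm (exp (of_real (x / S) * of_real r - of_real (\<alpha> * r\<^sup>2 / 2)) :: complex))"
      by (intro integrable_norm gaussian_integral \<alpha>)
    moreover have "integrable lborel (\<lambda>w. norm (kernel k S x (?z w)))"
      by (intro integrable_norm kernel_line_integrable k S \<sigma>)
    ultimately show "integrable (lborel \<Otimes>\<^sub>M lborel) (\<lambda>(r, w). norm (exp (of_real (x / S) * of_real r - of_real (\<alpha> * r\<^sup>2 / 2)) :: complex)
        * (1 / sqrt (2 * pi * q) * norm (kernel k S x (?z w))))"
      by (intro lborel_pair.integrable_times) auto
    show "AE p in lborel \<Otimes>\<^sub>M lborel. norm (?F p) \<le> norm (case p of (r, w) \<Rightarrow> norm (exp (of_real (x / S) * of_real r - of_real (\<alpha> * r\<^sup>2 / 2)) :: complex)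
        * (1 / sqrt (2 * pi * q) * norm (kernel k S x (?z w))))"
    proof (rule AE_I2)
      fix p :: "real \<times> real"
      obtain r w where p: "p = (r, w)" by (cases p)
      have eq: "norm (?F (r, w)) = norm (exp (of_real (x / S) * of_real r - of_real (\<alpha> * r\<^sup>2 / 2)) :: complex)
        * (1 / sqrt (2 * pi * q) * norm (kernel k S x (?z w)))"
        using q(1) S unfolding prod.case F by (simp add: kernel_def norm_mult norm_divide norm_exp_eq_Re)
      show "norm (?F p) \<le> norm (case p of (r, w) \<Rightarrow> norm (exp (of_real (x / S) * of_real r - of_real (\<alpha> * r\<^sup>2 / 2)) :: complex)
        * (1 / sqrt (2 * pi * q) * norm (kernel k S x (?z w))))"
        unfolding p eq unfolding prod.case real_norm_def by (rule abs_ge_self)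
    qed
  qed
  have "(\<integral>r. of_real (normal_density 0 (sqrt q) r) * M_mart N \<nu> (\<nu> k) a S (x + r) \<partial>lborel)
      = (\<integral>r. (\<integral>w. ?F (r, w) \<partial>lborel) \<partial>lborel)"
    unfolding M_mart_shift[OF k S \<sigma>] by (simp only: prod.case integral_mult_right_zero)
  also have "\<dots> = (\<integral>w. (\<integral>r. ?F (r, w) \<partial>lborel) \<partial>lborel)"
    using lborel_pair.Fubini_integral[of "\<lambda>r w. ?F (r, w)"] int by simp
  also have "\<dots> = (\<integral>w. kernel k s x (?z w) \<partial>lborel)"
  proof (rule Bochner_Integration.integral_cong[OF refl])
    fix w
    let ?b = "(of_real x - ?z w) / of_real S"
    have "(\<integral>r. ?F (r, w) \<partial>lborel) = of_real ?c * exp ((of_real x - ?z w)\<^sup>2 / of_real (2 * S)) * Phi N \<nu> (\<nu> k) a (?z w)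
        * (of_real (sqrt (2 * pi / \<alpha>)) * exp (?b\<^sup>2 / of_real (2 * \<alpha>)))"
      unfolding prod.case F by (simp only: integral_mult_right_zero gaussian_integral(2)[OF \<alpha>])
    also have "\<dots> = of_real (?c * sqrt (2 * pi / \<alpha>)) * exp ((of_real x - ?z w)\<^sup>2 / of_real (2 * S) + ?b\<^sup>2 / of_real (2 * \<alpha>)) * Phi N \<nu> (\<nu> k) a (?z w)"
      unfolding exp_add of_real_mult by (simp only: mult_ac)
    also have "?c * sqrt (2 * pi / \<alpha>) = 1 / sqrt (2 * pi * s)"
    proof -
      have "?c * sqrt (2 * pi / \<alpha>) = sqrt (1 / (2 * pi * q) * (1 / (2 * pi * S)) * (2 * pi / \<alpha>))"
        by (simp add: real_sqrt_mult real_sqrt_divide)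
      also have "1 / (2 * pi * q) * (1 / (2 * pi * S)) * (2 * pi / \<alpha>) = 1 / (2 * pi * s)"
        using q(1) S s by (simp add: \<alpha>_def field_simps)
      finally show ?thesis by (simp add: real_sqrt_divide)
    qed
    also have "(of_real x - ?z w)\<^sup>2 / of_real (2 * S) + ?b\<^sup>2 / of_real (2 * \<alpha>) = (of_real x - ?z w)\<^sup>2 / of_real (2 * s)"
    proof -
      have "?b\<^sup>2 / of_real (2 * \<alpha>) = (of_real x - ?z w)\<^sup>2 * of_real (q / (2 * s * S))"
        using q(1) S s by (simp add: \<alpha>_def power_divide) (simp add: field_simps power2_eq_square)
      then have "(of_real x - ?z w)\<^sup>2 / of_real (2 * S) + ?b\<^sup>2 / of_real (2 * \<alpha>) = (of_real x - ?z w)\<^sup>2 * of_real (1 / (2 * S) + q / (2 * s * S))"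
        unfolding of_real_add distrib_left by simp
      also have "1 / (2 * S) + q / (2 * s * S) = (s + q) / (2 * s * S)" using s by (simp add: add_divide_distrib)
      also have "(s + q) / (2 * s * S) = 1 / (2 * s)" unfolding q(2)[symmetric] using S by simp
      also have "(of_real x - ?z w)\<^sup>2 * of_real (1 / (2 * s)) = (of_real x - ?z w)\<^sup>2 / of_real (2 * s)" by simp
      finally show ?thesis .
    qed
    finally show "(\<integral>r. ?F (r, w) \<partial>lborel) = kernel k s x (?z w)"
      by (simp add: kernel_def)
  qed
  also have "\<dots> = M_mart N \<nu> (\<nu> k) a s x" by (rule M_mart_shift[OF k s(1) \<sigma>, symmetric])
  finally show ?thesis unfolding q_def .
qed

end

section \<open>Shifting the spectral contours\<close>

lemma preserves_translate:
  assumes "finite I"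
  shows "preserves (lborel_pow I) (lborel_pow I) (\<lambda>x. \<lambda>i\<in>I. x i + c)"
proof -
  have "preserves (lborel_pow I) (lborel_pow I) (\<lambda>x i. if i \<in> I then 1 * x i + c else x i)"
    using assms by (intro preserves_shears) auto
  also have "?this \<longleftrightarrow> ?thesis"
    by (intro preserves_cong) (auto simp: space_PiM fun_eq_iff PiE_def extensional_def)
  finally show ?thesis .
qed

text \<open>
  Shifting all \<open>N\<close> contours by the same amount. The integrand is Gaussian along the orbits of the
  diagonal translations, so it suffices to integrate over these orbits first.
\<close>

lemma diagonal_contour_shift:
  fixes G :: "(nat \<Rightarrow> real) \<Rightarrow> complex" and t d X :: real
  assumes N: "N \<ge> 1" and t: "t > 0"
    and Gm: "G \<in> borel_measurable (lborel_pow {1..N})"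
    and equi: "\<And>k c. G (\<lambda>i\<in>{1..N}. k i + c) = exp (- \<i> * of_real (c * X)) * G k"
    and int: "integrable (lborel_pow {1..N}) (\<lambda>k. of_real (exp (- t * (\<Sum>j=1..N. (k j)\<^sup>2) / 2)) * G k)"
  shows "(\<integral>k. of_real (exp (- t * (\<Sum>j=1..N. (k j)\<^sup>2) / 2)) * G k \<partial>lborel_pow {1..N})
    = (\<integral>k. exp (- of_real t * (\<Sum>j=1..N. (of_real (k j) - \<i> * of_real d)\<^sup>2) / 2) * (of_real (exp (- d * X)) * G k) \<partial>lborel_pow {1..N})"
proof -
  let ?I = "{1..N}" and ?M = "lborel_pow {1..N}"
  interpret M: sigma_finite_measure ?M by (rule sigma_finite_lborel_pow) simp
  interpret P: pair_sigma_finite lborel ?M ..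
  define F where "F = (\<lambda>k. of_real (exp (- t * (\<Sum>j=1..N. (k j)\<^sup>2) / 2)) * G k)"
  define \<sigma> where "\<sigma> = (\<lambda>k. \<Sum>j=1..N. k j :: real)"
  define c0 where "c0 = t * N * d\<^sup>2 / 2 - d * X"
  \<comment> \<open>The shifted integrand is F (1 - \<phi> (\<sigma>)), so the claim becomes that F
    \<phi> (\<sigma>) integrates to 0.\<close>
  define \<phi> where "\<phi> = (\<lambda>s::real. 1 - exp (\<i> * of_real (t * d * s) + of_real c0))"
  \<comment> \<open>The translations form a noncompact group, so integration over an orbit is
    introduced by inserting 1 as the integral of g (\<sigma> / N - c) over c.\<close>
  define g where "g = (\<lambda>u::real. std_normal_density u)"
  let ?T = "\<lambda>c k. \<lambda>i\<in>?I. k i + c :: real"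
  have N0: "real N > 0" using N by simp
  have [measurable]: "G \<in> borel_measurable ?M" by (rule Gm)
  have \<sigma>m[measurable]: "\<sigma> \<in> borel_measurable ?M" unfolding \<sigma>_def by measurable
  have Fm[measurable]: "F \<in> borel_measurable ?M" unfolding F_def by measurable
  have gm[measurable]: "g \<in> borel_measurable borel" unfolding g_def by measurable
  have \<phi>m[measurable]: "\<phi> \<in> borel_measurable borel" unfolding \<phi>_def by measurable
  have Fi: "integrable ?M F" using int unfolding F_def .
  have \<phi>b: "norm (\<phi> s) \<le> 1 + exp c0" for s
    unfolding \<phi>_def by (rule order_trans[OF norm_triangle_ineq4]) (simp add: norm_exp_eq_Re)
  have F\<phi>: "integrable ?M (\<lambda>k. F k * \<phi> (\<sigma> k))"
  proof (rule Bochner_Integration.integrable_bound)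
    show "integrable ?M (\<lambda>k. norm (F k) * (1 + exp c0))" using Fi by (intro integrable_mult_left integrable_norm)
    show "AE k in ?M. norm (F k * \<phi> (\<sigma> k)) \<le> norm (norm (F k) * (1 + exp c0))"
      using \<phi>b by (intro AE_I2) (auto simp: norm_mult intro!: mult_mono)
  qed measurable
  have gi: "integrable lborel g" and gI: "(\<integral>u. g u \<partial>lborel) = 1" and g0: "\<And>u. g u \<ge> 0"
    unfolding g_def by (simp_all add: integrable_normal_density integral_normal_density)
  have gaff: "integrable lborel (\<lambda>c. g (u - c))" "(\<integral>c. g (u - c) \<partial>lborel) = 1" for u
    using lborel_integrable_real_affine_iff[of "- 1" g u] lborel_integral_real_affine[of "- 1" g u] gi gI by auto
  have Tm: "(\<lambda>(c, k). ?T c k) \<in> lborel \<Otimes>\<^sub>M ?M \<rightarrow>\<^sub>M ?M"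
    unfolding split_beta by (intro measurable_restrict) measurable
  have \<sigma>T: "\<sigma> (?T c k) = \<sigma> k + N * c" for c :: real and k
    by (simp add: \<sigma>_def sum.distrib)
  \<comment> \<open>\<open>?H\<close> is \<open>?K\<close> with k translated by c. The translation
    takes the weight out of the way of c, so that F \<phi> (\<sigma>) is integrated along the whole
    orbit.\<close>
  let ?K = "\<lambda>(c, k). F k * \<phi> (\<sigma> k) * of_real (g (\<sigma> k / N - c))"
  let ?H = "\<lambda>(c, k). F (?T c k) * \<phi> (\<sigma> (?T c k)) * of_real (g (\<sigma> k / N))"
  have KH: "?H (c, k) = ?K (c, ?T c k)" for c k
  proof -
    have "\<sigma> (?T c k) / N - c = \<sigma> k / N" unfolding \<sigma>T using N0 by (simp add: add_divide_distrib)
    then show ?thesis by (simp only: prod.case)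
  qed
  have Km: "?K \<in> borel_measurable (lborel \<Otimes>\<^sub>M ?M)" by measurable
  have Kc: "(\<lambda>k. ?K (c, k)) \<in> borel_measurable ?M" for c
    unfolding prod.case by measurable
  have K: "integrable (lborel \<Otimes>\<^sub>M ?M) ?K"
  proof -
    interpret Q: pair_sigma_finite ?M lborel ..
    have "integrable (?M \<Otimes>\<^sub>M lborel) (\<lambda>(k, c). F k * \<phi> (\<sigma> k) * of_real (g (\<sigma> k / N - c)))"
    proof (rule Q.Fubini_integrable)
      show "(\<lambda>(k, c). F k * \<phi> (\<sigma> k) * of_real (g (\<sigma> k / N - c))) \<in> borel_measurable (?M \<Otimes>\<^sub>M lborel)" by measurable
      show "integrable ?M (\<lambda>k. \<integral>c. norm (case (k, c) of (k, c) \<Rightarrow> F k * \<phi> (\<sigma> k) * of_real (g (\<sigma> k / N - c))) \<partial>lborel)"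
        using integrable_norm[OF F\<phi>] g0 by (simp add: norm_mult gaff)
      show "AE k in ?M. integrable lborel (\<lambda>c. case (k, c) of (k, c) \<Rightarrow> F k * \<phi> (\<sigma> k) * of_real (g (\<sigma> k / N - c)))"
        using gaff by simp
    qed
    then show ?thesis using P.integrable_product_swap_iff[of ?K] by (simp add: split_beta)
  qed
  have Ht: "preserves ?M ?M (?T c)" for c by (rule preserves_translate) simp
  have H: "integrable (lborel \<Otimes>\<^sub>M ?M) ?H"
  proof (rule P.Fubini_integrable)
    have "(\<lambda>p. F (?T (fst p) (snd p))) \<in> borel_measurable (lborel \<Otimes>\<^sub>M ?M)"
      "(\<lambda>p. \<sigma> (?T (fst p) (snd p))) \<in> borel_measurable (lborel \<Otimes>\<^sub>M ?M)"
      using measurable_compose[OF Tm Fm] measurable_compose[OF Tm \<sigma>m] by (simp_all add: split_beta)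
    then show "?H \<in> borel_measurable (lborel \<Otimes>\<^sub>M ?M)" unfolding split_beta by measurable
    have "(\<integral>k. norm (?H (c, k)) \<partial>?M) = (\<integral>k. norm (?K (c, k)) \<partial>?M)" for c
      unfolding KH by (rule preserves_integral[OF Ht measurable_compose[OF Kc borel_measurable_norm]])
    then show "integrable lborel (\<lambda>c. \<integral>k. norm (?H (c, k)) \<partial>?M)"
      using P.integrable_fst'[OF integrable_norm[OF K]] by simp
    have "integrable ?M (\<lambda>k. ?H (c, k)) \<longleftrightarrow> integrable ?M (\<lambda>k. ?K (c, k))" for c
      unfolding KH by (rule preserves_integrable[OF Ht Kc])
    then show "AE c in lborel. integrable ?M (\<lambda>k. ?H (c, k))"
      using P.AE_integrable_fst'[OF K] by simp
  qed
  \<comment> \<open>Both parts are Gaussian in c, with linear coefficients that differ by i t d N;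
    after completing the square the factor \<open>e2\<close> compensates the difference
    exactly.\<close>
  have orbit: "(\<integral>c. F (?T c k) * \<phi> (\<sigma> (?T c k)) \<partial>lborel) = 0" for k
  proof -
    define b1 where "b1 = - of_real (t * \<sigma> k) - \<i> * of_real X"
    define b2 where "b2 = b1 + \<i> * of_real (t * d * N)"
    define e2 where "e2 = exp (\<i> * of_real (t * d * \<sigma> k) + of_real c0)"
    have \<alpha>: "t * N > 0" using t N0 by simp
    let ?g1 = "\<lambda>c. exp (b1 * of_real c - of_real (t * N * c\<^sup>2 / 2))" and ?g2 = "\<lambda>c. exp (b2 * of_real c - of_real (t * N * c\<^sup>2 / 2))"
    define Q where "Q = (\<Sum>j=1..N. (k j)\<^sup>2)"
    have sq: "(\<Sum>j=1..N. (?T c k j)\<^sup>2) = Q + 2 * c * \<sigma> k + N * c\<^sup>2" for c :: real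
      by (simp add: Q_def \<sigma>_def power2_sum sum.distrib sum_distrib_left mult_ac)
    have eq: "F (?T c k) * \<phi> (\<sigma> (?T c k)) = F k * ?g1 c - F k * e2 * ?g2 c" for c
    proof -
      have e1: "exp (of_real (- t * (Q + 2 * c * \<sigma> k + N * c\<^sup>2) / 2)) * exp (- \<i> * of_real (c * X))
          = exp (of_real (- t * Q / 2)) * ?g1 c"
        unfolding exp_add[symmetric] b1_def by (rule arg_cong[where f = exp]) (simp add: field_simps)
      have F1: "F (?T c k) = F k * ?g1 c"
      proof -
        have "F (?T c k) = exp (of_real (- t * (Q + 2 * c * \<sigma> k + N * c\<^sup>2) / 2)) * exp (- \<i> * of_real (c * X)) * G k"
          unfolding F_def equi sq exp_of_real by (simp only: mult.assoc)
        also have "\<dots> = F k * ?g1 c"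
          unfolding e1 unfolding F_def Q_def[symmetric] exp_of_real[symmetric] by (simp only: mult_ac)
        finally show ?thesis .
      qed
      have e3: "?g1 c * exp (\<i> * of_real (t * d * (\<sigma> k + N * c)) + of_real c0) = e2 * ?g2 c"
        unfolding e2_def b2_def exp_add[symmetric] by (rule arg_cong[where f = exp]) (simp add: algebra_simps)
      have "F (?T c k) * \<phi> (\<sigma> (?T c k))
          = F k * ?g1 c - F k * (?g1 c * exp (\<i> * of_real (t * d * (\<sigma> k + N * c)) + of_real c0))"
        unfolding F1 \<phi>_def \<sigma>T by (simp only: right_diff_distrib mult_1_right mult.assoc)
      then show ?thesis unfolding e3 by (simp only: mult.assoc)
    qed
    have "(\<integral>c. F (?T c k) * \<phi> (\<sigma> (?T c k)) \<partial>lborel) = F k * (\<integral>c. ?g1 c \<partial>lborel) - F k * e2 * (\<integral>c. ?g2 c \<partial>lborel)"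
      unfolding eq using gaussian_integral(1)[OF \<alpha>] by (subst Bochner_Integration.integral_diff) auto
    also have "F k * e2 * (\<integral>c. ?g2 c \<partial>lborel) = F k * (e2 * (\<integral>c. ?g2 c \<partial>lborel))" by (rule mult.assoc)
    also have "e2 * (\<integral>c. ?g2 c \<partial>lborel) = (\<integral>c. ?g1 c \<partial>lborel)"
    proof -
      have "(\<i> * of_real (t * d * \<sigma> k) + of_real c0) + b2\<^sup>2 / of_real (2 * (t * N)) = b1\<^sup>2 / of_real (2 * (t * N))"
      proof -
        have "b2\<^sup>2 = b1\<^sup>2 + of_real (2 * (t * N)) * (\<i> * of_real d * b1 - of_real (t * N * d\<^sup>2 / 2))"
          unfolding b2_def power2_sum by (simp add: power_mult_distrib algebra_simps power2_eq_square)
        moreover have nz: "complex_of_real (2 * (t * N)) \<noteq> 0" using \<alpha> by (simp only: of_real_eq_0_iff)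
        ultimately have "b2\<^sup>2 / of_real (2 * (t * N)) = b1\<^sup>2 / of_real (2 * (t * N)) + (\<i> * of_real d * b1 - of_real (t * N * d\<^sup>2 / 2))"
          by (simp only: add_divide_distrib nonzero_mult_div_cancel_left not_False_eq_True)
        then show ?thesis
          unfolding b1_def c0_def by (simp add: algebra_simps)
      qed
      from arg_cong[OF this, of exp] show ?thesis
        unfolding gaussian_integral(2)[OF \<alpha>] e2_def exp_add by (simp add: mult_ac)
    qed
    finally show ?thesis by (simp only: diff_self)
  qed
  have "(\<integral>k. F k * \<phi> (\<sigma> k) \<partial>?M) = (\<integral>k. (\<integral>c. ?K (c, k) \<partial>lborel) \<partial>?M)"
    by (simp add: gaff)
  also have "\<dots> = (\<integral>c. (\<integral>k. ?K (c, k) \<partial>?M) \<partial>lborel)"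
    using P.Fubini_integral[of "\<lambda>c k. ?K (c, k)"] K by simp
  also have "\<dots> = (\<integral>c. (\<integral>k. ?H (c, k) \<partial>?M) \<partial>lborel)"
    unfolding KH by (intro Bochner_Integration.integral_cong refl preserves_integral[OF Ht Kc, symmetric])
  also have "\<dots> = (\<integral>k. (\<integral>c. ?H (c, k) \<partial>lborel) \<partial>?M)"
    using P.Fubini_integral[of "\<lambda>c k. ?H (c, k)"] H by simp
  also have "\<dots> = 0" unfolding prod.case integral_mult_left_zero orbit by simp
  finally have zero: "(\<integral>k. F k * \<phi> (\<sigma> k) \<partial>?M) = 0" .
  have shift: "exp (- of_real t * (\<Sum>j=1..N. (of_real (k j) - \<i> * of_real d)\<^sup>2) / 2) * (of_real (exp (- d * X)) * G k)
      = F k - F k * \<phi> (\<sigma> k)" for k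
  proof -
    have e: "(\<Sum>j=1..N. (of_real (k j) - \<i> * of_real d)\<^sup>2) = of_real (\<Sum>j=1..N. (k j)\<^sup>2) - 2 * \<i> * of_real d * of_real (\<sigma> k) - of_real (N * d\<^sup>2)"
      by (simp add: power2_diff power_mult_distrib sum_subtractf sum.distrib sum_distrib_left \<sigma>_def mult_ac)
    have "- of_real t * (\<Sum>j=1..N. (of_real (k j) - \<i> * of_real d)\<^sup>2) / 2 + of_real (- d * X)
        = of_real (- t * (\<Sum>j=1..N. (k j)\<^sup>2) / 2) + (\<i> * of_real (t * d * \<sigma> k) + of_real c0)"
      unfolding e c0_def by (simp add: field_simps)
    from arg_cong[OF this, of exp] show ?thesis
      unfolding exp_add exp_of_real F_def \<phi>_def by (simp add: exp_of_real[symmetric] algebra_simps exp_add)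
  qed
  have "(\<integral>k. F k - F k * \<phi> (\<sigma> k) \<partial>?M) = (\<integral>k. F k \<partial>?M)"
    using Fi F\<phi> zero by simp
  then show ?thesis unfolding shift F_def by simp
qed

section \<open>Identities and bounds for the Sklyanin density\<close>

lemma rGamma_imaginary:
  "complex_of_real (inverse ((cmod (Gamma (\<i> * of_real y)))\<^sup>2)) = 1 / (Gamma (\<i> * of_real y) * Gamma (- (\<i> * of_real y)))"
proof -
  have "complex_of_real ((cmod (Gamma (\<i> * of_real y)))\<^sup>2) = Gamma (\<i> * of_real y) * cnj (Gamma (\<i> * of_real y))"
    by (rule complex_norm_square)
  also have "cnj (Gamma (\<i> * of_real y)) = Gamma (- (\<i> * of_real y))" by (simp add: cnj_Gamma)
  finally show ?thesis by (simp add: inverse_eq_divide)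
qed

text \<open>By reflection 1 / |Gamma (i y)|^2 = y sinh (\<pi> y) / \<pi> for y \<noteq> 0; at y = 0
  the left side is 0 by convention.\<close>

lemma rGamma_imaginary_bound: "inverse ((cmod (Gamma (\<i> * of_real y)))\<^sup>2) \<le> exp ((1 + pi) * \<bar>y\<bar>)"
proof (cases "y = 0")
  case False
  have nI: "\<i> * of_real y \<notin> \<int>"
  proof
    assume "\<i> * of_real y \<in> \<int>"
    then obtain n where "\<i> * of_real y = of_int n" by (elim Ints_cases)
    from arg_cong[OF this, of Im] show False using False by simp
  qed
  have "inverse ((cmod (Gamma (\<i> * of_real y)))\<^sup>2) = norm (complex_of_real (inverse ((cmod (Gamma (\<i> * of_real y)))\<^sup>2)))"
    by (simp only: norm_of_real) simp
  also have "\<dots> = norm (1 / (- (of_real pi) / (\<i> * of_real y * sin (of_real pi * (\<i> * of_real y)))))"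
    unfolding rGamma_imaginary Gamma_mult_minus[OF nI] ..
  also have "\<dots> = \<bar>y\<bar> * norm (sin (of_real pi * (\<i> * of_real y))) / pi"
    by (simp add: norm_mult norm_divide)
  also have "\<dots> \<le> exp \<bar>y\<bar> * exp (pi * \<bar>y\<bar>) / 1"
  proof (intro frac_le mult_mono)
    show "\<bar>y\<bar> \<le> exp \<bar>y\<bar>" using exp_ge_add_one_self[of "\<bar>y\<bar>"] by linarith
    show "norm (sin (of_real pi * (\<i> * of_real y))) \<le> exp (pi * \<bar>y\<bar>)"
      using cmod_sin_le_exp[of 1 "of_real pi * (\<i> * of_real y)"] by (simp add: abs_mult)
    show "1 \<le> pi" using pi_gt3 by simp
  qed auto
  finally show ?thesis by (simp add: exp_add[symmetric] algebra_simps)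
qed simp

lemma sklyanin_nonneg: "sklyanin N \<mu> \<ge> 0"
  unfolding sklyanin_def by (intro mult_nonneg_nonneg prod_nonneg) auto

lemma sklyanin_eq:
  "complex_of_real (sklyanin N \<mu>) = 1 / of_real ((2 * pi) ^ N * fact N)
    * (\<Prod>(j, l)\<in>pairs N. 1 / (Gamma (\<i> * of_real (\<mu> l - \<mu> j)) * Gamma (- (\<i> * of_real (\<mu> l - \<mu> j)))))"
  unfolding sklyanin_def pairs_def[symmetric] of_real_mult of_real_prod
  by (intro arg_cong2[where f = "(*)"] prod.cong refl) (auto simp: rGamma_imaginary simp del: of_real_diff of_real_inverse of_real_power)

text \<open>Each difference is estimated by the sum over all coordinates. The bound thus becomes a
  product of functions of single coordinates, and integrability against a Gaussian reduces to
  dimension one.\<close>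

lemma sklyanin_bound:
  "sklyanin N \<mu> \<le> (\<Prod>m=1..N. exp (real (card (pairs N)) * (2 * (1 + pi)) * \<bar>\<mu> m\<bar>))"
proof -
  let ?B = "2 * (1 + pi) * (\<Sum>m=1..N. \<bar>\<mu> m\<bar>)"
  have "(\<Prod>(j, l)\<in>pairs N. inverse ((cmod (Gamma (\<i> * complex_of_real (\<mu> l - \<mu> j))))\<^sup>2)) \<le> (\<Prod>p\<in>pairs N. exp ?B)"
  proof (intro prod_mono conjI, clarify)
    fix p assume "p \<in> pairs N"
    then obtain j l where p: "p = (j, l)" "j \<in> {1..N}" "l \<in> {1..N}" by (auto simp: pairs_def)
    have "\<bar>\<mu> j\<bar> \<le> (\<Sum>m=1..N. \<bar>\<mu> m\<bar>)" "\<bar>\<mu> l\<bar> \<le> (\<Sum>m=1..N. \<bar>\<mu> m\<bar>)"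
      using p by (auto intro!: member_le_sum)
    then have "\<bar>\<mu> l - \<mu> j\<bar> \<le> 2 * (\<Sum>m=1..N. \<bar>\<mu> m\<bar>)" by linarith
    then have "(1 + pi) * \<bar>\<mu> l - \<mu> j\<bar> \<le> (1 + pi) * (2 * (\<Sum>m=1..N. \<bar>\<mu> m\<bar>))"
      by (intro mult_left_mono) (auto intro: add_nonneg_nonneg)
    also have "\<dots> = ?B" by (simp only: mult_ac)
    finally have "exp ((1 + pi) * \<bar>\<mu> l - \<mu> j\<bar>) \<le> exp ?B" by (simp only: exp_le_cancel_iff)
    with rGamma_imaginary_bound[of "\<mu> l - \<mu> j"]
    show "(case p of (j, l) \<Rightarrow> inverse ((cmod (Gamma (\<i> * complex_of_real (\<mu> l - \<mu> j))))\<^sup>2)) \<le> exp ?B"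
      unfolding p(1) prod.case by (rule order_trans)
  qed auto
  also have "\<dots> = (\<Prod>m=1..N. exp (real (card (pairs N)) * (2 * (1 + pi)) * \<bar>\<mu> m\<bar>))"
    by (simp add: exp_of_nat_mult[symmetric] exp_sum[symmetric] sum_distrib_left mult_ac)
  finally have 1: "(\<Prod>(j, l)\<in>pairs N. inverse ((cmod (Gamma (\<i> * complex_of_real (\<mu> l - \<mu> j))))\<^sup>2))
      \<le> (\<Prod>m=1..N. exp (real (card (pairs N)) * (2 * (1 + pi)) * \<bar>\<mu> m\<bar>))" .
  have "1 \<le> (2 * pi) ^ N * fact N"
  proof -
    have "1 \<le> (2 * pi) ^ N" using pi_gt3 by (intro one_le_power) simp
    moreover have "1 \<le> (fact N :: real)" by (rule fact_ge_1)
    ultimately show ?thesis using mult_mono[of 1 "(2 * pi) ^ N" 1 "fact N"] by simp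
  qed
  then have "1 / ((2 * pi) ^ N * fact N) \<le> 1" by simp
  then have "sklyanin N \<mu> \<le> 1 * (\<Prod>(j, l)\<in>pairs N. inverse ((cmod (Gamma (\<i> * complex_of_real (\<mu> l - \<mu> j))))\<^sup>2))"
    unfolding sklyanin_def pairs_def[symmetric] by (intro mult_right_mono prod_nonneg) auto
  with 1 show ?thesis by simp
qed

lemma Gamma_complex_measurable [measurable]: "(Gamma :: complex \<Rightarrow> complex) \<in> borel_measurable borel"
proof -
  have "(rGamma :: complex \<Rightarrow> complex) \<in> borel_measurable borel"
    by (intro borel_measurable_continuous_onI continuous_on_rGamma)
  then have "(\<lambda>z. inverse (rGamma z) :: complex) \<in> borel_measurable borel" by measurable
  then show ?thesis by (simp add: Gamma_def[abs_def])
qed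

lemma sklyanin_measurable: "(\<lambda>k. sklyanin N (\<lambda>j. a * k j)) \<in> borel_measurable (lborel_pow {1..N})"
proof -
  have "(\<lambda>k. inverse ((cmod (Gamma (\<i> * complex_of_real (a * k l - a * k j))))\<^sup>2)) \<in> borel_measurable (lborel_pow {1..N})"
    if "(j, l) \<in> pairs N" for j l
  proof -
    have "j \<in> {1..N}" "l \<in> {1..N}" using that by (auto simp: pairs_def)
    then show ?thesis by measurable
  qed
  then show ?thesis
    unfolding sklyanin_def pairs_def[symmetric] by (intro borel_measurable_times borel_measurable_prod) auto
qed

lemma exp_abs_gaussian_integrable:
  fixes t B :: real
  assumes t: "t > 0"
  shows "integrable lborel (\<lambda>y. exp (- t * y\<^sup>2 / 2) * exp (B * \<bar>y\<bar>))"
proof (rule Bochner_Integration.integrable_bound)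
  show "integrable lborel (\<lambda>y. exp (B\<^sup>2 / t) * exp (- (t / 4) * y\<^sup>2))"
    using gaussian_integrable[of "t / 4"] t by simp
  show "AE y in lborel. norm (exp (- t * y\<^sup>2 / 2) * exp (B * \<bar>y\<bar>)) \<le> norm (exp (B\<^sup>2 / t) * exp (- (t / 4) * y\<^sup>2))"
  proof (rule AE_I2)
    fix y :: real
    have "0 \<le> (t * \<bar>y\<bar> / 2 - B)\<^sup>2 / t" using t by simp
    also have "\<dots> = t * y\<^sup>2 / 4 - B * \<bar>y\<bar> + B\<^sup>2 / t"
      using t by (simp add: power2_diff power_mult_distrib power_divide field_simps) (simp add: power2_eq_square)
    finally have "- t * y\<^sup>2 / 2 + B * \<bar>y\<bar> \<le> B\<^sup>2 / t + - (t / 4) * y\<^sup>2" by simp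
    then show "norm (exp (- t * y\<^sup>2 / 2) * exp (B * \<bar>y\<bar>)) \<le> norm (exp (B\<^sup>2 / t) * exp (- (t / 4) * y\<^sup>2))"
      by (simp only: exp_add[symmetric] norm_exp real_norm_def abs_exp_cancel exp_le_cancel_iff)
  qed
qed measurable

lemma sklyanin_gaussian_integrable:
  assumes t: "t > 0"
  shows "integrable (lborel_pow {1..N}) (\<lambda>k. exp (- t * (\<Sum>j=1..N. (k j)\<^sup>2) / 2) * sklyanin N (\<lambda>j. a * k j))"
proof (rule Bochner_Integration.integrable_bound)
  let ?B = "real (card (pairs N)) * (2 * (1 + pi)) * \<bar>a\<bar>"
  show "integrable (lborel_pow {1..N}) (\<lambda>k. \<Prod>m=1..N. exp (- t * (k m)\<^sup>2 / 2) * exp (?B * \<bar>k m\<bar>))"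
    using t by (intro lborel_pow.product_integrable_prod exp_abs_gaussian_integrable) auto
  show "(\<lambda>k. exp (- t * (\<Sum>j=1..N. (k j)\<^sup>2) / 2) * sklyanin N (\<lambda>j. a * k j)) \<in> borel_measurable (lborel_pow {1..N})"
    using sklyanin_measurable[of N a] by measurable
  show "AE k in lborel_pow {1..N}. norm (exp (- t * (\<Sum>j=1..N. (k j)\<^sup>2) / 2) * sklyanin N (\<lambda>j. a * k j))
      \<le> norm (\<Prod>m=1..N. exp (- t * (k m)\<^sup>2 / 2) * exp (?B * \<bar>k m\<bar>))"
  proof (rule AE_I2)
    fix k
    have e: "exp (- t * (\<Sum>j=1..N. (k j)\<^sup>2) / 2) = (\<Prod>m=1..N. exp (- t * (k m)\<^sup>2 / 2))"
      by (simp add: exp_sum[symmetric] sum_distrib_left sum_divide_distrib sum_negf[symmetric])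
    have "sklyanin N (\<lambda>j. a * k j) \<le> (\<Prod>m=1..N. exp (?B * \<bar>k m\<bar>))"
      using sklyanin_bound[of N "\<lambda>j. a * k j"] by (simp add: abs_mult mult_ac)
    then have "exp (- t * (\<Sum>j=1..N. (k j)\<^sup>2) / 2) * sklyanin N (\<lambda>j. a * k j)
        \<le> (\<Prod>m=1..N. exp (- t * (k m)\<^sup>2 / 2)) * (\<Prod>m=1..N. exp (?B * \<bar>k m\<bar>))"
      unfolding e by (intro mult_left_mono prod_nonneg) auto
    then show "norm (exp (- t * (\<Sum>j=1..N. (k j)\<^sup>2) / 2) * sklyanin N (\<lambda>j. a * k j))
      \<le> norm (\<Prod>m=1..N. exp (- t * (k m)\<^sup>2 / 2) * exp (?B * \<bar>k m\<bar>))"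
      using sklyanin_nonneg[of N "\<lambda>j. a * k j"] by (simp add: prod.distrib abs_mult prod_nonneg)
  qed
qed

section \<open>Symmetries and a majorant of the Whittaker function\<close>

lemma whittaker_cong: "(\<And>k. k \<in> {1..N} \<Longrightarrow> x k = y k) \<Longrightarrow> whittaker N \<mu> x = whittaker N \<mu> y"
  unfolding whittaker_def whittaker_F_def
  by (intro Bochner_Integration.integral_cong refl arg_cong[where f = exp] arg_cong2[where f = "(-)"] sum.cong arg_cong2[where f = "(*)"] arg_cong[where f = complex_of_real] arg_cong2[where f = "(+)"] arg_cong[where f = uminus]) auto

lemma sum_increment: "(\<Sum>j<Suc n. increment f j) = f n"
  by (induction n) (simp_all add: increment_def)

lemma whittaker_shift_parameter:
  assumes N: "N \<ge> 1"
  shows "whittaker N (\<lambda>j. \<mu> j + c) x = exp (c * of_real (\<Sum>k=1..N. x k)) * whittaker N \<mu> x"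
proof -
  have "whittaker_F N (\<lambda>j. \<mu> j + c) (frame N x T) = c * of_real (\<Sum>k=1..N. x k) + whittaker_F N \<mu> (frame N x T)" for T
  proof -
    let ?f = "\<lambda>j. \<Sum>k=1..Suc j. frame N x T (Suc j, k)"
    obtain n where n: "N = Suc n" using N by (cases N) auto
    have "(\<Sum>j<N. c * complex_of_real (increment ?f j)) = c * of_real (\<Sum>j<Suc n. increment ?f j)"
      unfolding n of_real_sum sum_distrib_left by (rule refl)
    also have "(\<Sum>j<Suc n. increment ?f j) = (\<Sum>k=1..N. x k)"
      unfolding sum_increment n frame_def by simp
    finally show ?thesis
      unfolding whittaker_F_frame by (simp add: distrib_right sum.distrib)
  qed
  then show ?thesis unfolding whittaker_frame by (simp add: exp_add)
qed

text \<open>Translating the integration variables along with \<open>x\<close> leaves the potential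
  unchanged, as it depends on differences, and adds \<open>c\<close> to every row increment.\<close>

lemma whittaker_shift_argument:
  assumes N: "N \<ge> 1"
  shows "whittaker N \<mu> (\<lambda>k. x k + c) = exp (of_real c * (\<Sum>j=1..N. \<mu> j)) * whittaker N \<mu> x"
proof -
  let ?S = "\<lambda>T. \<lambda>p\<in>tri N. T p + c :: real"
  have eq: "whittaker_F N \<mu> (frame N (\<lambda>k. x k + c) (?S T)) = of_real c * (\<Sum>j=1..N. \<mu> j) + whittaker_F N \<mu> (frame N x T)" for T
  proof -
    have fr: "frame N (\<lambda>k. x k + c) (?S T) (j, k) = frame N x T (j, k) + c" if "1 \<le> k" "k \<le> j" "j \<le> N" for j k
      using that by (auto simp: frame_def tri_def)
    have "tri_energy N (frame N (\<lambda>k. x k + c) (?S T)) = tri_energy N (frame N x T)"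
      unfolding tri_energy_def by (intro sum.cong refl) (use N in \<open>auto simp: fr\<close>)
    moreover have "increment (\<lambda>j. \<Sum>k=1..Suc j. frame N (\<lambda>k. x k + c) (?S T) (Suc j, k)) j
        = increment (\<lambda>j. \<Sum>k=1..Suc j. frame N x T (Suc j, k)) j + c" if "j < N" for j
    proof -
      have "(\<Sum>k=1..Suc i. frame N (\<lambda>k. x k + c) (?S T) (Suc i, k)) = (\<Sum>k=1..Suc i. frame N x T (Suc i, k)) + (Suc i) * c" if "i < N" for i
      proof -
        have "(\<Sum>k=1..Suc i. frame N (\<lambda>k. x k + c) (?S T) (Suc i, k)) = (\<Sum>k=1..Suc i. frame N x T (Suc i, k) + c)"
          using that by (intro sum.cong refl fr) auto
        then show ?thesis by (simp add: sum.distrib)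
      qed
      from this[of j] this[of "j - 1"] show ?thesis
        using that unfolding increment_def by (cases j) (simp_all add: algebra_simps)
    qed
    then have "(\<Sum>j<N. \<mu> (Suc j) * complex_of_real (increment (\<lambda>j. \<Sum>k=1..Suc j. frame N (\<lambda>k. x k + c) (?S T) (Suc j, k)) j))
        = (\<Sum>j<N. \<mu> (Suc j) * complex_of_real (increment (\<lambda>j. \<Sum>k=1..Suc j. frame N x T (Suc j, k)) j + c))"
      by (intro sum.cong refl arg_cong2[where f = "(*)"] arg_cong[where f = complex_of_real]) auto
    moreover have "(\<Sum>j<N. \<mu> (Suc j) * of_real c) = of_real c * (\<Sum>j=1..N. \<mu> j)"
      by (simp add: sum.atLeast1_atMost_eq sum_distrib_left mult.commute)
    ultimately show ?thesis
      unfolding whittaker_F_frame by (simp add: distrib_left sum.distrib)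
  qed
  have [measurable]: "(\<lambda>T. exp (whittaker_F N \<mu> (frame N (\<lambda>k. x k + c) T))) \<in> borel_measurable (lborel_pow (tri N))"
  proof -
    have "(\<lambda>k\<in>{1..N}. x k + c) \<in> space (lborel_pow {1..N})" by (auto simp: space_PiM)
    then have "Pair (\<lambda>k\<in>{1..N}. x k + c) \<in> lborel_pow (tri N) \<rightarrow>\<^sub>M lborel_pow {1..N} \<Otimes>\<^sub>M lborel_pow (tri N)"
      by (rule measurable_Pair1')
    from measurable_compose[OF this whittaker_F_measurable]
    have "(\<lambda>T. exp (whittaker_F N \<mu> (frame N (\<lambda>k\<in>{1..N}. x k + c) T))) \<in> borel_measurable (lborel_pow (tri N))"
      by simp
    moreover have "whittaker_F N \<mu> (frame N (\<lambda>k\<in>{1..N}. x k + c) T) = whittaker_F N \<mu> (frame N (\<lambda>k. x k + c) T)" for T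
      unfolding whittaker_F_def frame_def
      by (intro arg_cong2[where f = "(-)"] sum.cong refl arg_cong2[where f = "(*)"] arg_cong[where f = complex_of_real] arg_cong2[where f = "(+)"] arg_cong[where f = uminus] arg_cong[where f = exp]) auto
    ultimately show ?thesis by simp
  qed
  have "whittaker N \<mu> (\<lambda>k. x k + c) = (\<integral>T. exp (whittaker_F N \<mu> (frame N (\<lambda>k. x k + c) (?S T))) \<partial>lborel_pow (tri N))"
    unfolding whittaker_frame by (rule preserves_integral[OF preserves_translate, symmetric]) measurable
  also have "\<dots> = exp (of_real c * (\<Sum>j=1..N. \<mu> j)) * whittaker N \<mu> x"
    unfolding eq whittaker_frame exp_add by simp
  finally show ?thesis .
qed

text \<open>The potential is real, so taking moduli affects the linear term only. The bound is
  uniform in the imaginary parts of the parameters, that is, in the spectral variables.\<close>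

lemma norm_whittaker_le:
  "norm (whittaker N \<mu> x) \<le> Re (whittaker N (\<lambda>j. of_real (Re (\<mu> j))) x)"
proof -
  have re: "Re (whittaker_F N (\<lambda>j. of_real (Re (\<mu> j))) T) = Re (whittaker_F N \<mu> T)" for T
    by (simp add: whittaker_F_frame Re_sum)
  have im: "whittaker_F N (\<lambda>j. of_real (Re (\<mu> j))) T = of_real (Re (whittaker_F N (\<lambda>j. of_real (Re (\<mu> j))) T))" for T
    by (simp add: whittaker_F_frame complex_eq_iff Re_sum Im_sum)
  have "norm (whittaker N \<mu> x) \<le> (\<integral>T. norm (exp (whittaker_F N \<mu> (frame N x T))) \<partial>lborel_pow (tri N))"
    unfolding whittaker_frame by (rule integral_norm_bound)
  also have "\<dots> = (\<integral>T. exp (Re (whittaker_F N \<mu> (frame N x T))) \<partial>lborel_pow (tri N))"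
    by (simp add: norm_exp_eq_Re)
  also have "\<dots> = Re (complex_of_real (\<integral>T. exp (Re (whittaker_F N \<mu> (frame N x T))) \<partial>lborel_pow (tri N)))" by simp
  also have "complex_of_real (\<integral>T. exp (Re (whittaker_F N \<mu> (frame N x T))) \<partial>lborel_pow (tri N))
      = whittaker N (\<lambda>j. of_real (Re (\<mu> j))) x"
  proof -
    have "exp (whittaker_F N (\<lambda>j. of_real (Re (\<mu> j))) T) = of_real (exp (Re (whittaker_F N \<mu> T)))" for T
      by (subst im) (simp only: re exp_of_real)
    then show ?thesis unfolding whittaker_frame by simp
  qed
  finally show ?thesis .
qed

section \<open>The Brownian side\<close>

lemma distributed_complex_integral:
  fixes g :: "'b \<Rightarrow> complex"
  assumes d: "distributed P L X (\<lambda>x. ennreal (f x))" and g[measurable]: "g \<in> borel_measurable L"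
    and f0: "\<And>x. f x \<ge> 0" and f[measurable]: "f \<in> borel_measurable L"
  shows "integrable P (\<lambda>\<omega>. g (X \<omega>)) \<longleftrightarrow> integrable L (\<lambda>x. f x *\<^sub>R g x)"
    and "(\<integral>\<omega>. g (X \<omega>) \<partial>P) = (\<integral>x. f x *\<^sub>R g x \<partial>L)"
proof -
  have [measurable]: "X \<in> P \<rightarrow>\<^sub>M L" using d by (simp add: distributed_def)
  have eq: "distr P L X = density L (\<lambda>x. ennreal (f x))" using d by (simp add: distributed_def)
  have "integrable P (\<lambda>\<omega>. g (X \<omega>)) \<longleftrightarrow> integrable (distr P L X) g" by (rule integrable_distr_eq[symmetric]) measurable
  also have "\<dots> \<longleftrightarrow> integrable L (\<lambda>x. f x *\<^sub>R g x)"
    unfolding eq using f0 by (intro integrable_density) auto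
  finally show "integrable P (\<lambda>\<omega>. g (X \<omega>)) \<longleftrightarrow> integrable L (\<lambda>x. f x *\<^sub>R g x)" .
  have "(\<integral>\<omega>. g (X \<omega>) \<partial>P) = (\<integral>x. g x \<partial>distr P L X)" by (rule integral_distr[symmetric]) measurable
  also have "\<dots> = (\<integral>x. f x *\<^sub>R g x \<partial>L)"
    unfolding eq using f0 by (intro integral_density) auto
  finally show "(\<integral>\<omega>. g (X \<omega>) \<partial>P) = (\<integral>x. f x *\<^sub>R g x \<partial>L)" .
qed

text \<open>The starting value is prescribed almost surely, whereas \<open>v\<close> plus the
  increment from time 0 has the stated density outright and agrees with \<open>W s\<close> almost
  surely.\<close>

lemma brownian_motion_marginal:
  assumes W: "brownian_motion Q v W" and s: "s > 0"
  shows "distributed Q lborel (\<lambda>\<omega>. v + (W s \<omega> - W 0 \<omega>)) (\<lambda>x. ennreal (normal_density v (sqrt s) x))"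
    and "AE \<omega> in Q. v + (W s \<omega> - W 0 \<omega>) = W s \<omega>"
proof -
  interpret prob_space Q using W by (simp add: brownian_motion_def)
  have "distributed Q lborel (\<lambda>\<omega>. W s \<omega> - W 0 \<omega>) (\<lambda>x. ennreal (normal_density 0 (sqrt (s - 0)) x))"
    using W s unfolding brownian_motion_def by blast
  from normal_density_affine[OF this[simplified], of 1 v] s
  show "distributed Q lborel (\<lambda>\<omega>. v + (W s \<omega> - W 0 \<omega>)) (\<lambda>x. ennreal (normal_density v (sqrt s) x))" by simp
  have "AE \<omega> in Q. W 0 \<omega> = v" using W by (simp add: brownian_motion_def)
  then show "AE \<omega> in Q. v + (W s \<omega> - W 0 \<omega>) = W s \<omega>" by eventually_elim simp
qed

text \<open>Independence of the increments over [0, s] and [s, S]; the explicit joint density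
  replaces conditioning at time s.\<close>

lemma brownian_motion_pair:
  assumes W: "brownian_motion Q v W" and s: "0 < s" "s < S"
  shows "distributed Q (lborel \<Otimes>\<^sub>M lborel) (\<lambda>\<omega>. (v + (W s \<omega> - W 0 \<omega>), W S \<omega> - W s \<omega>))
    (\<lambda>z. ennreal (normal_density v (sqrt s) (fst z) * normal_density 0 (sqrt (S - s)) (snd z)))"
proof -
  interpret prob_space Q using W by (simp add: brownian_motion_def)
  define \<tau> where "\<tau> = (\<lambda>i::nat. if i = 0 then 0 else if i = 1 then s else S)"
  have "\<forall>(n::nat) \<tau>. 0 \<le> \<tau> 0 \<and> (\<forall>i<n. \<tau> i \<le> \<tau> (Suc i)) \<longrightarrow>
      indep_vars (\<lambda>_. borel) (\<lambda>i \<omega>. W (\<tau> (Suc i)) \<omega> - W (\<tau> i) \<omega>) {..<n}"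
    using W unfolding brownian_motion_def by blast
  moreover have "0 \<le> \<tau> 0 \<and> (\<forall>i<2. \<tau> i \<le> \<tau> (Suc i))"
    using s by (auto simp: \<tau>_def less_Suc_eq numeral_2_eq_2)
  ultimately have "indep_vars (\<lambda>_. borel) (\<lambda>i \<omega>. W (\<tau> (Suc i)) \<omega> - W (\<tau> i) \<omega>) {..<2}" by blast
  from indep_var_compose[OF indep_var_restrict[OF this, of "{0}" "{1}"], of "\<lambda>x. v + x 0" lborel "\<lambda>x. x 1" lborel]
  have ind: "indep_var lborel (\<lambda>\<omega>. v + (W s \<omega> - W 0 \<omega>)) lborel (\<lambda>\<omega>. W S \<omega> - W s \<omega>)"
    by (simp add: comp_def \<tau>_def)
  have "distributed Q lborel (\<lambda>\<omega>. W S \<omega> - W s \<omega>) (\<lambda>x. ennreal (normal_density 0 (sqrt (S - s)) x))"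
    using W s unfolding brownian_motion_def by (meson less_imp_le)
  from distributed_joint_indep[OF lborel.sigma_finite_measure_axioms lborel.sigma_finite_measure_axioms brownian_motion_marginal(1)[OF W s(1)] this ind]
  show ?thesis by (simp add: case_prod_unfold ennreal_mult)
qed

context spectrum
begin

text \<open>At s = 1/t and c = h/t the determinant of this matrix is the common value of both
  expectations in the theorem.\<close>

definition gram :: "real \<Rightarrow> real \<Rightarrow> nat \<Rightarrow> nat \<Rightarrow> complex" where
  "gram s c j k = (\<integral>x. indicator {c..} x *\<^sub>R (of_real (normal_density (\<nu> j) (sqrt s) x) * M_mart N \<nu> (\<nu> k) a s x) \<partial>lborel)"

text \<open>The increment after time s is integrated first; by \<open>M_mart_martingale\<close> this
  replaces S by s, so the value does not depend on S.\<close>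

lemma brownian_expectation:
  assumes W: "brownian_motion Q (\<nu> j) W" and j: "j \<in> {1..N}" and k: "k \<in> {1..N}" and s: "0 < s" "s \<le> S"
  shows "integrable Q (\<lambda>\<omega>. of_bool (c \<le> W s \<omega>) * M_mart N \<nu> (\<nu> k) a S (W S \<omega>))"
    and "(\<integral>\<omega>. of_bool (c \<le> W s \<omega>) * M_mart N \<nu> (\<nu> k) a S (W S \<omega>) \<partial>Q) = gram s c j k"
proof -
  let ?v = "\<nu> j"
  have S: "S > 0" using s by simp
  interpret prob_space Q using W by (simp add: brownian_motion_def)
  have Wm[measurable]: "W r \<in> borel_measurable Q" if "r \<ge> 0" for r using W that by (simp add: brownian_motion_def)
  have [measurable]: "W s \<in> borel_measurable Q" "W S \<in> borel_measurable Q" "W 0 \<in> borel_measurable Q" using s by (auto intro: Wm)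
  have Mm[measurable]: "M_mart N \<nu> (\<nu> k) a r \<in> borel_measurable borel" if "r > 0" for r
    by (rule M_mart_measurable[OF k that])
  have [measurable]: "M_mart N \<nu> (\<nu> k) a S \<in> borel_measurable borel" "M_mart N \<nu> (\<nu> k) a s \<in> borel_measurable borel"
    using Mm S s by auto
  let ?U = "\<lambda>r \<omega>. ?v + (W r \<omega> - W 0 \<omega>)"
  have MU: "integrable Q (\<lambda>\<omega>. M_mart N \<nu> (\<nu> k) a S (?U S \<omega>))"
    using density_M_mart(1)[OF j k S]
    by (subst distributed_complex_integral(1)[OF brownian_motion_marginal(1)[OF W S]]) (auto simp: scaleR_conv_of_real)
  have M: "integrable Q (\<lambda>\<omega>. M_mart N \<nu> (\<nu> k) a S (W S \<omega>))"
  proof (rule integrable_cong_AE_imp[OF MU])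
    show "AE \<omega> in Q. M_mart N \<nu> (\<nu> k) a S (?U S \<omega>) = M_mart N \<nu> (\<nu> k) a S (W S \<omega>)"
      using brownian_motion_marginal(2)[OF W S] by eventually_elim simp
  qed measurable
  show int: "integrable Q (\<lambda>\<omega>. of_bool (c \<le> W s \<omega>) * M_mart N \<nu> (\<nu> k) a S (W S \<omega>))"
    by (rule Bochner_Integration.integrable_bound[OF M]) (auto simp: norm_mult)
  show "(\<integral>\<omega>. of_bool (c \<le> W s \<omega>) * M_mart N \<nu> (\<nu> k) a S (W S \<omega>) \<partial>Q) = gram s c j k"
  proof (cases "s = S")
    case True
    have "(\<integral>\<omega>. of_bool (c \<le> W s \<omega>) * M_mart N \<nu> (\<nu> k) a S (W S \<omega>) \<partial>Q)
        = (\<integral>\<omega>. of_bool (c \<le> ?U s \<omega>) * M_mart N \<nu> (\<nu> k) a s (?U s \<omega>) \<partial>Q)"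
    proof (rule integral_cong_AE)
      show "AE \<omega> in Q. of_bool (c \<le> W s \<omega>) * M_mart N \<nu> (\<nu> k) a S (W S \<omega>) = of_bool (c \<le> ?U s \<omega>) * M_mart N \<nu> (\<nu> k) a s (?U s \<omega>)"
        using brownian_motion_marginal(2)[OF W s(1)] by eventually_elim (simp add: True)
    qed measurable
    also have "\<dots> = (\<integral>x. normal_density ?v (sqrt s) x *\<^sub>R (of_bool (c \<le> x) * M_mart N \<nu> (\<nu> k) a s x) \<partial>lborel)"
      by (rule distributed_complex_integral(2)[OF brownian_motion_marginal(1)[OF W s(1)]]) auto
    also have "\<dots> = gram s c j k"
      unfolding gram_def by (intro Bochner_Integration.integral_cong refl) (auto simp: indicator_def scaleR_conv_of_real)
    finally show ?thesis .
  next
    case False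
    then have sS: "s < S" using s by simp
    let ?p = "normal_density ?v (sqrt s)" and ?q = "normal_density 0 (sqrt (S - s))"
    let ?G = "\<lambda>z. of_bool (c \<le> fst z) * M_mart N \<nu> (\<nu> k) a S (fst z + snd z)"
    let ?F = "\<lambda>z. (?p (fst z) * ?q (snd z)) *\<^sub>R ?G z"
    let ?Z = "\<lambda>\<omega>. (?U s \<omega>, W S \<omega> - W s \<omega>)"
    have AE: "AE \<omega> in Q. of_bool (c \<le> W s \<omega>) * M_mart N \<nu> (\<nu> k) a S (W S \<omega>) = ?G (?Z \<omega>)"
      using brownian_motion_marginal(2)[OF W s(1)] by eventually_elim simp
    have Gm: "?G \<in> borel_measurable (lborel \<Otimes>\<^sub>M lborel)" by measurable
    have GZm: "(\<lambda>\<omega>. ?G (?Z \<omega>)) \<in> borel_measurable Q" by measurable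
    have pm: "(\<lambda>z. ?p (fst z) * ?q (snd z)) \<in> borel_measurable (lborel \<Otimes>\<^sub>M lborel)" by measurable
    note D = distributed_complex_integral[OF brownian_motion_pair[OF W s(1) sS] Gm _ pm]
    have "integrable Q (\<lambda>\<omega>. ?G (?Z \<omega>))"
      by (rule integrable_cong_AE_imp[OF int GZm]) (use AE in eventually_elim, simp)
    then have F: "integrable (lborel \<Otimes>\<^sub>M lborel) ?F" by (subst (asm) D(1)) auto
    have "(\<integral>\<omega>. of_bool (c \<le> W s \<omega>) * M_mart N \<nu> (\<nu> k) a S (W S \<omega>) \<partial>Q) = (\<integral>\<omega>. ?G (?Z \<omega>) \<partial>Q)"
      by (rule integral_cong_AE[OF _ GZm AE]) measurable
    also have "\<dots> = (\<integral>z. ?F z \<partial>(lborel \<Otimes>\<^sub>M lborel))" by (rule D(2)) simp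
    also have "\<dots> = (\<integral>x. (\<integral>r. ?F (x, r) \<partial>lborel) \<partial>lborel)"
      by (rule lborel_pair.integral_fst'[OF F, symmetric])
    also have "\<dots> = gram s c j k"
      unfolding gram_def
    proof (rule Bochner_Integration.integral_cong[OF refl])
      fix x
      have "(\<integral>r. ?F (x, r) \<partial>lborel)
          = (\<integral>r. of_real (?p x) * of_bool (c \<le> x) * (of_real (?q r) * M_mart N \<nu> (\<nu> k) a S (x + r)) \<partial>lborel)"
        by (simp add: scaleR_conv_of_real mult_ac)
      also have "\<dots> = of_real (?p x) * of_bool (c \<le> x) * M_mart N \<nu> (\<nu> k) a s x"
        by (simp only: integral_mult_right_zero M_mart_martingale[OF k s(1) sS])
      finally show "(\<integral>r. ?F (x, r) \<partial>lborel) = indicator {c..} x *\<^sub>R (of_real (?p x) * M_mart N \<nu> (\<nu> k) a s x)"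
        by (auto simp: indicator_def)
    qed
    finally show ?thesis .
  qed
qed

text \<open>Each term of the Leibniz expansion is a product over independent components, so its
  expectation is a product of entries of \<open>gram\<close>.\<close>

lemma brownian_determinant:
  fixes c :: real
  assumes B: "indep_brownian_motions Q N \<nu> B" and N: "N \<ge> 1" and s: "0 < s" "s \<le> S"
  defines "Y \<equiv> \<lambda>\<omega>. (\<Prod>j=1..N. of_bool (B j s \<omega> \<ge> c)) * D_mart N \<nu> a S (\<lambda>j. B j S \<omega>)"
  shows "integrable Q Y" and "(\<integral>\<omega>. Y \<omega> \<partial>Q) = det1 N (gram s c)"
proof -
  let ?P = "{p. p permutes {1..N}}"
  have bm: "brownian_motion Q (\<nu> j) (B j)" if "j \<in> {1..N}" for j
    using B that by (simp add: indep_brownian_motions_def)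
  interpret prob_space Q using bm[of 1] N by (simp add: brownian_motion_def)
  have S: "S > 0" using s by simp
  let ?e = "\<lambda>p j \<omega>. of_bool (c \<le> B j s \<omega>) * M_mart N \<nu> (\<nu> (p j)) a S (B j S \<omega>)"
  have Y: "Y \<omega> = (\<Sum>p\<in>?P. of_int (sign p) * (\<Prod>j=1..N. ?e p j \<omega>))" for \<omega>
    unfolding Y_def D_mart_def det1_eq_detS detS_def by (simp add: sum_distrib_left prod.distrib mult_ac)
  have mem: "p j \<in> {1..N}" if "p \<in> ?P" "j \<in> {1..N}" for p j
    using that permutes_in_image[of p "{1..N}" j] by simp
  have indep: "indep_vars (\<lambda>_. borel) (\<lambda>j \<omega>. ?e p j \<omega>) {1..N}" if p: "p \<in> ?P" for p
  proof -
    \<comment> \<open>Independence is given for whole paths on [0, \<infinity>), so each factor is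
      written as a function of the path, read at the times s and S.\<close>
    let ?f = "\<lambda>j x. of_bool (c \<le> x s) * M_mart N \<nu> (\<nu> (p j)) a S (x S)"
    have "indep_vars (\<lambda>_. PiM {0..} (\<lambda>_. borel)) (\<lambda>j \<omega>. restrict (\<lambda>t. B j t \<omega>) {0..}) {1..N}"
      using B by (simp add: indep_brownian_motions_def)
    moreover have "?f j \<in> borel_measurable (PiM {0::real..} (\<lambda>_. borel))" if "j \<in> {1..N}" for j
    proof -
      have [measurable]: "M_mart N \<nu> (\<nu> (p j)) a S \<in> borel_measurable borel"
        by (rule M_mart_measurable[OF mem[OF p that] S])
      have [measurable]: "(\<lambda>x. x s) \<in> borel_measurable (PiM {0::real..} (\<lambda>_. borel))" "(\<lambda>x. x S) \<in> borel_measurable (PiM {0::real..} (\<lambda>_. borel))"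
        using s by (auto intro!: measurable_component_singleton)
      show ?thesis by measurable
    qed
    ultimately have "indep_vars (\<lambda>_. borel) (\<lambda>j \<omega>. ?f j (restrict (\<lambda>t. B j t \<omega>) {0..})) {1..N}"
      by (rule indep_vars_compose2)
    then show ?thesis using s by simp
  qed
  have int: "integrable Q (\<lambda>\<omega>. ?e p j \<omega>)" if "p \<in> ?P" "j \<in> {1..N}" for p j
    by (rule brownian_expectation(1)[OF bm[OF that(2)] that(2) mem[OF that] s])
  have prod: "integrable Q (\<lambda>\<omega>. \<Prod>j=1..N. ?e p j \<omega>)" if "p \<in> ?P" for p
    by (rule indep_vars_integrable[OF _ indep[OF that] int[OF that]]) auto
  show "integrable Q Y"
    unfolding Y using prod by (intro Bochner_Integration.integrable_sum integrable_mult_right) auto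
  have "(\<integral>\<omega>. Y \<omega> \<partial>Q) = (\<Sum>p\<in>?P. of_int (sign p) * (\<integral>\<omega>. (\<Prod>j=1..N. ?e p j \<omega>) \<partial>Q))"
    unfolding Y using prod by (subst Bochner_Integration.integral_sum) auto
  also have "\<dots> = (\<Sum>p\<in>?P. of_int (sign p) * (\<Prod>j=1..N. gram s c j (p j)))"
  proof (intro sum.cong refl arg_cong2[where f = "(*)"])
    fix p assume p: "p \<in> ?P"
    have "(\<integral>\<omega>. (\<Prod>j=1..N. ?e p j \<omega>) \<partial>Q) = (\<Prod>j=1..N. \<integral>\<omega>. ?e p j \<omega> \<partial>Q)"
      by (rule indep_vars_lebesgue_integral[OF _ indep[OF p] int[OF p]]) auto
    also have "\<dots> = (\<Prod>j=1..N. gram s c j (p j))"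
      by (intro prod.cong refl brownian_expectation(2)[OF bm _ mem[OF p] s])
    finally show "(\<integral>\<omega>. (\<Prod>j=1..N. ?e p j \<omega>) \<partial>Q) = (\<Prod>j=1..N. gram s c j (p j))" .
  qed
  also have "\<dots> = det1 N (gram s c)" by (simp add: det1_eq_detS detS_def)
  finally show "(\<integral>\<omega>. Y \<omega> \<partial>Q) = det1 N (gram s c)" .
qed

end

section \<open>The O'Connell side\<close>

lemma det1_transpose: "det1 n (\<lambda>i j. f j i) = det1 n f"
proof -
  have "mat n n (\<lambda>(j, k). f (Suc k) (Suc j)) = transpose_mat (mat n n (\<lambda>(j, k). f (Suc j) (Suc k)))"
    by (intro eq_matI) auto
  then show ?thesis
    unfolding det1_def using Determinant.det_transpose[of "mat n n (\<lambda>(j, k). f (Suc j) (Suc k))" n] by simp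
qed

lemma det1_identity: "det1 n (\<lambda>i j. if i = j then 1 else 0) = 1"
proof -
  have "mat n n (\<lambda>(j, k). if Suc j = Suc k then 1 else 0) = (1\<^sub>m n :: complex mat)"
    by (intro eq_matI) auto
  then show ?thesis unfolding det1_def by simp
qed

lemma det1_tendsto:
  assumes "\<And>i j. i \<in> {1..n} \<Longrightarrow> j \<in> {1..n} \<Longrightarrow> (\<lambda>m. f m i j) \<longlonglongrightarrow> g i j"
  shows "(\<lambda>m. det1 n (f m)) \<longlonglongrightarrow> det1 n g"
  unfolding det1_eq_detS detS_def
proof (intro tendsto_sum tendsto_mult tendsto_const tendsto_prod assms)
  fix p i assume "p \<in> {p. p permutes {1..n}}" "i \<in> {1..n}"
  then show "p i \<in> {1..n}" using permutes_in_image[of p "{1..n}" i] by simp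
qed

lemma det1_cnj: "cnj (det1 n f) = det1 n (\<lambda>i j. cnj (f i j))"
  unfolding det1_eq_detS detS_def by simp

lemma whittaker_cong_parameter: "(\<And>j. j \<in> {1..N} \<Longrightarrow> \<mu> j = \<nu> j) \<Longrightarrow> whittaker N \<mu> x = whittaker N \<nu> x"
  unfolding whittaker_def whittaker_F_def
  by (intro Bochner_Integration.integral_cong refl arg_cong[where f = exp] arg_cong2[where f = "(-)"] sum.cong arg_cong2[where f = "(*)"]) auto

lemma sklyanin_cong: "(\<And>j l. j \<in> {1..N} \<Longrightarrow> l \<in> {1..N} \<Longrightarrow> \<mu> l - \<mu> j = \<nu> l - \<nu> j) \<Longrightarrow> sklyanin N \<mu> = sklyanin N \<nu>"
  unfolding sklyanin_def pairs_def[symmetric]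
  by (intro arg_cong2[where f = "(*)"] refl prod.cong) (auto simp: pairs_def simp del: of_real_diff)

lemma Theta_bounds: "0 < Theta a x" "Theta a x \<le> 1"
  by (simp_all add: Theta_def)

lemma Theta_mono: "a > 0 \<Longrightarrow> x \<le> y \<Longrightarrow> Theta a x \<le> Theta a y"
  by (simp add: Theta_def divide_right_mono)

lemma scale_measurable:
  "(\<lambda>x. \<lambda>j\<in>{1..N}. x j / a) \<in> lborel_pow {1..N} \<rightarrow>\<^sub>M lborel_pow {1..N}"
  by (intro measurable_restrict) auto

lemma whittaker_scaled: "whittaker N \<mu> (\<lambda>j. x j / a) = whittaker N \<mu> (\<lambda>j\<in>{1..N}. x j / a)"
  by (rule whittaker_cong) simp

lemma whittaker_scaled_measurable:
  "(\<lambda>x. whittaker N \<mu> (\<lambda>j. x j / a)) \<in> borel_measurable (lborel_pow {1..N})"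
  unfolding whittaker_scaled by (rule measurable_compose[OF scale_measurable whittaker_measurable])

lemma whittaker_scaled_pair_measurable:
  assumes \<mu>: "\<And>j. j \<in> {1..N} \<Longrightarrow> (\<lambda>k. \<mu> k j) \<in> borel_measurable M"
  shows "(\<lambda>(k, x). whittaker N (\<mu> k) (\<lambda>j. x j / a)) \<in> borel_measurable (M \<Otimes>\<^sub>M lborel_pow {1..N})"
proof -
  have "(\<lambda>z. (fst z, \<lambda>j\<in>{1..N}. snd z j / a)) \<in> M \<Otimes>\<^sub>M lborel_pow {1..N} \<rightarrow>\<^sub>M M \<Otimes>\<^sub>M lborel_pow {1..N}"
    using measurable_compose[OF measurable_snd scale_measurable] by (intro measurable_Pair measurable_fst)
  from measurable_compose[OF this whittaker_measurable_pair[OF \<mu>]] show ?thesis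
    unfolding whittaker_scaled by (simp add: split_beta)
qed

text \<open>The substitution x -> h + a x turns \<open>Theta\<close> into exp (-exp (-x_1)). Its
  scaling gives a^N, and the shift of the arguments by h / a gives the exponential, by
  \<open>whittaker_shift_argument\<close>.\<close>

lemma stade_scaled:
  assumes N: "N \<ge> 1" and a: "a > 0"
    and neg: "\<And>p q. p \<in> {1..N} \<Longrightarrow> q \<in> {1..N} \<Longrightarrow> Re (\<mu> q + \<nu> p) < 0"
  shows "integrable (lborel_pow {1..N}) (\<lambda>x. of_real (Theta a (x 1 - h)) * (whittaker N \<mu> (\<lambda>j. x j / a) * whittaker N \<nu> (\<lambda>j. x j / a)))"
    and "(\<integral>x. of_real (Theta a (x 1 - h)) * (whittaker N \<mu> (\<lambda>j. x j / a) * whittaker N \<nu> (\<lambda>j. x j / a)) \<partial>lborel_pow {1..N})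
      = of_real a ^ N * exp (of_real (h / a) * (\<Sum>j=1..N. \<mu> j + \<nu> j)) * (\<Prod>p=1..N. \<Prod>q=1..N. Gamma (- (\<mu> q + \<nu> p)))"
proof -
  let ?M = "lborel_pow {1..N}"
  let ?F = "\<lambda>x. complex_of_real (Theta a (x 1 - h)) * (whittaker N \<mu> (\<lambda>j. x j / a) * whittaker N \<nu> (\<lambda>j. x j / a))"
  let ?e = "exp (of_real (h / a) * (\<Sum>j=1..N. \<mu> j + \<nu> j))"
  let ?S = "\<lambda>x. complex_of_real (exp (- exp (- x 1))) * (whittaker N \<mu> x * whittaker N \<nu> x)"
  have 1: "1 \<in> {1..N}" using N by simp
  have Fm: "?F \<in> borel_measurable ?M"
  proof -
    have [measurable]: "(\<lambda>x. x 1) \<in> borel_measurable ?M" using 1 by measurable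
    show ?thesis
      unfolding Theta_def by (intro borel_measurable_times whittaker_scaled_measurable complex_of_real_measurable) measurable
  qed
  have eq: "?F (\<lambda>i\<in>{1..N}. h + a * x i) = ?e * ?S x" for x
  proof -
    have "whittaker N \<rho> (\<lambda>j. (\<lambda>i\<in>{1..N}. h + a * x i) j / a) = exp (of_real (h / a) * (\<Sum>j=1..N. \<rho> j)) * whittaker N \<rho> x" for \<rho>
    proof -
      have "whittaker N \<rho> (\<lambda>j. (\<lambda>i\<in>{1..N}. h + a * x i) j / a) = whittaker N \<rho> (\<lambda>j. x j + h / a)"
        using a by (intro whittaker_cong) (auto simp: field_simps)
      then show ?thesis by (simp only: whittaker_shift_argument[OF N])
    qed
    moreover have "Theta a ((\<lambda>i\<in>{1..N}. h + a * x i) 1 - h) = exp (- exp (- x 1))"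
      using 1 a by (simp add: Theta_def)
    moreover have "?e = exp (of_real (h / a) * (\<Sum>j=1..N. \<mu> j)) * exp (of_real (h / a) * (\<Sum>j=1..N. \<nu> j))"
      by (simp add: sum.distrib distrib_left exp_add)
    ultimately show ?thesis by (simp only: mult_ac)
  qed
  have "integrable ?M (\<lambda>x. ?e * ?S x)"
    by (intro integrable_mult_right whittaker_stade(1)[OF N neg])
  then show "integrable ?M ?F"
    unfolding eq[symmetric] using integral_lborel_pow_affine(1)[OF _ a Fm, of h] by blast
  have "(\<integral>x. ?F x \<partial>?M) = a ^ card {1..N} *\<^sub>R (\<integral>x. ?F (\<lambda>i\<in>{1..N}. h + a * x i) \<partial>?M)"
    by (rule integral_lborel_pow_affine(2)[OF _ a Fm]) simp
  also have "\<dots> = of_real a ^ N * (?e * (\<integral>x. ?S x \<partial>?M))"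
    unfolding eq by (simp add: scaleR_conv_of_real)
  also have "(\<integral>x. ?S x \<partial>?M) = (\<Prod>p=1..N. \<Prod>q=1..N. Gamma (- (\<mu> q + \<nu> p)))"
    by (rule whittaker_stade(2)[OF N neg])
  finally show "(\<integral>x. ?F x \<partial>?M) = of_real a ^ N * ?e * (\<Prod>p=1..N. \<Prod>q=1..N. Gamma (- (\<mu> q + \<nu> p)))"
    by (simp only: mult.assoc)
qed

context spectrum
begin

text \<open>At time 1/t and threshold h/t the contour integrand of \<open>gram\<close> splits into a
  factor for j and a factor \<open>Phi\<close> for k, the shape that Andreief's identity
  requires.\<close>

lemma gram_integrand:
  assumes t: "t > 0"
  shows "exp (- ((z - of_real (\<nu> j)) / of_real (1 / t)) * of_real (h / t)) / ((z - of_real (\<nu> j)) / of_real (1 / t))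
      * (of_real (normal_density (\<nu> j) (sqrt (1 / t)) 0) * kernel k (1 / t) 0 z)
    = (exp (of_real (t / 2) * z\<^sup>2 - of_real h * z) * (of_real (1 / (2 * pi)) * exp (of_real (h * \<nu> j - t * (\<nu> j)\<^sup>2 / 2))) * (1 / (z - of_real (\<nu> j))))
      * Phi N \<nu> (\<nu> k) a z"
proof -
  let ?c = "1 / sqrt (2 * pi * (1 / t))"
  have s: "1 / t > 0" using t by simp
  have n: "complex_of_real (normal_density (\<nu> j) (sqrt (1 / t)) 0) = of_real ?c * exp (- of_real (t * (\<nu> j)\<^sup>2 / 2))"
    unfolding normal_density_sqrt[OF s] of_real_mult exp_of_real[symmetric] by (simp add: mult_ac)
  have k: "kernel k (1 / t) 0 z = of_real ?c * exp (of_real (t / 2) * z\<^sup>2) * Phi N \<nu> (\<nu> k) a z"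
    by (simp add: kernel_def mult_ac)
  have e: "exp (- ((z - of_real (\<nu> j)) / of_real (1 / t)) * of_real (h / t)) * (exp (- of_real (t * (\<nu> j)\<^sup>2 / 2)) * exp (of_real (t / 2) * z\<^sup>2))
      = exp (of_real (t / 2) * z\<^sup>2 - of_real h * z) * exp (of_real (h * \<nu> j - t * (\<nu> j)\<^sup>2 / 2))"
    unfolding exp_add[symmetric] using t by (intro arg_cong[where f = exp]) (simp add: field_simps)
  have c: "complex_of_real ?c * of_real ?c = of_real t * of_real (1 / (2 * pi))"
    unfolding of_real_mult[symmetric] of_real_eq_iff using t by simp
  have d: "1 / ((z - of_real (\<nu> j)) / of_real (1 / t)) = of_real (1 / t) * (1 / (z - of_real (\<nu> j)))"
    by simp
  let ?E = "exp (- ((z - of_real (\<nu> j)) / of_real (1 / t)) * of_real (h / t))"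
  have "?E / ((z - of_real (\<nu> j)) / of_real (1 / t)) * (of_real (normal_density (\<nu> j) (sqrt (1 / t)) 0) * kernel k (1 / t) 0 z)
    = (?E * (exp (- of_real (t * (\<nu> j)\<^sup>2 / 2)) * exp (of_real (t / 2) * z\<^sup>2))) * ((of_real ?c * of_real ?c) * (1 / ((z - of_real (\<nu> j)) / of_real (1 / t)))) * Phi N \<nu> (\<nu> k) a z"
    unfolding n k by (simp add: mult_ac)
  also have "\<dots> = (exp (of_real (t / 2) * z\<^sup>2 - of_real h * z) * exp (of_real (h * \<nu> j - t * (\<nu> j)\<^sup>2 / 2)))
      * ((of_real t * of_real (1 / (2 * pi))) * (of_real (1 / t) * (1 / (z - of_real (\<nu> j))))) * Phi N \<nu> (\<nu> k) a z"
    unfolding e c d ..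
  also have "(complex_of_real t * of_real (1 / (2 * pi))) * (of_real (1 / t) * (1 / (z - of_real (\<nu> j)))) = of_real (1 / (2 * pi)) * (1 / (z - of_real (\<nu> j)))"
    using t by simp
  finally show ?thesis by (simp only: mult_ac)
qed

definition row :: "real \<Rightarrow> real \<Rightarrow> nat \<Rightarrow> real \<Rightarrow> complex" where
  "row t h j y = exp (of_real (t / 2) * (Complex \<delta> y)\<^sup>2 - of_real h * Complex \<delta> y)
    * (of_real (1 / (2 * pi)) * exp (of_real (h * \<nu> j - t * (\<nu> j)\<^sup>2 / 2))) * (1 / (Complex \<delta> y - of_real (\<nu> j)))"

lemma gram_eq:
  assumes t: "t > 0" and j: "j \<in> {1..N}" and k: "k \<in> {1..N}"
  shows "integrable lborel (\<lambda>y. row t h j y * Phi N \<nu> (\<nu> k) a (Complex \<delta> y))"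
    and "gram (1 / t) (h / t) j k = (\<integral>y. row t h j y * Phi N \<nu> (\<nu> k) a (Complex \<delta> y) \<partial>lborel)"
proof -
  have s: "1 / t > 0" using t by simp
  have v: "\<nu> j < \<delta>" using \<nu>_bound[OF j] by auto
  note R = density_M_mart_right[OF k s v, of "h / t"]
  show "integrable lborel (\<lambda>y. row t h j y * Phi N \<nu> (\<nu> k) a (Complex \<delta> y))"
    using R(3) unfolding gram_integrand[OF t] row_def .
  show "gram (1 / t) (h / t) j k = (\<integral>y. row t h j y * Phi N \<nu> (\<nu> k) a (Complex \<delta> y) \<partial>lborel)"
    unfolding gram_def R(2) gram_integrand[OF t] row_def ..
qed

text \<open>With z_l = \<delta> + i k_l one has a z_l = 1/2 + i a k_l, so Stade's Gamma arguments
  are a (z_l - \<nu>_q) and \<open>det_product\<close> applies. The factors 1 / (2 \<pi>) of the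
  rows cancel (2 \<pi>)^N in the Sklyanin density; its N! survives until Andreief's
  identity.\<close>

lemma determinantal_integrand:
  fixes k :: "nat \<Rightarrow> real"
  assumes t: "t > 0" and k: "inj_on k {1..N}"
  defines "z \<equiv> \<lambda>l. Complex \<delta> (k l)"
  shows "det1 N (\<lambda>l j. row t h j (k l)) * det1 N (\<lambda>l q. Phi N \<nu> (\<nu> q) a (z l))
    = fact N * (exp (of_real (- t * (\<Sum>j=1..N. (a * \<nu> j)\<^sup>2) / (2 * a\<^sup>2)))
        * (exp (- of_real t * (\<Sum>j=1..N. (of_real (k j) - \<i> * of_real \<delta>)\<^sup>2) / 2) * of_real (sklyanin N (\<lambda>j. a * k j))
          * (of_real a ^ N * exp (of_real (h / a) * (\<Sum>j=1..N. of_real (a * \<nu> j) + (- \<i> * of_real (a * k j) + (- 1 / 2))))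
            * (\<Prod>p=1..N. \<Prod>q=1..N. Gamma (- (of_real (a * \<nu> q) + (- \<i> * of_real (a * k p) + (- 1 / 2))))))))"
proof -
  let ?r = "\<lambda>l. exp (of_real (t / 2) * (z l)\<^sup>2 - of_real h * z l)"
  let ?e = "\<lambda>j. exp (complex_of_real (h * \<nu> j - t * (\<nu> j)\<^sup>2 / 2))"
  let ?c = "\<lambda>j. of_real (1 / (2 * pi)) * ?e j"
  have a0: "complex_of_real a \<noteq> 0" using a by simp
  have zi: "inj_on z {1..N}"
  proof (rule inj_onI)
    fix l m assume "l \<in> {1..N}" "m \<in> {1..N}" "z l = z m"
    then show "l = m" using inj_onD[OF k, of l m] by (simp only: z_def complex.inject)
  qed
  have rez: "Re (z l) = 1 / (2 * a)" for l by (simp add: z_def \<delta>_def)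
  have W: "of_real a * (z j - z i) = \<i> * of_real (a * k j - a * k i)" for i j
    by (simp add: z_def complex_eq_iff algebra_simps)
  have sk: "(\<Prod>(i, j)\<in>pairs N. 1 / (Gamma (of_real a * (z j - z i)) * Gamma (- (of_real a * (z j - z i)))))
      = of_real ((2 * pi) ^ N * fact N) * of_real (sklyanin N (\<lambda>j. a * k j))"
    unfolding W sklyanin_eq by simp
  have G: "- (of_real (a * \<nu> q) + (- \<i> * of_real (a * k p) + (- 1 / 2))) = of_real a * (z p - of_real (\<nu> q))" for p q
    using a\<delta> by (simp add: z_def complex_eq_iff algebra_simps)
  have dp: "det1 N (\<lambda>l j. 1 / (z l - of_real (\<nu> j))) * det1 N (\<lambda>l q. Phi N \<nu> (\<nu> q) a (z l))
      = of_real a ^ N * (\<Prod>l=1..N. \<Prod>j=1..N. Gamma (of_real a * (z l - of_real (\<nu> j))))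
        * (of_real ((2 * pi) ^ N * fact N) * of_real (sklyanin N (\<lambda>j. a * k j)))"
    unfolding sk[symmetric] by (rule det_product[OF a inj small rez zi])
  have "det1 N (\<lambda>l j. row t h j (k l)) = (\<Prod>l=1..N. ?r l) * (\<Prod>j=1..N. ?c j) * det1 N (\<lambda>l j. 1 / (z l - of_real (\<nu> j)))"
    unfolding row_def z_def by (rule det1_scale)
  then have "det1 N (\<lambda>l j. row t h j (k l)) * det1 N (\<lambda>l q. Phi N \<nu> (\<nu> q) a (z l))
      = (\<Prod>l=1..N. ?r l) * (\<Prod>j=1..N. ?c j) * (det1 N (\<lambda>l j. 1 / (z l - of_real (\<nu> j))) * det1 N (\<lambda>l q. Phi N \<nu> (\<nu> q) a (z l)))"
    by (simp only: mult.assoc)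
  also have "\<dots> = (\<Prod>l=1..N. ?r l) * (\<Prod>j=1..N. ?c j) * (of_real a ^ N * (\<Prod>l=1..N. \<Prod>j=1..N. Gamma (of_real a * (z l - of_real (\<nu> j))))
      * (of_real ((2 * pi) ^ N * fact N) * of_real (sklyanin N (\<lambda>j. a * k j))))"
    by (simp only: dp)
  also have "(\<Prod>j=1..N. ?c j) = of_real (1 / (2 * pi)) ^ N * (\<Prod>j=1..N. ?e j)"
    by (simp only: prod.distrib prod_constant card_atLeastAtMost diff_Suc_1)
  also have "(\<Prod>l=1..N. ?r l) * (of_real (1 / (2 * pi)) ^ N * (\<Prod>j=1..N. ?e j)) * (of_real a ^ N * (\<Prod>l=1..N. \<Prod>j=1..N. Gamma (of_real a * (z l - of_real (\<nu> j))))
      * (of_real ((2 * pi) ^ N * fact N) * of_real (sklyanin N (\<lambda>j. a * k j))))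
    = (of_real (1 / (2 * pi)) ^ N * of_real ((2 * pi) ^ N * fact N)) * ((\<Prod>l=1..N. ?r l) * (\<Prod>j=1..N. ?e j))
      * (of_real (sklyanin N (\<lambda>j. a * k j)) * (of_real a ^ N * (\<Prod>l=1..N. \<Prod>j=1..N. Gamma (of_real a * (z l - of_real (\<nu> j))))))"
    by (simp only: mult_ac)
  also have "of_real (1 / (2 * pi)) ^ N * of_real ((2 * pi) ^ N * fact N) = (fact N :: complex)"
  proof -
    have "complex_of_real ((1 / (2 * pi)) ^ N * ((2 * pi) ^ N * fact N)) = of_real (fact N)"
      by (simp add: power_divide)
    then show ?thesis by simp
  qed
  also have "(\<Prod>l=1..N. ?r l) * (\<Prod>j=1..N. ?e j) = exp (of_real (- t * (\<Sum>j=1..N. (a * \<nu> j)\<^sup>2) / (2 * a\<^sup>2)))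
      * exp (- of_real t * (\<Sum>j=1..N. (of_real (k j) - \<i> * of_real \<delta>)\<^sup>2) / 2)
      * exp (of_real (h / a) * (\<Sum>j=1..N. of_real (a * \<nu> j) + (- \<i> * of_real (a * k j) + (- 1 / 2))))"
  proof -
    have summand: "of_real (t / 2) * (z j)\<^sup>2 - of_real h * z j + of_real (h * \<nu> j - t * (\<nu> j)\<^sup>2 / 2)
        = of_real (- t * (a * \<nu> j)\<^sup>2 / (2 * a\<^sup>2)) + - of_real t * (of_real (k j) - \<i> * of_real \<delta>)\<^sup>2 / 2
          + of_real (h / a) * (of_real (a * \<nu> j) + (- \<i> * of_real (a * k j) + (- 1 / 2)))" for j
    proof -
      \<comment> \<open>Here z = i (k - i \<delta>), so the Gaussian in z is the shifted Gaussian in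
        k.\<close>
      have m1: "(z j)\<^sup>2 = - (of_real (k j) - \<i> * of_real \<delta>)\<^sup>2"
        by (simp add: z_def Complex_eq power2_eq_square algebra_simps)
      have m2: "of_real (h / a) * (of_real (a * \<nu> j) + (- \<i> * of_real (a * k j) + (- 1 / 2))) = of_real (h * \<nu> j) - of_real h * z j"
        using a by (simp add: z_def \<delta>_def complex_eq_iff field_simps)
      have m3: "- t * (a * \<nu> j)\<^sup>2 / (2 * a\<^sup>2) = - t * (\<nu> j)\<^sup>2 / 2" using a by (simp add: power_mult_distrib)
      show ?thesis unfolding m1 m2 m3 by (simp add: algebra_simps)
    qed
    have "(\<Prod>l=1..N. ?r l) * (\<Prod>j=1..N. ?e j) = exp (\<Sum>j=1..N. of_real (t / 2) * (z j)\<^sup>2 - of_real h * z j + of_real (h * \<nu> j - t * (\<nu> j)\<^sup>2 / 2))"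
      by (simp add: exp_sum prod.distrib exp_add)
    also have "(\<Sum>j=1..N. of_real (t / 2) * (z j)\<^sup>2 - of_real h * z j + of_real (h * \<nu> j - t * (\<nu> j)\<^sup>2 / 2))
        = of_real (- t * (\<Sum>j=1..N. (a * \<nu> j)\<^sup>2) / (2 * a\<^sup>2)) + - of_real t * (\<Sum>j=1..N. (of_real (k j) - \<i> * of_real \<delta>)\<^sup>2) / 2
          + of_real (h / a) * (\<Sum>j=1..N. of_real (a * \<nu> j) + (- \<i> * of_real (a * k j) + (- 1 / 2)))"
    proof -
      have p1: "complex_of_real (- t * (\<Sum>j=1..N. (a * \<nu> j)\<^sup>2) / (2 * a\<^sup>2)) = (\<Sum>j=1..N. of_real (- t * (a * \<nu> j)\<^sup>2 / (2 * a\<^sup>2)))"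
        by (simp only: sum_distrib_left sum_divide_distrib of_real_sum)
      have p2: "- of_real t * (\<Sum>j=1..N. (of_real (k j) - \<i> * of_real \<delta>)\<^sup>2) / 2 = (\<Sum>j=1..N. - of_real t * (of_real (k j) - \<i> * of_real \<delta>)\<^sup>2 / 2)"
        by (simp only: sum_distrib_left sum_divide_distrib)
      have p3: "of_real (h / a) * (\<Sum>j=1..N. of_real (a * \<nu> j) + (- \<i> * of_real (a * k j) + (- 1 / 2)))
          = (\<Sum>j=1..N. of_real (h / a) * (of_real (a * \<nu> j) + (- \<i> * of_real (a * k j) + (- 1 / 2))))"
        by (rule sum_distrib_left)
      show ?thesis unfolding p1 p2 p3 unfolding summand sum.distrib by (rule refl)
    qed
    finally show ?thesis by (simp only: exp_add)
  qed
  finally show ?thesis unfolding G by (simp only: mult_ac)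
qed

text \<open>\<open>diagonal_contour_shift\<close> applies with shift \<delta>: the Sklyanin density
  depends on differences, and a common shift of the parameters multiplies the Whittaker function by
  an exponential. The shift lowers each parameter by a \<delta> = 1/2.\<close>

lemma shifted_density:
  assumes N: "N \<ge> 1" and t: "t > 0"
  shows "oconnell_density N (\<lambda>j. a * \<nu> j) a t x
    = of_real (exp (- t * (\<Sum>j=1..N. (a * \<nu> j)\<^sup>2) / (2 * a\<^sup>2))) * whittaker N (\<lambda>j. of_real (a * \<nu> j)) (\<lambda>j. x j / a)
      * (\<integral>k. exp (- of_real t * (\<Sum>j=1..N. (of_real (k j) - \<i> * of_real \<delta>)\<^sup>2) / 2) * of_real (sklyanin N (\<lambda>j. a * k j))
          * whittaker N (\<lambda>j. - \<i> * of_real (a * k j) + (- 1 / 2)) (\<lambda>j. x j / a) \<partial>lborel_pow {1..N})"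
proof -
  let ?M = "lborel_pow {1..N}"
  let ?w = "\<lambda>k. whittaker N (\<lambda>j. - \<i> * complex_of_real (a * k j)) (\<lambda>j. x j / a)"
  let ?s = "\<lambda>k. complex_of_real (sklyanin N (\<lambda>j. a * k j))"
  let ?G = "\<lambda>k. ?w k * ?s k"
  let ?X = "\<Sum>j=1..N. x j"
  have wm: "?w \<in> borel_measurable ?M"
  proof -
    let ?y = "\<lambda>j\<in>{1..N}. x j / a"
    have "?y \<in> space ?M" by (auto simp: space_PiM)
    then have "(\<lambda>k. (k, ?y)) \<in> ?M \<rightarrow>\<^sub>M ?M \<Otimes>\<^sub>M ?M" by (rule measurable_Pair2')
    moreover have "(\<lambda>(k, x). whittaker N (\<lambda>j. - \<i> * complex_of_real (a * k j)) x) \<in> borel_measurable (?M \<Otimes>\<^sub>M ?M)"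
      by (rule whittaker_measurable_pair) measurable
    ultimately have "(\<lambda>k. whittaker N (\<lambda>j. - \<i> * complex_of_real (a * k j)) ?y) \<in> borel_measurable ?M"
      using measurable_compose by fastforce
    then show ?thesis unfolding whittaker_scaled[of N _ x a] .
  qed
  have sm: "?s \<in> borel_measurable ?M" by (intro complex_of_real_measurable sklyanin_measurable)
  have Gm: "?G \<in> borel_measurable ?M" using wm sm by (rule borel_measurable_times)
  have sumx: "(\<Sum>k=1..N. x k / a) = ?X / a" by (simp add: sum_divide_distrib)
  have equi: "?G (\<lambda>i\<in>{1..N}. k i + c) = exp (- \<i> * of_real (c * ?X)) * ?G k" for k c
  proof -
    have "?w (\<lambda>i\<in>{1..N}. k i + c) = whittaker N (\<lambda>j. - \<i> * complex_of_real (a * k j) + - \<i> * of_real (a * c)) (\<lambda>j. x j / a)"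
      by (rule whittaker_cong_parameter) (simp add: algebra_simps)
    also have "\<dots> = exp (- \<i> * of_real (a * c) * of_real (?X / a)) * ?w k"
      unfolding whittaker_shift_parameter[OF N] sumx ..
    also have "- \<i> * complex_of_real (a * c) * of_real (?X / a) = - \<i> * of_real (c * ?X)" using a by simp
    finally have "?w (\<lambda>i\<in>{1..N}. k i + c) = exp (- \<i> * of_real (c * ?X)) * ?w k" .
    moreover have "sklyanin N (\<lambda>j. a * (\<lambda>i\<in>{1..N}. k i + c) j) = sklyanin N (\<lambda>j. a * k j)"
      by (rule sklyanin_cong) (simp add: algebra_simps)
    ultimately show ?thesis by (simp only: mult.assoc)
  qed
  \<comment> \<open>Imaginary parameters are dominated by the parameter 0, giving a bound constant
    in k.\<close>
  have bound: "norm (?w k) \<le> Re (whittaker N (\<lambda>_. 0) (\<lambda>j. x j / a))" for k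
    using norm_whittaker_le[of N "\<lambda>j. - \<i> * complex_of_real (a * k j)" "\<lambda>j. x j / a"] by simp
  have int: "integrable ?M (\<lambda>k. of_real (exp (- t * (\<Sum>j=1..N. (k j)\<^sup>2) / 2)) * ?G k)"
  proof (rule Bochner_Integration.integrable_bound)
    show "integrable ?M (\<lambda>k. exp (- t * (\<Sum>j=1..N. (k j)\<^sup>2) / 2) * sklyanin N (\<lambda>j. a * k j) * Re (whittaker N (\<lambda>_. 0) (\<lambda>j. x j / a)))"
      by (intro integrable_mult_left sklyanin_gaussian_integrable t)
    show "(\<lambda>k. of_real (exp (- t * (\<Sum>j=1..N. (k j)\<^sup>2) / 2)) * ?G k) \<in> borel_measurable ?M"
      by (intro borel_measurable_times Gm complex_of_real_measurable) measurable
    show "AE k in ?M. norm (of_real (exp (- t * (\<Sum>j=1..N. (k j)\<^sup>2) / 2)) * ?G k)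
        \<le> norm (exp (- t * (\<Sum>j=1..N. (k j)\<^sup>2) / 2) * sklyanin N (\<lambda>j. a * k j) * Re (whittaker N (\<lambda>_. 0) (\<lambda>j. x j / a)))"
    proof (rule AE_I2)
      fix k
      have "norm (of_real (exp (- t * (\<Sum>j=1..N. (k j)\<^sup>2) / 2)) * ?G k)
          = exp (- t * (\<Sum>j=1..N. (k j)\<^sup>2) / 2) * sklyanin N (\<lambda>j. a * k j) * norm (?w k)"
        using sklyanin_nonneg[of N "\<lambda>j. a * k j"] by (simp add: norm_mult)
      also have "\<dots> \<le> exp (- t * (\<Sum>j=1..N. (k j)\<^sup>2) / 2) * sklyanin N (\<lambda>j. a * k j) * Re (whittaker N (\<lambda>_. 0) (\<lambda>j. x j / a))"
        using sklyanin_nonneg[of N "\<lambda>j. a * k j"] by (intro mult_left_mono bound) simp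
      finally show "norm (of_real (exp (- t * (\<Sum>j=1..N. (k j)\<^sup>2) / 2)) * ?G k)
        \<le> norm (exp (- t * (\<Sum>j=1..N. (k j)\<^sup>2) / 2) * sklyanin N (\<lambda>j. a * k j) * Re (whittaker N (\<lambda>_. 0) (\<lambda>j. x j / a)))"
        by (simp only: real_norm_def)
    qed
  qed
  have half: "of_real (exp (- \<delta> * ?X)) * ?w k = whittaker N (\<lambda>j. - \<i> * complex_of_real (a * k j) + (- 1 / 2)) (\<lambda>j. x j / a)" for k
  proof -
    have "complex_of_real (exp (- \<delta> * ?X)) = exp (- 1 / 2 * of_real (?X / a))"
      unfolding exp_of_real[symmetric] by (rule arg_cong[where f = exp]) (simp add: \<delta>_def)
    then show ?thesis unfolding whittaker_shift_parameter[OF N] sumx by simp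
  qed
  have "(\<integral>k. of_real (exp (- t * (\<Sum>j=1..N. (k j)\<^sup>2) / 2)) * ?G k \<partial>?M)
      = (\<integral>k. exp (- of_real t * (\<Sum>j=1..N. (of_real (k j) - \<i> * of_real \<delta>)\<^sup>2) / 2) * (of_real (exp (- \<delta> * ?X)) * ?G k) \<partial>?M)"
    by (rule diagonal_contour_shift[OF N t Gm equi int])
  also have "\<dots> = (\<integral>k. exp (- of_real t * (\<Sum>j=1..N. (of_real (k j) - \<i> * of_real \<delta>)\<^sup>2) / 2) * ?s k
          * whittaker N (\<lambda>j. - \<i> * of_real (a * k j) + (- 1 / 2)) (\<lambda>j. x j / a) \<partial>?M)"
    unfolding half[symmetric] by (simp only: mult_ac)
  finally show ?thesis
    unfolding oconnell_density_def by (simp only: mult.assoc)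
qed

text \<open>The exchange of the integrals over x and k is the crux. In k the Gaussian times the
  Sklyanin density is integrable; in x the majorant \<theta> \<psi> \<open>?b\<close>, with
  \<open>?b\<close> the Whittaker function of constant parameters -1/2, is integrable by Stade's
  identity.\<close>

lemma density_expectation:
  assumes N: "N \<ge> 1" and t: "t > 0"
  shows "integrable (lborel_pow {1..N}) (\<lambda>x. of_real (Theta a (x 1 - h)) * oconnell_density N (\<lambda>j. a * \<nu> j) a t x)"
    and "(\<integral>x. of_real (Theta a (x 1 - h)) * oconnell_density N (\<lambda>j. a * \<nu> j) a t x \<partial>lborel_pow {1..N}) = det1 N (gram (1 / t) (h / t))"
proof -
  let ?M = "lborel_pow {1..N}"
  interpret M: sigma_finite_measure ?M by (rule sigma_finite_lborel_pow) simp
  interpret P: pair_sigma_finite ?M ?M ..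
  have 1: "1 \<in> {1..N}" using N by simp
  define C0 where "C0 = complex_of_real (exp (- t * (\<Sum>j=1..N. (a * \<nu> j)\<^sup>2) / (2 * a\<^sup>2)))"
  define \<psi> where "\<psi> = (\<lambda>x. whittaker N (\<lambda>j. complex_of_real (a * \<nu> j)) (\<lambda>j. x j / a))"
  define \<xi> where "\<xi> = (\<lambda>k x. whittaker N (\<lambda>j. - \<i> * complex_of_real (a * k j) + (- 1 / 2)) (\<lambda>j. x j / a))"
  define E where "E = (\<lambda>k. exp (- of_real t * (\<Sum>j=1..N. (of_real (k j) - \<i> * of_real \<delta>)\<^sup>2) / 2) * complex_of_real (sklyanin N (\<lambda>j. a * k j)))"
  define \<theta> where "\<theta> = (\<lambda>x::nat \<Rightarrow> real. complex_of_real (Theta a (x 1 - h)))"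
  let ?b = "\<lambda>x. whittaker N (\<lambda>_. - 1 / 2) (\<lambda>j. x j / a)"
  have dens: "\<theta> x * oconnell_density N (\<lambda>j. a * \<nu> j) a t x = C0 * (\<integral>k. \<theta> x * (\<psi> x * (E k * \<xi> k x)) \<partial>?M)" for x
  proof -
    have "oconnell_density N (\<lambda>j. a * \<nu> j) a t x = C0 * \<psi> x * (\<integral>k. E k * \<xi> k x \<partial>?M)"
      unfolding shifted_density[OF N t] C0_def \<psi>_def \<xi>_def E_def by (rule refl)
    then have "\<theta> x * oconnell_density N (\<lambda>j. a * \<nu> j) a t x = C0 * (\<theta> x * (\<psi> x * (\<integral>k. E k * \<xi> k x \<partial>?M)))"
      by (simp only: mult_ac)
    then show ?thesis by (simp only: integral_mult_right_zero)
  qed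
  \<comment> \<open>Here the bound a |\<nu>_j| < 1/2 meets the sign condition of Stade's
    identity.\<close>
  have neg: "Re (of_real (a * \<nu> q) + (- \<i> * of_real (a * k p) + (- 1 / 2))) < 0" if "q \<in> {1..N}" for k p q
  proof -
    have "\<bar>a * \<nu> q\<bar> < 1 / 2" using small[OF that] a by (simp add: abs_mult)
    then show ?thesis by simp
  qed
  have \<psi>m[measurable]: "\<psi> \<in> borel_measurable ?M" unfolding \<psi>_def by (rule whittaker_scaled_measurable)
  have \<theta>m[measurable]: "\<theta> \<in> borel_measurable ?M"
  proof -
    have [measurable]: "(\<lambda>x. x 1) \<in> borel_measurable ?M" using 1 by measurable
    show ?thesis unfolding \<theta>_def Theta_def by (intro complex_of_real_measurable) measurable
  qed
  have Em[measurable]: "E \<in> borel_measurable ?M"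
    unfolding E_def by (intro borel_measurable_times complex_of_real_measurable sklyanin_measurable) measurable
  have \<xi>m: "(\<lambda>(k, x). \<xi> k x) \<in> borel_measurable (?M \<Otimes>\<^sub>M ?M)"
    unfolding \<xi>_def by (rule whittaker_scaled_pair_measurable) measurable
  let ?g = "\<lambda>(k, x). \<theta> x * (\<psi> x * (E k * \<xi> k x))"
  have gm: "?g \<in> borel_measurable (?M \<Otimes>\<^sub>M ?M)" using \<xi>m unfolding split_beta by measurable
  \<comment> \<open>In modulus the contour shift costs only the constant exp (t N \<delta>^2 /
    2).\<close>
  have nE: "norm (E k) = exp (t * N * \<delta>\<^sup>2 / 2) * (exp (- t * (\<Sum>j=1..N. (k j)\<^sup>2) / 2) * sklyanin N (\<lambda>j. a * k j))" for k
  proof -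
    have "Re (- of_real t * (\<Sum>j=1..N. (of_real (k j) - \<i> * of_real \<delta>)\<^sup>2) / 2) = t * N * \<delta>\<^sup>2 / 2 + - t * (\<Sum>j=1..N. (k j)\<^sup>2) / 2"
      by (simp add: Re_sum power2_eq_square sum_subtractf) (simp add: field_simps)
    then have "norm (exp (- of_real t * (\<Sum>j=1..N. (of_real (k j) - \<i> * of_real \<delta>)\<^sup>2) / 2)) = exp (t * N * \<delta>\<^sup>2 / 2) * exp (- t * (\<Sum>j=1..N. (k j)\<^sup>2) / 2)"
      by (simp only: norm_exp_eq_Re exp_add)
    then show ?thesis
      using sklyanin_nonneg[of N "\<lambda>j. a * k j"] unfolding E_def norm_mult norm_of_real by simp
  qed
  have Ei: "integrable ?M (\<lambda>k. norm (E k))"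
    unfolding nE by (intro integrable_mult_right sklyanin_gaussian_integrable t)
  have bi: "integrable ?M (\<lambda>x. norm (\<theta> x * (\<psi> x * ?b x)))"
    unfolding \<theta>_def \<psi>_def using neg[of _ "\<lambda>_. 0"] by (intro integrable_norm stade_scaled(1)[OF N a]) auto
  have \<xi>b: "norm (\<xi> k x) \<le> norm (?b x)" for k x
  proof -
    have "norm (\<xi> k x) \<le> Re (whittaker N (\<lambda>j. of_real (Re (- \<i> * complex_of_real (a * k j) + (- 1 / 2)))) (\<lambda>j. x j / a))"
      unfolding \<xi>_def by (rule norm_whittaker_le)
    also have "\<dots> = Re (?b x)" by simp
    also have "\<dots> \<le> norm (?b x)" by (rule complex_Re_le_cmod)
    finally show ?thesis .
  qed
  have g: "integrable (?M \<Otimes>\<^sub>M ?M) ?g"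
  proof (rule Bochner_Integration.integrable_bound[OF P.integrable_times[OF Ei bi] gm], rule AE_I2)
    fix p :: "(nat \<Rightarrow> real) \<times> (nat \<Rightarrow> real)"
    obtain k x where p: "p = (k, x)" by (cases p)
    have "norm (?g (k, x)) = norm (E k) * (norm (\<theta> x * \<psi> x) * norm (\<xi> k x))"
      by (simp add: norm_mult)
    also have "\<dots> \<le> norm (E k) * (norm (\<theta> x * \<psi> x) * norm (?b x))"
      by (intro mult_left_mono \<xi>b) auto
    finally show "norm (?g p) \<le> norm (case p of (k, x) \<Rightarrow> norm (E k) * norm (\<theta> x * (\<psi> x * ?b x)))"
      by (simp add: p norm_mult)
  qed
  have dens': "(\<lambda>x. of_real (Theta a (x 1 - h)) * oconnell_density N (\<lambda>j. a * \<nu> j) a t x) = (\<lambda>x. C0 * (\<integral>k. ?g (k, x) \<partial>?M))"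
    using dens by (auto simp: \<theta>_def)
  have gx: "integrable ?M (\<lambda>x. \<integral>k. ?g (k, x) \<partial>?M)"
    using P.integrable_snd[of "\<lambda>k x. ?g (k, x)"] g by simp
  show "integrable ?M (\<lambda>x. of_real (Theta a (x 1 - h)) * oconnell_density N (\<lambda>j. a * \<nu> j) a t x)"
    unfolding dens' using gx by (rule integrable_mult_right)
  let ?D = "\<lambda>k. det1 N (\<lambda>l j. row t h j (k l)) * det1 N (\<lambda>l q. Phi N \<nu> (\<nu> q) a (Complex \<delta> (k l)))"
  \<comment> \<open>\<open>determinantal_integrand\<close> asks for distinct k_l; coincidences form
    a null set.\<close>
  have AE: "AE k in ?M. C0 * (\<integral>x. ?g (k, x) \<partial>?M) = 1 / fact N * ?D k"
    using AE_distinct_coordinates[of "{1..N}", OF finite_atLeastAtMost]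
  proof eventually_elim
    case (elim k)
    have "(\<integral>x. ?g (k, x) \<partial>?M) = (\<integral>x. E k * (\<theta> x * (\<psi> x * \<xi> k x)) \<partial>?M)"
      by (simp only: prod.case mult_ac)
    also have "\<dots> = E k * (\<integral>x. \<theta> x * (\<psi> x * \<xi> k x) \<partial>?M)" by (rule integral_mult_right_zero)
    also have "(\<integral>x. \<theta> x * (\<psi> x * \<xi> k x) \<partial>?M)
        = of_real a ^ N * exp (of_real (h / a) * (\<Sum>j=1..N. of_real (a * \<nu> j) + (- \<i> * of_real (a * k j) + (- 1 / 2))))
            * (\<Prod>p=1..N. \<Prod>q=1..N. Gamma (- (of_real (a * \<nu> q) + (- \<i> * of_real (a * k p) + (- 1 / 2)))))"
      unfolding \<theta>_def \<psi>_def \<xi>_def by (rule stade_scaled(2)[OF N a neg])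
    finally show ?case
      unfolding determinantal_integrand[OF t elim] C0_def E_def exp_of_real by simp
  qed
  have gk: "integrable ?M (\<lambda>k. \<integral>x. ?g (k, x) \<partial>?M)" using P.integrable_fst'[OF g] .
  have "(\<integral>x. of_real (Theta a (x 1 - h)) * oconnell_density N (\<lambda>j. a * \<nu> j) a t x \<partial>?M) = C0 * (\<integral>x. (\<integral>k. ?g (k, x) \<partial>?M) \<partial>?M)"
    unfolding dens' by (rule integral_mult_right_zero)
  also have "(\<integral>x. (\<integral>k. ?g (k, x) \<partial>?M) \<partial>?M) = (\<integral>k. (\<integral>x. ?g (k, x) \<partial>?M) \<partial>?M)"
    using P.Fubini_integral[of "\<lambda>k x. ?g (k, x)"] g by simp
  also have "C0 * (\<integral>k. (\<integral>x. ?g (k, x) \<partial>?M) \<partial>?M) = (\<integral>k. C0 * (\<integral>x. ?g (k, x) \<partial>?M) \<partial>?M)"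
    by (rule integral_mult_right_zero[symmetric])
  also have "\<dots> = (\<integral>k. 1 / fact N * ?D k \<partial>?M)"
  proof (rule integral_cong_AE[OF _ _ AE])
    show "(\<lambda>k. C0 * (\<integral>x. ?g (k, x) \<partial>?M)) \<in> borel_measurable ?M"
      using gk by (intro borel_measurable_times borel_measurable_const borel_measurable_integrable)
    have [measurable]: "(\<lambda>y. Complex \<delta> y) \<in> borel_measurable borel"
      by (intro borel_measurable_continuous_onI) (simp add: Complex_eq continuous_intros)
    have [measurable]: "row t h j \<in> borel_measurable borel" for j unfolding row_def by measurable
    have [measurable]: "(\<lambda>y. Phi N \<nu> (\<nu> q) a (Complex \<delta> y)) \<in> borel_measurable borel" if "q \<in> {1..N}" for q
      using kernel_line_measurable(1)[OF that, of \<delta>] \<delta>_pos by simp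
    have mem: "p l \<in> {1..N}" if "p permutes {1..N}" "l \<in> {1..N}" for p l
      using that permutes_in_image[of p "{1..N}" l] by simp
    have "(\<lambda>k. row t h (p l) (k l)) \<in> borel_measurable ?M" if "l \<in> {1..N}" for p l
      using that by measurable
    moreover have "(\<lambda>k. Phi N \<nu> (\<nu> (p l)) a (Complex \<delta> (k l))) \<in> borel_measurable ?M" if "l \<in> {1..N}" "p permutes {1..N}" for p l
      by (rule measurable_compose[OF _ kernel_line_measurable(1)[OF mem[OF that(2,1)], of \<delta>]]) (use that \<delta>_pos in auto)
    ultimately show "(\<lambda>k. 1 / fact N * ?D k) \<in> borel_measurable ?M"
      unfolding det1_eq_detS detS_def
      by (intro borel_measurable_times borel_measurable_const borel_measurable_sum borel_measurable_prod) auto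
  qed
  also have "\<dots> = 1 / fact N * (fact N * det1 N (\<lambda>j q. \<integral>y. row t h j y * Phi N \<nu> (\<nu> q) a (Complex \<delta> y) \<partial>lborel))"
    using andreief[of N "row t h" "\<lambda>q y. Phi N \<nu> (\<nu> q) a (Complex \<delta> y)"] gram_eq(1)[OF t] by simp
  also have "\<dots> = det1 N (\<lambda>j q. \<integral>y. row t h j y * Phi N \<nu> (\<nu> q) a (Complex \<delta> y) \<partial>lborel)" by simp
  also have "\<dots> = det1 N (gram (1 / t) (h / t))"
    by (intro det1_cong gram_eq(2)[OF t, symmetric])
  finally show "(\<integral>x. of_real (Theta a (x 1 - h)) * oconnell_density N (\<lambda>j. a * \<nu> j) a t x \<partial>?M) = det1 N (gram (1 / t) (h / t))" .
qed

lemma gram_real: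
  assumes "j \<in> {1..N}" "k \<in> {1..N}" "s > 0"
  shows "cnj (gram s c j k) = gram s c j k"
  unfolding gram_def Bochner_Integration.integral_cnj[symmetric]
  by (intro Bochner_Integration.integral_cong refl) (simp add: scaleR_conv_of_real M_mart_real[OF assms(2,3)])

text \<open>As the threshold tends to -\<infinity> the half-line integral becomes the
  biorthogonality integral of \<open>density_M_mart\<close>. This is what reveals the total mass of
  the signed density.\<close>

lemma gram_tendsto:
  assumes j: "j \<in> {1..N}" and k: "k \<in> {1..N}" and s: "s > 0" and c: "filterlim c at_bot sequentially"
  shows "(\<lambda>n. gram s (c n) j k) \<longlonglongrightarrow> (if j = k then 1 else 0)"
proof -
  let ?g = "\<lambda>x. of_real (normal_density (\<nu> j) (sqrt s) x) * M_mart N \<nu> (\<nu> k) a s x"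
  have g: "integrable lborel ?g" by (rule density_M_mart(1)[OF j k s])
  have [measurable]: "?g \<in> borel_measurable lborel" using g by (rule borel_measurable_integrable)
  have "(\<lambda>n. \<integral>x. indicator {c n..} x *\<^sub>R ?g x \<partial>lborel) \<longlonglongrightarrow> (\<integral>x. ?g x \<partial>lborel)"
  proof (rule integral_dominated_convergence[where w = "\<lambda>x. norm (?g x)"])
    show "AE x in lborel. (\<lambda>n. indicator {c n..} x *\<^sub>R ?g x) \<longlonglongrightarrow> ?g x"
    proof (rule AE_I2, rule tendsto_eventually)
      fix x :: real
      have "eventually (\<lambda>n. c n \<le> x) sequentially" using c by (simp add: filterlim_at_bot)
      then show "eventually (\<lambda>n. indicator {c n..} x *\<^sub>R ?g x = ?g x) sequentially"
        by eventually_elim simp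
    qed
    show "AE x in lborel. norm (indicator {c n..} x *\<^sub>R ?g x) \<le> norm (?g x)" for n
      by (rule AE_I2) (simp add: indicator_def)
    show "(\<lambda>x. indicator {c n..} x *\<^sub>R ?g x) \<in> borel_measurable lborel" for n by measurable
  qed (use g in \<open>simp_all add: integrable_norm\<close>)
  then show ?thesis unfolding gram_def density_M_mart(2)[OF j k s] .
qed

text \<open>The minus sign of det (1 - K) is carried by the function -1(x < c).\<close>

lemma gram_fredholm:
  assumes j: "j \<in> {1..N}" and k: "k \<in> {1..N}" and s: "s > 0"
  shows "integrable lborel (\<lambda>x. of_real (- of_bool (x < c)) * of_real (normal_density (\<nu> j) (sqrt s) x) * M_mart N \<nu> (\<nu> k) a s x)"
    and "(if k = j then 1 else 0) + (\<integral>x. of_real (- of_bool (x < c)) * of_real (normal_density (\<nu> j) (sqrt s) x) * M_mart N \<nu> (\<nu> k) a s x \<partial>lborel)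
      = gram s c j k"
proof -
  let ?g = "\<lambda>x. of_real (normal_density (\<nu> j) (sqrt s) x) * M_mart N \<nu> (\<nu> k) a s x"
  have g: "integrable lborel ?g" by (rule density_M_mart(1)[OF j k s])
  have i: "integrable lborel (\<lambda>x. indicator {c..} x *\<^sub>R ?g x)" by (rule integrable_mult_indicator[OF _ g]) simp
  have eq: "of_real (- of_bool (x < c)) * of_real (normal_density (\<nu> j) (sqrt s) x) * M_mart N \<nu> (\<nu> k) a s x
      = indicator {c..} x *\<^sub>R ?g x - ?g x" for x
    by (simp add: indicator_def)
  show "integrable lborel (\<lambda>x. of_real (- of_bool (x < c)) * of_real (normal_density (\<nu> j) (sqrt s) x) * M_mart N \<nu> (\<nu> k) a s x)"
    unfolding eq using i g by (rule Bochner_Integration.integrable_diff)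
  show "(if k = j then 1 else 0) + (\<integral>x. of_real (- of_bool (x < c)) * of_real (normal_density (\<nu> j) (sqrt s) x) * M_mart N \<nu> (\<nu> k) a s x \<partial>lborel)
      = gram s c j k"
    unfolding eq Bochner_Integration.integral_diff[OF i g] density_M_mart(2)[OF j k s] gram_def by simp
qed

lemma fredholm_gram:
  assumes s: "s > 0"
  shows "fredholm_expansion s (oconnell_kernel N \<nu> a) (\<lambda>x. - of_bool (x < c)) (det1 N (gram s c))"
proof -
  let ?\<alpha> = "\<lambda>u x. complex_of_real (normal_density (\<nu> u) (sqrt s) x)" and ?\<beta> = "\<lambda>u. M_mart N \<nu> (\<nu> u) a s"
  have K: "oconnell_kernel N \<nu> a s x s y = (\<Sum>u=1..N. ?\<alpha> u x * ?\<beta> u y)" for x y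
    unfolding oconnell_kernel_def using inj by (simp add: sum.reindex)
  have "fredholm_expansion s (oconnell_kernel N \<nu> a) (\<lambda>x. - of_bool (x < c))
      (det1 N (\<lambda>u v. (if u = v then 1 else 0) + (\<integral>x. complex_of_real (- of_bool (x < c)) * ?\<alpha> v x * ?\<beta> u x \<partial>lborel)))"
  proof (rule fredholm_expansion_finite_rank)
    show "oconnell_kernel N \<nu> a s x s y = (\<Sum>u=1..N. ?\<alpha> u x * ?\<beta> u y)" for x y by (rule K)
    show "integrable lborel (\<lambda>x. complex_of_real (- of_bool (x < c)) * ?\<alpha> v x * ?\<beta> u x)" if "u \<in> {1..N}" "v \<in> {1..N}" for u v
      by (rule gram_fredholm(1)[OF that(2,1) s])
  qed
  \<comment> \<open>The finite rank formula puts the row index on \<open>?\<beta>\<close> and the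
    column index on \<open>?\<alpha>\<close>, so the transpose of \<open>gram\<close>
    appears.\<close>
  also have "det1 N (\<lambda>u v. (if u = v then 1 else 0) + (\<integral>x. complex_of_real (- of_bool (x < c)) * ?\<alpha> v x * ?\<beta> u x \<partial>lborel))
      = det1 N (\<lambda>u v. gram s c v u)"
    by (intro det1_cong gram_fredholm(2)[OF _ _ s])
  also have "\<dots> = det1 N (gram s c)" by (rule det1_transpose)
  finally show ?thesis .
qed

text \<open>
  The definition of the process only provides the positive part of the density. Its negative part
  vanishes because the signed density already has total mass \<open>1\<close>, which is seen in the limit
  \<open>h \<rightarrow> -\<infinity>\<close>.
\<close>

lemma process_expectation:
  assumes N: "N \<ge> 1" and t: "t > 0" and X: "oconnell_process P N (\<lambda>j. a * \<nu> j) a X"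
  shows "complex_of_real (\<integral>\<omega>. Theta a (X t \<omega> 1 - h) \<partial>P) = det1 N (gram (1 / t) (h / t))"
proof -
  let ?M = "lborel_pow {1..N}"
  interpret prob_space P using X by (simp add: oconnell_process_def)
  have 1: "1 \<in> {1..N}" using N by simp
  have s: "1 / t > 0" using t by simp
  define q where "q = (\<lambda>x. Re (oconnell_density N (\<lambda>j. a * \<nu> j) a t x))"
  define r where "r = (\<lambda>h. Re (det1 N (gram (1 / t) (h / t))))"
  define \<theta> where "\<theta> = (\<lambda>h x. Theta a (x (1::nat) - h))"
  have x1[measurable]: "(\<lambda>x. x 1) \<in> borel_measurable ?M" using 1 by measurable
  have \<theta>m[measurable]: "\<theta> h \<in> borel_measurable ?M" for h unfolding \<theta>_def Theta_def by measurable
  have Re_eq: "Re (of_real (Theta a (x 1 - h)) * oconnell_density N (\<lambda>j. a * \<nu> j) a t x) = \<theta> h x * q x" for h x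
    by (simp add: q_def \<theta>_def)
  have \<theta>q: "integrable ?M (\<lambda>x. \<theta> h x * q x)" "(\<integral>x. \<theta> h x * q x \<partial>?M) = r h" for h
    using integrable_Re[OF density_expectation(1)[OF N t, of h]] integral_Re[OF density_expectation(1)[OF N t, of h]]
    unfolding Re_eq density_expectation(2)[OF N t] r_def .
  have \<theta>0: "\<theta> h x > 0" "\<theta> h x \<le> 1" for h x by (simp_all add: \<theta>_def Theta_bounds)
  \<comment> \<open>\<open>density_expectation\<close> concerns \<theta> q; dividing by the positive
    function \<theta> recovers q.\<close>
  have qm[measurable]: "q \<in> borel_measurable ?M"
  proof -
    have "(\<lambda>x. (\<theta> 0 x * q x) / \<theta> 0 x) \<in> borel_measurable ?M"
      using borel_measurable_integrable[OF \<theta>q(1)[of 0]] by measurable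
    then show ?thesis using \<theta>0[of 0] by (simp add: less_imp_neq[symmetric])
  qed
  define q1 where "q1 = (\<lambda>x. max 0 (q x))"
  define q2 where "q2 = (\<lambda>x. max 0 (- q x))"
  have q1m[measurable]: "q1 \<in> borel_measurable ?M" unfolding q1_def by measurable
  have q2m[measurable]: "q2 \<in> borel_measurable ?M" unfolding q2_def by measurable
  have q10: "q1 x \<ge> 0" and q20: "q2 x \<ge> 0" and q12: "q x = q1 x - q2 x" for x by (auto simp: q1_def q2_def)
  \<comment> \<open>\<open>ennreal\<close> truncates negative values to 0, so \<open>X t\<close> is
    distributed with density \<open>q1\<close>.\<close>
  have q1_eq: "(\<lambda>x. ennreal (q x)) = (\<lambda>x. ennreal (q1 x))"
    by (auto simp: q1_def max_def ennreal_neg fun_eq_iff)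
  have D: "distributed P ?M (X t) (\<lambda>x. ennreal (q1 x))"
    unfolding q1_eq[symmetric] q_def using X t unfolding oconnell_process_def by blast
  note I = distributed_complex_integral[OF D _ q10 q1m]
  have q1i: "integrable ?M q1" and q1I: "(\<integral>x. q1 x \<partial>?M) = 1"
  proof -
    have "integrable ?M (\<lambda>x. q1 x *\<^sub>R (1::complex))" using I(1)[of "\<lambda>_. 1"] by simp
    then have "integrable ?M (\<lambda>x. complex_of_real (q1 x))" by (simp add: scaleR_conv_of_real)
    from integrable_Re[OF this] show "integrable ?M q1" by simp
    have "complex_of_real 1 = (\<integral>x. q1 x *\<^sub>R (1::complex) \<partial>?M)" using I(2)[of "\<lambda>_. 1"] by (simp add: prob_space)
    then have "complex_of_real 1 = complex_of_real (\<integral>x. q1 x \<partial>?M)" by (simp add: scaleR_conv_of_real)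
    then show "(\<integral>x. q1 x \<partial>?M) = 1" by (simp only: of_real_eq_iff)
  qed
  have \<theta>q1: "integrable ?M (\<lambda>x. \<theta> h x * q1 x)" for h
  proof (rule Bochner_Integration.integrable_bound[OF q1i])
    show "(\<lambda>x. \<theta> h x * q1 x) \<in> borel_measurable ?M" by measurable
    show "AE x in ?M. norm (\<theta> h x * q1 x) \<le> norm (q1 x)"
      using \<theta>0[of h] q10 by (intro AE_I2) (simp add: abs_mult mult_left_le_one_le less_imp_le)
  qed
  have eq2: "\<theta> h x * q2 x = \<theta> h x * q1 x - \<theta> h x * q x" for h x
    by (simp add: q12 algebra_simps)
  have \<theta>q2: "integrable ?M (\<lambda>x. \<theta> h x * q2 x)" for h
    unfolding eq2 by (intro Bochner_Integration.integrable_diff \<theta>q1 \<theta>q)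
  have I2: "(\<integral>x. \<theta> h x * q2 x \<partial>?M) = (\<integral>x. \<theta> h x * q1 x \<partial>?M) - r h" for h
    unfolding eq2 Bochner_Integration.integral_diff[OF \<theta>q1 \<theta>q(1)] \<theta>q(2) ..
  \<comment> \<open>Lowering h to h' raises \<theta>, hence also its integral against
    \<open>q2\<close>. At h' this integral is that of \<theta> \<open>q1\<close>, which is at most
    1, minus \<open>r h'\<close>.\<close>
  have le: "(\<integral>x. \<theta> h x * q2 x \<partial>?M) \<le> 1 - r h'" if "h' \<le> h" for h'
  proof -
    have "(\<integral>x. \<theta> h x * q2 x \<partial>?M) \<le> (\<integral>x. \<theta> h' x * q2 x \<partial>?M)"
      using that a q20 by (intro integral_mono \<theta>q2 mult_right_mono) (auto simp: \<theta>_def intro!: Theta_mono)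
    also have "\<dots> \<le> 1 - r h'"
    proof -
      have "(\<integral>x. \<theta> h' x * q1 x \<partial>?M) \<le> (\<integral>x. q1 x \<partial>?M)"
        using \<theta>0[of h'] q10 by (intro integral_mono \<theta>q1 q1i) (auto simp: mult_left_le_one_le less_imp_le)
      then show ?thesis unfolding I2 q1I by simp
    qed
    finally show ?thesis .
  qed
  have r1: "(\<lambda>n. r (- real n)) \<longlonglongrightarrow> 1"
  proof -
    have "filterlim (\<lambda>n. - real n / t) at_bot sequentially" using t by real_asymp
    then have "(\<lambda>n. det1 N (gram (1 / t) (- real n / t))) \<longlonglongrightarrow> det1 N (\<lambda>i j. if i = j then 1 else 0)"
      by (intro det1_tendsto gram_tendsto s)
    from tendsto_Re[OF this] show ?thesis by (simp add: det1_identity r_def)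
  qed
  have "(\<integral>x. \<theta> h x * q2 x \<partial>?M) \<le> 1 - 1"
  proof (rule tendsto_lowerbound[of "\<lambda>n. 1 - r (- real n)" _ sequentially])
    show "(\<lambda>n. 1 - r (- real n)) \<longlonglongrightarrow> 1 - 1" by (intro tendsto_intros r1)
    obtain m :: nat where m: "- h \<le> real m" using real_arch_simple by blast
    show "eventually (\<lambda>n. (\<integral>x. \<theta> h x * q2 x \<partial>?M) \<le> 1 - r (- real n)) sequentially"
      using m by (intro eventually_sequentiallyI[of m] le) linarith
  qed simp
  moreover have "(\<integral>x. \<theta> h x * q2 x \<partial>?M) \<ge> 0"
    using \<theta>0 q20 by (intro Bochner_Integration.integral_nonneg mult_nonneg_nonneg) (auto simp: less_imp_le)
  ultimately have zero: "(\<integral>x. \<theta> h x * q1 x \<partial>?M) = r h" unfolding I2 by simp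
  have "complex_of_real (\<integral>\<omega>. Theta a (X t \<omega> 1 - h) \<partial>P) = (\<integral>\<omega>. complex_of_real (\<theta> h (X t \<omega>)) \<partial>P)"
    by (simp add: \<theta>_def)
  also have "\<dots> = (\<integral>x. q1 x *\<^sub>R complex_of_real (\<theta> h x) \<partial>?M)"
    by (rule I(2)) measurable
  also have "\<dots> = (\<integral>x. complex_of_real (\<theta> h x * q1 x) \<partial>?M)"
    by (simp add: scaleR_conv_of_real mult.commute)
  also have "\<dots> = complex_of_real (r h)" by (simp only: integral_complex_of_real zero)
  also have "\<dots> = det1 N (gram (1 / t) (h / t))"
  proof -
    \<comment> \<open>\<open>r\<close> retains only the real part; the determinant equals it because
      its entries are real.\<close>
    have "cnj (det1 N (gram (1 / t) (h / t))) = det1 N (gram (1 / t) (h / t))"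
      unfolding det1_cnj by (intro det1_cong gram_real s)
    then show ?thesis by (simp add: r_def complex_eq_iff)
  qed
  finally show ?thesis .
qed

end

theorem proposition7p3:
  fixes N :: nat and a h t T :: real and \<nu> :: "nat \<Rightarrow> real"
    and P :: "'w measure" and X :: "real \<Rightarrow> 'w \<Rightarrow> nat \<Rightarrow> real"
    and Q :: "'v measure" and B :: "nat \<Rightarrow> real \<Rightarrow> 'v \<Rightarrow> real"
  assumes "N \<ge> 2" and "a > 0"
    and "strict_mono_on {1..N} \<nu>"
    and "\<And>j. j \<in> {1..N} \<Longrightarrow> a * \<bar>\<nu> j\<bar> < 1/2"
    and "oconnell_process P N (\<lambda>j. a * \<nu> j) a X"
    and "indep_brownian_motions Q N \<nu> B"
    and "0 < T" and "T \<le> t"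
  shows "let lhs = complex_of_real (\<integral>\<omega>. Theta a (X t \<omega> 1 - h) \<partial>P);
             Y = (\<lambda>\<omega>. (\<Prod>j=1..N. of_bool (B j (1/t) \<omega> \<ge> h/t))
                       * D_mart N \<nu> a (1/T) (\<lambda>j. B j (1/T) \<omega>))
         in integrable Q Y
          \<and> lhs = (\<integral>\<omega>. Y \<omega> \<partial>Q)
          \<and> F_determinantal lhs
          \<and> fredholm_expansion (1/t) (oconnell_kernel N \<nu> a) (\<lambda>x. - of_bool (x < h/t)) lhs"
proof -
  interpret spectrum N a \<nu>
    using assms(2-4) by unfold_locales (auto dest: strict_mono_on_imp_inj_on)
  have N: "N \<ge> 1" and t: "t > 0" using assms by auto
  \<comment> \<open>T \<le> t becomes 1/t \<le> 1/T, the order of times in which the martingale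
    property is applied.\<close>
  have s: "0 < 1 / t" "1 / t \<le> 1 / T" using assms t by (auto simp: frac_le)
  note Y = brownian_determinant[OF assms(6) N s, of "h / t"]
  note lhs = process_expectation[OF N t assms(5), of h]
  have "fredholm_expansion (1 / t) (oconnell_kernel N \<nu> a) (\<lambda>x. - of_bool (x < h / t)) (det1 N (gram (1 / t) (h / t)))"
    by (rule fredholm_gram[OF s(1)])
  then show ?thesis
    using Y unfolding Let_def lhs F_determinantal_def by auto
qed

end
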